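(* Let $k$ be any field, let $\bar{k}$ be an algebraic closure of $k$, and let $A$ and $A'$ be finitely generated $k$-domains such that the polynomial rings in one variable $A[x]$ and $A'[x]$ are isomorphic as $k$-algebras. If $A$ and $\bar{k}\otimes_k A$ are UFDs and the transcendence degree of $A$ over $k$ is $2$, then $A$ and $A'$ are isomorphic as $k$-algebras.
   Context: A $k$-domain is a commutative $k$-algebra that is an integral domain. The transcendence degree of a $k$-domain over $k$ is that of its field of fractions over $k$. *)

theory Defs
  imports "HOL-Algebra.Algebra"
begin

text \<open>
  Algebras over a field \<open>K\<close> are the commutative algebras of \<^locale>\<open>algebra\<close>: module records
  over \<open>K\<close> whose underlying ring is commutative.
\<close>

definition scalars :: "('k, 'n) ring_scheme \<Rightarrow> ('k, 'a, 'm) module_scheme \<Rightarrow> 'a set"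
  where "scalars K A = (\<lambda>c. c \<odot>\<^bsub>A\<^esub> \<one>\<^bsub>A\<^esub>) ` carrier K"

definition k_domain :: "('k, 'n) ring_scheme \<Rightarrow> ('k, 'a, 'm) module_scheme \<Rightarrow> bool"
  where "k_domain K A \<longleftrightarrow> algebra K A \<and> domain A"

definition finitely_generated_algebra ::
    "('k, 'n) ring_scheme \<Rightarrow> ('k, 'a, 'm) module_scheme \<Rightarrow> bool"
  where "finitely_generated_algebra K A \<longleftrightarrow>
    (\<exists>S. finite S \<and> S \<subseteq> carrier A \<and> generate_ring A (scalars K A \<union> S) = carrier A)"

definition algebra_isomorphic ::
    "('k, 'n) ring_scheme \<Rightarrow> ('k, 'a, 'm) module_scheme \<Rightarrow> ('k, 'b, 'p) module_scheme \<Rightarrow> bool"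
  where "algebra_isomorphic K A B \<longleftrightarrow>
    (\<exists>h \<in> ring_iso A B. \<forall>c \<in> carrier K. \<forall>x \<in> carrier A. h (c \<odot>\<^bsub>A\<^esub> x) = c \<odot>\<^bsub>B\<^esub> h x)"


section \<open>The polynomial algebra\<close>

text \<open>
  The scalar multiplication of \<^term>\<open>UP A\<close> is by elements of \<open>A\<close>; here it is replaced by the one
  by elements of the base field of \<open>A\<close>.
\<close>

definition poly_algebra :: "('k, 'a, 'm) module_scheme \<Rightarrow> ('k, nat \<Rightarrow> 'a) module"
  where "poly_algebra A =
    \<lparr>carrier = carrier (UP A), monoid.mult = monoid.mult (UP A), monoid.one = monoid.one (UP A),
     ring.zero = ring.zero (UP A), ring.add = ring.add (UP A), smult = (\<lambda>c p n. c \<odot>\<^bsub>A\<^esub> p n)\<rparr>"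

lemma poly_algebra_algebra:
  assumes "algebra K A"
  shows "algebra K (poly_algebra A)"
proof -
  interpret A: algebra K A by fact
  interpret P: UP_cring A "UP A"
    by unfold_locales
  have carr: "carrier (poly_algebra A) = carrier (UP A)"
    and ops: "(\<otimes>\<^bsub>poly_algebra A\<^esub>) = (\<otimes>\<^bsub>UP A\<^esub>)" "(\<oplus>\<^bsub>poly_algebra A\<^esub>) = (\<oplus>\<^bsub>UP A\<^esub>)"
      "\<one>\<^bsub>poly_algebra A\<^esub> = \<one>\<^bsub>UP A\<^esub>" "\<zero>\<^bsub>poly_algebra A\<^esub> = \<zero>\<^bsub>UP A\<^esub>"
    by (simp_all add: poly_algebra_def)
  have neg: "\<exists>y\<in>carrier (UP A). y \<oplus>\<^bsub>UP A\<^esub> x = \<zero>\<^bsub>UP A\<^esub>" if "x \<in> carrier (UP A)" for x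
    using P.P.l_neg[OF that] P.P.a_inv_closed[OF that] by blast
  have cr: "cring (poly_algebra A)"
    by (intro cringI abelian_groupI comm_monoidI; unfold carr ops)
      (simp_all add: P.P.m_ac P.P.a_ac P.P.l_distr P.P.r_distr neg)
  have up: "carrier (UP A) = up A"
    by (simp only: UP_def partial_object.simps)
  have smult: "c \<odot>\<^bsub>poly_algebra A\<^esub> p = (\<lambda>n. c \<odot>\<^bsub>A\<^esub> p n)" for c p
    by (simp add: poly_algebra_def)
  have add: "p \<oplus>\<^bsub>poly_algebra A\<^esub> q = (\<lambda>i. p i \<oplus>\<^bsub>A\<^esub> q i)"
    and mult: "p \<otimes>\<^bsub>poly_algebra A\<^esub> q = (\<lambda>n. \<Oplus>\<^bsub>A\<^esub>i\<in>{..n}. p i \<otimes>\<^bsub>A\<^esub> q (n - i))"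
    if "p \<in> up A" "q \<in> up A" for p q
    using that by (simp_all only: poly_algebra_def UP_def partial_object.simps monoid.simps
        ring.simps module.simps restrict_apply' up)
  have sm: "(\<lambda>n. c \<odot>\<^bsub>A\<^esub> p n) \<in> up A" if c: "c \<in> carrier K" and p: "p \<in> up A" for c p
  proof
    show "c \<odot>\<^bsub>A\<^esub> p n \<in> carrier A" for n using c p by auto
    obtain n where "bound \<zero>\<^bsub>A\<^esub> n p" using p by (auto simp: up_def)
    then have "bound \<zero>\<^bsub>A\<^esub> n (\<lambda>n. c \<odot>\<^bsub>A\<^esub> p n)"
      using c by (auto simp: bound_def)
    then show "\<exists>n. bound \<zero>\<^bsub>A\<^esub> n (\<lambda>n. c \<odot>\<^bsub>A\<^esub> p n)" ..
  qed
  have upc: "p n \<in> carrier A" if "p \<in> up A" for p n using that by auto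
  have fs: "(\<Oplus>\<^bsub>A\<^esub>i\<in>{..n}. (c \<odot>\<^bsub>A\<^esub> p i) \<otimes>\<^bsub>A\<^esub> q (n - i)) =
      c \<odot>\<^bsub>A\<^esub> (\<Oplus>\<^bsub>A\<^esub>i\<in>{..n}. p i \<otimes>\<^bsub>A\<^esub> q (n - i))"
    if c: "c \<in> carrier K" and p: "p \<in> up A" and q: "q \<in> up A" for c p q n
  proof -
    have "(\<Oplus>\<^bsub>A\<^esub>i\<in>{..n}. (c \<odot>\<^bsub>A\<^esub> p i) \<otimes>\<^bsub>A\<^esub> q (n - i)) =
        (\<Oplus>\<^bsub>A\<^esub>i\<in>{..n}. c \<odot>\<^bsub>A\<^esub> (p i \<otimes>\<^bsub>A\<^esub> q (n - i)))"
      using c p q by (intro A.M.finsum_cong') (auto simp: A.smult_assoc2 upc)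
    also have "\<dots> = c \<odot>\<^bsub>A\<^esub> (\<Oplus>\<^bsub>A\<^esub>i\<in>{..n}. p i \<otimes>\<^bsub>A\<^esub> q (n - i))"
      using c p q by (intro A.finsum_smult_ldistr[symmetric]) (auto simp: upc)
    finally show ?thesis .
  qed
  have up_ops: "(\<lambda>i. p i \<oplus>\<^bsub>A\<^esub> q i) \<in> up A" if "p \<in> up A" "q \<in> up A" for p q
    using that by (rule A.up_add_closed)
  show ?thesis
    by (rule algebraI[OF A.R_cring cr], unfold carr up smult)
      (simp_all only: add mult sm fs up_ops upc A.smult_l_distr A.smult_r_distr A.smult_assoc1
        A.smult_one A.R.one_closed cong: if_cong)
qed


section \<open>Fraction fields\<close>

definition fraction :: "('a, 'm) ring_scheme \<Rightarrow> 'a \<Rightarrow> 'a \<Rightarrow> ('a \<times> 'a) set"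
  where "fraction A a b =
    {(c, d). c \<in> carrier A \<and> d \<in> carrier A - {\<zero>\<^bsub>A\<^esub>} \<and> a \<otimes>\<^bsub>A\<^esub> d = c \<otimes>\<^bsub>A\<^esub> b}"

definition fraction_field :: "('k, 'a, 'm) module_scheme \<Rightarrow> ('k, ('a \<times> 'a) set) module"
  where "fraction_field A =
    \<lparr>carrier = {fraction A a b | a b. a \<in> carrier A \<and> b \<in> carrier A - {\<zero>\<^bsub>A\<^esub>}},
     monoid.mult = (\<lambda>P Q. \<Union>(a, b) \<in> P. \<Union>(c, d) \<in> Q. fraction A (a \<otimes>\<^bsub>A\<^esub> c) (b \<otimes>\<^bsub>A\<^esub> d)),
     monoid.one = fraction A \<one>\<^bsub>A\<^esub> \<one>\<^bsub>A\<^esub>,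
     ring.zero = fraction A \<zero>\<^bsub>A\<^esub> \<one>\<^bsub>A\<^esub>,
     ring.add = (\<lambda>P Q. \<Union>(a, b) \<in> P. \<Union>(c, d) \<in> Q.
       fraction A (a \<otimes>\<^bsub>A\<^esub> d \<oplus>\<^bsub>A\<^esub> c \<otimes>\<^bsub>A\<^esub> b) (b \<otimes>\<^bsub>A\<^esub> d)),
     smult = (\<lambda>k P. \<Union>(a, b) \<in> P. fraction A (k \<odot>\<^bsub>A\<^esub> a) b)\<rparr>"

context domain
begin

abbreviation (input) "nz \<equiv> carrier R - {\<zero>}"

lemma fraction_eqI:
  assumes "a \<in> carrier R" "b \<in> nz" "c \<in> carrier R" "d \<in> nz" "a \<otimes> d = c \<otimes> b"
  shows "fraction R a b = fraction R c d"
proof -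
  have *: "x \<otimes> w = z \<otimes> y \<Longrightarrow> x \<otimes> v = u \<otimes> y \<Longrightarrow> u \<otimes> w = z \<otimes> v"
    if "x \<in> carrier R" "y \<in> nz" "u \<in> carrier R" "v \<in> nz" "z \<in> carrier R" "w \<in> nz" for x y u v z w
  proof -
    assume h: "x \<otimes> w = z \<otimes> y" "x \<otimes> v = u \<otimes> y"
    have "y \<otimes> (u \<otimes> w) = (u \<otimes> y) \<otimes> w" using that by (simp add: m_ac)
    also have "\<dots> = (x \<otimes> w) \<otimes> v" using that by (simp add: h(2)[symmetric] m_ac)
    also have "\<dots> = y \<otimes> (z \<otimes> v)" using that by (simp add: h(1) m_ac)
    finally show ?thesis using that m_lcancel[of y "u \<otimes> w" "z \<otimes> v"] by simp
  qed
  have "(z, w) \<in> fraction R a b \<longleftrightarrow> (z, w) \<in> fraction R c d" for z w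
    using *[of a b c d z w] *[of c d a b z w] assms by (auto simp: fraction_def)
  then show ?thesis by (simp add: set_eq_iff split_paired_All)
qed

lemma fraction_self: "a \<in> carrier R \<Longrightarrow> b \<in> nz \<Longrightarrow> (a, b) \<in> fraction R a b"
  by (simp add: fraction_def)

lemma fraction_eq_iff:
  assumes "a \<in> carrier R" "b \<in> nz" "c \<in> carrier R" "d \<in> nz"
  shows "fraction R a b = fraction R c d \<longleftrightarrow> a \<otimes> d = c \<otimes> b"
  using fraction_eqI[OF assms] fraction_self[OF assms(3,4)] by (auto simp: fraction_def)

lemma fraction_cancel:
  assumes "a \<in> carrier R" "b \<in> nz" "c \<in> nz"
  shows "fraction R (c \<otimes> a) (c \<otimes> b) = fraction R a b"
  using assms by (intro fraction_eqI) (auto simp: integral_iff m_ac)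

lemma fraction_UN:
  assumes "a \<in> carrier R" "b \<in> nz"
    and "\<And>x y. x \<in> carrier R \<Longrightarrow> y \<in> nz \<Longrightarrow> a \<otimes> y = x \<otimes> b \<Longrightarrow> f x y = f a b"
  shows "(\<Union>(x, y) \<in> fraction R a b. f x y) = f a b"
proof -
  have "f x y = f a b" if "(x, y) \<in> fraction R a b" for x y
    using that assms(3) by (auto simp: fraction_def)
  then have "(\<Union>(x, y) \<in> fraction R a b. f x y) \<subseteq> f a b"
    by (simp add: UN_subset_iff split_beta)
  moreover have "f a b \<subseteq> (\<Union>(x, y) \<in> fraction R a b. f x y)"
    using fraction_self[OF assms(1,2)] by blast
  ultimately show ?thesis by (rule equalityI)
qed

lemma fraction_UN2:
  assumes "a \<in> carrier R" "b \<in> nz" "c \<in> carrier R" "d \<in> nz"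
    and "\<And>x y z w. x \<in> carrier R \<Longrightarrow> y \<in> nz \<Longrightarrow> z \<in> carrier R \<Longrightarrow> w \<in> nz \<Longrightarrow>
      a \<otimes> y = x \<otimes> b \<Longrightarrow> c \<otimes> w = z \<otimes> d \<Longrightarrow> f x y z w = f a b c d"
  shows "(\<Union>(x, y) \<in> fraction R a b. \<Union>(z, w) \<in> fraction R c d. f x y z w) = f a b c d"
proof -
  have "f x y z w = f a b c d"
    if "(x, y) \<in> fraction R a b" "(z, w) \<in> fraction R c d" for x y z w
    using that assms(5) by (auto simp: fraction_def)
  then have "(\<Union>(x, y) \<in> fraction R a b. \<Union>(z, w) \<in> fraction R c d. f x y z w) \<subseteq> f a b c d"
    by (simp add: UN_subset_iff split_beta)
  moreover have "f a b c d \<subseteq> (\<Union>(x, y) \<in> fraction R a b. \<Union>(z, w) \<in> fraction R c d. f x y z w)"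
    using fraction_self[OF assms(1,2)] fraction_self[OF assms(3,4)] by blast
  ultimately show ?thesis by (rule equalityI)
qed

end

context
  fixes K :: "('k, 'n) ring_scheme" and A :: "('k, 'a, 'm) module_scheme"
  assumes KA: "algebra K A" and dA: "domain A"
begin

interpretation algebra K A by (rule KA)
interpretation domain A by (rule dA)

lemma fraction_nonzero_mult: "b \<in> nz \<Longrightarrow> d \<in> nz \<Longrightarrow> b \<otimes>\<^bsub>A\<^esub> d \<in> nz"
  by (auto simp: integral_iff)

lemma fraction_mult:
  assumes "a \<in> carrier A" "b \<in> nz" "c \<in> carrier A" "d \<in> nz"
  shows "fraction A a b \<otimes>\<^bsub>fraction_field A\<^esub> fraction A c d = fraction A (a \<otimes>\<^bsub>A\<^esub> c) (b \<otimes>\<^bsub>A\<^esub> d)"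
proof -
  have "(\<Union>(x, y) \<in> fraction A a b. \<Union>(z, w) \<in> fraction A c d. fraction A (x \<otimes>\<^bsub>A\<^esub> z) (y \<otimes>\<^bsub>A\<^esub> w)) =
      fraction A (a \<otimes>\<^bsub>A\<^esub> c) (b \<otimes>\<^bsub>A\<^esub> d)"
  proof (rule fraction_UN2[OF assms], rule fraction_eqI)
    fix x y z w
    assume h: "x \<in> carrier A" "y \<in> nz" "z \<in> carrier A" "w \<in> nz" "a \<otimes>\<^bsub>A\<^esub> y = x \<otimes>\<^bsub>A\<^esub> b" "c \<otimes>\<^bsub>A\<^esub> w = z \<otimes>\<^bsub>A\<^esub> d"
    have "(x \<otimes>\<^bsub>A\<^esub> z) \<otimes>\<^bsub>A\<^esub> (b \<otimes>\<^bsub>A\<^esub> d) = (x \<otimes>\<^bsub>A\<^esub> b) \<otimes>\<^bsub>A\<^esub> (z \<otimes>\<^bsub>A\<^esub> d)" using assms h(1-4) by (simp add: m_ac)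
    also have "\<dots> = (a \<otimes>\<^bsub>A\<^esub> y) \<otimes>\<^bsub>A\<^esub> (c \<otimes>\<^bsub>A\<^esub> w)" by (simp only: h)
    also have "\<dots> = (a \<otimes>\<^bsub>A\<^esub> c) \<otimes>\<^bsub>A\<^esub> (y \<otimes>\<^bsub>A\<^esub> w)" using assms h(1-4) by (simp add: m_ac)
    finally show "(x \<otimes>\<^bsub>A\<^esub> z) \<otimes>\<^bsub>A\<^esub> (b \<otimes>\<^bsub>A\<^esub> d) = (a \<otimes>\<^bsub>A\<^esub> c) \<otimes>\<^bsub>A\<^esub> (y \<otimes>\<^bsub>A\<^esub> w)" .
  qed (use assms fraction_nonzero_mult in auto)
  then show ?thesis by (simp add: fraction_field_def)
qed

lemma fraction_add:
  assumes "a \<in> carrier A" "b \<in> nz" "c \<in> carrier A" "d \<in> nz"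
  shows "fraction A a b \<oplus>\<^bsub>fraction_field A\<^esub> fraction A c d = fraction A (a \<otimes>\<^bsub>A\<^esub> d \<oplus>\<^bsub>A\<^esub> c \<otimes>\<^bsub>A\<^esub> b) (b \<otimes>\<^bsub>A\<^esub> d)"
proof -
  have "(\<Union>(x, y) \<in> fraction A a b. \<Union>(z, w) \<in> fraction A c d. fraction A (x \<otimes>\<^bsub>A\<^esub> w \<oplus>\<^bsub>A\<^esub> z \<otimes>\<^bsub>A\<^esub> y) (y \<otimes>\<^bsub>A\<^esub> w)) =
      fraction A (a \<otimes>\<^bsub>A\<^esub> d \<oplus>\<^bsub>A\<^esub> c \<otimes>\<^bsub>A\<^esub> b) (b \<otimes>\<^bsub>A\<^esub> d)"
  proof (rule fraction_UN2[OF assms], rule fraction_eqI)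
    fix x y z w
    assume h: "x \<in> carrier A" "y \<in> nz" "z \<in> carrier A" "w \<in> nz" "a \<otimes>\<^bsub>A\<^esub> y = x \<otimes>\<^bsub>A\<^esub> b" "c \<otimes>\<^bsub>A\<^esub> w = z \<otimes>\<^bsub>A\<^esub> d"
    have "(x \<otimes>\<^bsub>A\<^esub> w \<oplus>\<^bsub>A\<^esub> z \<otimes>\<^bsub>A\<^esub> y) \<otimes>\<^bsub>A\<^esub> (b \<otimes>\<^bsub>A\<^esub> d) = (x \<otimes>\<^bsub>A\<^esub> b) \<otimes>\<^bsub>A\<^esub> (w \<otimes>\<^bsub>A\<^esub> d) \<oplus>\<^bsub>A\<^esub> (z \<otimes>\<^bsub>A\<^esub> d) \<otimes>\<^bsub>A\<^esub> (y \<otimes>\<^bsub>A\<^esub> b)"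
      using assms h(1-4) by (simp add: m_ac l_distr r_distr)
    also have "\<dots> = (a \<otimes>\<^bsub>A\<^esub> y) \<otimes>\<^bsub>A\<^esub> (w \<otimes>\<^bsub>A\<^esub> d) \<oplus>\<^bsub>A\<^esub> (c \<otimes>\<^bsub>A\<^esub> w) \<otimes>\<^bsub>A\<^esub> (y \<otimes>\<^bsub>A\<^esub> b)" by (simp only: h)
    also have "\<dots> = (a \<otimes>\<^bsub>A\<^esub> d \<oplus>\<^bsub>A\<^esub> c \<otimes>\<^bsub>A\<^esub> b) \<otimes>\<^bsub>A\<^esub> (y \<otimes>\<^bsub>A\<^esub> w)" using assms h(1-4) by (simp add: m_ac l_distr r_distr)
    finally show "(x \<otimes>\<^bsub>A\<^esub> w \<oplus>\<^bsub>A\<^esub> z \<otimes>\<^bsub>A\<^esub> y) \<otimes>\<^bsub>A\<^esub> (b \<otimes>\<^bsub>A\<^esub> d) = (a \<otimes>\<^bsub>A\<^esub> d \<oplus>\<^bsub>A\<^esub> c \<otimes>\<^bsub>A\<^esub> b) \<otimes>\<^bsub>A\<^esub> (y \<otimes>\<^bsub>A\<^esub> w)" .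
  qed (use assms fraction_nonzero_mult in auto)
  then show ?thesis by (simp add: fraction_field_def)
qed

lemma fraction_smult:
  assumes "k \<in> carrier K" "a \<in> carrier A" "b \<in> nz"
  shows "k \<odot>\<^bsub>fraction_field A\<^esub> fraction A a b = fraction A (k \<odot>\<^bsub>A\<^esub> a) b"
proof -
  have "(\<Union>(x, y) \<in> fraction A a b. fraction A (k \<odot>\<^bsub>A\<^esub> x) y) = fraction A (k \<odot>\<^bsub>A\<^esub> a) b"
    using assms by (intro fraction_UN fraction_eqI) (auto simp: smult_assoc2)
  then show ?thesis by (simp add: fraction_field_def)
qed

lemma fraction_zero: "\<zero>\<^bsub>fraction_field A\<^esub> = fraction A \<zero>\<^bsub>A\<^esub> \<one>\<^bsub>A\<^esub>"
  and fraction_one: "\<one>\<^bsub>fraction_field A\<^esub> = fraction A \<one>\<^bsub>A\<^esub> \<one>\<^bsub>A\<^esub>"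
  by (simp_all add: fraction_field_def)

lemma fraction_closed: "a \<in> carrier A \<Longrightarrow> b \<in> nz \<Longrightarrow> fraction A a b \<in> carrier (fraction_field A)"
  by (auto simp: fraction_field_def)

lemma fraction_cases:
  assumes "x \<in> carrier (fraction_field A)"
  obtains a b where "a \<in> carrier A" "b \<in> nz" "x = fraction A a b"
  using assms by (auto simp: fraction_field_def)

lemmas fraction_ops = fraction_mult fraction_add fraction_smult fraction_zero fraction_one

lemma fraction_field_cring: "cring (fraction_field A)"
proof (intro cringI abelian_groupI comm_monoidI)
  fix x y z
  assume "x \<in> carrier (fraction_field A)" "y \<in> carrier (fraction_field A)" "z \<in> carrier (fraction_field A)"
  then obtain a b c d e f where [simp]: "a \<in> carrier A" "c \<in> carrier A" "e \<in> carrier A"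
    and n: "b \<in> nz" "d \<in> nz" "f \<in> nz"
    and xyz: "x = fraction A a b" "y = fraction A c d" "z = fraction A e f"
    by (elim fraction_cases)
  have [simp]: "b \<in> carrier A" "d \<in> carrier A" "f \<in> carrier A" "b \<noteq> \<zero>\<^bsub>A\<^esub>" "d \<noteq> \<zero>\<^bsub>A\<^esub>" "f \<noteq> \<zero>\<^bsub>A\<^esub>"
    using n by auto
  note [simp] = integral_iff m_ac l_distr r_distr a_ac xyz fraction_ops
  show "x \<otimes>\<^bsub>fraction_field A\<^esub> y \<otimes>\<^bsub>fraction_field A\<^esub> z = x \<otimes>\<^bsub>fraction_field A\<^esub> (y \<otimes>\<^bsub>fraction_field A\<^esub> z)"
    by simp
  show "x \<oplus>\<^bsub>fraction_field A\<^esub> y \<oplus>\<^bsub>fraction_field A\<^esub> z = x \<oplus>\<^bsub>fraction_field A\<^esub> (y \<oplus>\<^bsub>fraction_field A\<^esub> z)"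
    by simp
  have "fraction A (f \<otimes>\<^bsub>A\<^esub> ((a \<otimes>\<^bsub>A\<^esub> d \<oplus>\<^bsub>A\<^esub> c \<otimes>\<^bsub>A\<^esub> b) \<otimes>\<^bsub>A\<^esub> e)) (f \<otimes>\<^bsub>A\<^esub> (b \<otimes>\<^bsub>A\<^esub> d \<otimes>\<^bsub>A\<^esub> f)) =
      fraction A ((a \<otimes>\<^bsub>A\<^esub> d \<oplus>\<^bsub>A\<^esub> c \<otimes>\<^bsub>A\<^esub> b) \<otimes>\<^bsub>A\<^esub> e) (b \<otimes>\<^bsub>A\<^esub> d \<otimes>\<^bsub>A\<^esub> f)"
    by (rule fraction_cancel) auto
  then show "(x \<oplus>\<^bsub>fraction_field A\<^esub> y) \<otimes>\<^bsub>fraction_field A\<^esub> z =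
      x \<otimes>\<^bsub>fraction_field A\<^esub> z \<oplus>\<^bsub>fraction_field A\<^esub> y \<otimes>\<^bsub>fraction_field A\<^esub> z"
    by simp
next
  fix x y
  assume "x \<in> carrier (fraction_field A)" "y \<in> carrier (fraction_field A)"
  then obtain a b c d where [simp]: "a \<in> carrier A" "c \<in> carrier A"
    and n: "b \<in> nz" "d \<in> nz"
    and xyz: "x = fraction A a b" "y = fraction A c d"
    by (elim fraction_cases)
  have [simp]: "b \<in> carrier A" "d \<in> carrier A" "b \<noteq> \<zero>\<^bsub>A\<^esub>" "d \<noteq> \<zero>\<^bsub>A\<^esub>"
    using n by auto
  note [simp] = integral_iff m_ac l_distr r_distr a_ac xyz fraction_ops
  show "x \<otimes>\<^bsub>fraction_field A\<^esub> y \<in> carrier (fraction_field A)"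
    "x \<oplus>\<^bsub>fraction_field A\<^esub> y \<in> carrier (fraction_field A)"
    by (auto intro!: fraction_closed)
  show "x \<otimes>\<^bsub>fraction_field A\<^esub> y = y \<otimes>\<^bsub>fraction_field A\<^esub> x"
    "x \<oplus>\<^bsub>fraction_field A\<^esub> y = y \<oplus>\<^bsub>fraction_field A\<^esub> x"
    by simp_all
next
  fix x assume "x \<in> carrier (fraction_field A)"
  then obtain a b where [simp]: "a \<in> carrier A" and n: "b \<in> nz" and x: "x = fraction A a b"
    by (elim fraction_cases)
  have [simp]: "b \<in> carrier A" "b \<noteq> \<zero>\<^bsub>A\<^esub>"
    using n by auto
  note [simp] = integral_iff m_ac l_distr r_distr a_ac x fraction_ops
  show "\<one>\<^bsub>fraction_field A\<^esub> \<otimes>\<^bsub>fraction_field A\<^esub> x = x"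
    "\<zero>\<^bsub>fraction_field A\<^esub> \<oplus>\<^bsub>fraction_field A\<^esub> x = x"
    by simp_all
  have "fraction A (\<ominus>\<^bsub>A\<^esub> a) b \<oplus>\<^bsub>fraction_field A\<^esub> x = \<zero>\<^bsub>fraction_field A\<^esub>"
    by (simp add: fraction_eq_iff l_minus r_minus r_neg l_neg)
  moreover have "fraction A (\<ominus>\<^bsub>A\<^esub> a) b \<in> carrier (fraction_field A)"
    by (intro fraction_closed) simp_all
  ultimately show "\<exists>y\<in>carrier (fraction_field A). y \<oplus>\<^bsub>fraction_field A\<^esub> x = \<zero>\<^bsub>fraction_field A\<^esub>"
    by blast
next
  show "\<one>\<^bsub>fraction_field A\<^esub> \<in> carrier (fraction_field A)"
    "\<zero>\<^bsub>fraction_field A\<^esub> \<in> carrier (fraction_field A)"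
    by (auto simp: fraction_ops intro!: fraction_closed)
qed

lemma fraction_field_field: "field (fraction_field A)"
proof -
  interpret F: cring "fraction_field A" by (rule fraction_field_cring)
  show ?thesis
  proof (rule F.cring_fieldI2)
    show "\<zero>\<^bsub>fraction_field A\<^esub> \<noteq> \<one>\<^bsub>fraction_field A\<^esub>"
      by (simp add: fraction_ops fraction_eq_iff)
  next
    fix x assume "x \<in> carrier (fraction_field A)" "x \<noteq> \<zero>\<^bsub>fraction_field A\<^esub>"
    then obtain a b where ab: "a \<in> carrier A" "b \<in> nz" "x = fraction A a b"
      by (metis fraction_cases)
    with \<open>x \<noteq> _\<close> have a: "a \<in> nz"
      by (auto simp: fraction_ops fraction_eq_iff)
    have "x \<otimes>\<^bsub>fraction_field A\<^esub> fraction A b a = \<one>\<^bsub>fraction_field A\<^esub>"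
      using a ab by (simp add: fraction_ops fraction_eq_iff integral_iff m_ac)
    then show "\<exists>y\<in>carrier (fraction_field A). x \<otimes>\<^bsub>fraction_field A\<^esub> y = \<one>\<^bsub>fraction_field A\<^esub>"
      using fraction_closed[OF _ a, of b] ab by auto
  qed
qed

lemma smult_assoc2_r:
  "k \<in> carrier K \<Longrightarrow> x \<in> carrier A \<Longrightarrow> y \<in> carrier A \<Longrightarrow> x \<otimes>\<^bsub>A\<^esub> (k \<odot>\<^bsub>A\<^esub> y) = k \<odot>\<^bsub>A\<^esub> (x \<otimes>\<^bsub>A\<^esub> y)"
  by (simp add: m_comm[of x] smult_assoc2)

lemma fraction_field_algebra: "algebra K (fraction_field A)"
proof (rule algebraI[OF R_cring fraction_field_cring])
  fix k l x
  assume [simp]: "k \<in> carrier K" "l \<in> carrier K" and "x \<in> carrier (fraction_field A)"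
  then obtain a b where [simp]: "a \<in> carrier A" and n: "b \<in> nz" and xyz: "x = fraction A a b"
    by (elim fraction_cases)
  have [simp]: "b \<in> carrier A" "b \<noteq> \<zero>\<^bsub>A\<^esub>"
    using n by auto
  note [simp] = integral_iff m_ac l_distr r_distr a_ac xyz fraction_ops smult_assoc2 smult_assoc2_r
    smult_l_distr smult_r_distr smult_assoc1
  have "fraction A (b \<otimes>\<^bsub>A\<^esub> ((k \<oplus>\<^bsub>K\<^esub> l) \<odot>\<^bsub>A\<^esub> a)) (b \<otimes>\<^bsub>A\<^esub> b) = fraction A ((k \<oplus>\<^bsub>K\<^esub> l) \<odot>\<^bsub>A\<^esub> a) b"
    by (rule fraction_cancel) auto
  then show "(k \<oplus>\<^bsub>K\<^esub> l) \<odot>\<^bsub>fraction_field A\<^esub> x =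
      k \<odot>\<^bsub>fraction_field A\<^esub> x \<oplus>\<^bsub>fraction_field A\<^esub> l \<odot>\<^bsub>fraction_field A\<^esub> x"
    by simp
  show "(k \<otimes>\<^bsub>K\<^esub> l) \<odot>\<^bsub>fraction_field A\<^esub> x = k \<odot>\<^bsub>fraction_field A\<^esub> (l \<odot>\<^bsub>fraction_field A\<^esub> x)"
    by simp
next
  fix k x y
  assume [simp]: "k \<in> carrier K"
    and "x \<in> carrier (fraction_field A)" "y \<in> carrier (fraction_field A)"
  then obtain a b c d where [simp]: "a \<in> carrier A" "c \<in> carrier A"
    and n: "b \<in> nz" "d \<in> nz"
    and xyz: "x = fraction A a b" "y = fraction A c d"
    by (elim fraction_cases)
  have [simp]: "b \<in> carrier A" "d \<in> carrier A" "b \<noteq> \<zero>\<^bsub>A\<^esub>" "d \<noteq> \<zero>\<^bsub>A\<^esub>"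
    using n by auto
  note [simp] = integral_iff m_ac l_distr r_distr a_ac xyz fraction_ops smult_assoc2 smult_assoc2_r
    smult_l_distr smult_r_distr smult_assoc1
  show "k \<odot>\<^bsub>fraction_field A\<^esub> (x \<oplus>\<^bsub>fraction_field A\<^esub> y) =
      k \<odot>\<^bsub>fraction_field A\<^esub> x \<oplus>\<^bsub>fraction_field A\<^esub> k \<odot>\<^bsub>fraction_field A\<^esub> y"
    "(k \<odot>\<^bsub>fraction_field A\<^esub> x) \<otimes>\<^bsub>fraction_field A\<^esub> y = k \<odot>\<^bsub>fraction_field A\<^esub> (x \<otimes>\<^bsub>fraction_field A\<^esub> y)"
    by simp_all
next
  fix k x
  assume [simp]: "k \<in> carrier K" and "x \<in> carrier (fraction_field A)"
  then obtain a b where [simp]: "a \<in> carrier A" and n: "b \<in> nz" and xyz: "x = fraction A a b"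
    by (elim fraction_cases)
  have [simp]: "b \<in> carrier A" "b \<noteq> \<zero>\<^bsub>A\<^esub>"
    using n by auto
  note [simp] = integral_iff m_ac l_distr r_distr a_ac xyz fraction_ops smult_assoc2 smult_assoc2_r
    smult_l_distr smult_r_distr smult_assoc1
  show "k \<odot>\<^bsub>fraction_field A\<^esub> x \<in> carrier (fraction_field A)"
    by (auto intro!: fraction_closed)
next
  fix x assume "x \<in> carrier (fraction_field A)"
  then show "\<one>\<^bsub>K\<^esub> \<odot>\<^bsub>fraction_field A\<^esub> x = x"
    by (metis fraction_cases fraction_smult R.one_closed smult_one)
qed

end


section \<open>Transcendence degree\<close>

text \<open>
  Monomials in elements of \<open>B\<close> are indexed by multisets, and a polynomial by a finite set \<open>S\<close> of
  monomials with coefficients \<open>c\<close>; so the condition below says that no nonzero polynomial over \<open>K\<close>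
  vanishes on \<open>B\<close>.
\<close>

definition algebraically_independent ::
    "('k, 'n) ring_scheme \<Rightarrow> ('k, 'a, 'm) module_scheme \<Rightarrow> 'a set \<Rightarrow> bool"
  where "algebraically_independent K F B \<longleftrightarrow> B \<subseteq> carrier F \<and>
    (\<forall>S c. finite S \<and> (\<forall>m \<in> S. set_mset m \<subseteq> B) \<and> c \<in> S \<rightarrow> carrier K \<and>
       (\<Oplus>\<^bsub>F\<^esub>m \<in> S. c m \<odot>\<^bsub>F\<^esub> (\<Otimes>\<^bsub>F\<^esub>b \<in> set_mset m. b [^]\<^bsub>F\<^esub> count m b)) = \<zero>\<^bsub>F\<^esub> \<longrightarrow>
       (\<forall>m \<in> S. c m = \<zero>\<^bsub>K\<^esub>))"

definition transcendence_basis ::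
    "('k, 'n) ring_scheme \<Rightarrow> ('k, 'a, 'm) module_scheme \<Rightarrow> 'a set \<Rightarrow> bool"
  where "transcendence_basis K F B \<longleftrightarrow> algebraically_independent K F B \<and>
    (\<forall>x \<in> carrier F. (ring.algebraic F over generate_field F (scalars K F \<union> B)) x)"

text \<open>
  A relation rather than a function, so that it makes no claim when the degree is infinite.
\<close>

definition has_transcendence_degree ::
    "('k, 'n) ring_scheme \<Rightarrow> ('k, 'a, 'm) module_scheme \<Rightarrow> nat \<Rightarrow> bool"
  where "has_transcendence_degree K A n \<longleftrightarrow>
    (\<exists>B. transcendence_basis K (fraction_field A) B \<and> finite B \<and> card B = n)"


section \<open>Tensor products of algebras\<close>

text \<open>
  The free abelian group on \<open>carrier L \<times> carrier A\<close>, with componentwise multiplication of pairs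
  extended biadditively.  Its quotient by the subgroup of bilinearity relations is the tensor
  product.
\<close>

definition pair_ring ::
    "('l, 'm) ring_scheme \<Rightarrow> ('a, 'p) ring_scheme \<Rightarrow> (('l \<times> 'a) \<Rightarrow>\<^sub>0 int) ring"
  where "pair_ring L A =
    \<lparr>carrier = carrier (free_Abelian_group (carrier L \<times> carrier A)),
     monoid.mult = (\<lambda>f g. frag_extend (\<lambda>p. frag_extend
       (\<lambda>q. frag_of (fst p \<otimes>\<^bsub>L\<^esub> fst q, snd p \<otimes>\<^bsub>A\<^esub> snd q)) g) f),
     monoid.one = frag_of (\<one>\<^bsub>L\<^esub>, \<one>\<^bsub>A\<^esub>),
     ring.zero = 0,
     ring.add = (+)\<rparr>"

definition tensor_relations ::
    "('k, 'n) ring_scheme \<Rightarrow> ('k, 'l, 'm) module_scheme \<Rightarrow> ('k, 'a, 'p) module_scheme \<Rightarrow>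
     (('l \<times> 'a) \<Rightarrow>\<^sub>0 int) set"
  where "tensor_relations K L A =
    {frag_of (x \<oplus>\<^bsub>L\<^esub> x', a) - frag_of (x, a) - frag_of (x', a) | x x' a.
       x \<in> carrier L \<and> x' \<in> carrier L \<and> a \<in> carrier A} \<union>
    {frag_of (x, a \<oplus>\<^bsub>A\<^esub> a') - frag_of (x, a) - frag_of (x, a') | x a a'.
       x \<in> carrier L \<and> a \<in> carrier A \<and> a' \<in> carrier A} \<union>
    {frag_of (c \<odot>\<^bsub>L\<^esub> x, a) - frag_of (x, c \<odot>\<^bsub>A\<^esub> a) | c x a.
       c \<in> carrier K \<and> x \<in> carrier L \<and> a \<in> carrier A}"

definition tensor_ideal ::
    "('k, 'n) ring_scheme \<Rightarrow> ('k, 'l, 'm) module_scheme \<Rightarrow> ('k, 'a, 'p) module_scheme \<Rightarrow>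
     (('l \<times> 'a) \<Rightarrow>\<^sub>0 int) set"
  where "tensor_ideal K L A =
    generate (free_Abelian_group (carrier L \<times> carrier A)) (tensor_relations K L A)"

definition tensor_ring ::
    "('k, 'n) ring_scheme \<Rightarrow> ('k, 'l, 'm) module_scheme \<Rightarrow> ('k, 'a, 'p) module_scheme \<Rightarrow>
     (('l \<times> 'a) \<Rightarrow>\<^sub>0 int) set ring"
  where "tensor_ring K L A = pair_ring L A Quot tensor_ideal K L A"

lemma tensor_relations_cases:
  assumes "r \<in> tensor_relations K L A"
  obtains (left) x x' a where "x \<in> carrier L" "x' \<in> carrier L" "a \<in> carrier A"
      "r = frag_of (x \<oplus>\<^bsub>L\<^esub> x', a) - frag_of (x, a) - frag_of (x', a)"
  | (right) x a a' where "x \<in> carrier L" "a \<in> carrier A" "a' \<in> carrier A"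
      "r = frag_of (x, a \<oplus>\<^bsub>A\<^esub> a') - frag_of (x, a) - frag_of (x, a')"
  | (smult) c x a where "c \<in> carrier K" "x \<in> carrier L" "a \<in> carrier A"
      "r = frag_of (c \<odot>\<^bsub>L\<^esub> x, a) - frag_of (x, c \<odot>\<^bsub>A\<^esub> a)"
  using assms unfolding tensor_relations_def by blast

lemma frag_extend_diff_fun:
  fixes h h' :: "'b \<Rightarrow> 'a \<Rightarrow>\<^sub>0 int"
  shows "frag_extend (\<lambda>p. h p - h' p) f = frag_extend h f - frag_extend h' f"
proof -
  have "frag_cmul c (a - b) = frag_cmul c a - frag_cmul c b" for c and a b :: "'a \<Rightarrow>\<^sub>0 int"
    using frag_cmul_distrib2[of c a "- b"] by (simp add: poly_mapping_eqI lookup_minus right_diff_distrib)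
  then show ?thesis by (simp add: frag_extend_def flip: sum_subtractf)
qed

lemma pair_ring_simps:
  "x \<in> carrier (pair_ring L A) \<longleftrightarrow> Poly_Mapping.keys x \<subseteq> carrier L \<times> carrier A"
  "\<one>\<^bsub>pair_ring L A\<^esub> = frag_of (\<one>\<^bsub>L\<^esub>, \<one>\<^bsub>A\<^esub>)"
  "\<zero>\<^bsub>pair_ring L A\<^esub> = 0"
  "f \<oplus>\<^bsub>pair_ring L A\<^esub> g = f + g"
  "frag_of p \<otimes>\<^bsub>pair_ring L A\<^esub> frag_of q = frag_of (fst p \<otimes>\<^bsub>L\<^esub> fst q, snd p \<otimes>\<^bsub>A\<^esub> snd q)"
  "0 \<otimes>\<^bsub>pair_ring L A\<^esub> f = 0"
  "f \<otimes>\<^bsub>pair_ring L A\<^esub> 0 = 0"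
  "(f - f') \<otimes>\<^bsub>pair_ring L A\<^esub> g = f \<otimes>\<^bsub>pair_ring L A\<^esub> g - f' \<otimes>\<^bsub>pair_ring L A\<^esub> g"
  "f \<otimes>\<^bsub>pair_ring L A\<^esub> (g - g') = f \<otimes>\<^bsub>pair_ring L A\<^esub> g - f \<otimes>\<^bsub>pair_ring L A\<^esub> g'"
  "(f + f') \<otimes>\<^bsub>pair_ring L A\<^esub> g = f \<otimes>\<^bsub>pair_ring L A\<^esub> g + f' \<otimes>\<^bsub>pair_ring L A\<^esub> g"
  "- f \<otimes>\<^bsub>pair_ring L A\<^esub> g = - (f \<otimes>\<^bsub>pair_ring L A\<^esub> g)"
  by (simp_all add: pair_ring_def frag_extend_diff frag_extend_diff_fun frag_extend_add
      frag_extend_minus frag_extend_eq_0)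

lemma pair_ring_mult_closed:
  assumes "cring L" "cring A"
    and "Poly_Mapping.keys f \<subseteq> carrier L \<times> carrier A" "Poly_Mapping.keys g \<subseteq> carrier L \<times> carrier A"
  shows "Poly_Mapping.keys (f \<otimes>\<^bsub>pair_ring L A\<^esub> g) \<subseteq> carrier L \<times> carrier A"
proof -
  interpret L: cring L by fact
  interpret A: cring A by fact
  show ?thesis
    using assms(3)
  proof (induction f rule: frag_induction)
    case (one p)
    show ?case
      using assms(4)
    proof (induction g rule: frag_induction)
      case (diff x y)
      then show ?case
        unfolding pair_ring_simps(9) by (intro order_trans[OF keys_diff] Un_least)
    qed (use one in \<open>auto simp: pair_ring_simps\<close>)
  next
    case (diff x y)
    then show ?case
      unfolding pair_ring_simps(8) by (intro order_trans[OF keys_diff] Un_least)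
  qed (simp add: pair_ring_simps)
qed

lemma pair_ring_cring:
  assumes "cring L" "cring A"
  shows "cring (pair_ring L A)"
proof -
  interpret L: cring L by fact
  interpret A: cring A by fact
  let ?S = "carrier L \<times> carrier A"
  have comm: "f \<otimes>\<^bsub>pair_ring L A\<^esub> g = g \<otimes>\<^bsub>pair_ring L A\<^esub> f"
    if f: "Poly_Mapping.keys f \<subseteq> ?S" and g: "Poly_Mapping.keys g \<subseteq> ?S" for f g
    using f
  proof (induction f rule: frag_induction)
    case (one p)
    show ?case
      using g by (induction g rule: frag_induction)
        (use one in \<open>auto simp: pair_ring_simps L.m_comm A.m_comm\<close>)
  qed (auto simp: pair_ring_simps)
  have assoc: "f \<otimes>\<^bsub>pair_ring L A\<^esub> g \<otimes>\<^bsub>pair_ring L A\<^esub> h = f \<otimes>\<^bsub>pair_ring L A\<^esub> (g \<otimes>\<^bsub>pair_ring L A\<^esub> h)"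
    if f: "Poly_Mapping.keys f \<subseteq> ?S" and g: "Poly_Mapping.keys g \<subseteq> ?S"
      and h: "Poly_Mapping.keys h \<subseteq> ?S" for f g h
    using f
  proof (induction f rule: frag_induction)
    case p: (one p)
    show ?case
      using g
    proof (induction g rule: frag_induction)
      case q: (one q)
      show ?case
        using h by (induction h rule: frag_induction)
          (use p q in \<open>auto simp: pair_ring_simps L.m_assoc A.m_assoc\<close>)
    qed (auto simp: pair_ring_simps)
  qed (auto simp: pair_ring_simps)
  have one: "\<one>\<^bsub>pair_ring L A\<^esub> \<otimes>\<^bsub>pair_ring L A\<^esub> f = f" if "Poly_Mapping.keys f \<subseteq> ?S" for f
    using that by (induction f rule: frag_induction) (auto simp: pair_ring_simps)
  have add: "Poly_Mapping.keys (x + y) \<subseteq> ?S"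
    if "Poly_Mapping.keys x \<subseteq> ?S" "Poly_Mapping.keys y \<subseteq> ?S" for x y :: "('a \<times> 'c) \<Rightarrow>\<^sub>0 int"
    using that by (intro order_trans[OF keys_add] Un_least)
  have neg: "\<exists>y\<in>carrier (pair_ring L A). y + x = 0" if "Poly_Mapping.keys x \<subseteq> ?S" for x
    using that by (intro bexI[of _ "- x"]) (simp_all add: pair_ring_simps)
  show ?thesis
    by (intro cringI abelian_groupI comm_monoidI; unfold pair_ring_simps(1-4))
      ((rule comm add.commute; assumption?) | simp add: add assoc pair_ring_mult_closed[OF assms]
        neg one[unfolded pair_ring_simps] pair_ring_simps(10) add.assoc)+
qed

lemma tensor_ideal_ideal:
  assumes L: "algebra K L" and A: "algebra K A"
  shows "ideal (tensor_ideal K L A) (pair_ring L A)"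
proof -
  interpret L: algebra K L by fact
  interpret A: algebra K A by fact
  interpret P: cring "pair_ring L A"
    by (rule pair_ring_cring[OF L.M_cring A.M_cring])
  let ?S = "carrier L \<times> carrier A"
  let ?R = "tensor_relations K L A" and ?I = "tensor_ideal K L A"
  have add_mon: "add_monoid (pair_ring L A) = free_Abelian_group ?S"
    by (simp add: pair_ring_def free_Abelian_group_def)
  have k2: "Poly_Mapping.keys (frag_of u - frag_of v) \<subseteq> ?S" if "u \<in> ?S" "v \<in> ?S" for u v
    using that by (intro order_trans[OF keys_diff]) simp
  have k3: "Poly_Mapping.keys (frag_of u - frag_of v - frag_of w) \<subseteq> ?S"
    if "u \<in> ?S" "v \<in> ?S" "w \<in> ?S" for u v w
    using that by (intro order_trans[OF keys_diff] Un_least k2) simp_all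
  have R: "Poly_Mapping.keys r \<subseteq> ?S" if "r \<in> ?R" for r
    using that by (cases rule: tensor_relations_cases) (simp_all add: k2 k3)
  then have RS: "?R \<subseteq> carrier (free_Abelian_group ?S)" by auto
  interpret G: group "free_Abelian_group ?S" by simp
  have sub: "subgroup ?I (free_Abelian_group ?S)"
    unfolding tensor_ideal_def by (rule G.generate_is_subgroup[OF RS])
  have inI: "r \<in> ?R \<Longrightarrow> r \<in> ?I" for r
    unfolding tensor_ideal_def by (rule generate.incl)
  have diffI: "x - y \<in> ?I" if "x \<in> ?I" "y \<in> ?I" for x y
  proof -
    have "Poly_Mapping.keys y \<subseteq> ?S" using subgroup.mem_carrier[OF sub that(2)] by simp
    then show ?thesis
      using subgroup.m_closed[OF sub that(1) subgroup.m_inv_closed[OF sub that(2)]] by simp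
  qed
  have zeroI: "0 \<in> ?I" using subgroup.one_closed[OF sub] by simp
  have pR: "r \<otimes>\<^bsub>pair_ring L A\<^esub> frag_of p \<in> ?R" if r: "r \<in> ?R" and p: "p \<in> ?S" for r p
  proof -
    obtain u v where [simp]: "p = (u, v)" "u \<in> carrier L" "v \<in> carrier A" using p by auto
    note [simp] = pair_ring_simps L.l_distr A.l_distr L.smult_assoc2 A.smult_assoc2
    from r show ?thesis
    proof (cases rule: tensor_relations_cases)
      case (left x x' a)
      then have "r \<otimes>\<^bsub>pair_ring L A\<^esub> frag_of p = frag_of (x \<otimes>\<^bsub>L\<^esub> u \<oplus>\<^bsub>L\<^esub> x' \<otimes>\<^bsub>L\<^esub> u, a \<otimes>\<^bsub>A\<^esub> v)
          - frag_of (x \<otimes>\<^bsub>L\<^esub> u, a \<otimes>\<^bsub>A\<^esub> v) - frag_of (x' \<otimes>\<^bsub>L\<^esub> u, a \<otimes>\<^bsub>A\<^esub> v)" by simp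
      moreover have "x \<otimes>\<^bsub>L\<^esub> u \<in> carrier L" "x' \<otimes>\<^bsub>L\<^esub> u \<in> carrier L" "a \<otimes>\<^bsub>A\<^esub> v \<in> carrier A"
        using left by auto
      ultimately show ?thesis unfolding tensor_relations_def by blast
    next
      case (right x a a')
      then have "r \<otimes>\<^bsub>pair_ring L A\<^esub> frag_of p = frag_of (x \<otimes>\<^bsub>L\<^esub> u, a \<otimes>\<^bsub>A\<^esub> v \<oplus>\<^bsub>A\<^esub> a' \<otimes>\<^bsub>A\<^esub> v)
          - frag_of (x \<otimes>\<^bsub>L\<^esub> u, a \<otimes>\<^bsub>A\<^esub> v) - frag_of (x \<otimes>\<^bsub>L\<^esub> u, a' \<otimes>\<^bsub>A\<^esub> v)" by simp
      moreover have "x \<otimes>\<^bsub>L\<^esub> u \<in> carrier L" "a \<otimes>\<^bsub>A\<^esub> v \<in> carrier A" "a' \<otimes>\<^bsub>A\<^esub> v \<in> carrier A"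
        using right by auto
      ultimately show ?thesis unfolding tensor_relations_def by blast
    next
      case (smult c x a)
      then have "r \<otimes>\<^bsub>pair_ring L A\<^esub> frag_of p = frag_of (c \<odot>\<^bsub>L\<^esub> (x \<otimes>\<^bsub>L\<^esub> u), a \<otimes>\<^bsub>A\<^esub> v)
          - frag_of (x \<otimes>\<^bsub>L\<^esub> u, c \<odot>\<^bsub>A\<^esub> (a \<otimes>\<^bsub>A\<^esub> v))" by simp
      moreover have "x \<otimes>\<^bsub>L\<^esub> u \<in> carrier L" "a \<otimes>\<^bsub>A\<^esub> v \<in> carrier A"
        using smult by auto
      ultimately show ?thesis unfolding tensor_relations_def using smult(1) by blast
    qed
  qed
  have RI: "r \<otimes>\<^bsub>pair_ring L A\<^esub> f \<in> ?I" if r: "r \<in> ?R" and f: "Poly_Mapping.keys f \<subseteq> ?S" for r f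
    using f
  proof (induction f rule: frag_induction)
    case (one p)
    then show ?case using pR[OF r] inI by blast
  qed (auto simp: pair_ring_simps zeroI diffI)
  have II: "i \<otimes>\<^bsub>pair_ring L A\<^esub> f \<in> ?I" if "i \<in> ?I" and f: "Poly_Mapping.keys f \<subseteq> ?S" for i f
    using that(1) unfolding tensor_ideal_def
  proof (induction rule: generate.induct)
    case one
    then show ?case
      using zeroI by (simp add: pair_ring_simps tensor_ideal_def)
  next
    case (incl h)
    then show ?case using RI[OF _ f] by (simp add: tensor_ideal_def)
  next
    case (inv h)
    then show ?case
      using diffI[OF zeroI RI[OF inv f]] R[OF inv] by (simp add: pair_ring_simps tensor_ideal_def)
  next
    case (eng h1 h2)
    then show ?case
      using subgroup.m_closed[OF sub] by (simp add: pair_ring_simps tensor_ideal_def)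
  qed
  show ?thesis
  proof (rule idealI)
    show "ring (pair_ring L A)" by (rule P.ring_axioms)
    show "subgroup ?I (add_monoid (pair_ring L A))" using sub by (simp only: add_mon)
    fix i x assume i: "i \<in> ?I" and x: "x \<in> carrier (pair_ring L A)"
    show "i \<otimes>\<^bsub>pair_ring L A\<^esub> x \<in> ?I"
      using II[OF i] x by (simp add: pair_ring_simps(1))
    moreover have "i \<in> carrier (pair_ring L A)"
      using subgroup.mem_carrier[OF sub i] by (simp add: pair_ring_simps(1))
    ultimately show "x \<otimes>\<^bsub>pair_ring L A\<^esub> i \<in> ?I" using P.m_comm x by simp
  qed
qed

lemma tensor_ring_cring:
  assumes "algebra K L" "algebra K A"
  shows "cring (tensor_ring K L A)"
  unfolding tensor_ring_def
proof (rule ideal.quotient_is_cring)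
  show "ideal (tensor_ideal K L A) (pair_ring L A)"
    using assms by (rule tensor_ideal_ideal)
  show "cring (pair_ring L A)"
    using assms by (simp add: pair_ring_cring algebra_def)
qed

end

theory Submission
  imports Defs "HOL-Computational_Algebra.Polynomial"
begin

text \<open>
  Identify \<open>A[x]\<close> with \<open>A'[x']\<close>.  If \<open>A \<noteq> A'\<close> as subrings, the Hasse derivatives with respect to
  \<open>x'\<close> are nonzero on \<open>A\<close>, and the leading part of them for a suitable weight of \<open>x\<close> induces a
  nontrivial locally finite iterative higher derivation of \<open>A\<close>.  Its ring of invariants \<open>C\<close> has
  transcendence degree \<open>1\<close>, and the primes of \<open>L \<otimes> C\<close> have residue field \<open>L\<close>, where \<open>L\<close> is the
  algebraic closure.  Among the elements of \<open>A\<close> of least positive degree choose \<open>t\<close> such that its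
  leading coefficient has as few prime factors as possible; factoriality of \<open>A\<close> and of \<open>L \<otimes> A\<close>
  then allows one to divide by the primes of \<open>C\<close>, and \<open>A = C[t]\<close>.  Likewise \<open>A' = C'[t']\<close>.  If
  \<open>C = C'\<close> both are polynomial rings over the same ring.  Otherwise neither of \<open>C\<close>, \<open>C'\<close> is \<open>K\<close>, by a
  count of dimensions, so \<open>C\<close> has elements of positive degree in \<open>x'\<close>, which forces \<open>C = K[s]\<close>, and
  similarly for \<open>C'\<close>; hence \<open>A\<close> and \<open>A'\<close> are polynomial rings in two variables over \<open>K\<close>.
\<close>


section \<open>Subrings of a commutative ring and their polynomials\<close>

text \<open>Higher derivations take the place of derivations because in characteristic p a
  derivation kills all p-th powers and its kernel is too large. The obstacle is to get from "some
  multiple c * a with c in C lies in \<open>C[t]\<close>" to \<open>A = C[t]\<close>. A prime p of C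
  may divide a polynomial in t without dividing its coefficients: modulo p the polynomial lives over
  an algebraic extension of K and need not have a linear factor there. Modulo a prime q of
  \<open>L \<otimes> A\<close> above p its coefficients become constants of L, it splits, and q
  divides t - m for some m in L. Coordinates of a multiple of this relation lead back to A, where p
  divides \<alpha> * t - r although p does not divide \<alpha>. Then t could be replaced by some (t
  - r') / p with r' in C, whose leading coefficient has one prime less. The transcendence degree
  enters through upper bounds: any four elements of \<open>A[x]\<close>, three of A, two of C are
  dependent. These come from counting monomials, which works with subrings alone and does not have
  to leave them for their fraction fields.\<close>

hide_const (open) UnivPoly.coeff UnivPoly.monom

text \<open>The unit \<open>e\<close> of \<open>S\<close> is an idempotent of the ambient ring and in general not \<open>1\<close>.\<close>

locale rng_in =
  fixes e :: "'r::comm_ring_1" and S :: "'r set"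
  assumes one_in: "e \<in> S"
    and one_mult: "a \<in> S \<Longrightarrow> e * a = a"
    and diff_in: "a \<in> S \<Longrightarrow> b \<in> S \<Longrightarrow> a - b \<in> S"
    and mult_in: "a \<in> S \<Longrightarrow> b \<in> S \<Longrightarrow> a * b \<in> S"
begin

lemma mult_one: "a \<in> S \<Longrightarrow> a * e = a"
  using one_mult by (simp add: mult.commute)

lemma zero_in [simp]: "0 \<in> S"
  using diff_in[OF one_in one_in] by simp

lemma uminus_in: "a \<in> S \<Longrightarrow> - a \<in> S"
  using diff_in[OF zero_in] by fastforce

lemma add_in: "a \<in> S \<Longrightarrow> b \<in> S \<Longrightarrow> a + b \<in> S"
  using diff_in[OF _ uminus_in] by fastforce

lemma sum_in: "(\<And>i. i \<in> I \<Longrightarrow> f i \<in> S) \<Longrightarrow> sum f I \<in> S"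
  by (induction I rule: infinite_finite_induct) (auto intro: add_in)

text \<open>\<open>b ^ 0\<close> is 1, which need not lie in S. This is why powers and products
  carry a factor from S throughout.\<close>

lemma mult_power_in: "a \<in> S \<Longrightarrow> b \<in> S \<Longrightarrow> a * b ^ n \<in> S"
  by (induction n) (auto intro: mult_in simp: mult.left_commute[of a b] mult_in)

lemma power_in: "b \<in> S \<Longrightarrow> n > 0 \<Longrightarrow> b ^ n \<in> S"
  using mult_power_in[of b b "n - 1"] by (cases n) auto

lemma mult_prod_in: "a \<in> S \<Longrightarrow> (\<And>b. b \<in> set ps \<Longrightarrow> b \<in> S) \<Longrightarrow> a * prod_list ps \<in> S"
  by (induction ps) (auto intro: mult_in simp: mult.left_commute[of a])

lemma of_nat_mult_in: "a \<in> S \<Longrightarrow> of_nat n * a \<in> S"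
  by (induction n) (auto simp: distrib_right intro: add_in)

end

text \<open>A set of polynomials over the ambient ring: \<open>polys S\<close> is again a
  \<open>rng_in\<close>, with unit \<open>[:e:]\<close>, so the construction can be iterated and
  whatever is proved for S applies to it.\<close>

definition polys :: "'r::comm_ring_1 set \<Rightarrow> 'r poly set"
  where "polys S = {p. \<forall>i. coeff p i \<in> S}"

lemma polys_coeff: "p \<in> polys S \<Longrightarrow> coeff p i \<in> S"
  by (simp add: polys_def)

lemma polys_mono: "S \<subseteq> T \<Longrightarrow> polys S \<subseteq> polys T"
  by (auto simp: polys_def)

context rng_in
begin

lemma polys_rng_in: "rng_in [:e:] (polys S)"
proof
  show "[:e:] \<in> polys S"
    by (auto simp: polys_def coeff_pCons one_in split: nat.split)
  show "[:e:] * p = p" if "p \<in> polys S" for p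
    using that by (intro poly_eqI) (simp add: polys_def one_mult)
  show "p - q \<in> polys S" if "p \<in> polys S" "q \<in> polys S" for p q
    using that by (simp add: polys_def diff_in)
  show "p * q \<in> polys S" if "p \<in> polys S" "q \<in> polys S" for p q
    using that by (auto simp: polys_def coeff_mult intro!: sum_in mult_in)
qed

interpretation P: rng_in "[:e:]" "polys S"
  by (rule polys_rng_in)

lemma const_in_polys [simp]: "[:a:] \<in> polys S \<longleftrightarrow> a \<in> S"
  by (auto simp: polys_def coeff_pCons dest: spec[of _ 0] split: nat.split)

lemma monom_in_polys: "a \<in> S \<Longrightarrow> monom a n \<in> polys S"
  by (simp add: polys_def)

lemma pCons_in_polys: "a \<in> S \<Longrightarrow> p \<in> polys S \<Longrightarrow> pCons a p \<in> polys S"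
  by (auto simp: polys_def coeff_pCons split: nat.split)

lemma smult_in_polys: "a \<in> S \<Longrightarrow> p \<in> polys S \<Longrightarrow> smult a p \<in> polys S"
  by (auto simp: polys_def intro: mult_in)

lemma poly_in: "p \<in> polys S \<Longrightarrow> x \<in> S \<Longrightarrow> poly p x \<in> S"
  unfolding poly_altdef by (intro sum_in mult_power_in) (auto simp: polys_def)

lemma polys_induct [consumes 1, case_names zero pCons]:
  assumes "p \<in> polys S" and "P 0"
    and "\<And>a p. a \<in> S \<Longrightarrow> p \<in> polys S \<Longrightarrow> P p \<Longrightarrow> P (pCons a p)"
  shows "P p"
  using assms(1)
proof (induction p)
  case (pCons a p)
  have "a \<in> S" "p \<in> polys S"
    using polys_coeff[OF pCons.prems, of 0] polys_coeff[OF pCons.prems, of "Suc i" for i]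
    by (auto simp: polys_def)
  then show ?case using pCons assms(3) by blast
qed (rule assms(2))

end

locale dom_in = rng_in +
  assumes one_nz: "e \<noteq> 0"
    and integral: "a \<in> S \<Longrightarrow> b \<in> S \<Longrightarrow> a * b = 0 \<Longrightarrow> a = 0 \<or> b = 0"
begin

lemma mult_nz: "a \<in> S \<Longrightarrow> b \<in> S \<Longrightarrow> a \<noteq> 0 \<Longrightarrow> b \<noteq> 0 \<Longrightarrow> a * b \<noteq> 0"
  using integral by blast

lemma cancel: "a \<in> S \<Longrightarrow> b \<in> S \<Longrightarrow> c \<in> S \<Longrightarrow> c \<noteq> 0 \<Longrightarrow> c * a = c * b \<Longrightarrow> a = b"
  using integral[of c "a - b"] diff_in by (auto simp: algebra_simps)

lemma power_nz: "b \<in> S \<Longrightarrow> b \<noteq> 0 \<Longrightarrow> b ^ n \<noteq> 0"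
proof (induction n)
  case (Suc n)
  then show ?case
    using mult_nz[of b "b ^ n"] power_in[of b n] by (cases "n = 0") auto
qed (use one_nz in \<open>auto\<close>)

lemma mult_power_nz: "a \<in> S \<Longrightarrow> b \<in> S \<Longrightarrow> a \<noteq> 0 \<Longrightarrow> b \<noteq> 0 \<Longrightarrow> a * b ^ n \<noteq> 0"
  using mult_nz[of a "b ^ n"] power_in[of b n] power_nz[of b n] by (cases "n = 0") auto

text \<open>The ambient ring may have zero divisors; degrees add because the two leading
  coefficients lie in the domain S.\<close>

lemma degree_mult_polys:
  assumes "p \<in> polys S" "q \<in> polys S" "p \<noteq> 0" "q \<noteq> 0"
  shows "degree (p * q) = degree p + degree q" "lead_coeff (p * q) = lead_coeff p * lead_coeff q"
    "p * q \<noteq> 0"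
proof -
  have nz: "lead_coeff p * lead_coeff q \<noteq> 0"
    using assms by (intro mult_nz) (auto simp: polys_def)
  then show d: "degree (p * q) = degree p + degree q"
    using degree_mult_le[of p q] le_degree[of "p * q" "degree p + degree q"]
    by (simp add: coeff_mult_degree_sum)
  then show "lead_coeff (p * q) = lead_coeff p * lead_coeff q"
    by (simp add: coeff_mult_degree_sum)
  then show "p * q \<noteq> 0" using nz by auto
qed

lemma polys_dom_in: "dom_in [:e:] (polys S)"
proof (intro dom_in.intro polys_rng_in dom_in_axioms.intro)
  show "[:e:] \<noteq> 0" using one_nz by simp
  show "p = 0 \<or> q = 0" if "p \<in> polys S" "q \<in> polys S" "p * q = 0" for p q
    using degree_mult_polys(3)[of p q] that by blast
qed

interpretation P: dom_in "[:e:]" "polys S"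
  by (rule polys_dom_in)

text \<open>The factor a keeps the case n = 0 inside \<open>polys S\<close>, as \<open>p ^ 0\<close>
  is 1 and not \<open>[:e:]\<close>.\<close>

lemma degree_power_polys:
  assumes "p \<in> polys S" "p \<noteq> 0" "a \<in> S" "a \<noteq> 0"
  shows "degree (smult a (p ^ n)) = n * degree p" "smult a (p ^ n) \<noteq> 0" "smult a (p ^ n) \<in> polys S"
proof -
  have "degree (smult a (p ^ n)) = n * degree p \<and> smult a (p ^ n) \<noteq> 0 \<and> smult a (p ^ n) \<in> polys S"
  proof (induction n)
    case 0
    then show ?case using assms by (simp add: one_pCons del: const_in_polys, simp)
  next
    case (Suc n)
    have "smult a (p ^ Suc n) = p * smult a (p ^ n)" by simp
    then show ?case
      using degree_mult_polys[OF assms(1) _ assms(2), of "smult a (p ^ n)"] Suc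
        P.mult_in[OF assms(1), of "smult a (p ^ n)"]
      by auto
  qed
  then show "degree (smult a (p ^ n)) = n * degree p" "smult a (p ^ n) \<noteq> 0" "smult a (p ^ n) \<in> polys S"
    by auto
qed

end

section \<open>Units, primes and the number of prime factors\<close>

definition unit_in :: "'r::comm_ring_1 \<Rightarrow> 'r set \<Rightarrow> 'r \<Rightarrow> bool"
  where "unit_in e S u \<longleftrightarrow> u \<in> S \<and> (\<exists>v\<in>S. u * v = e)"

definition dvd_in :: "'r::comm_ring_1 set \<Rightarrow> 'r \<Rightarrow> 'r \<Rightarrow> bool"
  where "dvd_in S p a \<longleftrightarrow> (\<exists>c\<in>S. a = p * c)"

definition prime_in :: "'r::comm_ring_1 \<Rightarrow> 'r set \<Rightarrow> 'r \<Rightarrow> bool"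
  where "prime_in e S p \<longleftrightarrow> p \<in> S \<and> p \<noteq> 0 \<and> \<not> unit_in e S p \<and>
    (\<forall>a\<in>S. \<forall>b\<in>S. dvd_in S p (a * b) \<longrightarrow> dvd_in S p a \<or> dvd_in S p b)"

text \<open>The unit keeps the product in S even for an empty list. The number n of primes serves as
  a measure in inductions and decides the choice of the generator t later.\<close>

definition prime_fact :: "'r::comm_ring_1 \<Rightarrow> 'r set \<Rightarrow> nat \<Rightarrow> 'r \<Rightarrow> bool"
  where "prime_fact e S n a \<longleftrightarrow>
    (\<exists>u ps. unit_in e S u \<and> (\<forall>p\<in>set ps. prime_in e S p) \<and> length ps = n \<and> a = u * prod_list ps)"

text \<open>Kaplansky's form of factoriality: factorizations into primes exist, and uniqueness
  follows from primality.\<close>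

definition factorial_in :: "'r::comm_ring_1 \<Rightarrow> 'r set \<Rightarrow> bool"
  where "factorial_in e S \<longleftrightarrow> dom_in e S \<and> (\<forall>a\<in>S. a \<noteq> 0 \<longrightarrow> (\<exists>n. prime_fact e S n a))"

context dom_in
begin

lemma dvd_in_mult: "dvd_in S p a \<Longrightarrow> b \<in> S \<Longrightarrow> dvd_in S p (a * b)"
  by (auto simp: dvd_in_def mult.assoc intro!: bexI[OF _ mult_in])

lemma dvd_in_add: "dvd_in S p a \<Longrightarrow> dvd_in S p b \<Longrightarrow> dvd_in S p (a + b)"
  by (auto simp: dvd_in_def simp flip: distrib_left intro!: bexI[OF _ add_in])

lemma dvd_in_diff: "dvd_in S p a \<Longrightarrow> dvd_in S p b \<Longrightarrow> dvd_in S p (a - b)"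
  by (auto simp: dvd_in_def simp flip: right_diff_distrib intro!: bexI[OF _ diff_in])

lemma dvd_in_0: "dvd_in S p 0"
  by (auto simp: dvd_in_def intro!: bexI[of _ 0])

lemma dvd_in_sum: "(\<And>i. i \<in> I \<Longrightarrow> dvd_in S p (f i)) \<Longrightarrow> dvd_in S p (sum f I)"
  by (induction I rule: infinite_finite_induct) (auto intro: dvd_in_add dvd_in_0)

lemma dvd_in_trans: "dvd_in S p a \<Longrightarrow> dvd_in S a b \<Longrightarrow> dvd_in S p b"
  by (auto simp: dvd_in_def mult.assoc intro!: bexI[OF _ mult_in])

lemma unit_mult: "unit_in e S u \<Longrightarrow> unit_in e S v \<Longrightarrow> unit_in e S (u * v)"
proof -
  assume "unit_in e S u" "unit_in e S v"
  then obtain a b where ab: "u \<in> S" "v \<in> S" "a \<in> S" "b \<in> S" "u * a = e" "v * b = e"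
    by (auto simp: unit_in_def)
  have "u * v * (a * b) = (u * a) * (v * b)" by (simp add: mult_ac)
  then have "u * v * (a * b) = e" using ab one_in one_mult by simp
  then show ?thesis using ab mult_in by (auto simp: unit_in_def)
qed

lemma unit_multD: "a \<in> S \<Longrightarrow> b \<in> S \<Longrightarrow> unit_in e S (a * b) \<Longrightarrow> unit_in e S a"
  by (auto simp: unit_in_def mult.assoc intro!: bexI[OF _ mult_in])

lemma unit_one: "unit_in e S e"
  using one_in one_mult by (auto simp: unit_in_def)

lemma prime_not_dvd_unit: "prime_in e S p \<Longrightarrow> unit_in e S u \<Longrightarrow> \<not> dvd_in S p u"
  unfolding prime_in_def dvd_in_def using unit_multD by blast

lemma prime_dvd_fact:
  assumes p: "prime_in e S p" and "unit_in e S u" "\<And>q. q \<in> set ps \<Longrightarrow> prime_in e S q"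
    and "dvd_in S p (u * prod_list ps)"
  shows "\<exists>q\<in>set ps. dvd_in S p q"
  using assms(2-)
proof (induction ps)
  case Nil
  then show ?case using prime_not_dvd_unit[OF p] by simp
next
  case (Cons q ps)
  have q: "q \<in> S" "u * prod_list ps \<in> S"
    using Cons.prems by (auto simp: prime_in_def unit_in_def intro!: mult_prod_in)
  have "dvd_in S p (q * (u * prod_list ps))" using Cons.prems(3) by (simp add: mult_ac)
  then have "dvd_in S p q \<or> dvd_in S p (u * prod_list ps)"
    using p q by (simp add: prime_in_def)
  then show ?case using Cons by auto
qed

lemma prime_dvd_prime:
  assumes "prime_in e S p" "prime_in e S q" "dvd_in S p q"
  shows "\<exists>w. unit_in e S w \<and> q = p * w"
proof -
  from assms(3) obtain w where w: "w \<in> S" "q = p * w" by (auto simp: dvd_in_def)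
  have p: "p \<in> S" "p \<noteq> 0" "q \<in> S" "q \<noteq> 0" using assms by (auto simp: prime_in_def)
  have "dvd_in S q (p * w)" using w p one_in mult_one by (auto simp: dvd_in_def intro!: bexI[of _ e])
  then consider "dvd_in S q p" | "dvd_in S q w" using assms(2) p w by (auto simp: prime_in_def)
  then show ?thesis
  proof cases
    case 1
    then obtain v where v: "v \<in> S" "p = q * v" by (auto simp: dvd_in_def)
    then have "p * e = p * (w * v)" using w p by (simp add: mult_one mult.assoc)
    then have "w * v = e" using cancel[OF one_in mult_in[OF w(1) v(1)] p(1,2)] by simp
    then show ?thesis using w v by (auto simp: unit_in_def)
  next
    case 2
    then obtain v where v: "v \<in> S" "w = q * v" by (auto simp: dvd_in_def)
    then have "q * e = q * (p * v)" using w mult_one[OF p(3)] by (simp add: mult_ac)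
    then have "p * v = e" using cancel[OF one_in mult_in[OF p(1) v(1)] p(3,4)] by simp
    then show ?thesis using assms(1) v p by (auto simp: unit_in_def prime_in_def)
  qed
qed

text \<open>The prime p divides one of the listed primes and so is associated to it; removing that
  one from the list leaves a factorization of c.\<close>

lemma prime_fact_div:
  assumes p: "prime_in e S p" and c: "c \<in> S" and f: "prime_fact e S n (p * c)"
  shows "\<exists>m. n = Suc m \<and> prime_fact e S m c"
proof -
  obtain u ps where ups: "unit_in e S u" "\<forall>q\<in>set ps. prime_in e S q" "length ps = n" "p * c = u * prod_list ps"
    using f by (auto simp: prime_fact_def)
  have pS: "p \<in> S" "p \<noteq> 0" using p by (auto simp: prime_in_def)
  have "dvd_in S p (u * prod_list ps)" using ups(4)[symmetric] c by (auto simp: dvd_in_def)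
  then obtain q where q: "q \<in> set ps" "dvd_in S p q" using prime_dvd_fact[OF p ups(1)] ups(2) by blast
  then obtain w where w: "unit_in e S w" "q = p * w" using prime_dvd_prime[OF p] ups(2) by blast
  obtain ys zs where yz: "ps = ys @ q # zs" using q(1) by (meson split_list)
  have uw: "unit_in e S (u * w)" using unit_mult ups(1) w(1) by blast
  have mem: "u * w * prod_list (ys @ zs) \<in> S"
    using uw ups(2) by (intro mult_prod_in) (auto simp: unit_in_def prime_in_def yz)
  have "p * c = p * (u * w * prod_list (ys @ zs))"
    using ups(4) w(2) by (simp add: yz mult_ac)
  then have "c = u * w * prod_list (ys @ zs)" using cancel[OF c mem pS] by simp
  then have "prime_fact e S (length (ys @ zs)) c"
    unfolding prime_fact_def using uw ups(2) yz by (intro exI[of _ "u * w"] exI[of _ "ys @ zs"]) auto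
  then show ?thesis using ups(3) yz by auto
qed

lemma prime_fact_0: "prime_fact e S 0 c \<longleftrightarrow> unit_in e S c"
  by (auto simp: prime_fact_def)

lemma prime_fact_in: "prime_fact e S n c \<Longrightarrow> c \<in> S"
  by (auto simp: prime_fact_def unit_in_def prime_in_def intro!: mult_prod_in)

lemma prime_fact_SucD:
  assumes "prime_fact e S (Suc n) c"
  obtains p c' where "prime_in e S p" "prime_fact e S n c'" "c = p * c'" "c' \<in> S"
proof -
  obtain u ps where ups: "unit_in e S u" "\<forall>q\<in>set ps. prime_in e S q" "length ps = Suc n" "c = u * prod_list ps"
    using assms by (auto simp: prime_fact_def)
  then obtain p qs where "ps = p # qs" by (cases ps) auto
  then have "prime_in e S p" "prime_fact e S n (u * prod_list qs)" "c = p * (u * prod_list qs)"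
    using ups by (auto simp: prime_fact_def mult_ac)
  then show ?thesis using that prime_fact_in by blast
qed

text \<open>The primes of the product are peeled off one at a time, each from the factor that it
  divides. The additivity of the count makes \<open>irred_factorization\<close> terminate.\<close>

lemma prime_fact_split:
  assumes "prime_fact e S n (a * b)" "a \<in> S" "b \<in> S"
  shows "\<exists>i j. i + j = n \<and> prime_fact e S i a \<and> prime_fact e S j b"
  using assms
proof (induction n arbitrary: a b)
  case 0
  then show ?case using unit_multD[of a b] unit_multD[of b a] by (auto simp: prime_fact_0 mult.commute)
next
  case (Suc n)
  obtain p c where p: "prime_in e S p" and c: "prime_fact e S n c" "a * b = p * c" "c \<in> S"
    using Suc.prems(1) by (rule prime_fact_SucD)
  have ppS: "p \<in> S" "p \<noteq> 0" using p by (auto simp: prime_in_def)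
  have main: "\<exists>i j. i + j = Suc n \<and> prime_fact e S i x \<and> prime_fact e S j y"
    if d: "dvd_in S p x" and xy: "x \<in> S" "y \<in> S" "x * y = p * c" for x y
  proof -
    obtain x' where x': "x' \<in> S" "x = p * x'" using d by (auto simp: dvd_in_def)
    have "p * (x' * y) = p * c" using xy x' by (simp add: mult.assoc)
    then have "x' * y = c" using cancel[OF _ c(3) ppS] mult_in x' xy by blast
    then obtain i j where ij: "i + j = n" "prime_fact e S i x'" "prime_fact e S j y"
      using Suc.IH[of x' y] c x' xy by auto
    obtain u ps where ups: "unit_in e S u" "\<forall>q\<in>set ps. prime_in e S q" "length ps = i" "x' = u * prod_list ps"
      using ij by (auto simp: prime_fact_def)
    then have "prime_fact e S (Suc i) x"
      unfolding prime_fact_def using x' p by (intro exI[of _ u] exI[of _ "p # ps"]) (auto simp: mult_ac)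
    then show ?thesis using ij by (intro exI[of _ "Suc i"] exI[of _ j]) auto
  qed
  have "dvd_in S p (a * b)" using c by (auto simp: dvd_in_def)
  then have "dvd_in S p a \<or> dvd_in S p b" using p Suc.prems by (auto simp: prime_in_def)
  then show ?case
  proof
    assume "dvd_in S p a"
    then show ?case using main[of a b] Suc.prems c by simp
  next
    assume "dvd_in S p b"
    then obtain i j where "i + j = Suc n" "prime_fact e S i b" "prime_fact e S j a"
      using main[of b a] Suc.prems c by (auto simp: mult.commute)
    then show ?case by (intro exI[of _ j] exI[of _ i]) auto
  qed
qed

end


section \<open>Factoriality of polynomial rings\<close>

context dom_in
begin

interpretation P: dom_in "[:e:]" "polys S"
  by (rule polys_dom_in)

lemma unit_nz: "unit_in e S u \<Longrightarrow> u \<noteq> 0"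
  using one_nz by (auto simp: unit_in_def)

lemma prime_unit_mult:
  assumes p: "prime_in e S p" and u: "unit_in e S u"
  shows "prime_in e S (p * u)"
proof -
  obtain v where v: "u \<in> S" "v \<in> S" "u * v = e" using u by (auto simp: unit_in_def)
  have pS: "p \<in> S" "p \<noteq> 0" using p by (auto simp: prime_in_def)
  have *: "dvd_in S (p * u) a \<longleftrightarrow> dvd_in S p a" for a
  proof
    assume "dvd_in S (p * u) a"
    then show "dvd_in S p a" using v mult_in by (auto simp: dvd_in_def mult.assoc)
  next
    assume "dvd_in S p a"
    then obtain c where c: "c \<in> S" "a = p * c" by (auto simp: dvd_in_def)
    have "p * u * (v * c) = p * ((u * v) * c)" by (simp add: mult_ac)
    then have "a = p * u * (v * c)" using c v one_mult by simp
    then show "dvd_in S (p * u) a" using c v mult_in by (auto simp: dvd_in_def)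
  qed
  have "p * u \<noteq> 0" using mult_nz[of p u] pS v unit_nz[OF u] by blast
  then show ?thesis
    using p v unit_multD[of p u] * mult_in by (auto simp: prime_in_def)
qed

lemma const_dvd_iff:
  assumes "f \<in> polys S" "p \<in> S"
  shows "dvd_in (polys S) [:p:] f \<longleftrightarrow> (\<forall>i. dvd_in S p (coeff f i))"
proof
  show "dvd_in (polys S) [:p:] f \<Longrightarrow> \<forall>i. dvd_in S p (coeff f i)"
    by (auto simp: dvd_in_def polys_def)
next
  assume "\<forall>i. dvd_in S p (coeff f i)"
  with assms(1) show "dvd_in (polys S) [:p:] f"
  proof (induction f rule: polys_induct)
    case zero
    then show ?case using P.dvd_in_0 by simp
  next
    case (pCons a f)
    have "dvd_in S p a" "\<forall>i. dvd_in S p (coeff f i)"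
      using pCons.prems[rule_format, of 0] pCons.prems[rule_format, of "Suc i" for i] by auto
    then obtain c g where "c \<in> S" "a = p * c" "g \<in> polys S" "f = [:p:] * g"
      using pCons.IH by (auto simp: dvd_in_def)
    then show ?case using pCons_in_polys by (auto simp: dvd_in_def intro!: bexI[of _ "pCons c g"])
  qed
qed

lemma unit_polysD:
  assumes "unit_in [:e:] (polys S) f"
  shows "degree f = 0" "unit_in e S (lead_coeff f)"
proof -
  obtain g where g: "f \<in> polys S" "g \<in> polys S" "f * g = [:e:]" using assms by (auto simp: unit_in_def)
  then have nz: "f \<noteq> 0" "g \<noteq> 0" using one_nz by auto
  note d = degree_mult_polys[OF g(1,2) nz]
  show "degree f = 0" using d(1) g(3) by simp
  show "unit_in e S (lead_coeff f)" using d(2) g by (auto simp: unit_in_def polys_def)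
qed

lemma unit_const: "unit_in [:e:] (polys S) [:a:] \<longleftrightarrow> unit_in e S a"
proof
  show "unit_in [:e:] (polys S) [:a:] \<Longrightarrow> unit_in e S a" using unit_polysD(2)[of "[:a:]"] by simp
  assume "unit_in e S a"
  then obtain v where "a \<in> S" "v \<in> S" "a * v = e" by (auto simp: unit_in_def)
  then show "unit_in [:e:] (polys S) [:a:]" by (auto simp: unit_in_def intro!: bexI[of _ "[:v:]"])
qed

text \<open>Gauss's lemma. At the sum of the least indices where f and g have coefficients not
  divisible by p, all terms of the convolution but one are divisible by p.\<close>

lemma const_prime:
  assumes p: "prime_in e S p"
  shows "prime_in [:e:] (polys S) [:p:]"
proof -
  have pS: "p \<in> S" "p \<noteq> 0" "\<not> unit_in e S p" using p by (auto simp: prime_in_def)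
  have "dvd_in (polys S) [:p:] f \<or> dvd_in (polys S) [:p:] g"
    if fg: "f \<in> polys S" "g \<in> polys S" "dvd_in (polys S) [:p:] (f * g)" for f g
  proof (rule ccontr)
    assume "\<not> ?thesis"
    then have nf: "\<exists>i. \<not> dvd_in S p (coeff f i)" and ng: "\<exists>i. \<not> dvd_in S p (coeff g i)"
      using const_dvd_iff[OF fg(1) pS(1)] const_dvd_iff[OF fg(2) pS(1)] by blast+
    define i where "i = (LEAST i. \<not> dvd_in S p (coeff f i))"
    define j where "j = (LEAST j. \<not> dvd_in S p (coeff g j))"
    have i: "\<not> dvd_in S p (coeff f i)" "\<And>k. k < i \<Longrightarrow> dvd_in S p (coeff f k)"
      unfolding i_def using LeastI_ex[OF nf] not_less_Least by blast+
    have j: "\<not> dvd_in S p (coeff g j)" "\<And>k. k < j \<Longrightarrow> dvd_in S p (coeff g k)"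
      unfolding j_def using LeastI_ex[OF ng] not_less_Least by blast+
    have cf: "coeff f k \<in> S" "coeff g k \<in> S" for k using fg by (auto simp: polys_def)
    have "dvd_in S p (coeff (f * g) (i + j))"
      using const_dvd_iff[OF P.mult_in[OF fg(1,2)] pS(1)] fg(3) by blast
    moreover have "coeff (f * g) (i + j) = (\<Sum>k\<in>{..i+j}-{i}. coeff f k * coeff g (i + j - k)) + coeff f i * coeff g j"
      unfolding coeff_mult by (subst sum.remove[of _ i]) (auto simp: add.commute)
    moreover have "dvd_in S p (\<Sum>k\<in>{..i+j}-{i}. coeff f k * coeff g (i + j - k))"
    proof (rule dvd_in_sum)
      fix k assume k: "k \<in> {..i+j}-{i}"
      consider "k < i" | "i + j - k < j" using k by force
      then show "dvd_in S p (coeff f k * coeff g (i + j - k))"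
      proof cases
        case 1
        then show ?thesis using i(2) cf dvd_in_mult by blast
      next
        case 2
        then show ?thesis using j(2) cf dvd_in_mult by (metis mult.commute)
      qed
    qed
    ultimately have "dvd_in S p (coeff f i * coeff g j)"
      using dvd_in_diff by fastforce
    then show False using i(1) j(1) p cf by (auto simp: prime_in_def)
  qed
  then show ?thesis using pS by (auto simp: prime_in_def unit_const)
qed

text \<open>Division with remainder over the field of fractions, with the denominators collected in
  c.\<close>

lemma pseudo_division:
  assumes "f \<in> polys S" and h: "h \<in> polys S" "h \<noteq> 0"
  shows "\<exists>c w r. c \<in> S \<and> c \<noteq> 0 \<and> w \<in> polys S \<and> r \<in> polys S \<and> smult c f = h * w + r \<and>
    (r = 0 \<or> degree r < degree h)"
  using assms(1)
\<comment> \<open>The measure separates the zero polynomial from the nonzero constants, which have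
  the same \<open>degree\<close>.\<close>
proof (induction "if f = 0 then 0 else Suc (degree f)" arbitrary: f rule: less_induct)
  case less
  show ?case
  proof (cases "f = 0 \<or> degree f < degree h")
    case True
    then show ?thesis using less.prems one_in one_nz P.one_mult[OF less.prems]
      by (intro exI[of _ e] exI[of _ 0] exI[of _ f]) auto
  next
    case False
    have l: "lead_coeff f \<in> S" "lead_coeff h \<in> S" "lead_coeff h \<noteq> 0" using h less.prems by (auto simp: polys_def)
    define f' where "f' = smult (lead_coeff h) f - h * monom (lead_coeff f) (degree f - degree h)"
    have f'S: "f' \<in> polys S" unfolding f'_def
      by (intro P.diff_in P.mult_in smult_in_polys monom_in_polys l h less.prems)
    have "coeff (monom (lead_coeff f) (degree f - degree h) * h) (degree f) = lead_coeff f * lead_coeff h"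
      using False by (simp add: coeff_monom_mult)
    then have c0: "coeff f' (degree f) = 0" unfolding f'_def by (simp add: mult.commute)
    have "degree (h * monom (lead_coeff f) (degree f - degree h)) \<le> degree f"
      using degree_mult_le[of h "monom (lead_coeff f) (degree f - degree h)"] False
        degree_monom_le[of "lead_coeff f" "degree f - degree h"] by linarith
    then have "degree f' \<le> degree f" unfolding f'_def
      by (intro degree_diff_le) (auto intro: order.trans[OF degree_smult_le])
    with c0 have "f' = 0 \<or> degree f' < degree f"
      using leading_coeff_0_iff[of f'] le_neq_implies_less by metis
    then have "(if f' = 0 then 0 else Suc (degree f')) < (if f = 0 then 0 else Suc (degree f))" using False by auto
    from less.hyps[OF this f'S] obtain c w r where
      *: "c \<in> S" "c \<noteq> 0" "w \<in> polys S" "r \<in> polys S" "smult c f' = h * w + r" "r = 0 \<or> degree r < degree h" by blast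
    have "smult (c * lead_coeff h) f = smult c f' + h * smult c (monom (lead_coeff f) (degree f - degree h))"
      by (simp add: f'_def smult_diff_right)
    also have "\<dots> = h * (w + smult c (monom (lead_coeff f) (degree f - degree h))) + r"
      using *(5) by (simp add: algebra_simps)
    finally show ?thesis
      using * l mult_nz mult_in by (intro exI[of _ "c * lead_coeff h"] exI conjI)
        (auto intro!: P.add_in smult_in_polys monom_in_polys)
  qed
qed

definition irred_in :: "'a \<Rightarrow> bool" where "irred_in f \<longleftrightarrow> f \<in> S \<and> f \<noteq> 0 \<and> \<not> unit_in e S f \<and>
    (\<forall>a\<in>S. \<forall>b\<in>S. f = a * b \<longrightarrow> unit_in e S a \<or> unit_in e S b)"

text \<open>Content one, expressed by prime constants; there is no gcd to define the content
  itself.\<close>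

definition primitive :: "'a poly \<Rightarrow> bool"
  where "primitive h \<longleftrightarrow> (\<forall>p. prime_in e S p \<longrightarrow> \<not> dvd_in (polys S) [:p:] h)"

text \<open>Each prime factor of c stays prime in the polynomial ring and does not divide h, so it
  divides w and can be cancelled.\<close>

lemma primitive_strip:
  assumes "prime_fact e S n c" "primitive h" "h \<in> polys S" "w \<in> polys S" "f \<in> polys S" "smult c f = h * w"
  shows "dvd_in (polys S) h f"
  using assms
proof (induction n arbitrary: c w)
  case 0
  then obtain v where v: "c \<in> S" "v \<in> S" "c * v = e" by (auto simp: prime_fact_0 unit_in_def)
  have "f = smult (c * v) f" using v P.one_mult[OF 0(5)] by simp
  also have "\<dots> = h * smult v w" using 0(6) by (metis mult.commute mult_smult_right smult_smult)
  finally show ?case using 0(4) v smult_in_polys unfolding dvd_in_def by blast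
next
  case (Suc n)
  obtain p c' where p: "prime_in e S p" and c': "prime_fact e S n c'" "c = p * c'" "c' \<in> S"
    using Suc.prems(1) by (rule prime_fact_SucD)
  have P: "prime_in [:e:] (polys S) [:p:]" by (rule const_prime[OF p])
  have sm: "[:p:] * smult c' f = smult c f" by (simp add: c'(2) mult.commute)
  have "h * w = [:p:] * smult c' f" using Suc.prems(6) sm by simp
  then have "dvd_in (polys S) [:p:] (h * w)"
    using smult_in_polys[OF c'(3) Suc.prems(5)] unfolding dvd_in_def by blast
  then have "dvd_in (polys S) [:p:] w" using P Suc.prems p by (auto simp: prime_in_def primitive_def)
  then obtain w' where w': "w' \<in> polys S" "w = [:p:] * w'" by (auto simp: dvd_in_def)
  have "[:p:] * smult c' f = [:p:] * (h * w')" unfolding sm Suc.prems(6) w'(2) by simp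
  then have "smult c' f = h * w'"
    using P.cancel[of "smult c' f" "h * w'" "[:p:]"] P c' w' Suc.prems smult_in_polys P.mult_in
    by (simp add: prime_in_def)
  then show ?case using Suc c' w' by blast
qed

text \<open>Dividing h by a prime constant lowers the number of primes in its leading coefficient,
  so the process ends.\<close>

lemma primitive_part:
  assumes "prime_fact e S n (lead_coeff h)" "h \<in> polys S" "h \<noteq> 0"
  shows "\<exists>d h0. d \<in> S \<and> d \<noteq> 0 \<and> h0 \<in> polys S \<and> h = smult d h0 \<and> primitive h0"
  using assms
proof (induction n arbitrary: h rule: less_induct)
  case (less n)
  show ?case
  proof (cases "primitive h")
    case True
    then show ?thesis using less.prems one_in one_nz P.one_mult[OF less.prems(2)]
      by (intro exI[of _ e] exI[of _ h]) auto
  next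
    case False
    then obtain p g where p: "prime_in e S p" "g \<in> polys S" "h = [:p:] * g" by (auto simp: primitive_def dvd_in_def)
    have pS: "p \<in> S" "p \<noteq> 0" "g \<noteq> 0" using p less.prems by (auto simp: prime_in_def)
    have "lead_coeff h = p * lead_coeff g"
      using degree_mult_polys(2)[of "[:p:]" g] p pS by simp
    then obtain m where "n = Suc m" "prime_fact e S m (lead_coeff g)"
      using prime_fact_div[OF p(1), of "lead_coeff g" n] less.prems p(2) by (auto simp: polys_def)
    then obtain d h0 where "d \<in> S" "d \<noteq> 0" "h0 \<in> polys S" "g = smult d h0" "primitive h0"
      using less.IH[of m g] p pS by auto
    then show ?thesis using p pS mult_in mult_nz by (intro exI[of _ "p * d"] exI[of _ h0]) (auto simp: mult.commute)
  qed
qed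

end

text \<open>The measure is the degree plus the number of primes in the leading coefficient. It is
  additive on products and positive on nonunits, so it drops for both factors of a proper
  factorization.\<close>

lemma (in dom_in) irred_factorization:
  assumes "f \<in> polys S" "f \<noteq> 0" "prime_fact e S n (lead_coeff f)"
  shows "\<exists>u qs. unit_in [:e:] (polys S) u \<and> (\<forall>q\<in>set qs. dom_in.irred_in [:e:] (polys S) q) \<and> f = u * prod_list qs"
  using assms
proof (induction "degree f + n" arbitrary: f n rule: less_induct)
  case less
  interpret P: dom_in "[:e:]" "polys S" by (rule polys_dom_in)
  consider "unit_in [:e:] (polys S) f" | "P.irred_in f"
    | a b where "a \<in> polys S" "b \<in> polys S" "f = a * b" "\<not> unit_in [:e:] (polys S) a" "\<not> unit_in [:e:] (polys S) b"
    using less.prems by (auto simp: P.irred_in_def)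
  then show ?case
  proof cases
    case 1
    then show ?thesis by (intro exI[of _ f] exI[of _ "[]"]) simp
  next
    case 2
    then show ?thesis using P.unit_one P.one_mult[OF less.prems(1)]
      by (intro exI[of _ "[:e:]"] exI[of _ "[f]"]) simp
  next
    case 3
    have nz: "a \<noteq> 0" "b \<noteq> 0" using 3 less.prems by auto
    note d = degree_mult_polys[OF 3(1,2) nz]
    have "lead_coeff a \<in> S" "lead_coeff b \<in> S" using 3 by (auto simp: polys_def)
    then obtain i j where ij: "i + j = n" "prime_fact e S i (lead_coeff a)" "prime_fact e S j (lead_coeff b)"
      using prime_fact_split[of n "lead_coeff a" "lead_coeff b"] d 3 less.prems by auto
    have pos: "degree x + k > 0" if "x \<in> polys S" "\<not> unit_in [:e:] (polys S) x" "prime_fact e S k (lead_coeff x)" for x k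
    proof (rule ccontr)
      assume "\<not> ?thesis"
      then have "degree x = 0" "unit_in e S (lead_coeff x)" using that(3) prime_fact_0 by auto
      then obtain a where "x = [:a:]" "unit_in e S a" by (auto elim: degree_eq_zeroE)
      then show False using that(2) unit_const by simp
    qed
    have "degree a + i < degree f + n" "degree b + j < degree f + n"
      using pos[OF 3(1,4) ij(2)] pos[OF 3(2,5) ij(3)] d(1) 3(3) ij(1) by auto
    from less.hyps[OF this(1) 3(1) nz(1) ij(2)] less.hyps[OF this(2) 3(2) nz(2) ij(3)]
    obtain u us v vs where
      *: "unit_in [:e:] (polys S) u" "\<forall>q\<in>set us. P.irred_in q" "a = u * prod_list us"
      "unit_in [:e:] (polys S) v" "\<forall>q\<in>set vs. P.irred_in q" "b = v * prod_list vs" by blast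
    then show ?thesis using P.unit_mult 3(3)
      by (intro exI[of _ "u * v"] exI[of _ "us @ vs"]) (auto simp: mult_ac)
  qed
qed

text \<open>An irreducible constant is a prime of S times a unit. An irreducible q of positive
  degree is primitive. If q divides f * g, let h be an element of least degree in the ideal J
  generated by f and q; its primitive part h0 divides both of them. Either q is h0 times a unit, and
  then q divides f, or h0 is a unit, so that J contains a nonzero constant b; then q divides b * g,
  and b can be stripped off.\<close>

lemma (in dom_in) irred_prime_polys:
  assumes fact: "factorial_in e S" and q: "dom_in.irred_in [:e:] (polys S) q"
  shows "prime_in [:e:] (polys S) q"
proof -
  interpret P: dom_in "[:e:]" "polys S" by (rule polys_dom_in)
  have qS: "q \<in> polys S" "q \<noteq> 0" "\<not> unit_in [:e:] (polys S) q"
    and qab: "\<And>a b. a \<in> polys S \<Longrightarrow> b \<in> polys S \<Longrightarrow> q = a * b \<Longrightarrow> unit_in [:e:] (polys S) a \<or> unit_in [:e:] (polys S) b"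
    using q by (auto simp: P.irred_in_def)
  have pf: "\<exists>n. prime_fact e S n a" if "a \<in> S" "a \<noteq> 0" for a
    using fact that by (auto simp: factorial_in_def)
  show ?thesis
  proof (cases "degree q = 0")
    case True
    then obtain a where a: "q = [:a:]" by (auto elim: degree_eq_zeroE)
    have aS: "a \<in> S" "a \<noteq> 0" "\<not> unit_in e S a" using qS a unit_const by auto
    then obtain n where n: "prime_fact e S n a" using pf by blast
    then have "n \<noteq> 0" using aS prime_fact_0 by (cases n) auto
    then obtain p a' where p: "prime_in e S p" "a = p * a'" "a' \<in> S"
      using n by (metis prime_fact_SucD not0_implies_Suc)
    have pS: "p \<in> S" "\<not> unit_in e S p" using p by (auto simp: prime_in_def)
    have "unit_in e S a'" using qab[of "[:p:]" "[:a':]"] p pS a unit_const by auto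
    then show ?thesis using a p prime_unit_mult const_prime by simp
  next
    case False
    have qprim: "primitive q"
    proof -
      have False if p: "prime_in e S p" "g \<in> polys S" "q = [:p:] * g" for p g
      proof -
        have "p \<in> S" "\<not> unit_in e S p" using p by (auto simp: prime_in_def)
        then have "unit_in [:e:] (polys S) g" using qab[of "[:p:]" g] p unit_const by auto
        then have "degree g = 0" by (rule unit_polysD)
        then show False using p False degree_mult_le[of "[:p:]" g] by simp
      qed
      then show ?thesis by (auto simp: primitive_def dvd_in_def)
    qed
    have "dvd_in (polys S) q f \<or> dvd_in (polys S) q g"
      if fg: "f \<in> polys S" "g \<in> polys S" "dvd_in (polys S) q (f * g)" for f g
    proof -
      define J where "J = {u * f + v * q | u v. u \<in> polys S \<and> v \<in> polys S}"
      have JS: "x \<in> polys S" if "x \<in> J" for x using that fg qS P.add_in P.mult_in by (auto simp: J_def)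
      have Jd: "x - y * w \<in> J" if xy: "x \<in> J" "y \<in> J" "w \<in> polys S" for x y w
      proof -
        obtain u v u' v' where *: "u \<in> polys S" "v \<in> polys S" "u' \<in> polys S" "v' \<in> polys S"
          "x = u * f + v * q" "y = u' * f + v' * q" using xy by (auto simp: J_def)
        have "x - y * w = (u - u' * w) * f + (v - v' * w) * q" using * by (simp add: algebra_simps)
        moreover have "u - u' * w \<in> polys S" "v - v' * w \<in> polys S"
          using * xy(3) P.diff_in P.mult_in by blast+
        ultimately show ?thesis unfolding J_def by blast
      qed
      have "0 * f + [:e:] * q \<in> J" unfolding J_def using P.one_in P.zero_in by blast
      then have qJ: "q \<in> J" using P.one_mult[OF qS(1)] by simp
      have "[:e:] * f + 0 * q \<in> J" unfolding J_def using P.one_in P.zero_in by blast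
      then have fJ: "f \<in> J" using P.one_mult[OF fg(1)] by simp
      \<comment> \<open>Over the field of fractions h would generate the ideal J; here it divides
        every element of J up to a constant factor (\<open>hdvd\<close>).\<close>
      obtain h where h: "h \<in> J" "h \<noteq> 0" and hmin: "\<And>g. g \<in> J \<Longrightarrow> g \<noteq> 0 \<Longrightarrow> degree h \<le> degree g"
        using ex_has_least_nat[of "\<lambda>h. h \<in> J \<and> h \<noteq> 0" q degree] qJ qS by blast
      have hS: "h \<in> polys S" using JS h by blast
      have hdvd: "\<exists>c w. c \<in> S \<and> c \<noteq> 0 \<and> w \<in> polys S \<and> smult c x = h * w" if x: "x \<in> J" for x
      proof -
        obtain c w r where *: "c \<in> S" "c \<noteq> 0" "w \<in> polys S" "r \<in> polys S" "smult c x = h * w + r" "r = 0 \<or> degree r < degree h"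
          using pseudo_division[OF JS[OF x] hS h(2)] by blast
        have "[:c:] * x \<in> J" 
        proof -
          obtain u v where "u \<in> polys S" "v \<in> polys S" "x = u * f + v * q" using x by (auto simp: J_def)
          then have "[:c:] * x = smult c u * f + smult c v * q" by (simp add: smult_add_right)
          then show ?thesis using \<open>u \<in> _\<close> \<open>v \<in> _\<close> *(1) smult_in_polys unfolding J_def by blast
        qed
        then have "r \<in> J" using Jd[of "[:c:] * x" h w] h(1) *(3) *(5) by simp
        then have "r = 0" using hmin[of r] *(6) by linarith
        then show ?thesis using *(1,2,3,5) by auto
      qed
      have "lead_coeff h \<in> S" "lead_coeff h \<noteq> 0" using hS h by (auto simp: polys_def)
      then obtain d h0 where h0: "d \<in> S" "d \<noteq> 0" "h0 \<in> polys S" "h = smult d h0" "primitive h0"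
        using primitive_part[OF _ hS h(2)] pf by blast
      have h0dvd: "dvd_in (polys S) h0 x" if x: "x \<in> J" for x
      proof -
        obtain c w where *: "c \<in> S" "c \<noteq> 0" "w \<in> polys S" "smult c x = h * w" using hdvd[OF x] by blast
        obtain n where "prime_fact e S n c" using pf * by blast
        moreover have "smult c x = h0 * smult d w" using * h0 by simp
        ultimately show ?thesis using primitive_strip[OF _ h0(5,3)] * h0 JS[OF x] smult_in_polys by blast
      qed
      obtain z where z: "z \<in> polys S" "q = h0 * z" using h0dvd[OF qJ] by (auto simp: dvd_in_def)
      obtain k where k: "k \<in> polys S" "f = h0 * k" using h0dvd[OF fJ] by (auto simp: dvd_in_def)
      from qab[OF h0(3) z] show ?thesis
      proof
        assume "unit_in [:e:] (polys S) z"
        then obtain z' where z': "z' \<in> polys S" "z * z' = [:e:]" by (auto simp: unit_in_def)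
        have "q * (z' * k) = h0 * ((z * z') * k)" using z by (simp only: mult_ac)
        then have "f = q * (z' * k)" unfolding z'(2) P.one_mult[OF k(1)] k(2) by simp
        then show ?thesis using z' k P.mult_in by (auto simp: dvd_in_def)
      next
        assume "unit_in [:e:] (polys S) h0"
        then have "degree h0 = 0" by (rule unit_polysD(1))
        then have "degree h = 0" using degree_smult_le[of d h0] h0(4) by simp
        then obtain b where b: "h = [:b:]" by (auto elim: degree_eq_zeroE)
        then have bS: "b \<in> S" "b \<noteq> 0" using hS h by auto
        obtain u v where uv: "u \<in> polys S" "v \<in> polys S" "[:b:] = u * f + v * q" using h(1) b by (auto simp: J_def)
        obtain c where c: "c \<in> polys S" "f * g = q * c" using fg by (auto simp: dvd_in_def)
        have "smult b g = [:b:] * g" by simp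
        also have "\<dots> = u * (f * g) + v * q * g" unfolding uv(3) by (simp add: algebra_simps)
        also have "\<dots> = q * (u * c + v * g)" unfolding c(2) by (simp add: algebra_simps)
        finally have eq: "smult b g = q * (u * c + v * g)" .
        obtain n where "prime_fact e S n b" using pf bS by blast
        then show ?thesis using primitive_strip[OF _ qprim qS(1) _ fg(2) eq] uv c fg P.add_in P.mult_in by blast
      qed
    qed
    then show ?thesis using qS by (auto simp: prime_in_def)
  qed
qed

theorem factorial_polys:
  assumes "factorial_in e S"
  shows "factorial_in [:e:] (polys S)"
proof -
  interpret dom_in e S using assms by (simp add: factorial_in_def)
  have "\<exists>n. prime_fact [:e:] (polys S) n f" if "f \<in> polys S" "f \<noteq> 0" for f
  proof -
    have "lead_coeff f \<in> S" "lead_coeff f \<noteq> 0" using that by (auto simp: polys_def)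
    then obtain n where "prime_fact e S n (lead_coeff f)" using assms by (auto simp: factorial_in_def)
    then show ?thesis using irred_factorization[OF that] irred_prime_polys[OF assms] 
      unfolding prime_fact_def by blast
  qed
  then show ?thesis using polys_dom_in by (auto simp: factorial_in_def)
qed

text \<open>The hypothesis \<open>closed\<close> says that S is factorially closed in T, so the
  primes occurring in a factorization over T of an element of S already lie in S. The two instances
  are the invariants of a higher derivation, and A in \<open>A[x]\<close>; both are closed because a
  degree is additive.\<close>

lemma factorial_closed_subring:
  assumes T: "factorial_in e T" and S: "rng_in e S" "S \<subseteq> T"
    and closed: "\<And>a b. a \<in> T \<Longrightarrow> b \<in> T \<Longrightarrow> a * b \<in> S \<Longrightarrow> a * b \<noteq> 0 \<Longrightarrow> a \<in> S"
  shows "factorial_in e S"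
    and "\<And>p. p \<in> S \<Longrightarrow> prime_in e T p \<Longrightarrow> prime_in e S p"
    and "\<And>u. u \<in> S \<Longrightarrow> unit_in e T u \<Longrightarrow> unit_in e S u"
proof -
  interpret T: dom_in e T using T by (simp add: factorial_in_def)
  interpret S: dom_in e S
    using S T.one_nz T.integral by (intro dom_in.intro dom_in_axioms.intro) auto
  have closed2: "b \<in> S" if "a \<in> T" "b \<in> T" "a * b \<in> S" "a * b \<noteq> 0" for a b
    using closed[of b a] that by (simp add: mult.commute)
  show un: "unit_in e S u" if u: "u \<in> S" "unit_in e T u" for u
  proof -
    obtain v where "v \<in> T" "u * v = e" using u by (auto simp: unit_in_def)
    then show ?thesis using u closed2[of u v] S(2) S.one_in T.one_nz unfolding unit_in_def by blast
  qed
  show pr: "prime_in e S p" if p: "p \<in> S" "prime_in e T p" for p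
  proof -
    have d: "dvd_in S p a \<longleftrightarrow> dvd_in T p a" if "a \<in> S" for a
    proof (cases "a = 0")
      case False
      have "p \<in> T" using p by (simp add: prime_in_def)
      then have "c \<in> S" if "c \<in> T" "a = p * c" for c
        using closed2[of p c] that \<open>a \<in> S\<close> False by blast
      then show ?thesis using S(2) unfolding dvd_in_def by blast
    qed (simp add: S.dvd_in_0 T.dvd_in_0)
    have "\<not> unit_in e S p" using p S(2) unfolding prime_in_def unit_in_def by blast
    moreover have "dvd_in S p a \<or> dvd_in S p b" if "a \<in> S" "b \<in> S" "dvd_in S p (a * b)" for a b
      using p(2) d[of a] d[of b] d[of "a * b"] that S.mult_in S(2) unfolding prime_in_def by blast
    ultimately show ?thesis using p unfolding prime_in_def by blast
  qed
  have "\<exists>n. prime_fact e S n a" if a: "a \<in> S" "a \<noteq> 0" for a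
  proof -
    obtain n where n: "prime_fact e T n a" using T S(2) a unfolding factorial_in_def by blast
    then show ?thesis using a
    proof (induction n arbitrary: a)
      case 0
      then show ?case using un T.prime_fact_0 S.prime_fact_0 by blast
    next
      case (Suc n)
      obtain p b where p: "prime_in e T p" "prime_fact e T n b" "a = p * b" "b \<in> T"
        using Suc.prems(1) by (rule T.prime_fact_SucD)
      have "p \<in> T" using p by (simp add: prime_in_def)
      then have S': "p \<in> S" "b \<in> S" "b \<noteq> 0" using closed[of p b] closed2[of p b] p Suc.prems by auto
      then obtain m u ps where "unit_in e S u" "\<forall>p\<in>set ps. prime_in e S p" "length ps = m" "b = u * prod_list ps"
        using Suc.IH[of b] p by (auto simp: prime_fact_def)
      then have "prime_fact e S (Suc m) a" unfolding prime_fact_def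
        using p pr S' by (intro exI[of _ u] exI[of _ "p # ps"]) (auto simp: mult_ac)
      then show ?case by blast
    qed
  qed
  then show "factorial_in e S" using S.dom_in_axioms by (auto simp: factorial_in_def)
qed


section \<open>Algebraic dependence by counting monomials\<close>

no_notation var (\<open>X\<index>\<close>)

definition adj :: "'r::comm_ring_1 set \<Rightarrow> 'r \<Rightarrow> 'r set"
  where "adj S y = (\<lambda>p. poly p y) ` polys S"

primrec adjl :: "'r::comm_ring_1 set \<Rightarrow> 'r list \<Rightarrow> 'r set"
  where "adjl K [] = K" | "adjl K (y # ys) = adj (adjl K ys) y"

definition alg_in :: "'r::comm_ring_1 set \<Rightarrow> 'r \<Rightarrow> bool"
  where "alg_in S y \<longleftrightarrow> (\<exists>p\<in>polys S. p \<noteq> 0 \<and> poly p y = 0)"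

text \<open>Some entry is algebraic over the ring generated by the entries after it. The recursion
  allows to conclude step by step: if the head is transcendental over a ring containing the tail,
  the dependence lies in the tail.\<close>

primrec algdep :: "'r::comm_ring_1 set \<Rightarrow> 'r list \<Rightarrow> bool"
  where "algdep K [] = False" | "algdep K (y # ys) = (algdep K ys \<or> alg_in (adjl K ys) y)"

definition subfield_in :: "'r::comm_ring_1 \<Rightarrow> 'r set \<Rightarrow> bool"
  where "subfield_in e K \<longleftrightarrow> rng_in e K \<and> e \<noteq> 0 \<and> (\<forall>k\<in>K. k \<noteq> 0 \<longrightarrow> (\<exists>v\<in>K. k * v = e))"

lemma alg_in_mono: "S \<subseteq> T \<Longrightarrow> alg_in S y \<Longrightarrow> alg_in T y"
  unfolding alg_in_def using polys_mono by blast

lemma adj_rng_in: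
  assumes "rng_in e S" "e * y = y"
  shows "rng_in e (adj S y)" "S \<subseteq> adj S y" "y \<in> adj S y"
proof -
  interpret S: rng_in e S by fact
  interpret P: rng_in "[:e:]" "polys S" by (rule S.polys_rng_in)
  show sub: "S \<subseteq> adj S y"
  proof
    fix a assume "a \<in> S"
    then have "poly [:a:] y \<in> adj S y" unfolding adj_def by (intro imageI) simp
    then show "a \<in> adj S y" by simp
  qed
  have "[:0, e:] \<in> polys S" using S.one_in by (intro S.pCons_in_polys) auto
  then have "poly [:0, e:] y \<in> adj S y" unfolding adj_def by (rule imageI)
  then show "y \<in> adj S y" using assms(2) by (simp add: mult.commute)
  show "rng_in e (adj S y)"
  proof
    show "e \<in> adj S y" using sub S.one_in by blast
    fix a b assume "a \<in> adj S y" "b \<in> adj S y"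
    then obtain p q where pq: "p \<in> polys S" "q \<in> polys S" "a = poly p y" "b = poly q y" by (auto simp: adj_def)
    show "e * a = a" using arg_cong[OF P.one_mult[OF pq(1)], of "\<lambda>p. poly p y"] by (simp add: pq(3))
    show "a - b \<in> adj S y" using imageI[OF P.diff_in[OF pq(1,2)], of "\<lambda>p. poly p y"] by (simp add: pq adj_def)
    show "a * b \<in> adj S y" using imageI[OF P.mult_in[OF pq(1,2)], of "\<lambda>p. poly p y"] by (simp add: pq adj_def)
  qed
qed

lemma adj_subset: "rng_in e D \<Longrightarrow> S \<subseteq> D \<Longrightarrow> y \<in> D \<Longrightarrow> adj S y \<subseteq> D"
  unfolding adj_def using rng_in.poly_in[of e D] polys_mono[of S D] by blast

lemma adjl_rng_in:
  assumes "rng_in e D" "rng_in e K" "K \<subseteq> D" "set ys \<subseteq> D"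
  shows "rng_in e (adjl K ys) \<and> K \<subseteq> adjl K ys \<and> adjl K ys \<subseteq> D"
  using assms(4)
proof (induction ys)
  case (Cons y ys)
  then have y: "e * y = y" using assms(1) by (simp add: rng_in.one_mult)
  note IH = Cons.IH[OF order.trans[OF _ Cons.prems]]
  then show ?case
    using adj_rng_in[OF _ y, of "adjl K ys"] adj_subset[OF assms(1), of "adjl K ys" y] Cons.prems by auto
qed (use assms in auto)

section \<open>Linear spans and homogeneous systems\<close>

inductive_set lspan :: "'r::comm_ring_1 set \<Rightarrow> 'r set \<Rightarrow> 'r set" for K X where
  zero: "0 \<in> lspan K X"
| add: "k \<in> K \<Longrightarrow> x \<in> X \<Longrightarrow> v \<in> lspan K X \<Longrightarrow> k * x + v \<in> lspan K X"

definition set_mult :: "'r::comm_ring_1 set \<Rightarrow> 'r set \<Rightarrow> 'r set" (infixl "\<otimes>\<^sub>s" 70)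
  where "X \<otimes>\<^sub>s Y = (\<lambda>(x, y). x * y) ` (X \<times> Y)"

lemma lspan_mono: "v \<in> lspan K X \<Longrightarrow> X \<subseteq> Y \<Longrightarrow> v \<in> lspan K Y"
  by (induction rule: lspan.induct) (auto intro: lspan.intros)

lemma lspan_add: "v \<in> lspan K X \<Longrightarrow> w \<in> lspan K X \<Longrightarrow> v + w \<in> lspan K X"
  by (induction rule: lspan.induct) (auto simp: add.assoc intro: lspan.intros)

lemma lspan_sum: "(\<And>i. i \<in> I \<Longrightarrow> f i \<in> lspan K X) \<Longrightarrow> sum f I \<in> lspan K X"
  by (induction I rule: infinite_finite_induct) (auto intro: lspan_add lspan.zero)

lemma lspan_single: "k \<in> K \<Longrightarrow> x \<in> X \<Longrightarrow> k * x \<in> lspan K X"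
  using lspan.add[OF _ _ lspan.zero, of k K x X] by simp

lemma lspan_mult:
  assumes K: "rng_in e K" and "v \<in> lspan K X" "w \<in> lspan K Y"
  shows "v * w \<in> lspan K (X \<otimes>\<^sub>s Y)"
  using assms(2)
proof (induction rule: lspan.induct)
  case (add k x v)
  have "k * x * w \<in> lspan K (X \<otimes>\<^sub>s Y)"
    using assms(3)
  proof (induction rule: lspan.induct)
    case (add l y w)
    have "k * x * (l * y + w) = (k * l) * (x * y) + k * x * w" by (simp add: algebra_simps)
    moreover have "k * l \<in> K" using K add \<open>k \<in> K\<close> by (simp add: rng_in.mult_in)
    moreover have "x * y \<in> X \<otimes>\<^sub>s Y" using \<open>x \<in> X\<close> add by (auto simp: set_mult_def)
    ultimately show ?case using add.IH by (auto intro: lspan.add)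
  qed (simp add: lspan.zero)
  then show ?case using add.IH by (simp add: distrib_right lspan_add)
qed (simp add: lspan.zero)

lemma lspan_finite:
  assumes "rng_in e K" "v \<in> lspan K X" "finite X"
  shows "\<exists>k. (\<forall>x. k x \<in> K) \<and> v = (\<Sum>x\<in>X. k x * x)"
  using assms(2)
proof (induction rule: lspan.induct)
  case zero
  show ?case using assms(1) by (intro exI[of _ "\<lambda>_. 0"]) (simp add: rng_in.zero_in)
next
  case (add l x v)
  then obtain k where k: "\<forall>x. k x \<in> K" "v = (\<Sum>x\<in>X. k x * x)" by blast
  have "(\<Sum>y\<in>X. (k(x := k x + l)) y * y) = (\<Sum>y\<in>X. k y * y + (if y = x then l * x else 0))"
    by (intro sum.cong) (auto simp: distrib_right)
  also have "\<dots> = l * x + v" using add assms(3) k by (simp add: sum.distrib sum.delta)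
  finally show ?case using k add assms(1) by (intro exI[of _ "k(x := k x + l)"]) (auto simp: rng_in.add_in)
qed

text \<open>Gaussian elimination by induction on the set X of equations; the unknowns are indexed by
  I.\<close>

lemma linear_relation:
  assumes K: "subfield_in e K"
  shows "finite X \<Longrightarrow> finite I \<Longrightarrow> card X < card I \<Longrightarrow> (\<And>i x. i \<in> I \<Longrightarrow> m i x \<in> K) \<Longrightarrow>
    \<exists>c. (\<forall>i. c i \<in> K) \<and> (\<exists>i\<in>I. c i \<noteq> 0) \<and> (\<forall>x\<in>X. (\<Sum>i\<in>I. c i * m i x) = 0)"
proof (induction X arbitrary: I m rule: finite_induct)
  case empty
  then obtain i where "i \<in> I" by fastforce
  then show ?case using K by (intro exI[of _ "\<lambda>_. e"]) (auto simp: subfield_in_def rng_in_def)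
next
  case (insert x0 X)
  interpret K: rng_in e K using K by (simp add: subfield_in_def)
  show ?case
  proof (cases "\<forall>i\<in>I. m i x0 = 0")
    case True
    have "card X < card I" using insert by simp
    then obtain c where "\<forall>i. c i \<in> K" "\<exists>i\<in>I. c i \<noteq> 0" "\<forall>x\<in>X. (\<Sum>i\<in>I. c i * m i x) = 0"
      using insert.IH[OF insert.prems(1)] insert.prems(3) by blast
    then show ?thesis using True by (intro exI[of _ c]) auto
  next
    case False
    then obtain i0 where i0: "i0 \<in> I" "m i0 x0 \<noteq> 0" by blast
    then obtain w where w: "w \<in> K" "m i0 x0 * w = e" using K insert.prems(3) by (auto simp: subfield_in_def)
    let ?I = "I - {i0}"
    \<comment> \<open>The unknown \<open>i0\<close>, which has the invertible coefficient
      \<open>m i0 x0\<close>, is eliminated by means of the equation at \<open>x0\<close>.\<close>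
    let ?m = "\<lambda>i x. m i x - m i x0 * w * m i0 x"
    have "card X < card ?I" using insert i0 by simp
    moreover have "?m i x \<in> K" if "i \<in> ?I" for i x
      using that insert.prems(3) i0 w by (intro K.diff_in K.mult_in) auto
    ultimately obtain c where c: "\<forall>i. c i \<in> K" "\<exists>i\<in>?I. c i \<noteq> 0" "\<forall>x\<in>X. (\<Sum>i\<in>?I. c i * ?m i x) = 0"
      using insert.IH[of ?I ?m] insert.prems(1) by blast
    \<comment> \<open>The value forced on the eliminated unknown. With it the original equations
      become the reduced ones (\<open>eq\<close>), and the reduced equation at \<open>x0\<close> is
      trivial.\<close>
    define c0 where "c0 = - (\<Sum>i\<in>?I. c i * m i x0 * w)"
    have c0: "c0 \<in> K" unfolding c0_def
      using c insert.prems(3) w by (intro K.uminus_in K.sum_in K.mult_in) auto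
    have eq: "(\<Sum>i\<in>I. (c(i0 := c0)) i * m i x) = (\<Sum>i\<in>?I. c i * ?m i x)" for x
    proof -
      have "(\<Sum>i\<in>I. (c(i0 := c0)) i * m i x) = c0 * m i0 x + (\<Sum>i\<in>?I. c i * m i x)"
        using i0 insert.prems(1) by (subst sum.remove[of _ i0]) (auto intro!: sum.cong)
      also have "\<dots> = (\<Sum>i\<in>?I. c i * ?m i x)"
        by (simp add: c0_def sum_distrib_right sum_distrib_left right_diff_distrib sum_subtractf mult.assoc)
      finally show ?thesis .
    qed
    have "(\<Sum>i\<in>?I. c i * ?m i x0) = 0"
    proof (rule sum.neutral, intro ballI)
      fix i assume "i \<in> ?I"
      then have "m i x0 \<in> K" using insert.prems(3) by blast
      then have "m i x0 * (m i0 x0 * w) = m i x0" using w K.mult_one by simp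
      then have "m i x0 - m i x0 * w * m i0 x0 = 0" by (simp add: mult_ac)
      then show "c i * ?m i x0 = 0" by simp
    qed
    then have "\<forall>x\<in>insert x0 X. (\<Sum>i\<in>I. (c(i0 := c0)) i * m i x) = 0" unfolding eq using c(3) by blast
    moreover have "\<exists>i\<in>I. (c(i0 := c0)) i \<noteq> 0" using c(2) by auto
    ultimately show ?thesis using c(1) c0 by (intro exI[of _ "c(i0 := c0)"]) auto
  qed
qed

lemma lspan_relation:
  assumes K: "subfield_in e K" and fin: "finite X" "finite I" "card X < card I"
    and v: "\<And>i. i \<in> I \<Longrightarrow> v i \<in> lspan K X"
  shows "\<exists>c. (\<forall>i. c i \<in> K) \<and> (\<exists>i\<in>I. c i \<noteq> 0) \<and> (\<Sum>i\<in>I. c i * v i) = 0"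
proof -
  have Kr: "rng_in e K" using K by (simp add: subfield_in_def)
  have "\<forall>i\<in>I. \<exists>k. (\<forall>x. k x \<in> K) \<and> v i = (\<Sum>x\<in>X. k x * x)" using lspan_finite[OF Kr v fin(1)] by blast
  then obtain m where m: "\<And>i x. i \<in> I \<Longrightarrow> m i x \<in> K" "\<And>i. i \<in> I \<Longrightarrow> v i = (\<Sum>x\<in>X. m i x * x)"
    by metis
  obtain c where c: "\<forall>i. c i \<in> K" "\<exists>i\<in>I. c i \<noteq> 0" "\<forall>x\<in>X. (\<Sum>i\<in>I. c i * m i x) = 0"
    using linear_relation[OF K fin, of m] m(1) by blast
  have "(\<Sum>i\<in>I. c i * v i) = (\<Sum>i\<in>I. \<Sum>x\<in>X. c i * m i x * x)"
    using m(2) by (simp add: sum_distrib_left mult.assoc)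
  also have "\<dots> = (\<Sum>x\<in>X. (\<Sum>i\<in>I. c i * m i x) * x)"
    by (subst sum.swap) (simp add: sum_distrib_right)
  also have "\<dots> = 0" using c(3) by simp
  finally show ?thesis using c by blast
qed

section \<open>Monomials with bounded exponents and their growth\<close>

primrec mons :: "'r::comm_ring_1 list \<Rightarrow> nat \<Rightarrow> 'r set"
  where "mons [] M = {1}" | "mons (z # zs) M = mons zs M \<otimes>\<^sub>s ((\<lambda>i. z ^ i) ` {..M})"

lemma set_mult_finite: "finite X \<Longrightarrow> finite Y \<Longrightarrow> finite (X \<otimes>\<^sub>s Y) \<and> card (X \<otimes>\<^sub>s Y) \<le> card X * card Y"
  unfolding set_mult_def using card_image_le[of "X \<times> Y" "\<lambda>(x, y). x * y"] by (auto simp: card_cartesian_product)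

lemma set_mult_mem: "x \<in> X \<Longrightarrow> y \<in> Y \<Longrightarrow> x * y \<in> X \<otimes>\<^sub>s Y"
  by (auto simp: set_mult_def)

lemma mons_finite: "finite (mons zs M) \<and> card (mons zs M) \<le> (M + 1) ^ length zs"
proof (induction zs)
  case (Cons z zs)
  have "card ((\<lambda>i. z ^ i) ` {..M}) \<le> M + 1" using card_image_le[of "{..M}" "\<lambda>i. z ^ i"] by simp
  then have "card (mons zs M) * card ((\<lambda>i. z ^ i) ` {..M}) \<le> (M + 1) ^ length zs * (M + 1)"
    using Cons by (intro mult_le_mono) auto
  then show ?case using Cons set_mult_finite[of "mons zs M" "(\<lambda>i. z ^ i) ` {..M}"]
    by (simp add: algebra_simps)
qed simp

lemma mons_mono: "M \<le> N \<Longrightarrow> mons zs M \<subseteq> mons zs N"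
  by (induction zs) (fastforce simp: set_mult_def)+

lemma mons_one: "1 \<in> mons zs M"
proof (induction zs)
  case (Cons z zs)
  have "z ^ 0 \<in> (\<lambda>i. z ^ i) ` {..M}" by (rule imageI) simp
  from set_mult_mem[OF Cons this] show ?case by simp
qed simp

lemma mons_mult: "x \<in> mons zs M \<Longrightarrow> y \<in> mons zs N \<Longrightarrow> x * y \<in> mons zs (M + N)"
proof (induction zs arbitrary: x y)
  case (Cons z zs)
  then obtain x' i y' j where *: "x' \<in> mons zs M" "i \<le> M" "x = x' * z ^ i" "y' \<in> mons zs N" "j \<le> N" "y = y' * z ^ j"
    by (auto simp: set_mult_def)
  have "x' * y' * z ^ (i + j) \<in> mons (z # zs) (M + N)"
    using Cons.IH[OF *(1,4)] * by (auto intro!: set_mult_mem)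
  then show ?case using * by (simp add: power_add mult_ac)
qed simp

lemma adjl_lspan:
  assumes K: "rng_in e K"
  shows "v \<in> adjl K zs \<Longrightarrow> \<exists>M. v \<in> lspan K (mons zs M)"
proof (induction zs arbitrary: v)
  case Nil
  then show ?case using lspan_single[of v K 1 "{1}"] by auto
next
  case (Cons z zs)
  then obtain p where p: "p \<in> polys (adjl K zs)" "v = poly p z" by (auto simp: adj_def)
  have "\<forall>i. \<exists>M. coeff p i \<in> lspan K (mons zs M)" using Cons.IH p by (auto simp: polys_def)
  then obtain M where M: "\<And>i. coeff p i \<in> lspan K (mons zs (M i))" by metis
  define N where "N = Max (M ` {..degree p}) + degree p"
  have "coeff p i * z ^ i \<in> lspan K (mons (z # zs) N)" if i: "i \<le> degree p" for i
  proof -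
    have "M i \<le> Max (M ` {..degree p})" using i by (intro Max_ge) auto
    then have "M i \<le> N" by (simp add: N_def)
    then have c: "coeff p i \<in> lspan K (mons zs N)" using lspan_mono[OF M mons_mono] by blast
    have "c * z ^ i \<in> lspan K (mons (z # zs) N)" if "c \<in> lspan K (mons zs N)" for c
      using that
    proof (induction rule: lspan.induct)
      case (add k x v)
      have "x * z ^ i \<in> mons (z # zs) N" using add i by (auto simp: N_def intro!: set_mult_mem)
      from lspan.add[OF add(1) this add.IH] show ?case by (simp only: distrib_right mult.assoc)
    qed (simp add: lspan.zero)
    then show ?thesis using c by blast
  qed
  then show ?case unfolding p(2) poly_altdef by (blast intro: lspan_sum)
qed

primrec mon :: "'r::comm_ring_1 list \<Rightarrow> nat list \<Rightarrow> 'r"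
  where "mon [] gs = 1" | "mon (y # ys) gs = y ^ hd gs * mon ys (tl gs)"

lemma mon_in_adjl:
  assumes "rng_in e D" "rng_in e K" "K \<subseteq> D"
  shows "set ys \<subseteq> D \<Longrightarrow> k \<in> K \<Longrightarrow> k * mon ys gs \<in> adjl K ys"
proof (induction ys arbitrary: gs)
  case (Cons y ys)
  then have "k * mon ys (tl gs) \<in> adjl K ys" by simp
  then have "monom (k * mon ys (tl gs)) (hd gs) \<in> polys (adjl K ys)"
    using adjl_rng_in[OF assms, of ys] Cons.prems rng_in.monom_in_polys by (metis list.set_intros(2) subset_code(1))
  then show ?case by (auto simp: adj_def poly_monom mult_ac intro!: image_eqI[of _ _ "monom (k * mon ys (tl gs)) (hd gs)"])
qed simp

text \<open>Exponent vectors rather than monomials: they are counted with repetition, since two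
  vectors that give the same element already amount to a relation.\<close>

definition box :: "nat \<Rightarrow> nat \<Rightarrow> nat list set"
  where "box n N = {gs. set gs \<subseteq> {..N} \<and> length gs = n}"

lemma box_finite: "finite (box n N)" "card (box n N) = (N + 1) ^ n"
  unfolding box_def by (auto simp: finite_lists_length_eq card_lists_length_eq)

lemma box_Suc: "box (Suc n) N = (\<lambda>(g, gs). g # gs) ` ({..N} \<times> box n N)"
  by (auto simp: box_def length_Suc_conv image_iff)

text \<open>Collect the relation by powers of y. If the coefficient belonging to the head of g0
  vanishes, it is a relation among \<open>ys\<close> with a nonzero scalar; otherwise the whole is a
  nonzero polynomial over \<open>adjl K ys\<close> that vanishes at y.\<close>

lemma monomial_relation_algdep:
  assumes D: "rng_in e D" "rng_in e K" "K \<subseteq> D"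
  shows "set ys \<subseteq> D \<Longrightarrow> (\<And>g. c g \<in> K) \<Longrightarrow> g0 \<in> box (length ys) N \<Longrightarrow> c g0 \<noteq> 0 \<Longrightarrow>
    (\<Sum>gs\<in>box (length ys) N. c gs * mon ys gs) = 0 \<Longrightarrow> algdep K ys"
proof (induction ys arbitrary: c g0)
  case Nil
  have "box 0 N = {[]}" by (auto simp: box_def)
  then show ?case using Nil by simp
next
  case (Cons y ys)
  define b where "b g = (\<Sum>gs\<in>box (length ys) N. c (g # gs) * mon ys gs)" for g
  have A: "rng_in e (adjl K ys)" using adjl_rng_in[OF D, of ys] Cons.prems by simp
  have bS: "b g \<in> adjl K ys" for g unfolding b_def
    using mon_in_adjl[OF D] Cons.prems by (intro rng_in.sum_in[OF A]) auto
  have inj: "inj_on (\<lambda>(g, gs). g # gs) ({..N} \<times> box (length ys) N)" by (auto simp: inj_on_def)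
  have "0 = (\<Sum>(g, gs)\<in>{..N} \<times> box (length ys) N. c (g # gs) * (y ^ g * mon ys gs))"
    using Cons.prems(5) sum.reindex[OF inj, of "\<lambda>gs. c gs * mon (y # ys) gs"]
    by (simp add: box_Suc o_def case_prod_unfold)
  also have "\<dots> = (\<Sum>g\<le>N. b g * y ^ g)"
    unfolding b_def sum_distrib_right sum.cartesian_product[symmetric] by (simp only: mult_ac)
  finally have eq: "(\<Sum>g\<le>N. b g * y ^ g) = 0" by simp
  obtain g gs where g: "g0 = g # gs" "g \<le> N" "gs \<in> box (length ys) N"
    using Cons.prems(3) by (auto simp: box_Suc)
  show ?case
  proof (cases "b g = 0")
    case True
    then have "algdep K ys" using Cons.IH[of "\<lambda>gs. c (g # gs)" gs] Cons.prems g by (simp add: b_def)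
    then show ?thesis by simp
  next
    case False
    define p where "p = (\<Sum>g\<le>N. monom (b g) g)"
    have "p \<in> polys (adjl K ys)" unfolding p_def
      by (intro rng_in.sum_in[OF rng_in.polys_rng_in[OF A]] rng_in.monom_in_polys[OF A] bS)
    moreover have "coeff p g = b g" using g by (simp add: p_def coeff_sum)
    moreover have "poly p y = 0" using eq by (simp add: p_def poly_sum poly_monom)
    ultimately have "alg_in (adjl K ys) y" using False unfolding alg_in_def by (intro bexI[of _ p]) auto
    then show ?thesis by simp
  qed
qed

text \<open>F is the leading coefficient and d the degree of an equation for y. One factor F allows
  \<open>y ^ d\<close> to be replaced by lower powers at the cost of at most M in the exponents of
  \<open>zs\<close>. So F ^ N brings all powers up to N into the span of Y, the powers below d, with
  exponents in \<open>zs\<close> that grow only linearly in N.\<close>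

lemma algebraic_growth_single:
  assumes D: "dom_in e D" and K: "rng_in e K" "K \<subseteq> D" and zs: "set zs \<subseteq> D"
    and y: "y \<in> D" "alg_in (adjl K zs) y"
  shows "\<exists>F M Y. F \<in> D \<and> F \<noteq> 0 \<and> finite Y \<and>
    (\<forall>N. \<forall>g\<le>N. e * F ^ N * y ^ g \<in> lspan K (mons zs (N * M) \<otimes>\<^sub>s Y))"
proof -
  interpret D: dom_in e D by fact
  obtain P where P: "P \<in> polys (adjl K zs)" "P \<noteq> 0" "poly P y = 0" using y by (auto simp: alg_in_def)
  have AD: "adjl K zs \<subseteq> D" using adjl_rng_in[OF D.rng_in_axioms K zs] by simp
  define F d Y where "F = lead_coeff P" and "d = degree P" and "Y = (\<lambda>r. y ^ r) ` {..<d}"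
  have d: "d > 0" using P by (auto simp: d_def elim!: degree_eq_zeroE intro: gr0I)
  have "\<forall>i. \<exists>M. coeff P i \<in> lspan K (mons zs M)" using adjl_lspan[OF K(1)] P by (auto simp: polys_def)
  then obtain Mi where Mi: "\<And>i. coeff P i \<in> lspan K (mons zs (Mi i))" by metis
  define M where "M = Max (Mi ` {..d})"
  have c: "coeff P i \<in> lspan K (mons zs M)" if i: "i \<le> d" for i
  proof -
    have "Mi i \<le> M" using i Max_ge[of "Mi ` {..d}" "Mi i"] by (auto simp: M_def)
    then show ?thesis using lspan_mono[OF Mi mons_mono] by blast
  qed
  then have F: "F \<in> lspan K (mons zs M)" by (simp add: F_def d_def)
  have yr: "F * y ^ r \<in> lspan K (mons zs M \<otimes>\<^sub>s Y)" if "r < d" for r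
  proof -
    have ey: "e * y ^ r \<in> lspan K Y" using that D.one_in K by (intro lspan_single) (auto simp: Y_def rng_in_def)
    have "F * (e * y ^ r) = (e * F) * y ^ r" by (simp add: mult_ac)
    also have "e * F = F" using P(1) AD D.one_mult by (auto simp: F_def polys_def)
    finally show ?thesis using lspan_mult[OF K(1) F ey] by simp
  qed
  have yd: "F * y ^ d \<in> lspan K (mons zs M \<otimes>\<^sub>s Y)"
  proof -
    have "F * y ^ d + (\<Sum>i<d. coeff P i * y ^ i) = 0"
      using P(3) by (simp add: poly_altdef F_def add.commute flip: d_def lessThan_Suc_atMost)
    then have "F * y ^ d = (\<Sum>i<d. (- e) * (coeff P i * y ^ i))"
      using P(1) AD D.one_mult by (simp add: eq_neg_iff_add_eq_0 sum_negf mult.assoc[symmetric] polys_def subset_iff)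
    also have "\<dots> \<in> lspan K (mons zs M \<otimes>\<^sub>s Y)"
    proof (rule lspan_sum)
      fix i assume i: "i \<in> {..<d}"
      have "- e \<in> K" using K(1) by (simp add: rng_in.uminus_in rng_in.one_in)
      then have ey: "(- e) * y ^ i \<in> lspan K Y" using i by (intro lspan_single) (auto simp: Y_def)
      have "(- e) * (coeff P i * y ^ i) = coeff P i * ((- e) * y ^ i)" by (simp add: mult_ac)
      then show "(- e) * (coeff P i * y ^ i) \<in> lspan K (mons zs M \<otimes>\<^sub>s Y)"
        using lspan_mult[OF K(1) c ey, of i] i by simp (simp add: mult_ac)?
    qed
    finally show ?thesis .
  qed
  \<comment> \<open>One factor F pays for raising the exponent of y by at most one; iterating this N
    times gives the claim.\<close>
  have shift: "(F * y ^ s) * v \<in> lspan K (mons zs (M' + M) \<otimes>\<^sub>s Y)"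
    if "s \<le> 1" "v \<in> lspan K (mons zs M' \<otimes>\<^sub>s Y)" for s v M'
    using that(2)
  proof (induction rule: lspan.induct)
    case (add k x v)
    then obtain m r where mr: "m \<in> mons zs M'" "r < d" "x = m * y ^ r" by (auto simp: set_mult_def Y_def)
    have "F * y ^ (s + r) \<in> lspan K (mons zs M \<otimes>\<^sub>s Y)"
    proof (cases "s + r < d")
      case False
      then have "s + r = d" using that(1) mr(2) by linarith
      then show ?thesis using yd by simp
    qed (rule yr)
    then have "k * m * (F * y ^ (s + r)) \<in> lspan K ({m} \<otimes>\<^sub>s (mons zs M \<otimes>\<^sub>s Y))"
      using lspan_mult[OF K(1) lspan_single[OF add(1), of m "{m}"]] by simp
    moreover have "{m} \<otimes>\<^sub>s (mons zs M \<otimes>\<^sub>s Y) \<subseteq> mons zs (M' + M) \<otimes>\<^sub>s Y"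
    proof
      fix w assume "w \<in> {m} \<otimes>\<^sub>s (mons zs M \<otimes>\<^sub>s Y)"
      then obtain a b where "a \<in> mons zs M" "b \<in> Y" "w = (m * a) * b" by (auto simp: set_mult_def mult.assoc)
      then show "w \<in> mons zs (M' + M) \<otimes>\<^sub>s Y" using mons_mult[OF mr(1)] set_mult_mem by metis
    qed
    ultimately have "k * m * (F * y ^ (s + r)) \<in> lspan K (mons zs (M' + M) \<otimes>\<^sub>s Y)" by (rule lspan_mono)
    moreover have "(F * y ^ s) * (k * x + v) = k * m * (F * y ^ (s + r)) + (F * y ^ s) * v"
      by (simp add: mr(3) power_add algebra_simps)
    ultimately show ?case using add.IH by (simp add: lspan_add)
  qed (simp add: lspan.zero)
  have "e * F ^ N * y ^ g \<in> lspan K (mons zs (N * M) \<otimes>\<^sub>s Y)" if "g \<le> N" for N g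
    using that
  proof (induction N arbitrary: g)
    case 0
    have "y ^ 0 \<in> Y" unfolding Y_def using d by (intro imageI) simp
    then have "1 * y ^ 0 \<in> mons zs 0 \<otimes>\<^sub>s Y" by (intro set_mult_mem mons_one)
    then show ?case using 0 lspan_single[of e K "1 * y ^ 0"] K(1) by (simp add: rng_in.one_in)
  next
    case (Suc N)
    have *: "N * M + M = Suc N * M" by simp
    show ?case
    proof (cases g)
      case 0
      show ?thesis using shift[of 0, OF _ Suc.IH[of 0]] 0 unfolding * by (simp add: mult_ac)
    next
      case (Suc g')
      then show ?thesis using shift[of 1, OF _ Suc.IH[of g']] Suc.prems unfolding * by (simp add: mult_ac)
    qed
  qed
  moreover have "F \<in> D" "F \<noteq> 0" using P AD by (auto simp: F_def polys_def)
  moreover have "finite Y" by (simp add: Y_def)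
  ultimately show ?thesis by blast
qed

lemma algebraic_growth:
  assumes D: "dom_in e D" and K: "rng_in e K" "K \<subseteq> D" and zs: "set zs \<subseteq> D"
  shows "set ys \<subseteq> D \<Longrightarrow> (\<And>y. y \<in> set ys \<Longrightarrow> alg_in (adjl K zs) y) \<Longrightarrow>
    \<exists>F M Y. F \<in> D \<and> F \<noteq> 0 \<and> finite Y \<and>
    (\<forall>N. \<forall>gs\<in>box (length ys) N. e * F ^ N * mon ys gs \<in> lspan K (mons zs (N * M) \<otimes>\<^sub>s Y))"
proof (induction ys)
  case Nil
  interpret D: dom_in e D by fact
  have "e * e ^ N = e" for N by (induction N) (auto simp: D.one_mult[OF D.one_in] mult.left_commute)
  moreover have "e * 1 \<in> lspan K (mons zs 0 \<otimes>\<^sub>s {1})"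
    using K(1) set_mult_mem[OF mons_one, of 1 "{1}"] by (intro lspan_single) (auto simp: rng_in.one_in)
  ultimately show ?case using D.one_in D.one_nz by (intro exI[of _ e] exI[of _ 0] exI[of _ "{1}"]) auto
next
  case (Cons y ys)
  interpret D: dom_in e D by fact
  obtain F1 M1 Y1 where 1: "F1 \<in> D" "F1 \<noteq> 0" "finite Y1"
    "\<And>N g. g \<le> N \<Longrightarrow> e * F1 ^ N * y ^ g \<in> lspan K (mons zs (N * M1) \<otimes>\<^sub>s Y1)"
    using algebraic_growth_single[OF D K zs, of y] Cons.prems by auto
  obtain F2 M2 Y2 where 2: "F2 \<in> D" "F2 \<noteq> 0" "finite Y2"
    "\<And>N gs. gs \<in> box (length ys) N \<Longrightarrow> e * F2 ^ N * mon ys gs \<in> lspan K (mons zs (N * M2) \<otimes>\<^sub>s Y2)"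
  proof -
    have "set ys \<subseteq> D" "\<And>y. y \<in> set ys \<Longrightarrow> alg_in (adjl K zs) y" using Cons.prems by auto
    from Cons.IH[OF this] show ?thesis using that by blast
  qed
  have "e * (F1 * F2) ^ N * mon (y # ys) (g # gs) \<in> lspan K (mons zs (N * (M1 + M2)) \<otimes>\<^sub>s (Y1 \<otimes>\<^sub>s Y2))"
    if g: "g \<le> N" "gs \<in> box (length ys) N" for N g gs
  proof -
    have "(e * F1 ^ N * y ^ g) * (e * F2 ^ N * mon ys gs) = (e * e) * (F1 * F2) ^ N * mon (y # ys) (g # gs)"
      by (simp add: power_mult_distrib mult_ac)
    then have eq: "e * (F1 * F2) ^ N * mon (y # ys) (g # gs) = (e * F1 ^ N * y ^ g) * (e * F2 ^ N * mon ys gs)"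
      by (simp add: D.one_mult[OF D.one_in])
    have "(mons zs (N * M1) \<otimes>\<^sub>s Y1) \<otimes>\<^sub>s (mons zs (N * M2) \<otimes>\<^sub>s Y2) \<subseteq> mons zs (N * (M1 + M2)) \<otimes>\<^sub>s (Y1 \<otimes>\<^sub>s Y2)"
    proof
      fix x assume "x \<in> (mons zs (N * M1) \<otimes>\<^sub>s Y1) \<otimes>\<^sub>s (mons zs (N * M2) \<otimes>\<^sub>s Y2)"
      then obtain a b c d where *: "a \<in> mons zs (N * M1)" "b \<in> Y1" "c \<in> mons zs (N * M2)" "d \<in> Y2" "x = (a * b) * (c * d)"
        by (auto simp: set_mult_def)
      have "x = (a * c) * (b * d)" using * by (simp add: mult_ac)
      moreover have "a * c \<in> mons zs (N * (M1 + M2))" using mons_mult[OF *(1,3)] by (simp add: distrib_left)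
      ultimately show "x \<in> mons zs (N * (M1 + M2)) \<otimes>\<^sub>s (Y1 \<otimes>\<^sub>s Y2)" using * set_mult_mem by metis
    qed
    then show ?thesis unfolding eq using lspan_mono[OF lspan_mult[OF K(1) 1(4)[OF g(1)] 2(4)[OF g(2)]]] by blast
  qed
  then have "\<forall>N. \<forall>gs\<in>box (length (y # ys)) N. e * (F1 * F2) ^ N * mon (y # ys) gs \<in> lspan K (mons zs (N * (M1 + M2)) \<otimes>\<^sub>s (Y1 \<otimes>\<^sub>s Y2))"
    by (auto simp: box_Suc simp del: mon.simps)
  moreover have "finite (Y1 \<otimes>\<^sub>s Y2)" "F1 * F2 \<in> D" "F1 * F2 \<noteq> 0"
    using 1(1-3) 2(1-3) set_mult_finite[of Y1 Y2] D.mult_in D.mult_nz by blast+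
  ultimately show ?case by blast
qed

lemma generators_in_adjl:
  assumes "rng_in e D" "rng_in e K" "K \<subseteq> D" "set ys \<subseteq> D"
  shows "set ys \<subseteq> adjl K ys"
  using assms(4)
proof (induction ys)
  case (Cons y ys)
  have "rng_in e (adjl K ys)" using adjl_rng_in[OF assms(1-3), of ys] Cons.prems by simp
  moreover have "e * y = y" using assms(1) Cons.prems by (simp add: rng_in.one_mult)
  ultimately show ?case using adj_rng_in(2,3)[of e "adjl K ys" y] Cons by auto
qed simp

text \<open>The number of exponent vectors for \<open>ys\<close> grows with a higher power of N than
  the dimension of the space that contains F ^ N times the monomials. So these are linearly
  dependent for large N, and F ^ N can be cancelled in the domain D.\<close>

lemma growth_algdep:
  assumes D: "dom_in e D" and K: "subfield_in e K" "K \<subseteq> D" and ys: "set ys \<subseteq> D"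
    and len: "length zs < length ys" and F: "F \<in> D" "F \<noteq> 0" "finite Y"
    "\<And>N gs. gs \<in> box (length ys) N \<Longrightarrow> e * F ^ N * mon ys gs \<in> lspan K (mons zs (N * M) \<otimes>\<^sub>s Y)"
  shows "algdep K ys"
proof -
  interpret D: dom_in e D by fact
  have Kr: "rng_in e K" using K by (simp add: subfield_in_def)
  \<comment> \<open>This N is just large enough: (N * M + 1) ^ m * card Y is at most (N + 1) ^ m *
    (M + 1) ^ m * card Y = (N + 1) ^ m * N, which is less than (N + 1) ^ (m + 1).\<close>
  define m N where "m = length zs" and "N = (M + 1) ^ length zs * card Y"
  let ?X = "mons zs (N * M) \<otimes>\<^sub>s Y"
  have X: "finite ?X" "card ?X \<le> (N * M + 1) ^ m * card Y"
    using set_mult_finite[of "mons zs (N * M)" Y] mons_finite[of zs "N * M"] F(3)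
    by (auto simp: m_def intro: order.trans[OF _ mult_le_mono1])
  have "N * M + 1 \<le> (N + 1) * (M + 1)" by simp
  then have "(N * M + 1) ^ m * card Y \<le> ((N + 1) * (M + 1)) ^ m * card Y"
    by (intro mult_le_mono1 power_mono) auto
  also have "\<dots> = (N + 1) ^ m * N" by (simp only: power_mult_distrib N_def m_def mult.assoc)
  also have "\<dots> < (N + 1) ^ Suc m" by simp
  also have "\<dots> \<le> (N + 1) ^ length ys" using len by (intro power_increasing) (auto simp: m_def)
  finally have "card ?X < card (box (length ys) N)" using X box_finite by simp
  then obtain c where c: "\<And>i. c i \<in> K" "\<exists>i\<in>box (length ys) N. c i \<noteq> 0"
    "(\<Sum>gs\<in>box (length ys) N. c gs * (e * F ^ N * mon ys gs)) = 0"
    using lspan_relation[OF K(1) X(1) box_finite(1), of "length ys" N "\<lambda>gs. e * F ^ N * mon ys gs"] F(4) by blast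
  let ?s = "\<Sum>gs\<in>box (length ys) N. c gs * mon ys gs"
  have "e * F ^ N * ?s = 0" using c(3) by (simp add: sum_distrib_left mult_ac)
  moreover have "?s \<in> D"
    using mon_in_adjl[OF D.rng_in_axioms Kr K(2) ys c(1)] adjl_rng_in[OF D.rng_in_axioms Kr K(2) ys]
    by (intro D.sum_in) blast
  moreover have "e * F ^ N \<in> D" "e * F ^ N \<noteq> 0"
    using D.mult_power_in[OF D.one_in F(1)] D.mult_power_nz[OF D.one_in F(1) D.one_nz F(2)] by auto
  ultimately have "?s = 0" using D.integral by blast
  then show ?thesis using monomial_relation_algdep[OF D.rng_in_axioms Kr K(2) ys, of c] c(1,2) by blast
qed

lemma mon_in_mons_exponent: "x \<in> mons us R \<Longrightarrow> \<exists>gs\<in>box (length us) R. x = mon us gs"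
proof (induction us arbitrary: x)
  case (Cons u us)
  then obtain y i where yi: "y \<in> mons us R" "i \<le> R" "x = y * u ^ i" by (auto simp: set_mult_def)
  then obtain gs where "gs \<in> box (length us) R" "y = mon us gs" using Cons.IH by blast
  then show ?case using yi by (intro bexI[of _ "i # gs"]) (auto simp: box_def mult.commute)
qed (auto simp: box_def)

lemma lspan_mons_mult:
  assumes K: "rng_in e K" and "v \<in> lspan K (mons us M)" "w \<in> lspan K (mons us N)"
  shows "v * w \<in> lspan K (mons us (M + N))"
proof -
  have "mons us M \<otimes>\<^sub>s mons us N \<subseteq> mons us (M + N)" using mons_mult by (auto simp: set_mult_def)
  then show ?thesis using lspan_mult[OF assms] lspan_mono by blast
qed

lemma lspan_mons_mon:
  assumes K: "rng_in e K"
  shows "(\<And>w. w \<in> set ws \<Longrightarrow> w \<in> lspan K (mons us M)) \<Longrightarrow> gs \<in> box (length ws) N \<Longrightarrow>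
    e * mon ws gs \<in> lspan K (mons us (length ws * (N * M)))"
proof (induction ws arbitrary: gs)
  case Nil
  then show ?case using lspan_single[OF rng_in.one_in[OF K] mons_one, of us 0] by simp
next
  case (Cons w ws)
  then obtain g gs' where g: "gs = g # gs'" "g \<le> N" "gs' \<in> box (length ws) N" by (auto simp: box_Suc)
  have ee: "e * e = e" using K by (simp add: rng_in.one_in rng_in.one_mult)
  have w: "w \<in> lspan K (mons us M)" using Cons.prems by simp
  have "e * w ^ g \<in> lspan K (mons us (g * M))"
  proof (induction g)
    case 0
    then show ?case using lspan_single[OF rng_in.one_in[OF K] mons_one, of us 0] by simp
  next
    case (Suc g)
    then show ?case using lspan_mons_mult[OF K w Suc] by (simp add: mult_ac)
  qed
  then have 1: "e * w ^ g \<in> lspan K (mons us (N * M))"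
    by (rule lspan_mono[OF _ mons_mono]) (simp add: g(2))
  have 2: "e * mon ws gs' \<in> lspan K (mons us (length ws * (N * M)))"
    using Cons.IH[OF _ g(3)] Cons.prems(1) by simp
  have "(e * w ^ g) * (e * mon ws gs') = (e * e) * mon (w # ws) gs" by (simp add: g mult_ac)
  then show ?case using lspan_mons_mult[OF K 1 2] ee by (simp del: mon.simps)
qed

text \<open>More elements than \<open>zs\<close> has are dependent if they are built from elements
  algebraic over \<open>adjl K zs\<close>. Only the generators \<open>us\<close> have to be
  algebraic: monomials in \<open>ws\<close> are expanded into monomials in \<open>us\<close>, to
  which the growth bound applies.\<close>

theorem algdep_counting_adjl:
  assumes D: "dom_in e D" and K: "subfield_in e K" "K \<subseteq> D" and zs: "set zs \<subseteq> D" and us: "set us \<subseteq> D"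
    and ws: "set ws \<subseteq> adjl K us" and len: "length zs < length ws"
    and alg: "\<And>u. u \<in> set us \<Longrightarrow> alg_in (adjl K zs) u"
  shows "algdep K ws"
proof -
  interpret D: dom_in e D by fact
  have Kr: "rng_in e K" using K by (simp add: subfield_in_def)
  have wsD: "set ws \<subseteq> D" using ws adjl_rng_in[OF D.rng_in_axioms Kr K(2) us] by blast
  obtain F M Y where F: "F \<in> D" "F \<noteq> 0" "finite Y"
    "\<And>N gs. gs \<in> box (length us) N \<Longrightarrow> e * F ^ N * mon us gs \<in> lspan K (mons zs (N * M) \<otimes>\<^sub>s Y)"
    using algebraic_growth[OF D Kr K(2) zs us alg] by blast
  have "\<forall>w\<in>set ws. \<exists>M. w \<in> lspan K (mons us M)" using adjl_lspan[OF Kr] ws by blast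
  then obtain f where f: "\<And>w. w \<in> set ws \<Longrightarrow> w \<in> lspan K (mons us (f w))" by metis
  define M1 where "M1 = Max (f ` set ws)"
  have M1: "w \<in> lspan K (mons us M1)" if "w \<in> set ws" for w
    unfolding M1_def by (rule lspan_mono[OF f[OF that] mons_mono]) (use that in auto)
  \<comment> \<open>A monomial in \<open>ws\<close> with exponents up to N has exponents up to R * N
    in \<open>us\<close>, so F ^ R does for \<open>ws\<close> what F does for \<open>us\<close>. The
    \<open>Suc\<close> makes R positive, which keeps F ^ R in D.\<close>
  define R where "R = Suc (length ws * M1)"
  have span: "e * F ^ N * v \<in> lspan K (mons zs (N * M) \<otimes>\<^sub>s Y)" if "v \<in> lspan K (mons us N)" for v N
    using that
  proof (induction rule: lspan.induct)
    case (add k x v)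
    then obtain gs where gs: "gs \<in> box (length us) N" "x = mon us gs" using mon_in_mons_exponent by blast
    have "k * e = k" using add(1) Kr by (simp add: rng_in.mult_one)
    then have "k \<in> lspan K {1}" using lspan_single[of k K 1 "{1}"] add(1) by simp
    from lspan_mult[OF Kr this F(4)[OF gs(1)]]
    have "k * (e * F ^ N * x) \<in> lspan K ({1} \<otimes>\<^sub>s (mons zs (N * M) \<otimes>\<^sub>s Y))" by (simp add: gs(2))
    moreover have "{1} \<otimes>\<^sub>s (mons zs (N * M) \<otimes>\<^sub>s Y) \<subseteq> mons zs (N * M) \<otimes>\<^sub>s Y"
      by (auto simp: set_mult_def)
    ultimately have "k * (e * F ^ N * x) \<in> lspan K (mons zs (N * M) \<otimes>\<^sub>s Y)" by (rule lspan_mono)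
    moreover have "e * F ^ N * (k * x + v) = k * (e * F ^ N * x) + e * F ^ N * v" by (simp add: algebra_simps)
    ultimately show ?case using add.IH lspan_add by simp
  qed (simp add: lspan.zero)
  have FR: "F ^ R \<in> D" "F ^ R \<noteq> 0" using D.power_in[OF F(1), of R] D.power_nz[OF F(1,2), of R] R_def by blast+
  have "e * (F ^ R) ^ N * mon ws gs \<in> lspan K (mons zs (N * (R * M)) \<otimes>\<^sub>s Y)" if gs: "gs \<in> box (length ws) N" for N gs
  proof -
    have "e * mon ws gs \<in> lspan K (mons us (R * N))"
      by (rule lspan_mono[OF lspan_mons_mon[OF Kr M1 gs] mons_mono]) (simp_all add: R_def)
    from span[OF this] have "e * F ^ (R * N) * (e * mon ws gs) \<in> lspan K (mons zs (R * N * M) \<otimes>\<^sub>s Y)" .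
    moreover have "e * F ^ (R * N) * (e * mon ws gs) = (e * e) * (F ^ R) ^ N * mon ws gs"
      by (simp add: power_mult ac_simps flip: power_mult)
    ultimately show ?thesis using D.one_mult[OF D.one_in] by (simp add: mult_ac)
  qed
  then show ?thesis by (rule growth_algdep[OF D K wsD len FR F(3)])
qed

corollary algdep_counting:
  assumes D: "dom_in e D" and K: "subfield_in e K" "K \<subseteq> D" and zs: "set zs \<subseteq> D" and ys: "set ys \<subseteq> D"
    and len: "length zs < length ys" and alg: "\<And>y. y \<in> set ys \<Longrightarrow> alg_in (adjl K zs) y"
  shows "algdep K ys"
proof (rule algdep_counting_adjl[OF D K zs ys _ len alg])
  show "set ys \<subseteq> adjl K ys"
    using D K ys by (intro generators_in_adjl[of e D]) (auto simp: dom_in_def subfield_in_def)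
qed


section \<open>Locally finite iterative higher derivations\<close>

text \<open>Equivalently, \<open>\<lambda>a. \<Sum>i. d i a * T ^ i\<close> is an action of the additive group on the spectrum of \<open>A\<close>.\<close>

locale exp_family = dom_in e A for e :: "'r::comm_ring_1" and A +
  fixes d :: "nat \<Rightarrow> 'r \<Rightarrow> 'r"
  assumes d_in: "a \<in> A \<Longrightarrow> d i a \<in> A"
    and d_0: "a \<in> A \<Longrightarrow> d 0 a = a"
    and d_add: "a \<in> A \<Longrightarrow> b \<in> A \<Longrightarrow> d i (a + b) = d i a + d i b"
    and d_mult: "a \<in> A \<Longrightarrow> b \<in> A \<Longrightarrow> d n (a * b) = (\<Sum>i\<le>n. d i a * d (n - i) b)"
    and d_fin: "a \<in> A \<Longrightarrow> \<exists>N. \<forall>i\<ge>N. d i a = 0"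
    and d_iter: "a \<in> A \<Longrightarrow> d j (d i a) = of_nat ((i + j) choose i) * d (i + j) a"
begin

definition invs :: "'r set" where "invs = {a \<in> A. \<forall>i>0. d i a = 0}"

text \<open>The image of a under the coaction. Its degree is a degree function on A: additive on
  products of nonzero elements and zero exactly on the invariants.\<close>

definition gen :: "'r \<Rightarrow> 'r poly" where "gen a = Abs_poly (\<lambda>i. d i a)"

lemma coeff_gen: "a \<in> A \<Longrightarrow> coeff (gen a) i = d i a"
proof -
  assume "a \<in> A"
  then obtain N where "\<forall>i\<ge>N. d i a = 0" using d_fin by blast
  then have "finite {i. d i a \<noteq> 0}" by (intro finite_subset[OF _ finite_lessThan[of N]]) (auto simp: not_less[symmetric])
  then show ?thesis unfolding gen_def by (subst Abs_poly_inverse) (auto simp: eventually_cofinite)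
qed

lemma gen_polys: "a \<in> A \<Longrightarrow> gen a \<in> polys A"
  by (simp add: polys_def coeff_gen d_in)

lemma gen_add: "a \<in> A \<Longrightarrow> b \<in> A \<Longrightarrow> gen (a + b) = gen a + gen b"
  by (intro poly_eqI) (simp add: coeff_gen add_in d_add)

lemma gen_mult: "a \<in> A \<Longrightarrow> b \<in> A \<Longrightarrow> gen (a * b) = gen a * gen b"
  by (intro poly_eqI) (simp add: coeff_gen mult_in d_mult coeff_mult)

lemma d_zero: "d i 0 = 0"
  using d_add[of 0 0 i] by simp

lemma gen_zero_iff: "a \<in> A \<Longrightarrow> gen a = 0 \<longleftrightarrow> a = 0"
  using coeff_gen[of a 0] d_0 d_zero coeff_gen[of 0] by (auto intro!: poly_eqI)

lemma d_uminus: "a \<in> A \<Longrightarrow> d i (- a) = - d i a"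
  using d_add[of a "- a" i] uminus_in d_zero by (simp add: eq_neg_iff_add_eq_0 add.commute)

lemma d_diff: "a \<in> A \<Longrightarrow> b \<in> A \<Longrightarrow> d i (a - b) = d i a - d i b"
  using d_add[of a "- b" i] uminus_in d_uminus by simp

lemma invs_iff: "a \<in> A \<Longrightarrow> a \<in> invs \<longleftrightarrow> degree (gen a) = 0"
proof
  assume a: "a \<in> A"
  show "a \<in> invs \<Longrightarrow> degree (gen a) = 0"
    using a by (intro le_antisym degree_le) (auto simp: invs_def coeff_gen)
  show "a \<in> invs" if "degree (gen a) = 0"
    using that a coeff_eq_0[of "gen a"] by (auto simp: invs_def simp flip: coeff_gen)
qed

lemma invs_const: "a \<in> invs \<Longrightarrow> gen a = [:a:]"
  by (intro poly_eqI) (auto simp: invs_def coeff_gen coeff_pCons d_0 split: nat.split)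

lemma d_inv_mult: "c \<in> invs \<Longrightarrow> a \<in> A \<Longrightarrow> d i (c * a) = c * d i a"
  using gen_mult[of c a] invs_const[of c] coeff_gen[of "c * a" i] coeff_gen[of a i] mult_in[of c a]
  by (simp add: invs_def)

lemma degree_gen_mult:
  "a \<in> A \<Longrightarrow> b \<in> A \<Longrightarrow> a \<noteq> 0 \<Longrightarrow> b \<noteq> 0 \<Longrightarrow> degree (gen (a * b)) = degree (gen a) + degree (gen b)"
  using degree_mult_polys(1)[OF gen_polys gen_polys] by (simp add: gen_mult gen_zero_iff)

lemma invs_closed: "a \<in> A \<Longrightarrow> b \<in> A \<Longrightarrow> a * b \<in> invs \<Longrightarrow> a * b \<noteq> 0 \<Longrightarrow> a \<in> invs"
proof -
  assume *: "a \<in> A" "b \<in> A" "a * b \<in> invs" "a * b \<noteq> 0"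
  then have "a \<noteq> 0" "b \<noteq> 0" by auto
  then show ?thesis
    using * degree_gen_mult[of a b] invs_iff[of a] invs_iff[of "a * b"] mult_in[of a b] by simp
qed

lemma e_inv: "e \<in> invs"
proof -
  have "degree (gen (e * e)) = degree (gen e) + degree (gen e)"
    using degree_gen_mult[OF one_in one_in one_nz one_nz] .
  then show ?thesis using one_mult[OF one_in] invs_iff[OF one_in] by simp
qed

lemma invs_rng_in: "rng_in e invs"
proof
  show "e \<in> invs" by (rule e_inv)
  show "e * a = a" if "a \<in> invs" for a using that one_mult by (auto simp: invs_def)
  show "a - b \<in> invs" if "a \<in> invs" "b \<in> invs" for a b using that diff_in by (auto simp: invs_def d_diff)
  show "a * b \<in> invs" if "a \<in> invs" "b \<in> invs" for a b
    using that d_inv_mult[of a b] mult_in by (auto simp: invs_def)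
qed

text \<open>Divisors of the invariant element e are invariant, because the degrees of the factors
  add up to zero.\<close>

lemma field_inv:
  assumes "subfield_in e K" "K \<subseteq> A"
  shows "K \<subseteq> invs"
proof
  fix k assume k: "k \<in> K"
  show "k \<in> invs"
  proof (cases "k = 0")
    case False
    then obtain v where "v \<in> K" "k * v = e" using assms k by (auto simp: subfield_in_def)
    then show ?thesis using invs_closed[of k v] e_inv one_nz assms k by auto
  qed (simp add: invs_def d_zero)
qed

end

text \<open>The component of p of weight w, as an element of the coefficient ring, if the variable
  has weight Q. Weights that are not multiples of Q do not occur.\<close>

definition wcoeff :: "nat \<Rightarrow> 'r::zero poly \<Rightarrow> nat \<Rightarrow> 'r"
  where "wcoeff Q p w = (if Q dvd w then coeff p (w div Q) else 0)"

lemma wcoeff_eq_0: "Q > 0 \<Longrightarrow> Q * degree p < w \<Longrightarrow> wcoeff Q p w = 0"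
  by (auto simp: wcoeff_def dvd_def intro!: coeff_eq_0)

lemma wcoeff_add: "wcoeff Q (p + q) w = wcoeff Q p w + wcoeff Q q w"
  for p q :: "'r::comm_ring_1 poly"
  by (simp add: wcoeff_def)

lemma wcoeff_sum: "wcoeff Q (sum f I) w = (\<Sum>i\<in>I. wcoeff Q (f i) w)"
  for f :: "'i \<Rightarrow> 'r::comm_ring_1 poly"
  by (simp add: wcoeff_def coeff_sum)

text \<open>As w and v bound the weights of p and q, at most one term of the convolution reaches
  weight w + v.\<close>

lemma wcoeff_mult:
  fixes p q :: "'r::comm_ring_1 poly"
  assumes Q: "Q > 0" and "Q * degree p \<le> w" "Q * degree q \<le> v"
  shows "wcoeff Q (p * q) (w + v) = wcoeff Q p w * wcoeff Q q v"
proof (cases "Q dvd w \<and> Q dvd v")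
  case True
  then obtain m n where mn: "w = Q * m" "v = Q * n" by (auto simp: dvd_def)
  have le: "degree p \<le> m" "degree q \<le> n" using assms mn by auto
  have "coeff (p * q) (m + n) = (\<Sum>i\<le>m + n. coeff p i * coeff q (m + n - i))" by (rule coeff_mult)
  also have "\<dots> = (\<Sum>i\<in>{m}. coeff p i * coeff q (m + n - i))"
  proof (rule sum.mono_neutral_right)
    show "\<forall>i\<in>{..m + n} - {m}. coeff p i * coeff q (m + n - i) = 0"
    proof
      fix i assume i: "i \<in> {..m + n} - {m}"
      show "coeff p i * coeff q (m + n - i) = 0"
      proof (cases "i < m")
        case True
        then have "degree q < m + n - i" using le by linarith
        then show ?thesis by (simp add: coeff_eq_0)
      next
        case False
        then have "degree p < i" using le i by auto
        then show ?thesis by (simp add: coeff_eq_0)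
      qed
    qed
  qed auto
  finally have "coeff (p * q) (m + n) = coeff p m * coeff q n" by simp
  moreover have "(Q * m + Q * n) div Q = m + n" "Q dvd Q * m + Q * n"
    using Q by (auto simp flip: distrib_left)
  ultimately show ?thesis using mn Q by (simp add: wcoeff_def)
next
  case False
  have z: "wcoeff Q p w * wcoeff Q q v = 0" using False by (auto simp: wcoeff_def)
  show ?thesis
  proof (cases "Q dvd w + v")
    case True
    \<comment> \<open>The sum w + v may be a multiple of Q although w and v are not; then one of the
      two bounds is strict and the product does not reach the weight w + v.\<close>
    have "Q * degree p \<noteq> w \<or> Q * degree q \<noteq> v" using False by auto
    then have "Q * degree p + Q * degree q < w + v" using assms by linarith
    then have "Q * degree (p * q) < w + v" using degree_mult_le[of p q] Q
      by (metis add_mult_distrib2 le_less_trans mult_le_mono2)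
    then show ?thesis using z wcoeff_eq_0[OF Q] by simp
  qed (use z in \<open>simp add: wcoeff_def\<close>)
qed

text \<open>Generation in the form of an induction principle: a property that defines a subring and
  holds on K and on G holds on A.\<close>

definition fin_gen_in :: "'r::comm_ring_1 \<Rightarrow> 'r set \<Rightarrow> 'r set \<Rightarrow> 'r set \<Rightarrow> bool"
  where "fin_gen_in e K A G \<longleftrightarrow> finite G \<and> G \<subseteq> A \<and>
    (\<forall>S. rng_in e S \<longrightarrow> S \<subseteq> A \<longrightarrow> K \<subseteq> S \<longrightarrow> G \<subseteq> S \<longrightarrow> S = A)"

text \<open>P / Q is the largest of the ratios u / i.\<close>

lemma exists_slope:
  assumes fin: "finite F" and F: "(u0, i0) \<in> F" "\<And>u i. (u, i) \<in> F \<Longrightarrow> i > 0"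
  shows "\<exists>P Q::nat. Q > 0 \<and> (\<forall>(u, i)\<in>F. Q * u \<le> P * i) \<and> (\<exists>(u, i)\<in>F. Q * u = P * i)"
proof -
  let ?s = "\<lambda>(u, i). real u / real i"
  obtain P Q where PQ: "(P, Q) \<in> F" "\<And>x. x \<in> F \<Longrightarrow> ?s x \<le> ?s (P, Q)"
  proof -
    have "Max (?s ` F) \<in> ?s ` F" using fin F(1) by (intro Max_in) auto
    then obtain x where "x \<in> F" "?s x = Max (?s ` F)" by auto
    then show ?thesis using that[of "fst x" "snd x"] fin by (auto simp: Max_ge)
  qed
  have Q: "Q > 0" using F(2)[OF PQ(1)] .
  have "Q * u \<le> P * i" if "(u, i) \<in> F" for u i
  proof -
    have "real u / real i \<le> real P / real Q" using PQ(2)[OF that] by simp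
    then have "real (Q * u) \<le> real (P * i)" using Q F(2)[OF that] by (simp add: field_simps)
    then show ?thesis by (simp only: of_nat_le_iff)
  qed
  then show ?thesis using Q PQ(1) by (intro exI[of _ P] exI[of _ Q]) (auto intro!: bexI[of _ "(P, Q)"] simp: mult.commute)
qed

text \<open>The leading part of \<open>D\<close> for the grading of \<open>A[x]\<close> in which \<open>x\<close> has weight \<open>Q\<close> and
  \<open>D i\<close> has weight \<open>P * i\<close>; its restriction to \<open>A\<close>, with \<open>x\<close> set to \<open>1\<close>, is iterative because
  \<open>x\<close> turns out to be invariant under the leading part.\<close>

theorem exp_family_restrict:
  fixes A :: "'r::comm_ring_1 set" and D :: "nat \<Rightarrow> 'r poly \<Rightarrow> 'r poly"
  assumes A: "dom_in e A" and D: "exp_family [:e:] (polys A) D"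
    and K: "subfield_in e K" "K \<subseteq> A" and G: "fin_gen_in e K A G"
    and nontriv: "a0 \<in> A" "i0 > 0" "D i0 [:a0:] \<noteq> 0"
  shows "\<exists>d. exp_family e A d \<and> (\<exists>a\<in>A. a \<notin> exp_family.invs A d) \<and>
    (\<forall>a\<in>A. [:a:] \<in> exp_family.invs (polys A) D \<longrightarrow> a \<in> exp_family.invs A d)"
proof -
  interpret A: dom_in e A by fact
  interpret D: exp_family "[:e:]" "polys A" D by fact
  let ?x = "[:0, e:]"
  have xA: "?x \<in> polys A" using A.one_in by (intro A.pCons_in_polys) auto
  have cA: "[:a:] \<in> polys A" if "a \<in> A" for a using that by simp
  have Kp: "subfield_in [:e:] ((\<lambda>k. [:k:]) ` K)"
  proof -
    interpret K: rng_in e K using K by (simp add: subfield_in_def)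
    have "rng_in [:e:] ((\<lambda>k. [:k:]) ` K)"
    proof
      fix a b assume "a \<in> (\<lambda>k. [:k:]) ` K" "b \<in> (\<lambda>k. [:k:]) ` K"
      then obtain k l where kl: "k \<in> K" "l \<in> K" "a = [:k:]" "b = [:l:]" by auto
      show "a - b \<in> (\<lambda>k. [:k:]) ` K" using imageI[OF K.diff_in[OF kl(1,2)], of "\<lambda>k. [:k:]"] kl by simp
      show "a * b \<in> (\<lambda>k. [:k:]) ` K" using imageI[OF K.mult_in[OF kl(1,2)], of "\<lambda>k. [:k:]"] kl by (simp add: mult.commute)
    qed (use K.one_in K.one_mult in auto)
    moreover have "\<exists>v\<in>(\<lambda>k. [:k:]) ` K. k * v = [:e:]" if k: "k \<in> (\<lambda>k. [:k:]) ` K" "k \<noteq> 0" for k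
    proof -
      obtain l where l: "l \<in> K" "k = [:l:]" using k by blast
      then obtain v where "v \<in> K" "l * v = e" using k K unfolding subfield_in_def by auto
      then show ?thesis using l by (intro bexI[of _ "[:v:]"]) auto
    qed
    ultimately show ?thesis using A.one_nz unfolding subfield_in_def by auto
  qed
  have Kinv: "[:k:] \<in> D.invs" if "k \<in> K" for k
  proof -
    have "(\<lambda>k. [:k:]) ` K \<subseteq> polys A" using K(2) cA by blast
    then show ?thesis using D.field_inv[OF Kp] that by blast
  qed
  have Gfin: "finite G" "G \<subseteq> A" using G by (auto simp: fin_gen_in_def)
  \<comment> \<open>If D were trivial on all generators, the elements of A on which it is trivial
    would form a subring containing K and G, hence all of A, against \<open>nontriv\<close>.\<close>
  have "\<exists>g\<in>G. [:g:] \<notin> D.invs"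
  proof (rule ccontr)
    assume "\<not> ?thesis"
    then have "G \<subseteq> {a \<in> A. [:a:] \<in> D.invs}" using Gfin by auto
    moreover have "rng_in e {a \<in> A. [:a:] \<in> D.invs}"
    proof -
      interpret I: rng_in "[:e:]" D.invs by (rule D.invs_rng_in)
      show ?thesis
      proof
        fix a b assume ab: "a \<in> {a \<in> A. [:a:] \<in> D.invs}" "b \<in> {a \<in> A. [:a:] \<in> D.invs}"
        show "a - b \<in> {a \<in> A. [:a:] \<in> D.invs}" using ab A.diff_in I.diff_in[of "[:a:]" "[:b:]"] by auto
        show "a * b \<in> {a \<in> A. [:a:] \<in> D.invs}"
          using ab A.mult_in I.mult_in[of "[:a:]" "[:b:]"] by (auto simp: mult.commute)
      qed (use A.one_in A.one_mult I.one_in in auto)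
    qed
    moreover have "K \<subseteq> {a \<in> A. [:a:] \<in> D.invs}" using K Kinv by auto
    ultimately have "{a \<in> A. [:a:] \<in> D.invs} = A" using G by (auto simp: fin_gen_in_def)
    then have "[:a0:] \<in> D.invs" using nontriv by blast
    then show False using nontriv by (auto simp: D.invs_def)
  qed
  then obtain g0 j0 where g0: "g0 \<in> G" "j0 > 0" "D j0 [:g0:] \<noteq> 0" using Gfin by (auto simp: D.invs_def)
  \<comment> \<open>The pairs record how much \<open>D i\<close> raises the degree in x: from 0 for
    a generator of A and from 1 for x itself. With P / Q the largest ratio, \<open>D i\<close>
    raises the weight by at most P * i on all of \<open>A[x]\<close>, and somewhere by exactly
    that.\<close>
  define F where "F = {(degree (D i [:g:]), i) | g i. g \<in> G \<and> 0 < i \<and> D i [:g:] \<noteq> 0} \<union>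
    {(degree (D i ?x) - 1, i) | i. 0 < i \<and> D i ?x \<noteq> 0 \<and> degree (D i ?x) > 0}"
  have Fin: "finite F"
  proof -
    have fi: "finite {i. D i r \<noteq> 0}" if "r \<in> polys A" for r
    proof -
      obtain N where "\<forall>i\<ge>N. D i r = 0" using D.d_fin[OF \<open>r \<in> polys A\<close>] by blast
      then show ?thesis by (intro finite_subset[OF _ finite_lessThan[of N]]) (auto simp: not_less[symmetric])
    qed
    have "F \<subseteq> (\<Union>g\<in>G. (\<lambda>i. (degree (D i [:g:]), i)) ` {i. D i [:g:] \<noteq> 0}) \<union>
        (\<lambda>i. (degree (D i ?x) - 1, i)) ` {i. D i ?x \<noteq> 0}"
      unfolding F_def by auto
    moreover have "finite \<dots>" using Gfin fi[OF cA] fi[OF xA] by auto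
    ultimately show ?thesis by (rule finite_subset)
  qed
  have F0: "(degree (D j0 [:g0:]), j0) \<in> F" using g0 by (auto simp: F_def)
  have Fpos: "i > 0" if "(u, i) \<in> F" for u i using that by (auto simp: F_def)
  obtain P Q :: nat where *: "Q > 0 \<and> (\<forall>(u, i)\<in>F. Q * u \<le> P * i) \<and> (\<exists>(u, i)\<in>F. Q * u = P * i)"
  proof -
    have "\<exists>P Q. Q > 0 \<and> (\<forall>(u, i)\<in>F. Q * u \<le> P * i) \<and> (\<exists>(u, i)\<in>F. Q * u = P * i)"
      by (rule exists_slope[OF Fin F0]) (rule Fpos)
    then show ?thesis using that by (elim exE)
  qed
  then have Q: "Q > 0" and PQ: "\<And>u i. (u, i) \<in> F \<Longrightarrow> Q * u \<le> P * i"
    and att: "\<exists>(u, i)\<in>F. Q * u = P * i" by blast+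
  have dq: "u \<le> w div Q \<longleftrightarrow> Q * u \<le> w" for u w
    using Q by (simp add: less_eq_div_iff_mult_less_eq mult.commute)
  \<comment> \<open>The bound holds on generators by the choice of the slope. It passes to products
    by the Leibniz rule, hence the elements with this bound form a subring.\<close>
  have bg: "Q * degree (D i [:a:]) \<le> P * i" if "a \<in> A" for a i
  proof -
    let ?S = "{a \<in> A. \<forall>i. Q * degree (D i [:a:]) \<le> P * i}"
    have "rng_in e ?S"
    proof
      have "D i [:e:] = (if i = 0 then [:e:] else 0)" for i using D.e_inv D.d_0 by (auto simp: D.invs_def)
      then show "e \<in> ?S" using A.one_in by auto
      show "e * a = a" if "a \<in> ?S" for a using that A.one_mult by auto
      fix a b assume ab: "a \<in> ?S" "b \<in> ?S"
      then have abA: "a \<in> A" "b \<in> A" by auto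
      have "Q * degree (D i [:a - b:]) \<le> P * i" for i
      proof -
        have eq: "D i [:a - b:] = D i [:a:] - D i [:b:]" using D.d_diff[OF cA cA, OF abA] by simp
        have "Q * degree (D i [:a:] - D i [:b:]) \<le> Q * max (degree (D i [:a:])) (degree (D i [:b:]))"
          by (intro mult_le_mono2 degree_diff_le_max)
        also have "Q * max (degree (D i [:a:])) (degree (D i [:b:])) \<le> P * i" using ab by (auto simp: max_def)
        finally show ?thesis unfolding eq .
      qed
      then show "a - b \<in> ?S" using abA A.diff_in by auto
      have "Q * degree (D n [:a * b:]) \<le> P * n" for n
      proof -
        have "D n [:a * b:] = (\<Sum>i\<le>n. D i [:a:] * D (n - i) [:b:])"
          using D.d_mult[OF cA cA, OF abA, of n] by (simp add: mult.commute)
        moreover have "degree (D i [:a:] * D (n - i) [:b:]) \<le> (P * n) div Q" if "i \<le> n" for i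
        proof -
          have "Q * degree (D i [:a:] * D (n - i) [:b:]) \<le> Q * degree (D i [:a:]) + Q * degree (D (n - i) [:b:])"
            using degree_mult_le[of "D i [:a:]" "D (n - i) [:b:]"] by (metis distrib_left mult_le_mono2)
          also have "\<dots> \<le> P * i + P * (n - i)" using ab by (intro add_mono) auto
          also have "\<dots> = P * n" using that by (simp flip: distrib_left)
          finally show ?thesis by (simp only: dq)
        qed
        ultimately have "degree (D n [:a * b:]) \<le> (P * n) div Q" by (auto intro!: degree_sum_le)
        then show ?thesis by (simp only: dq)
      qed
      then show "a * b \<in> ?S" using abA A.mult_in by auto
    qed
    moreover have "K \<subseteq> ?S"
    proof
      fix k assume k: "k \<in> K"
      have "D i [:k:] = (if i = 0 then [:k:] else 0)" for i using Kinv[OF k] D.d_0 by (auto simp: D.invs_def)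
      then show "k \<in> ?S" using k K by auto
    qed
    moreover have "G \<subseteq> ?S"
    proof
      fix g assume g: "g \<in> G"
      have "Q * degree (D i [:g:]) \<le> P * i" for i
      proof (cases "i = 0 \<or> D i [:g:] = 0")
        case True
        then show ?thesis using D.d_0[OF cA] g Gfin by auto
      next
        case False
        then show ?thesis using PQ[of "degree (D i [:g:])" i] g by (auto simp: F_def)
      qed
      then show "g \<in> ?S" using g Gfin by auto
    qed
    ultimately have "?S = A" using G unfolding fin_gen_in_def by blast
    then show ?thesis using that by blast
  qed
  have bx: "Q * degree (D i ?x) \<le> Q + P * i" for i
  proof (cases "i = 0 \<or> D i ?x = 0 \<or> degree (D i ?x) = 0")
    case True
    then show ?thesis using D.d_0[OF xA] by auto
  next
    case False
    then have "Q * (degree (D i ?x) - 1) \<le> P * i" using PQ[of "degree (D i ?x) - 1" i] by (auto simp: F_def)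
    then show ?thesis using False by (cases "degree (D i ?x)") auto
  qed
  \<comment> \<open>\<open>bnd N r\<close> says that r has weight at most Q * N and that each
    \<open>D i\<close> adds at most P * i to it. It holds with N = 0 on A and with N = 1 for
    x.\<close>
  define bnd where "bnd N r \<longleftrightarrow> (\<forall>i. Q * degree (D i r) \<le> Q * N + P * i)" for N r
  have bndD: "Q * degree (D i r) \<le> Q * N + P * i" if "bnd N r" for N r i using that by (simp add: bnd_def)
  have bnd_mult: "bnd (M + N) (r * s)" if "bnd M r" "bnd N s" "r \<in> polys A" "s \<in> polys A" for M N r s
    unfolding bnd_def
  proof
    fix n
    have "degree (D i r * D (n - i) s) \<le> (Q * (M + N) + P * n) div Q" if i: "i \<le> n" for i
    proof -
      have "Q * degree (D i r * D (n - i) s) \<le> Q * degree (D i r) + Q * degree (D (n - i) s)"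
        using degree_mult_le[of "D i r" "D (n - i) s"] by (metis distrib_left mult_le_mono2)
      also have "\<dots> \<le> (Q * M + P * i) + (Q * N + P * (n - i))" using \<open>bnd M r\<close> \<open>bnd N s\<close> by (intro add_mono) (auto simp: bnd_def)
      also have "\<dots> = Q * (M + N) + P * (i + (n - i))" by (simp only: distrib_left add_ac)
      also have "\<dots> = Q * (M + N) + P * n" using i by simp
      finally show ?thesis by (simp only: dq)
    qed
    then have "degree (\<Sum>i\<le>n. D i r * D (n - i) s) \<le> (Q * (M + N) + P * n) div Q"
      by (intro degree_sum_le) auto
    then show "Q * degree (D n (r * s)) \<le> Q * (M + N) + P * n"
      using D.d_mult[OF \<open>r \<in> polys A\<close> \<open>s \<in> polys A\<close>, of n] by (simp only: dq)
  qed
  \<comment> \<open>The coefficient of the top weight Q * N + P * v in \<open>D v r\<close>, that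
    is, the leading part of \<open>D v\<close> on the component of degree N of r, with x set to
    1.\<close>
  define L where "L N r v = wcoeff Q (D v r) (Q * N + P * v)" for N r v
  have L_in: "L N r v \<in> A" if "r \<in> polys A" for N r v
    using D.d_in[OF that, of v] by (auto simp: L_def wcoeff_def polys_def)
  have L_mult: "L (M + N) (r * s) n = (\<Sum>i\<le>n. L M r i * L N s (n - i))"
    if "bnd M r" "bnd N s" "r \<in> polys A" "s \<in> polys A" for M N r s n
  proof -
    have "L (M + N) (r * s) n = (\<Sum>i\<le>n. wcoeff Q (D i r * D (n - i) s) (Q * (M + N) + P * n))"
      unfolding L_def using D.d_mult[of r s n] that by (simp add: wcoeff_sum)
    also have "\<dots> = (\<Sum>i\<le>n. L M r i * L N s (n - i))"
    proof (rule sum.cong)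
      fix i assume "i \<in> {..n}"
      then have "Q * (M + N) + P * n = (Q * M + P * i) + (Q * N + P * (n - i))"
        by (metis (no_types) add.assoc add.left_commute atMost_iff distrib_left le_add_diff_inverse)
      then show "wcoeff Q (D i r * D (n - i) s) (Q * (M + N) + P * n) = L M r i * L N s (n - i)"
        using wcoeff_mult[OF Q bndD[OF \<open>bnd M r\<close>, of i] bndD[OF \<open>bnd N s\<close>, of "n - i"]] by (simp add: L_def)
    qed simp
    finally show ?thesis .
  qed
  have L_0: "L N r v = 0" if "bnd M r" "M < N" for M N r v
    unfolding L_def using bndD[OF that(1), of v] that(2) Q
    by (intro wcoeff_eq_0) (auto intro: le_less_trans)
  have L_add: "L N (r + s) v = L N r v + L N s v" if "r \<in> polys A" "s \<in> polys A" for N r s v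
    using D.d_add[OF that] by (simp add: L_def wcoeff_add)
  define d where "d i a = L 0 [:a:] i" for i a
  define \<epsilon> where "\<epsilon> v = L 1 ?x v" for v
  have bc: "bnd 0 [:a:]" if "a \<in> A" for a using bg[OF that] by (simp add: bnd_def)
  have bX: "bnd 1 ?x" using bx by (simp add: bnd_def)
  have fin: "\<exists>N. \<forall>i\<ge>N. L M r i = 0" if r: "r \<in> polys A" for M r
  proof -
    obtain N where "\<forall>i\<ge>N. D i r = 0" using D.d_fin[OF r] by blast
    then show ?thesis by (intro exI[of _ N]) (simp add: L_def wcoeff_def)
  qed
  define Lp where "Lp N r = Abs_poly (L N r)" for N r
  have cLp: "coeff (Lp N r) i = L N r i" if r: "r \<in> polys A" for N r i
  proof -
    have "\<forall>\<^sub>\<infinity> i. L N r i = 0" using fin[OF r, of N] by (simp add: MOST_nat_le)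
    then show ?thesis by (simp add: Lp_def Abs_poly_inverse)
  qed
  have LpA: "Lp N r \<in> polys A" if r: "r \<in> polys A" for N r using cLp[OF r] L_in[OF r] by (simp add: polys_def)
  have Lp_mult: "Lp (M + N) (r * s) = Lp M r * Lp N s"
    if "bnd M r" "bnd N s" "r \<in> polys A" "s \<in> polys A" for M N r s
    using that D.mult_in by (intro poly_eqI) (simp add: cLp L_mult coeff_mult)
  have xn: "[:a:] * ?x ^ n \<in> polys A \<and> bnd n ([:a:] * ?x ^ n) \<and> Lp n ([:a:] * ?x ^ n) = Lp 0 [:a:] * Lp 1 ?x ^ n"
    if a: "a \<in> A" for a n
  proof (induction n)
    case 0
    then show ?case using bc[OF a] cA[OF a] by simp
  next
    case (Suc n)
    have eq: "[:a:] * ?x ^ Suc n = [:a:] * ?x ^ n * ?x" by (simp only: power_Suc mult_ac)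
    show ?case unfolding eq
      using D.mult_in[of "[:a:] * ?x ^ n" ?x] bnd_mult[of n "[:a:] * ?x ^ n" 1 ?x]
        Lp_mult[of n "[:a:] * ?x ^ n" 1 ?x] Suc xA bX
      by (simp only: Suc_eq_plus1 power_add mult.assoc power_one_right simp_thms)
  qed
  have axn: "[:a:] * ?x ^ n = monom a n" if "a \<in> A" for a n
  proof (induction n)
    case 0
    show ?case by (simp add: monom_0)
  next
    case (Suc n)
    have "[:a:] * ?x ^ Suc n = ?x * ([:a:] * ?x ^ n)" by (simp only: power_Suc mult.left_commute)
    also have "\<dots> = monom a (Suc n)" unfolding Suc using A.one_mult[OF that] by (simp add: smult_monom monom_Suc)
    finally show ?case .
  qed
  \<comment> \<open>Monomials of lower degree do not reach the top weight, so only the term of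
    degree m of r contributes.\<close>
  have Lp_main: "Lp m r = Lp 0 [:coeff r m:] * Lp 1 ?x ^ m" if r: "r \<in> polys A" "degree r \<le> m" for r m
  proof -
    have cr: "coeff r i \<in> A" for i using r by (simp add: polys_def)
    have mA: "monom (coeff r i) i \<in> polys A" for i using A.monom_in_polys[OF cr] .
    have "r = (\<Sum>i\<le>m. monom (coeff r i) i)" using r(2) poly_as_sum_of_monoms'[of r m] by simp
    have sum: "L m (\<Sum>i\<in>I. monom (coeff r i) i) v = (\<Sum>i\<in>I. L m (monom (coeff r i) i) v)" if "finite I" for I v
      using that
    proof (induction I rule: finite_induct)
      case empty
      show ?case using D.d_zero by (simp add: L_def wcoeff_def)
    next
      case (insert i I)
      have "(\<Sum>i\<in>I. monom (coeff r i) i) \<in> polys A" by (intro D.sum_in mA)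
      then show ?case using insert L_add[OF mA] by simp
    qed
    have "L m r v = L m (monom (coeff r m) m) v" for v
    proof -
      have "L m r v = (\<Sum>i\<le>m. L m (monom (coeff r i) i) v)"
        using sum[of "{..m}" v] \<open>r = _\<close> by simp
      also have "\<dots> = (\<Sum>i\<in>{m}. L m (monom (coeff r i) i) v)"
        using xn[OF cr] axn[OF cr] by (intro sum.mono_neutral_right) (auto intro!: L_0 simp: le_less)
      finally show ?thesis by simp
    qed
    then have "L m r = L m (monom (coeff r m) m)" by (rule ext)
    then have "Lp m r = Lp m (monom (coeff r m) m)" by (simp only: Lp_def)
    then show ?thesis using xn[OF cr, of m m] axn[OF cr, of m m] by simp
  qed
  \<comment> \<open>The top component of \<open>D i r\<close> is \<open>L N r i\<close> times x to
    the power N + P * i div Q. The iterative law for L therefore carries a power of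
    \<open>Lp 1 ?x\<close>, which disappears once x is known to be invariant
    (\<open>Lpx\<close>).\<close>
  have L_iter: "coeff (Lp 0 [:L N r i:] * Lp 1 ?x ^ (N + P * i div Q)) j = of_nat ((i + j) choose i) * L N r (i + j)"
    if r: "r \<in> polys A" "bnd N r" and dv: "Q dvd P * i" for N r i j
  proof -
    obtain m where m: "P * i = Q * m" using dv by (auto simp: dvd_def)
    have deg: "degree (D i r) \<le> N + m"
    proof -
      have "Q * degree (D i r) \<le> Q * (N + m)" using bndD[OF r(2), of i] m by (simp add: distrib_left)
      then show ?thesis using Q by simp
    qed
    have c: "coeff (D i r) (N + m) = L N r i" using m Q by (simp add: L_def wcoeff_def flip: distrib_left)
    have "coeff (Lp 0 [:L N r i:] * Lp 1 ?x ^ (N + P * i div Q)) j = L (N + m) (D i r) j"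
      using Lp_main[OF D.d_in[OF r(1)] deg] c m Q by (simp flip: cLp[OF D.d_in[OF r(1)]])
    also have "\<dots> = wcoeff Q (D j (D i r)) (Q * N + P * (i + j))"
      using m by (simp add: L_def distrib_left add.assoc)
    also have "\<dots> = of_nat ((i + j) choose i) * L N r (i + j)"
      unfolding D.d_iter[OF r(1)] L_def wcoeff_def by (simp add: of_nat_poly)
    finally show ?thesis .
  qed
  have Lnd: "L N r i = 0" if "\<not> Q dvd P * i" for N r i
    using that dvd_add_right_iff[of Q "Q * N" "P * i"] by (simp add: L_def wcoeff_def)
  have d0: "d 0 a = a" if "a \<in> A" for a using D.d_0[OF cA[OF that]] by (simp add: d_def L_def wcoeff_def)
  have \<epsilon>0: "\<epsilon> 0 = e" using D.d_0[OF xA] Q by (simp add: \<epsilon>_def L_def wcoeff_def)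
  have Lpx: "Lp 1 ?x = [:e:]"
  proof -
    have nz: "Lp 1 ?x \<noteq> 0" using cLp[OF xA, of 1 0] \<epsilon>0 A.one_nz by (auto simp: \<epsilon>_def)
    have "degree (Lp 1 ?x) = 0"
    proof (rule ccontr)
      assume v: "degree (Lp 1 ?x) \<noteq> 0"
      \<comment> \<open>Apply \<open>L_iter\<close> to x with i = v, the top index. The right hand
        sides vanish for j > 0, so the product on the left is constant; but its degree is at least M
        * v, and M is positive.\<close>
      define v where "v = degree (Lp 1 ?x)"
      have "coeff (Lp 1 ?x) v \<noteq> 0" using nz unfolding v_def by (simp only: leading_coeff_0_iff not_False_eq_True)
      then have lv: "L 1 ?x v \<noteq> 0" unfolding cLp[OF xA] .
      have Lx0: "L 1 ?x i = 0" if "i > v" for i using that cLp[OF xA, of 1 i] by (simp add: v_def coeff_eq_0)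
      have dv: "Q dvd P * v" using Lnd lv by blast
      define M where "M = 1 + P * v div Q"
      let ?p = "Lp 0 [:L 1 ?x v:] * Lp 1 ?x ^ M"
      have "coeff ?p j = 0" if "j > 0" for j
        using L_iter[OF xA bX dv, of j] Lx0[of "v + j"] that by (simp add: M_def)
      then have "degree ?p = 0" by (intro le_antisym degree_le) auto
      moreover have "Lp 0 [:L 1 ?x v:] \<noteq> 0" "Lp 0 [:L 1 ?x v:] \<in> polys A"
        using cLp[OF cA[OF L_in[OF xA]], of 0 1 v 0] d0[OF L_in[OF xA], of 1 v] lv LpA[OF cA[OF L_in[OF xA]]]
        by (auto simp: d_def)
      moreover have "Lp 1 ?x ^ M \<in> polys A" "Lp 1 ?x ^ M \<noteq> 0" "degree (Lp 1 ?x ^ M) = M * v"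
      proof -
        show 1: "Lp 1 ?x ^ M \<in> polys A" using LpA[OF xA] by (intro D.power_in) (auto simp: M_def)
        have "smult e (Lp 1 ?x ^ M) = Lp 1 ?x ^ M" using D.one_mult[OF 1] by simp
        then show "Lp 1 ?x ^ M \<noteq> 0" "degree (Lp 1 ?x ^ M) = M * v"
          using A.degree_power_polys[OF LpA[OF xA] nz A.one_in A.one_nz, of M] by (auto simp: v_def)
      qed
      ultimately have "M * v = 0" using A.degree_mult_polys(1)[of "Lp 0 [:L 1 ?x v:]" "Lp 1 ?x ^ M"] by simp
      then show False using v by (simp add: M_def v_def)
    qed
    then obtain c where "Lp 1 ?x = [:c:]" by (auto elim: degree_eq_zeroE)
    then show ?thesis using cLp[OF xA, of 1 0] \<epsilon>0 by (simp add: \<epsilon>_def)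
  qed
  have e_pow: "p * [:e:] ^ n = p" if "p \<in> polys A" for p n
    by (induction n) (simp, simp only: power_Suc mult.assoc[symmetric] D.mult_one[OF that])
  have iter: "d j (d i a) = of_nat ((i + j) choose i) * d (i + j) a" if a: "a \<in> A" for a i j
  proof (cases "Q dvd P * i")
    case True
    have "d j (d i a) = coeff (Lp 0 [:L 0 [:a:] i:]) j"
      unfolding d_def using cLp[OF cA[OF L_in[OF cA[OF a]]]] by simp
    then show ?thesis
      using L_iter[OF cA[OF a] bc[OF a] True, of j] e_pow[OF LpA[OF cA[OF L_in[OF cA[OF a]]]]] Lpx
      by (simp add: d_def)
  next
    case False
    have di: "d i a = 0" using Lnd[OF False] by (simp add: d_def)
    have dj0: "d j 0 = 0" using D.d_zero by (simp add: d_def L_def wcoeff_def)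
    have "of_nat ((i + j) choose i) * d (i + j) a = wcoeff Q (D j (D i [:a:])) (P * (i + j))"
      unfolding D.d_iter[OF cA[OF a]] d_def L_def wcoeff_def by (simp add: of_nat_poly)
    \<comment> \<open>As P * i is not a multiple of Q, the degree of \<open>D i [:a:]\<close> is
      strictly less than P * i / Q, and applying \<open>D j\<close> cannot bring it back to the top
      weight.\<close>
    also have "\<dots> = 0"
    proof -
      let ?m = "P * i div Q"
      have m: "Q * ?m < P * i" using False Q by (metis dvd_triv_left le_neq_implies_less times_div_less_eq_dividend)
      have "degree (D i [:a:]) \<le> ?m" using bg[OF a, of i] Q by (simp add: less_eq_div_iff_mult_less_eq mult.commute)
      have bndm: "bnd ?m (D i [:a:])"
      proof -
        have "D i [:a:] = (\<Sum>k\<le>?m. monom (coeff (D i [:a:]) k) k)"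
          using poly_as_sum_of_monoms'[OF \<open>degree (D i [:a:]) \<le> ?m\<close>] by simp
        have ck: "coeff (D i [:a:]) k \<in> A" for k using D.d_in[OF cA[OF a]] by (simp add: polys_def)
        have *: "bnd ?m (\<Sum>k\<in>I. monom (coeff (D i [:a:]) k) k) \<and> (\<Sum>k\<in>I. monom (coeff (D i [:a:]) k) k) \<in> polys A"
          if "finite I" "I \<subseteq> {..?m}" for I
          using that
        proof (induction I rule: finite_induct)
          case empty
          show ?case using D.d_zero by (simp add: bnd_def)
        next
          case (insert k I)
          let ?s = "\<Sum>k\<in>I. monom (coeff (D i [:a:]) k) k" and ?t = "monom (coeff (D i [:a:]) k) k"
          have s: "bnd ?m ?s" "?s \<in> polys A" using insert by auto
          have t: "bnd k ?t" "?t \<in> polys A" using xn[OF ck, of k k] axn[OF ck, of k k] by auto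
          have "k \<le> ?m" using insert by auto
          have "Q * degree (D v (?t + ?s)) \<le> Q * ?m + P * v" for v
          proof -
            have "degree (D v ?t + D v ?s) \<le> max (degree (D v ?t)) (degree (D v ?s))" by (rule degree_add_le_max)
            then have "Q * degree (D v ?t + D v ?s) \<le> max (Q * degree (D v ?t)) (Q * degree (D v ?s))"
              using Q by (auto simp: max_def split: if_splits)
            also have "\<dots> \<le> Q * ?m + P * v"
              using bndD[OF s(1), of v] bndD[OF t(1), of v] mult_le_mono2[OF \<open>k \<le> ?m\<close>, of Q]
              unfolding max.bounded_iff by linarith
            finally show ?thesis using D.d_add[OF t(2) s(2)] by simp
          qed
          then show ?case using insert D.add_in[OF t(2) s(2)] by (simp add: bnd_def)
        qed
        from *[of "{..?m}"] show ?thesis using \<open>D i [:a:] = _\<close> by simp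
      qed
      show ?thesis using bndD[OF bndm, of j] m
        by (intro wcoeff_eq_0[OF Q]) (simp add: distrib_left)
    qed
    finally show ?thesis using di dj0 by simp
  qed
  have dexp: "exp_family e A d"
  proof (intro exp_family.intro A exp_family_axioms.intro)
    show "d i a \<in> A" if "a \<in> A" for i a using L_in[OF cA[OF that]] by (simp add: d_def)
    show "d 0 a = a" if "a \<in> A" for a using d0[OF that] .
    show "d i (a + b) = d i a + d i b" if "a \<in> A" "b \<in> A" for i a b
      using L_add[OF cA cA, OF that] by (simp add: d_def)
    show "d n (a * b) = (\<Sum>i\<le>n. d i a * d (n - i) b)" if "a \<in> A" "b \<in> A" for n a b
      using L_mult[OF bc bc cA cA, OF that that] by (simp add: d_def mult.commute)
    show "\<exists>N. \<forall>i\<ge>N. d i a = 0" if "a \<in> A" for a using fin[OF cA[OF that]] by (simp add: d_def)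
    show "d j (d i a) = of_nat ((i + j) choose i) * d (i + j) a" if "a \<in> A" for a i j using iter[OF that] .
  qed
  interpret d: exp_family e A d by (rule dexp)
  have "\<exists>a\<in>A. a \<notin> d.invs"
  proof -
    \<comment> \<open>The maximal slope is attained by some member of F. It cannot be the one of x,
      because x is invariant under the leading part, so it is the one of a generator, on which d is
      then nontrivial.\<close>
    obtain u i where ui: "(u, i) \<in> F" "Q * u = P * i" using att by auto
    from ui(1) consider g where "g \<in> G" "0 < i" "D i [:g:] \<noteq> 0" "u = degree (D i [:g:])"
      | "0 < i" "D i ?x \<noteq> 0" "u = degree (D i ?x) - 1" "degree (D i ?x) > 0"
      unfolding F_def by auto
    then show ?thesis
    proof cases
      case 1
      then have "d i g \<noteq> 0" using ui(2) Q by (simp add: d_def L_def wcoeff_def flip: ui(2))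
      then show ?thesis using 1 Gfin by (auto simp: d.invs_def)
    next
      case 2
      then have "degree (D i ?x) = Suc u" by simp
      then have "Q * degree (D i ?x) = Q * 1 + P * i" unfolding ui(2)[symmetric] by simp
      then have "Q * 1 + P * i = Q * degree (D i ?x)" by simp
      then have "L 1 ?x i = lead_coeff (D i ?x)" unfolding L_def wcoeff_def using Q by simp
      then have "coeff (Lp 1 ?x) i \<noteq> 0" using 2 cLp[OF xA] by simp
      then have False using Lpx 2 by (simp add: coeff_pCons split: nat.splits)
      then show ?thesis ..
    qed
  qed
  moreover have "a \<in> d.invs" if "a \<in> A" "[:a:] \<in> D.invs" for a
    using that by (auto simp: D.invs_def d.invs_def d_def L_def wcoeff_def)
  ultimately show ?thesis using dexp by blast
qed


section \<open>Extension of scalars to an algebraically closed field\<close>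

text \<open>This describes \<open>B = L \<otimes> A\<close> over \<open>K\<close>: \<open>J\<close> is a basis of \<open>L\<close> over \<open>K\<close>, and \<open>co j b \<in> A\<close> is the
  coefficient of \<open>j\<close> in \<open>b\<close>.\<close>

locale tens =
  fixes e :: "'r::comm_ring_1" and K L J :: "'r set" and co :: "'r \<Rightarrow> 'r \<Rightarrow> 'r" and A B :: "'r set"
  assumes domB: "dom_in e B" and rngA: "rng_in e A" and AB: "A \<subseteq> B"
    and fieldL: "subfield_in e L" and LB: "L \<subseteq> B" and fieldK: "subfield_in e K" and KL: "K \<subseteq> L" and KA: "K \<subseteq> A"
    and closedL: "\<And>p. p \<in> polys L \<Longrightarrow> degree p > 0 \<Longrightarrow> \<exists>\<mu>\<in>L. poly p \<mu> = 0"
    and JL: "J \<subseteq> L" and eJ: "e \<in> J"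
    and co_in: "\<And>b j. b \<in> B \<Longrightarrow> j \<in> J \<Longrightarrow> co j b \<in> A"
    and co_fin: "\<And>b. b \<in> B \<Longrightarrow> finite {j \<in> J. co j b \<noteq> 0}"
    and co_sum: "\<And>b. b \<in> B \<Longrightarrow> b = (\<Sum>j | j \<in> J \<and> co j b \<noteq> 0. j * co j b)"
    and co_add: "\<And>b c j. b \<in> B \<Longrightarrow> c \<in> B \<Longrightarrow> j \<in> J \<Longrightarrow> co j (b + c) = co j b + co j c"
    and co_mult: "\<And>a b j. a \<in> A \<Longrightarrow> b \<in> B \<Longrightarrow> j \<in> J \<Longrightarrow> co j (a * b) = a * co j b"
    and co_L: "\<And>l j. l \<in> L \<Longrightarrow> j \<in> J \<Longrightarrow> co j l \<in> K"
    and co_e: "\<And>j. j \<in> J \<Longrightarrow> co j e = (if j = e then e else 0)"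
begin

sublocale B: dom_in e B by (rule domB)
sublocale A: dom_in e A
  using rngA B.one_nz B.integral AB by (intro dom_in.intro dom_in_axioms.intro) auto
sublocale L: rng_in e L using fieldL by (simp add: subfield_in_def)
sublocale K: rng_in e K using fieldK by (simp add: subfield_in_def)

lemma JB: "j \<in> J \<Longrightarrow> j \<in> B" using JL LB by auto

lemma co_zero: "j \<in> J \<Longrightarrow> co j 0 = 0"
  using co_add[of 0 0 j] by simp

lemma co_sum': "finite I \<Longrightarrow> (\<And>i. i \<in> I \<Longrightarrow> f i \<in> B) \<Longrightarrow> j \<in> J \<Longrightarrow> co j (sum f I) = (\<Sum>i\<in>I. co j (f i))"
  by (induction I rule: finite_induct) (auto simp: co_zero co_add B.sum_in)

lemma co_uminus: "b \<in> B \<Longrightarrow> j \<in> J \<Longrightarrow> co j (- b) = - co j b"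
  using co_add[of b "- b" j] B.uminus_in[of b] co_zero[of j] by (simp add: eq_neg_iff_add_eq_0 add.commute)

lemma co_diff: "b \<in> B \<Longrightarrow> c \<in> B \<Longrightarrow> j \<in> J \<Longrightarrow> co j (b - c) = co j b - co j c"
  using co_add[of b "- c" j] B.uminus_in[of c] co_uminus[of c j] by simp

lemma co_eq_0: "b \<in> B \<Longrightarrow> (\<And>j. j \<in> J \<Longrightarrow> co j b = 0) \<Longrightarrow> b = 0"
  using co_sum[of b] by (simp cong: conj_cong)

lemma co_A: "a \<in> A \<Longrightarrow> j \<in> J \<Longrightarrow> co j a = (if j = e then a else 0)"
  using co_mult[of a e j] B.one_in A.mult_one[of a] co_e[of j] by simp

lemma L_inter_A: "l \<in> L \<Longrightarrow> l \<in> A \<Longrightarrow> l \<in> K"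
  using co_A[of l e] co_L[of l e] eJ by simp

text \<open>An equation of a over K splits over L into linear factors, so a equals an element of L
  because B is a domain; and L meets A in K only. Thus K is algebraically closed in A.\<close>

lemma algebraic_const:
  assumes "a \<in> A" "alg_in K a"
  shows "a \<in> K"
proof -
  have root: "\<exists>\<mu>\<in>L. a - \<mu> = 0" if "p \<in> polys L" "p \<noteq> 0" "poly p a = 0" for p
    using that
  proof (induction "degree p" arbitrary: p rule: less_induct)
    case less
    show ?case
    proof (cases "degree p = 0")
      case True
      then show ?thesis using less.prems by (auto elim!: degree_eq_zeroE)
    next
      case False
      then obtain \<mu> where \<mu>: "\<mu> \<in> L" "poly p \<mu> = 0" using closedL less.prems by blast
      interpret P: rng_in "[:e:]" "polys L" by (rule L.polys_rng_in)
      let ?q = "synthetic_div p \<mu>"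
      have eq: "p = [:- \<mu>, 1:] * ?q" using synthetic_div_correct'[of \<mu> p] \<mu> by simp
      have q: "?q \<in> polys L" using less.prems(1)
        by (induction p rule: L.polys_induct) (use \<mu> L.poly_in L.pCons_in_polys in \<open>auto simp: synthetic_div_pCons\<close>)
      have "degree ?q < degree p" using False by (simp add: degree_synthetic_div)
      have "(a - \<mu>) * poly ?q a = 0" using less.prems(3) by (subst (asm) eq) (simp add: algebra_simps)
      moreover have "poly ?q a \<in> B" using q polys_mono[OF LB] AB assms(1) B.poly_in by blast
      moreover have "a - \<mu> \<in> B" using AB LB assms(1) \<mu> B.diff_in by blast
      ultimately consider "a - \<mu> = 0" | "poly ?q a = 0" using B.integral by blast
      then show ?thesis
      proof cases
        case 1
        then show ?thesis using \<mu> by blast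
      next
        case 2
        have "?q \<noteq> 0" using eq less.prems(2) by auto
        then show ?thesis using less.hyps[OF \<open>degree ?q < degree p\<close> q _ 2] by blast
      qed
    qed
  qed
  obtain p where "p \<in> polys K" "p \<noteq> 0" "poly p a = 0" using assms(2) by (auto simp: alg_in_def)
  then obtain \<mu> where "\<mu> \<in> L" "a - \<mu> = 0" using root polys_mono[OF KL] by blast
  then show ?thesis using L_inter_A assms(1) by simp
qed

text \<open>A polynomial over L splits into linear factors, and the prime q divides the value of one
  of them at t.\<close>

lemma prime_root:
  assumes q: "prime_in e B q" and g: "g \<in> polys L" "g \<noteq> 0" and t: "t \<in> B" "dvd_in B q (poly g t)"
  shows "\<exists>\<mu>\<in>L. dvd_in B q (t - \<mu>)"
  using g t(2)
proof (induction "degree g" arbitrary: g rule: less_induct)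
  case less
  show ?case
  proof (cases "degree g = 0")
    case True
    then obtain c where c: "g = [:c:]" by (auto elim: degree_eq_zeroE)
    then have "c \<in> L" "c \<noteq> 0" using less.prems by auto
    then obtain v where "v \<in> L" "c * v = e" using fieldL by (auto simp: subfield_in_def)
    then have "unit_in e B c" using \<open>c \<in> L\<close> LB unfolding unit_in_def by blast
    then show ?thesis using B.prime_not_dvd_unit[OF q] less.prems(3) c by simp
  next
    case False
    interpret P: rng_in "[:e:]" "polys L" by (rule L.polys_rng_in)
    from False obtain \<mu> where \<mu>: "\<mu> \<in> L" "poly g \<mu> = 0" using closedL less.prems by blast
    let ?q = "synthetic_div g \<mu>"
    have eq: "g = [:- \<mu>, 1:] * ?q" using synthetic_div_correct'[of \<mu> g] \<mu> by simp
    have gq: "?q \<in> polys L" using less.prems(1)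
      by (induction g rule: L.polys_induct) (use \<mu> L.poly_in L.pCons_in_polys in \<open>auto simp: synthetic_div_pCons\<close>)
    have deg: "degree ?q < degree g" using False by (simp add: degree_synthetic_div)
    have "poly g t = (t - \<mu>) * poly ?q t" by (subst eq) (simp add: algebra_simps)
    then have "dvd_in B q ((t - \<mu>) * poly ?q t)" using less.prems(3) by simp
    moreover have "poly ?q t \<in> B" using gq polys_mono[OF LB] t(1) B.poly_in by blast
    moreover have "t - \<mu> \<in> B" using LB t(1) \<mu> B.diff_in by blast
    ultimately consider "dvd_in B q (t - \<mu>)" | "dvd_in B q (poly ?q t)" using q unfolding prime_in_def by blast
    then show ?thesis
    proof cases
      case 1
      then show ?thesis using \<mu> by blast
    next
      case 2
      have "?q \<noteq> 0" using eq less.prems(2) by auto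
      then show ?thesis using less.hyps[OF deg gq _ 2] by blast
    qed
  qed
qed

text \<open>The copy of \<open>L \<otimes> S\<close> inside B, for a subring S of A that contains
  K.\<close>

definition ext :: "'r set \<Rightarrow> 'r set"
  where "ext S = {b \<in> B. \<forall>j\<in>J. co j b \<in> S}"

text \<open>The structure constants \<open>co i (j * j')\<close> of the basis lie in K, hence in
  S.\<close>

lemma co_prod_in:
  assumes S: "rng_in e S" "K \<subseteq> S" "S \<subseteq> A" and b: "b \<in> ext S" "c \<in> ext S" and i: "i \<in> J"
  shows "co i (b * c) \<in> S"
proof -
  interpret S: rng_in e S by fact
  let ?I = "{j \<in> J. co j b \<noteq> 0}" and ?I' = "{j \<in> J. co j c \<noteq> 0}"
  have bB: "b \<in> B" "c \<in> B" using b by (auto simp: ext_def)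
  have bS: "co j b \<in> S" "co j c \<in> S" if "j \<in> J" for j using b that by (auto simp: ext_def)
  have "b * c = (\<Sum>j\<in>?I. j * co j b) * (\<Sum>j\<in>?I'. j * co j c)"
    using co_sum[OF bB(1)] co_sum[OF bB(2)] by simp
  also have "\<dots> = (\<Sum>j\<in>?I. \<Sum>j'\<in>?I'. (co j b * co j' c) * (j * j'))"
    by (simp add: sum_product mult_ac)
  finally have eq: "b * c = (\<Sum>j\<in>?I. \<Sum>j'\<in>?I'. (co j b * co j' c) * (j * j'))" .
  have mem: "(co j b * co j' c) * (j * j') \<in> B" if "j \<in> J" "j' \<in> J" for j j'
    using that bS S(3) AB JB B.mult_in by (meson subsetD)
  have "co i (b * c) = (\<Sum>j\<in>?I. \<Sum>j'\<in>?I'. co i ((co j b * co j' c) * (j * j')))"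
  proof -
    have "co i (\<Sum>j\<in>?I. \<Sum>j'\<in>?I'. (co j b * co j' c) * (j * j'))
      = (\<Sum>j\<in>?I. co i (\<Sum>j'\<in>?I'. (co j b * co j' c) * (j * j')))"
      using mem i co_fin[OF bB(1)] by (intro co_sum' B.sum_in) auto
    also have "\<dots> = (\<Sum>j\<in>?I. \<Sum>j'\<in>?I'. co i ((co j b * co j' c) * (j * j')))"
      using mem i co_fin[OF bB(2)] by (intro sum.cong refl co_sum') auto
    finally show ?thesis unfolding eq .
  qed
  also have "\<dots> = (\<Sum>j\<in>?I. \<Sum>j'\<in>?I'. (co j b * co j' c) * co i (j * j'))"
    using bS S(3) S.mult_in i JB B.mult_in by (intro sum.cong refl co_mult) auto
  also have "\<dots> \<in> S"
  proof (intro S.sum_in S.mult_in)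
    fix j j' assume "j \<in> ?I" "j' \<in> ?I'"
    then show "co j b \<in> S" "co j' c \<in> S" "co i (j * j') \<in> S"
      using bS co_L[OF L.mult_in i, of j j'] JL S(2) by auto
  qed
  finally show ?thesis .
qed

lemma ext_tens:
  assumes S: "rng_in e S" "K \<subseteq> S" "S \<subseteq> A"
  shows "tens e K L J co S (ext S)"
proof
  interpret S: rng_in e S by fact
  have sub: "ext S \<subseteq> B" by (auto simp: ext_def)
  have LE: "L \<subseteq> ext S" using LB co_L S(2) by (auto simp: ext_def)
  show "e \<in> ext S" using LE L.one_in by blast
  show "e * a = a" if "a \<in> ext S" for a using that sub B.one_mult by blast
  show "a - b \<in> ext S" if "a \<in> ext S" "b \<in> ext S" for a b
    using that by (auto simp: ext_def co_diff S.diff_in B.diff_in)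
  show "a * b \<in> ext S" if "a \<in> ext S" "b \<in> ext S" for a b
    using that co_prod_in[OF S that] sub B.mult_in by (auto simp: ext_def)
  show "e \<noteq> 0" by (rule B.one_nz)
  show "a = 0 \<or> b = 0" if "a \<in> ext S" "b \<in> ext S" "a * b = 0" for a b
    using that sub B.integral by blast
  show "e \<in> S" "\<And>a. a \<in> S \<Longrightarrow> e * a = a" "\<And>a b. a \<in> S \<Longrightarrow> b \<in> S \<Longrightarrow> a - b \<in> S"
    "\<And>a b. a \<in> S \<Longrightarrow> b \<in> S \<Longrightarrow> a * b \<in> S"
    by (auto simp: S.one_in S.one_mult S.diff_in S.mult_in)
  show "S \<subseteq> ext S" using S AB co_A by (auto simp: ext_def)
  show "subfield_in e L" "subfield_in e K" "K \<subseteq> L" "J \<subseteq> L" "e \<in> J" by (rule fieldL fieldK KL JL eJ)+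
  show "L \<subseteq> ext S" "K \<subseteq> S" by (fact LE S(2))+
  show "\<exists>\<mu>\<in>L. poly p \<mu> = 0" if "p \<in> polys L" "degree p > 0" for p using closedL that .
  show "co j b \<in> S" if "b \<in> ext S" "j \<in> J" for b j using that by (auto simp: ext_def)
  show "finite {j \<in> J. co j b \<noteq> 0}" if "b \<in> ext S" for b using that co_fin sub by blast
  show "b = (\<Sum>j | j \<in> J \<and> co j b \<noteq> 0. j * co j b)" if "b \<in> ext S" for b using that co_sum sub by blast
  show "co j (b + c) = co j b + co j c" if "b \<in> ext S" "c \<in> ext S" "j \<in> J" for b c j using that co_add sub by blast
  show "co j (a * b) = a * co j b" if "a \<in> S" "b \<in> ext S" "j \<in> J" for a b j using that co_mult sub S(3) by blast
  show "co j l \<in> K" if "l \<in> L" "j \<in> J" for l j using that co_L by blast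
  show "co j e = (if j = e then e else 0)" if "j \<in> J" for j using that co_e by blast
qed

end

section \<open>Degrees under a higher derivation\<close>

lemma choose_prime_power_not_dvd:
  assumes "Factorial_Ring.prime (p::nat)" "m > 0" "\<not> p dvd m"
  shows "\<not> p dvd (p ^ a * m choose p ^ a)"
proof -
  have "multiplicity p (p ^ a * m choose p ^ a) = 0"
    using const_p_fac[OF assms(2,1)] assms(3) by (simp add: not_dvd_imp_multiplicity_0)
  moreover have "(p ^ a * m choose p ^ a) \<noteq> 0" using assms by (simp add: binomial_eq_0_iff)
  ultimately show ?thesis using assms(1)
    by (simp add: multiplicity_eq_zero_iff prime_nat_iff)
qed

context exp_family
begin

lemma coeff_zero_iff: "a \<in> A \<Longrightarrow> of_nat m * a = 0 \<longleftrightarrow> of_nat m * e = 0 \<or> a = 0"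
proof -
  assume a: "a \<in> A"
  have "of_nat m * a = (of_nat m * e) * a" using one_mult[OF a] by (simp add: mult.assoc)
  then show ?thesis using integral[OF of_nat_mult_in[OF one_in] a, of m] by auto
qed

text \<open>By \<open>d_iter\<close> the coefficients of \<open>gen (d i a)\<close> are those of
  \<open>gen a\<close>, shifted by i and multiplied by binomials. The top one survives because its
  binomial is nonzero in A.\<close>

lemma degree_gen_d:
  assumes a: "a \<in> A" and i: "i \<le> degree (gen a)" and nz: "of_nat (degree (gen a) choose i) * e \<noteq> 0" and "a \<noteq> 0"
  shows "degree (gen (d i a)) = degree (gen a) - i"
proof -
  let ?N = "degree (gen a)"
  have c: "coeff (gen (d i a)) j = of_nat ((i + j) choose i) * d (i + j) a" for j
    using coeff_gen[OF d_in[OF a]] d_iter[OF a] by simp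
  have "d ?N a \<noteq> 0" using assms(4) gen_zero_iff[OF a] by (simp flip: coeff_gen[OF a])
  then have "coeff (gen (d i a)) (?N - i) \<noteq> 0" using c[of "?N - i"] coeff_zero_iff[OF d_in[OF a]] nz i by simp
  moreover have "coeff (gen (d i a)) j = 0" if "j > ?N - i" for j
    unfolding c using that coeff_eq_0[of "gen a" "i + j"] by (simp add: coeff_gen[OF a])
  ultimately show ?thesis by (intro le_antisym degree_le le_degree) auto
qed

lemma lead_in_invs:
  assumes a: "a \<in> A"
  shows "d (degree (gen a)) a \<in> invs"
proof -
  have "d j (d (degree (gen a)) a) = 0" if "j > 0" for j
    using d_iter[OF a] coeff_eq_0[of "gen a" "degree (gen a) + j"] that by (simp add: coeff_gen[OF a])
  then show ?thesis using d_in[OF a] by (auto simp: invs_def)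
qed

text \<open>If no positive integer vanishes in A, then \<open>d (n - 1) t\<close> has degree 1, so n
  = 1. In characteristic p an element of degree p^g * N' with p not dividing N' yields one of degree
  p^g, because p^g * N' over p^g is a binomial prime to p. Hence n is itself a power of p; it is at
  most every such p^g and so divides it.\<close>

lemma min_degree_dvd:
  assumes t: "t \<in> A" "degree (gen t) = n" "n > 0"
    and min: "\<And>a. a \<in> A \<Longrightarrow> degree (gen a) > 0 \<Longrightarrow> n \<le> degree (gen a)"
    and a: "a \<in> A"
  shows "n dvd degree (gen a)"
proof (cases "\<exists>m>0. of_nat m * e = 0")
  case False
  obtain m where m: "n = Suc m" using t(3) by (cases n) auto
  have "of_nat (n choose m) * e \<noteq> 0" using False zero_less_Suc[of m] unfolding m binomial_Suc_n by blast
  moreover have "t \<noteq> 0" using t gen_zero_iff[OF t(1)] by auto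
  ultimately have "degree (gen (d m t)) = 1" using degree_gen_d[of t m] t m by simp
  then have "n \<le> 1" using min[OF d_in[OF t(1)], of m] by simp
  then have "n = 1" using t(3) by linarith
  then show ?thesis by simp
next
  case True
  \<comment> \<open>The characteristic of A, which is a prime number because A is a domain.\<close>
  define p where "p = (LEAST m. m > 0 \<and> of_nat m * e = 0)"
  have p: "p > 0" "of_nat p * e = 0" and pmin: "\<And>m. m > 0 \<Longrightarrow> of_nat m * e = 0 \<Longrightarrow> p \<le> m"
    using LeastI_ex[OF True] Least_le[of "\<lambda>m. m > 0 \<and> of_nat m * e = 0"] by (auto simp: p_def)
  have p1: "p \<noteq> 1" using p one_nz by auto
  have cz: "of_nat m * e \<noteq> 0" if "\<not> p dvd m" for m
  proof
    assume "of_nat m * e = 0"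
    moreover have "of_nat m * e = of_nat (m mod p) * e + of_nat (m div p) * (of_nat p * e)"
    proof -
      have "of_nat m * e = of_nat (m mod p + m div p * p) * e" by simp
      also have "\<dots> = of_nat (m mod p) * e + of_nat (m div p) * (of_nat p * e)"
        by (simp only: of_nat_add of_nat_mult distrib_right mult.assoc)
      finally show ?thesis .
    qed
    ultimately have "of_nat (m mod p) * e = 0" using p by simp
    then have "m mod p = 0" using pmin[of "m mod p"] p(1) by (metis leD mod_less_divisor neq0_conv)
    then show False using that by auto
  qed
  have "prime_elem p"
  proof (rule prime_elemI)
    show "p \<noteq> 0" "\<not> p dvd 1" using p p1 by auto
    fix m n assume "p dvd m * n"
    show "p dvd m \<or> p dvd n"
    proof (rule ccontr)
      assume "\<not> ?thesis"
      then have "of_nat m * (of_nat n * e) \<noteq> 0" using cz coeff_zero_iff[OF of_nat_mult_in[OF one_in], of m n] by blast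
      moreover obtain k where "m * n = p * k" using \<open>p dvd m * n\<close> by blast
      then have "of_nat m * (of_nat n * e) = of_nat (k * p) * e"
        unfolding mult.assoc[symmetric] of_nat_mult[symmetric] by (simp only: mult.commute)
      then have "of_nat m * (of_nat n * e) = of_nat k * (of_nat p * e)" by (simp add: mult.assoc)
      ultimately show False using p by simp
    qed
  qed
  then have "Factorial_Ring.prime p" by simp
  have pp: "\<exists>g N'. degree (gen b) = p ^ g * N' \<and> n \<le> p ^ g" if b: "b \<in> A" "degree (gen b) > 0" for b
  proof -
    let ?N = "degree (gen b)"
    have "?N \<noteq> 0" "\<not> is_unit p" using b(2) p1 by auto
    then obtain g N' where N: "?N = p ^ g * N'" "\<not> p dvd N'"
      by (rule multiplicity_decompose')
    have "N' \<noteq> 0" using N b(2) by (metis mult_0_right neq0_conv)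
    then have "N' > 0" by simp
    then have ch: "\<not> p dvd (?N choose p ^ g)" using choose_prime_power_not_dvd[OF \<open>Factorial_Ring.prime p\<close> _ N(2), of g] N(1) by simp
    have le: "p ^ g \<le> ?N" using N(1) \<open>N' > 0\<close> by simp
    then have "?N choose (?N - p ^ g) = ?N choose p ^ g" by (rule binomial_symmetric[symmetric])
    then have "of_nat (?N choose (?N - p ^ g)) * e \<noteq> 0" using cz ch by simp
    moreover have "b \<noteq> 0" using b gen_zero_iff[of b] by auto
    ultimately have "degree (gen (d (?N - p ^ g) b)) = p ^ g" using degree_gen_d[OF b(1), of "?N - p ^ g"] le by simp
    then have "n \<le> p ^ g" using min[OF d_in[OF b(1)], of "?N - p ^ g"] \<open>Factorial_Ring.prime p\<close> by (simp add: prime_gt_0_nat)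
    then show ?thesis using N by blast
  qed
  obtain f N' where f: "n = p ^ f * N'" "n \<le> p ^ f" using pp[OF t(1)] t by auto
  then have "N' = 1" using t(3) \<open>Factorial_Ring.prime p\<close> by (cases N') (auto simp: prime_gt_0_nat)
  then have nf: "n = p ^ f" using f by simp
  show ?thesis
  proof (cases "degree (gen a) = 0")
    case False
    then obtain g M where g: "degree (gen a) = p ^ g * M" "n \<le> p ^ g" using pp[OF a] by auto
    then have "f \<le> g" using nf prime_gt_1_nat[OF \<open>Factorial_Ring.prime p\<close>] by (simp add: power_increasing_iff)
    then show ?thesis using g nf by (simp add: le_imp_power_dvd)
  qed simp
qed

end


section \<open>Surfaces with a higher derivation\<close>

text \<open>The coefficients are kept as polynomials \<open>h i\<close> over K instead of their
  values at p, so that a factor p can be read off from their constant terms.\<close>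

lemma algdep2_family:
  assumes "algdep K [f, p]" "e * e = e" "\<And>k. k \<in> K \<Longrightarrow> e * k = k" "0 \<in> K"
  shows "\<exists>h n. (\<forall>i\<le>n. h i \<in> polys K) \<and> (\<exists>i\<le>n. h i \<noteq> 0) \<and> (\<Sum>i\<le>n. poly (h i) p * f ^ i) = 0"
proof -
  consider "alg_in K p" | "alg_in (adj K p) f" using assms(1) by auto
  then show ?thesis
  proof cases
    case 1
    then obtain g where "g \<in> polys K" "g \<noteq> 0" "poly g p = 0" by (auto simp: alg_in_def)
    then show ?thesis by (intro exI[of _ "\<lambda>_. g"] exI[of _ 0]) auto
  next
    case 2
    then obtain H where H: "H \<in> polys (adj K p)" "H \<noteq> 0" "poly H f = 0" by (auto simp: alg_in_def)
    then have "\<forall>i. \<exists>h. h \<in> polys K \<and> coeff H i = poly h p" by (auto simp: polys_def adj_def)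
    then obtain h where h: "\<And>i. h i \<in> polys K" "\<And>i. coeff H i = poly (h i) p" by metis
    have "h (degree H) \<noteq> 0" using H(2) h(2)[of "degree H"] by auto
    moreover have "(\<Sum>i\<le>degree H. poly (h i) p * f ^ i) = 0" using H(3) h(2) by (simp add: poly_altdef)
    ultimately show ?thesis using h(1) by blast
  qed
qed

text \<open>In a ring \<open>C\<close> of transcendence degree at most one, every residue ring \<open>C/p\<close> is algebraic.\<close>

lemma algebraic_mod:
  assumes C: "dom_in e C" and K: "subfield_in e K" "K \<subseteq> C" and fp: "f \<in> C" "p \<in> C" "p \<noteq> 0"
    and dep: "algdep K [f, p]"
  shows "\<exists>g\<in>polys K. g \<noteq> 0 \<and> dvd_in C p (poly g f)"
proof -
  interpret C: dom_in e C by fact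
  interpret K: rng_in e K using K by (simp add: subfield_in_def)
  \<comment> \<open>Relations between f and p, compared by the sum of the degrees of the
    \<open>h i\<close>. In a minimal one some \<open>h i\<close> has a nonzero constant term, since
    otherwise p could be cancelled from the relation.\<close>
  define R where "R = (\<lambda>(h :: nat \<Rightarrow> 'a poly, n). (\<forall>i\<le>n. h i \<in> polys K) \<and> (\<exists>i\<le>n. h i \<noteq> 0) \<and>
    (\<Sum>i\<le>n. poly (h i) p * f ^ i) = 0)"
  have "\<exists>x. R x"
    using algdep2_family[OF dep K.one_mult[OF K.one_in] K.one_mult] by (auto simp: R_def)
  then obtain x where x: "R x" "\<And>y. R y \<Longrightarrow> (\<Sum>i\<le>snd x. degree (fst x i)) \<le> (\<Sum>i\<le>snd y. degree (fst y i))"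
    using ex_has_least_nat[of R _ "\<lambda>x. \<Sum>i\<le>snd x. degree (fst x i)"] by blast
  obtain h n where hn: "x = (h, n)" by fastforce
  have h: "\<And>i. i \<le> n \<Longrightarrow> h i \<in> polys K" "\<exists>i\<le>n. h i \<noteq> 0" "(\<Sum>i\<le>n. poly (h i) p * f ^ i) = 0"
    using x(1) hn by (auto simp: R_def)
  have hmin: "(\<Sum>i\<le>n. degree (h i)) \<le> (\<Sum>i\<le>n. degree (h' i))" if "R (h', n)" for h'
    using x(2)[OF that] hn by simp
  have "\<forall>i. \<exists>g. i \<le> n \<longrightarrow> g \<in> polys K \<and> h i = pCons (coeff (h i) 0) g"
  proof
    fix i
    show "\<exists>g. i \<le> n \<longrightarrow> g \<in> polys K \<and> h i = pCons (coeff (h i) 0) g"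
    proof (cases "h i")
      case (pCons c g)
      have "g \<in> polys K" if "i \<le> n" using h(1)[OF that] pCons by (auto simp: polys_def dest: spec[of _ "Suc j" for j])
      then show ?thesis using pCons by auto
    qed
  qed
  then obtain g where g: "\<And>i. i \<le> n \<Longrightarrow> g i \<in> polys K" "\<And>i. i \<le> n \<Longrightarrow> h i = pCons (coeff (h i) 0) (g i)" by metis
  have gC: "poly (g i) p * f ^ i \<in> C" if "i \<le> n" for i
    using g(1)[OF that] polys_mono[OF K(2)] fp C.poly_in C.mult_power_in by blast
  define s where "s = (\<Sum>i\<le>n. poly (g i) p * f ^ i)"
  have sC: "s \<in> C" unfolding s_def using gC by (intro C.sum_in) auto
  have split: "poly (h i) p * f ^ i = coeff (h i) 0 * f ^ i + p * (poly (g i) p * f ^ i)" if "i \<le> n" for i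
    by (subst g(2)[OF that]) (simp add: algebra_simps)
  have sum: "(\<Sum>i\<le>n. coeff (h i) 0 * f ^ i) = - (p * s)"
  proof -
    have "(\<Sum>i\<le>n. coeff (h i) 0 * f ^ i) + p * s = (\<Sum>i\<le>n. poly (h i) p * f ^ i)"
      unfolding s_def sum_distrib_left sum.distrib[symmetric] using split by (intro sum.cong) auto
    then show ?thesis using h(3) by (simp add: eq_neg_iff_add_eq_0)
  qed
  \<comment> \<open>The relation modulo p: of each \<open>h i\<close> only the constant term
    remains.\<close>
  define G where "G = (\<Sum>i\<le>n. monom (coeff (h i) 0) i)"
  have cG: "coeff G i = (if i \<le> n then coeff (h i) 0 else 0)" for i by (simp add: G_def coeff_sum)
  have GK: "G \<in> polys K" using h(1) K.zero_in by (auto simp: polys_def cG)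
  have "poly G f = - (p * s)" using sum by (simp add: G_def poly_sum poly_monom)
  then have "poly G f = p * (- s)" by simp
  then have dvd: "dvd_in C p (poly G f)" using C.uminus_in[OF sC] unfolding dvd_in_def by blast
  moreover have "G \<noteq> 0"
  proof
    assume "G = 0"
    then have z: "coeff (h i) 0 = 0" if "i \<le> n" for i using cG[of i] that by simp
    then have "p * s = 0" using sum by simp
    then have "s = 0" using C.integral[OF fp(2) sC] fp(3) by blast
    obtain i0 where i0: "i0 \<le> n" "h i0 \<noteq> 0" using h(2) by blast
    have hg: "h i = pCons 0 (g i)" if "i \<le> n" for i using g(2)[OF that] z[OF that] by simp
    have g0: "g i0 \<noteq> 0" using hg[OF i0(1)] i0(2) by auto
    then have "R (g, n)" using g(1) i0 \<open>s = 0\<close> by (auto simp: R_def s_def)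
    then have "(\<Sum>i\<le>n. degree (h i)) \<le> (\<Sum>i\<le>n. degree (g i))" by (rule hmin)
    moreover have "(\<Sum>i\<le>n. degree (g i)) < (\<Sum>i\<le>n. degree (h i))"
    proof (rule sum_strict_mono_ex1)
      show "\<forall>i\<in>{..n}. degree (g i) \<le> degree (h i)" using hg by auto
      show "\<exists>i\<in>{..n}. degree (g i) < degree (h i)" using hg[OF i0(1)] g0 i0(1) by (intro bexI[of _ i0]) auto
    qed simp
    ultimately show False by simp
  qed
  ultimately show ?thesis using GK by blast
qed

text \<open>Let g be of least degree with p dividing g(f). Its constant term is nonzero, since p is
  prime and does not divide f. Being a unit of K, this constant term turns the divisibility into an
  expression of e by f and p.\<close>

lemma prime_comaximal:
  assumes C: "dom_in e C" and K: "subfield_in e K" "K \<subseteq> C" and p: "prime_in e C p" and f: "f \<in> C" "\<not> dvd_in C p f"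
    and dep: "algdep K [f, p]"
  shows "\<exists>u\<in>C. \<exists>v\<in>C. u * f + v * p = e"
proof -
  interpret C: dom_in e C by fact
  interpret K: rng_in e K using K by (simp add: subfield_in_def)
  have pC: "p \<in> C" "p \<noteq> 0" using p by (auto simp: prime_in_def)
  let ?R = "\<lambda>g. g \<in> polys K \<and> g \<noteq> 0 \<and> dvd_in C p (poly g f)"
  obtain g0 where "?R g0" using algebraic_mod[OF C K f(1) pC dep] by blast
  then obtain g where g: "?R g" "\<And>g'. ?R g' \<Longrightarrow> degree g \<le> degree g'" using ex_has_least_nat[of ?R g0 degree] by blast
  obtain c g' where cg: "g = pCons c g'" by (cases g)
  have cK: "c \<in> K" using g(1) cg polys_coeff[of g K 0] by simp
  have g'K: "g' \<in> polys K" using g(1) cg by (auto simp: polys_def dest: spec[of _ "Suc j" for j])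
  have g'C: "poly g' f \<in> C" using g'K polys_mono[OF K(2)] f(1) C.poly_in by blast
  have "c \<noteq> 0"
  proof
    assume "c = 0"
    then have "dvd_in C p (f * poly g' f)" using g(1) cg by simp
    then have "dvd_in C p (poly g' f)" using p f g'C unfolding prime_in_def by blast
    moreover have "g' \<noteq> 0" using g(1) cg \<open>c = 0\<close> by auto
    ultimately have "degree g \<le> degree g'" using g(2) g'K by blast
    then show False using cg \<open>g' \<noteq> 0\<close> by simp
  qed
  then obtain v where v: "v \<in> K" "c * v = e" using cK K by (auto simp: subfield_in_def)
  obtain w where w: "w \<in> C" "c + f * poly g' f = p * w" using g(1) cg by (auto simp: dvd_in_def)
  have "e = v * c" using v by (simp add: mult.commute)
  also have "\<dots> = v * (p * w - f * poly g' f)" using w(2) by (simp add: algebra_simps flip: w(2))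
  also have "\<dots> = (- (v * poly g' f)) * f + (v * w) * p" by (simp add: algebra_simps)
  finally have "(- (v * poly g' f)) * f + (v * w) * p = e" by simp
  moreover have "- (v * poly g' f) \<in> C" "v * w \<in> C" using v w g'C K(2) C.mult_in C.uminus_in by auto
  ultimately show ?thesis by blast
qed

text \<open>A surface insofar as \<open>dep3\<close> bounds the transcendence degree of A by two; B
  stands for \<open>L \<otimes> A\<close>.\<close>

locale exp_surface = exp_family e A d + tens e K L J co A B
  for e :: "'r::comm_ring_1" and K L J co A B d +
  assumes factA: "factorial_in e A" and factB: "factorial_in e B"
    and dep3: "\<And>a b c. a \<in> A \<Longrightarrow> b \<in> A \<Longrightarrow> c \<in> A \<Longrightarrow> algdep K [a, b, c]"
    and nontriv: "\<exists>a\<in>A. a \<notin> invs"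
begin

abbreviation "C \<equiv> invs"

lemma CA: "C \<subseteq> A" by (auto simp: invs_def)

lemma KC: "K \<subseteq> C" using field_inv[OF fieldK KA] .

sublocale C: dom_in e C
  using invs_rng_in CA integral one_nz by (intro dom_in.intro dom_in_axioms.intro) auto

lemma factC: "factorial_in e C"
  using factorial_closed_subring(1)[OF factA invs_rng_in CA] invs_closed by blast

text \<open>The element t has least positive degree n, and among those its leading coefficient
  \<open>d n t\<close> has the fewest prime factors. Suppose that p divides \<alpha> * t - r but not
  \<alpha>. Then u * \<alpha> + v * p = e by comaximality, so t = u * r + p * b1 with b1 = u * b + v
  * t. This b1 has degree n too, but its leading coefficient is that of t divided by p.\<close>

lemma exists_generator:
  obtains n t where "t \<in> A" "n > 0" "degree (gen t) = n"
    "\<And>a. a \<in> A \<Longrightarrow> n dvd degree (gen a)"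
    "\<And>p b \<alpha> r. prime_in e C p \<Longrightarrow> b \<in> A \<Longrightarrow> \<alpha> \<in> C \<Longrightarrow> r \<in> C \<Longrightarrow> algdep K [\<alpha>, p] \<Longrightarrow> \<alpha> * t - r = p * b \<Longrightarrow> dvd_in C p \<alpha>"
proof -
  obtain a1 where a1: "a1 \<in> A" "degree (gen a1) > 0" using nontriv invs_iff by blast
  obtain t0 where t0: "t0 \<in> A" "degree (gen t0) > 0" "\<And>a. a \<in> A \<Longrightarrow> degree (gen a) > 0 \<Longrightarrow> degree (gen t0) \<le> degree (gen a)"
    using ex_has_least_nat[of "\<lambda>a. a \<in> A \<and> degree (gen a) > 0" a1 "\<lambda>a. degree (gen a)"] a1 by blast
  define n where "n = degree (gen t0)"
  have n0: "n > 0" using t0 by (simp add: n_def)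
  let ?P = "\<lambda>k. \<exists>t\<in>A. degree (gen t) = n \<and> prime_fact e C k (d n t)"
  have lnz: "d n t \<noteq> 0" "d n t \<in> C" if "t \<in> A" "degree (gen t) = n" for t
  proof -
    have "gen t \<noteq> 0" using that n0 by auto
    then show "d n t \<noteq> 0" using that(2) by (metis coeff_gen[OF that(1)] leading_coeff_0_iff)
    show "d n t \<in> C" using lead_in_invs[OF that(1)] that(2) by simp
  qed
  have "\<exists>k. ?P k" using factC lnz[OF t0(1)] t0(1) unfolding factorial_in_def n_def by blast
  then have "?P (LEAST k. ?P k)" by (rule LeastI_ex)
  then obtain t where t: "t \<in> A" "degree (gen t) = n" "prime_fact e C (LEAST k. ?P k) (d n t)" by blast
  show ?thesis
  proof (rule that[OF t(1) n0 t(2)])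
    show "n dvd degree (gen a)" if "a \<in> A" for a
      using min_degree_dvd[OF t0(1) _ n0 _ that] t0(3) n_def by blast
    fix p b \<alpha> r assume p: "prime_in e C p" "b \<in> A" "\<alpha> \<in> C" "r \<in> C" "algdep K [\<alpha>, p]" "\<alpha> * t - r = p * b"
    show "dvd_in C p \<alpha>"
    proof (rule ccontr)
      assume "\<not> ?thesis"
      then obtain u v where uv: "u \<in> C" "v \<in> C" "u * \<alpha> + v * p = e"
        using prime_comaximal[OF C.dom_in_axioms fieldK KC p(1,3) _ p(5)] by blast
      have pC: "p \<in> C" "p \<noteq> 0" using p(1) by (auto simp: prime_in_def)
      define b1 where "b1 = u * b + v * t"
      have mA: "u \<in> A" "v \<in> A" "p \<in> A" "r \<in> A" "\<alpha> \<in> A" using uv p pC CA by auto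
      have b1: "b1 \<in> A" unfolding b1_def using mA p t by (intro add_in mult_in)
      have "t = (u * \<alpha> + v * p) * t" using uv one_mult t by simp
      also have "\<dots> = u * (\<alpha> * t - r) + u * r + v * p * t" by (simp add: algebra_simps)
      also have "\<dots> = u * r + p * b1" unfolding p(6) b1_def by (simp add: algebra_simps)
      finally have tb: "t = u * r + p * b1" .
      have urC: "u * r \<in> C" using C.mult_in uv p by blast
      have dt: "d i t = p * d i b1" if "i > 0" for i
        using d_add[of "u * r" "p * b1" i] urC CA d_inv_mult[OF pC(1) b1, of i] mult_in[OF mA(3) b1] that tb
        by (auto simp: invs_def)
      have "degree (gen b1) = n"
      proof (rule le_antisym)
        show "degree (gen b1) \<le> n"
        proof (rule degree_le, intro allI impI)
          fix i assume "n < i"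
          then have "p * d i b1 = 0" using dt[of i] coeff_eq_0[of "gen t" i] t by (simp add: coeff_gen)
          then show "coeff (gen b1) i = 0" using integral[OF mA(3) d_in[OF b1]] pC by (simp add: coeff_gen[OF b1])
        qed
        have "d n b1 \<noteq> 0" using dt[OF n0] lnz[OF t(1,2)] by auto
        then show "n \<le> degree (gen b1)" by (intro le_degree) (simp add: coeff_gen[OF b1])
      qed
      moreover obtain m where "(LEAST k. ?P k) = Suc m" "prime_fact e C m (d n b1)"
        using C.prime_fact_div[OF p(1) lnz(2)[OF b1 \<open>degree (gen b1) = n\<close>]] t(3) dt[OF n0] by auto
      ultimately have "(LEAST k. ?P k) \<le> m" using b1 by (intro Least_le) blast
      then show False using \<open>(LEAST k. ?P k) = Suc m\<close> by simp
    qed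
  qed
qed

text \<open>Different powers of t with coefficients in C have different degrees and cannot cancel;
  in particular t is transcendental over C.\<close>

lemma degree_gen_poly:
  assumes t: "t \<in> A" "degree (gen t) > 0"
  shows "F \<in> polys C \<Longrightarrow> F \<noteq> 0 \<Longrightarrow> poly F t \<noteq> 0 \<and> degree (gen (poly F t)) = degree (gen t) * degree F"
proof (induction F rule: C.polys_induct)
  case (pCons a F)
  have FA: "poly F t \<in> A" using pCons(2) polys_mono[OF CA] t(1) poly_in by blast
  have aA: "a \<in> A" "degree (gen a) = 0" using pCons(1) CA invs_iff by auto
  show ?case
  proof (cases "F = 0")
    case True
    then show ?thesis using pCons.prems aA by simp
  next
    case False
    have t0: "t \<noteq> 0" using t(2) gen_zero_iff[OF t(1)] by auto
    have tF: "t * poly F t \<in> A" "degree (gen (t * poly F t)) = degree (gen t) * Suc (degree F)"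
      using mult_in t FA degree_gen_mult[OF t(1) FA t0] pCons.IH[OF False] by auto
    have "degree (gen a + gen (t * poly F t)) = degree (gen (t * poly F t))"
      using tF aA t by (intro degree_add_eq_right) simp
    then have "degree (gen (poly (pCons a F) t)) = degree (gen t) * degree (pCons a F)"
      using False tF aA by (simp add: gen_add)
    moreover have "poly (pCons a F) t \<noteq> 0"
      using calculation t False gen_zero_iff[OF zero_in] by auto
    ultimately show ?thesis by blast
  qed
qed simp

text \<open>Since t is transcendental over C, a dependence among t, f and p is one between f and
  p.\<close>

lemma dep2:
  assumes t: "t \<in> A" "degree (gen t) > 0" and fp: "f \<in> C" "p \<in> C"
  shows "algdep K [f, p]"
proof -
  have "adjl K [f, p] \<subseteq> C"
    using adjl_rng_in[OF C.rng_in_axioms K.rng_in_axioms KC, of "[f, p]"] fp by auto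
  then have "\<not> alg_in (adjl K [f, p]) t"
    using degree_gen_poly[OF t] polys_mono[of "adjl K [f, p]" C] unfolding alg_in_def by blast
  then show ?thesis using dep3[of t f p] t fp CA by auto
qed

text \<open>Induction on the degree: as n divides it, a power of t can be used to cancel the leading
  coefficient of a multiple of a, the leading coefficients being invariant.\<close>

lemma clear_denominator:
  assumes t: "t \<in> A" "degree (gen t) = n" "n > 0" and dv: "\<And>a. a \<in> A \<Longrightarrow> n dvd degree (gen a)"
  shows "a \<in> A \<Longrightarrow> \<exists>c\<in>C. \<exists>F\<in>polys C. c \<noteq> 0 \<and> c * a = poly F t"
proof (induction "degree (gen a)" arbitrary: a rule: less_induct)
  case less
  interpret P: rng_in "[:e:]" "polys C" by (rule C.polys_rng_in)
  show ?case
  proof (cases "degree (gen a) = 0")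
    case True
    then have aC: "a \<in> C" using invs_iff less.prems by blast
    show ?thesis using C.one_in C.one_nz C.one_mult[OF aC] aC by (intro bexI[of _ e] bexI[of _ "[:a:]"]) auto
  next
    case False
    define N where "N = degree (gen a)"
    obtain m where m: "N = n * m" using dv[OF less.prems] N_def by auto
    \<comment> \<open>The multipliers for which c * a and l * t ^ m have the same leading
      coefficient; e covers the case m = 0.\<close>
    define l c where "l = d N a" and "c = e * (d n t) ^ m"
    have lC: "l \<in> C" using lead_in_invs[OF less.prems] by (simp add: l_def N_def)
    have tC: "d n t \<in> C" using lead_in_invs[OF t(1)] t(2) by simp
    have tnz: "d n t \<noteq> 0"
    proof -
      have "gen t \<noteq> 0" using t by auto
      then show ?thesis using t(2) by (metis coeff_gen[OF t(1)] leading_coeff_0_iff)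
    qed
    have c: "c \<in> C" "c \<noteq> 0" unfolding c_def using C.mult_power_in[OF C.one_in tC] C.mult_power_nz[OF C.one_in tC C.one_nz tnz] by auto
    define b where "b = c * a - l * t ^ m"
    have lt: "l * t ^ m \<in> A" using mult_power_in lC CA t(1) by blast
    have ca: "c * a \<in> A" using c CA less.prems mult_in by blast
    have bA: "b \<in> A" unfolding b_def using lt ca diff_in by blast
    have gt: "gen (l * t ^ k) = smult l (gen t ^ k) \<and> l * t ^ k \<in> A" for k
    proof (induction k)
      case 0
      show ?case using invs_const[OF lC] lC CA by auto
    next
      case (Suc k)
      have "l * t ^ Suc k = (l * t ^ k) * t" by (simp add: mult_ac)
      then show ?case using Suc gen_mult[of "l * t ^ k" t] t(1) mult_in[of "l * t ^ k" t] by (simp add: mult_ac)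
    qed
    have cN: "coeff (gen t ^ k) (n * k) = (d n t) ^ k" for k
    proof (induction k)
      case (Suc k)
      have "degree (gen t ^ k) \<le> n * k" using degree_power_le[of "gen t" k] t(2) by simp
      then show ?case using Suc wcoeff_mult[of 1 "gen t" n "gen t ^ k" "n * k"] t(2) coeff_gen[OF t(1), of n]
        by (simp add: wcoeff_def)
    qed simp
    have "gen b = gen (c * a) - gen (l * t ^ m)"
    proof (rule poly_eqI)
      fix i
      have "d i b = d i (c * a) - d i (l * t ^ m)" unfolding b_def by (rule d_diff[OF ca lt])
      then show "coeff (gen b) i = coeff (gen (c * a) - gen (l * t ^ m)) i"
        by (simp add: coeff_gen[OF bA] coeff_gen[OF ca] coeff_gen[OF lt])
    qed
    also have "\<dots> = smult c (gen a) - smult l (gen t ^ m)"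
      using gen_mult[of c a] c CA less.prems invs_const[OF c(1)] gt[of m] by auto
    finally have gb: "gen b = smult c (gen a) - smult l (gen t ^ m)" .
    have "coeff (gen b) N = 0"
    proof -
      have "coeff (gen b) N = c * l - l * (d n t) ^ m"
        unfolding gb using cN[of m] m by (simp add: coeff_gen[OF less.prems] l_def)
      moreover have "c * l = (e * l) * (d n t) ^ m" unfolding c_def by (simp only: mult_ac)
      then have "l * (d n t) ^ m = c * l" by (simp only: C.one_mult[OF lC])
      ultimately show ?thesis by simp
    qed
    moreover have "degree (gen b) \<le> N" unfolding gb
      using degree_power_le[of "gen t" m] t(2) m
      by (intro degree_diff_le order.trans[OF degree_smult_le]) (auto simp: N_def)
    ultimately have "degree (gen b) < N"
      using False by (metis N_def degree_0 leading_coeff_0_iff le_neq_implies_less neq0_conv)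
    then obtain c' F where F: "c' \<in> C" "F \<in> polys C" "c' \<noteq> 0" "c' * b = poly F t"
      using less.hyps[of b] bA N_def by blast
    have "(c' * c) * a = c' * b + (c' * l) * t ^ m" by (simp add: b_def algebra_simps)
    also have "\<dots> = poly (F + monom (c' * l) m) t" by (simp add: F(4) poly_monom)
    finally have "(c' * c) * a = poly (F + monom (c' * l) m) t" .
    moreover have "c' * c \<in> C" "c' * c \<noteq> 0" using C.mult_in C.mult_nz c F by auto
    moreover have "F + monom (c' * l) m \<in> polys C" using F C.mult_in lC C.monom_in_polys P.add_in by blast
    ultimately show ?thesis by blast
  qed
qed

end

section \<open>Division by the primes of the ring of invariants\<close>

locale slice = exp_surface +
  fixes n t
  assumes tA: "t \<in> A" and n0: "n > 0" and dt: "degree (gen t) = n"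
    and dv: "\<And>a. a \<in> A \<Longrightarrow> n dvd degree (gen a)"
    and mint: "\<And>p b \<alpha> r. prime_in e C p \<Longrightarrow> b \<in> A \<Longrightarrow> \<alpha> \<in> C \<Longrightarrow> r \<in> C \<Longrightarrow> algdep K [\<alpha>, p] \<Longrightarrow>
      \<alpha> * t - r = p * b \<Longrightarrow> dvd_in C p \<alpha>"
begin

lemma dep: "f \<in> C \<Longrightarrow> p \<in> C \<Longrightarrow> algdep K [f, p]"
  using dep2[OF tA] dt n0 by simp

lemma transc: "F \<in> polys C \<Longrightarrow> poly F t = 0 \<Longrightarrow> F = 0"
  using degree_gen_poly[OF tA] dt n0 by blast

abbreviation "CL \<equiv> ext C"

lemma E_tens: "tens e K L J co C CL"
  by (rule ext_tens[OF C.rng_in_axioms KC CA])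

lemma CL_B: "CL \<subseteq> B" by (auto simp: ext_def)

lemma tB: "t \<in> B" using tA AB by auto

text \<open>C has transcendence degree at most one, so f satisfies an equation over K modulo c0, and
  hence modulo q; its linear factors over L give the constant.\<close>

lemma mod_const:
  assumes q: "prime_in e B q" "c0 \<in> C" "c0 \<noteq> 0" "dvd_in B q c0" and f: "f \<in> C"
  shows "\<exists>\<mu>\<in>L. dvd_in B q (f - \<mu>)"
proof -
  obtain g where g: "g \<in> polys K" "g \<noteq> 0" "dvd_in C c0 (poly g f)"
    using algebraic_mod[OF C.dom_in_axioms fieldK KC f q(2,3) dep[OF f q(2)]] by blast
  have "dvd_in B c0 (poly g f)" using g(3) CA AB unfolding dvd_in_def by blast
  then have "dvd_in B q (poly g f)" using B.dvd_in_trans[OF q(4)] by blast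
  moreover have "f \<in> B" using f CA AB by blast
  moreover have "g \<in> polys L" using g(1) polys_mono[OF KL] by blast
  ultimately show ?thesis using prime_root[OF q(1) _ g(2)] by blast
qed

lemma denominator_sum:
  assumes "finite I" "I \<subseteq> J" "\<And>j. j \<in> I \<Longrightarrow> f j \<in> A"
  shows "\<exists>c\<in>C. \<exists>F\<in>polys CL. c \<noteq> 0 \<and> c * (\<Sum>j\<in>I. j * f j) = poly F t"
  using assms
proof (induction I rule: finite_induct)
  case empty
  interpret E: tens e K L J co C CL by (rule E_tens)
  show ?case using C.one_in C.one_nz E.B.zero_in by (intro bexI[of _ e] bexI[of _ 0]) (auto simp: polys_def)
next
  case (insert j I)
  interpret E: tens e K L J co C CL by (rule E_tens)
  interpret P: rng_in "[:e:]" "polys CL" by (rule E.B.polys_rng_in)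
  obtain c F where F: "c \<in> C" "F \<in> polys CL" "c \<noteq> 0" "c * (\<Sum>j\<in>I. j * f j) = poly F t" using insert by auto
  obtain c' F' where F': "c' \<in> C" "F' \<in> polys C" "c' \<noteq> 0" "c' * f j = poly F' t"
    using clear_denominator[OF tA dt n0 dv, of "f j"] insert.prems by auto
  have sub: "C \<subseteq> CL" "j \<in> CL" using E.AB E.JB insert.prems by auto
  have "(c * c') * (\<Sum>j\<in>insert j I. j * f j) = c' * (c * (\<Sum>j\<in>I. j * f j)) + (c * j) * (c' * f j)"
    using insert.hyps by (simp add: algebra_simps)
  also have "\<dots> = poly (smult c' F + smult (c * j) F') t" by (simp add: F(4) F'(4))
  finally have "(c * c') * (\<Sum>j\<in>insert j I. j * f j) = poly (smult c' F + smult (c * j) F') t" .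
  moreover have "smult c' F + smult (c * j) F' \<in> polys CL"
    using F F' sub E.B.mult_in polys_mono[OF sub(1)] by (intro P.add_in E.B.smult_in_polys) auto
  moreover have "c * c' \<in> C" "c * c' \<noteq> 0" using C.mult_in C.mult_nz F F' by auto
  ultimately show ?case by blast
qed

lemma denominator_B: "b \<in> B \<Longrightarrow> \<exists>c\<in>C. \<exists>F\<in>polys CL. c \<noteq> 0 \<and> c * b = poly F t"
proof -
  assume b: "b \<in> B"
  have "\<exists>c\<in>C. \<exists>F\<in>polys CL. c \<noteq> 0 \<and> c * (\<Sum>j | j \<in> J \<and> co j b \<noteq> 0. j * co j b) = poly F t"
    using co_fin[OF b] co_in[OF b] by (intro denominator_sum) auto
  then show ?thesis using co_sum[OF b] by simp
qed

lemma co_poly: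
  assumes F: "F \<in> polys CL" and j: "j \<in> J"
  shows "map_poly (co j) F \<in> polys C \<and> co j (poly F t) = poly (map_poly (co j) F) t"
proof -
  interpret E: tens e K L J co C CL by (rule E_tens)
  show ?thesis using F
  proof (induction F rule: E.B.polys_induct)
    case zero
    then show ?case using co_zero[OF j] by (simp add: polys_def)
  next
    case (pCons a F)
    have "poly F t \<in> B" using pCons(2) polys_mono[OF CL_B] tB B.poly_in by blast
    moreover have "a \<in> B" using pCons(1) CL_B by blast
    ultimately have "co j (poly (pCons a F) t) = co j a + t * co j (poly F t)"
      using co_add[of a "t * poly F t" j] co_mult[OF tA] tB B.mult_in j by auto
    moreover have "map_poly (co j) (pCons a F) = pCons (co j a) (map_poly (co j) F)"
      using co_zero[OF j] by (intro poly_eqI) (auto simp: coeff_map_poly coeff_pCons split: nat.split)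
    moreover have "co j a \<in> C" using pCons(1) j by (simp add: ext_def)
    ultimately show ?case using pCons.IH C.pCons_in_polys by simp
  qed
qed

text \<open>As t lies in A, taking coordinates commutes with evaluation at t, which reduces the
  claim to polynomials over C.\<close>

lemma transc_L:
  assumes F: "F \<in> polys CL" "poly F t = 0"
  shows "F = 0"
proof (rule poly_eqI)
  fix i
  have "co j (coeff F i) = 0" if j: "j \<in> J" for j
  proof -
    have "map_poly (co j) F = 0" using transc co_poly[OF F(1) j] F(2) co_zero[OF j] by auto
    then show ?thesis using co_zero[OF j] by (metis coeff_0 coeff_map_poly)
  qed
  moreover have "coeff F i \<in> B" using F(1) CL_B by (auto simp: polys_def)
  ultimately show "coeff F i = coeff 0 i" using co_eq_0 by simp
qed

text \<open>\<open>L \<otimes> C\<close> is factorially closed in B: with denominators cleared, two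
  polynomials in t have a product of degree 0, so both are constant. This puts a multiple c * b into
  \<open>L \<otimes> C\<close>, and C is factorially closed in A, which removes c from the
  coordinates.\<close>

lemma CL_closed:
  assumes b: "b \<in> B" "b' \<in> B" "b * b' \<in> CL" "b * b' \<noteq> 0"
  shows "b \<in> CL"
proof -
  interpret E: tens e K L J co C CL by (rule E_tens)
  interpret P: dom_in "[:e:]" "polys CL" by (rule E.B.polys_dom_in)
  obtain c F where F: "c \<in> C" "F \<in> polys CL" "c \<noteq> 0" "c * b = poly F t" using denominator_B[OF b(1)] by blast
  obtain c' F' where F': "c' \<in> C" "F' \<in> polys CL" "c' \<noteq> 0" "c' * b' = poly F' t" using denominator_B[OF b(2)] by blast
  have cCL: "c * c' * (b * b') \<in> CL" using F(1) F'(1) E.AB b(3) E.B.mult_in by blast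
  have "poly (F * F' - [:c * c' * (b * b'):]) t = 0" by (simp add: F(4)[symmetric] F'(4)[symmetric] algebra_simps)
  then have eq: "F * F' = [:c * c' * (b * b'):]"
    using transc_L[of "F * F' - [:c * c' * (b * b'):]"] cCL F(2) F'(2) P.mult_in P.diff_in by auto
  have cB: "c \<in> B" "c' \<in> B" using F F' CA AB by auto
  have "c * c' * (b * b') \<noteq> 0" using B.mult_nz b cB F(3) F'(3) B.mult_in by meson
  then have "F \<noteq> 0" "F' \<noteq> 0" using eq by auto
  then have "degree F = 0" using E.B.degree_mult_polys(1)[OF F(2) F'(2)] eq by simp
  then obtain a where a: "F = [:a:]" by (auto elim: degree_eq_zeroE)
  then have "c * b \<in> CL" using F(2,4) by simp
  then have "c * co j b \<in> C" if "j \<in> J" for j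
  proof -
    have "c \<in> A" using F(1) CA by blast
    then have "c * co j b = co j (c * b)" using co_mult b(1) that by simp
    then show ?thesis using \<open>c * b \<in> CL\<close> that by (simp add: ext_def)
  qed
  then have "co j b \<in> C" if "j \<in> J" for j
    using invs_closed[of "co j b" c] that F(1,3) CA co_in[OF b(1) that] integral[of "co j b" c] C.zero_in
    by (metis mult.commute subsetD)
  then show ?thesis using b(1) by (simp add: ext_def)
qed

lemma prime_factor_B:
  assumes "c \<in> B" "c \<noteq> 0" "\<not> unit_in e B c"
  shows "\<exists>q\<in>B. \<exists>q'\<in>B. prime_in e B q \<and> c = q * q'"
proof -
  obtain k where k: "prime_fact e B k c" using factB assms by (auto simp: factorial_in_def)
  then have "k \<noteq> 0" using assms(3) B.prime_fact_0 by (cases k) auto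
  then obtain q q' where "prime_in e B q" "c = q * q'" "q' \<in> B" using k by (metis B.prime_fact_SucD not0_implies_Suc)
  then show ?thesis by (auto simp: prime_in_def)
qed

lemma unit_B_A: "a \<in> A \<Longrightarrow> unit_in e B a \<Longrightarrow> unit_in e A a"
proof -
  assume a: "a \<in> A" "unit_in e B a"
  then obtain v where v: "v \<in> B" "a * v = e" by (auto simp: unit_in_def)
  then have "a * co e v = e" using co_mult[OF a(1) v(1) eJ] co_e[OF eJ] by simp
  then show ?thesis using a co_in[OF v(1) eJ] by (auto simp: unit_in_def)
qed

lemma unit_A_C: "a \<in> C \<Longrightarrow> unit_in e A a \<Longrightarrow> unit_in e C a"
  using factorial_closed_subring(3)[OF factA invs_rng_in CA] invs_closed by blast

text \<open>The step for which L and the choice of t are made. Let q be a prime of B dividing p, and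
  p = q * q'. Modulo q the coefficients of F are constants of L, so q divides G(t) for a nonzero G
  over L, and hence t - m for some m in L. Multiplied by q', the coordinates of this relation say
  that p divides (co j q') * t - co j (m * q') in A. By \<open>mint\<close> p divides every
  coordinate of q', hence q' itself, and q is a unit.\<close>

lemma coeff_divisible:
  assumes p: "prime_in e C p" and F: "F \<in> polys C" and a: "a \<in> A" "poly F t = p * a"
  shows "dvd_in C p (coeff F i0)"
proof (rule ccontr)
  assume ndvd: "\<not> ?thesis"
  interpret E: tens e K L J co C CL by (rule E_tens)
  have pC: "p \<in> C" "p \<noteq> 0" "\<not> unit_in e C p" using p by (auto simp: prime_in_def)
  have pB: "p \<in> B" "\<not> unit_in e B p" using pC CA AB unit_B_A unit_A_C by blast+
  obtain q q' where q: "prime_in e B q" "q \<in> B" "q' \<in> B" "p = q * q'" using prime_factor_B pB pC(2) by blast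
  have qp: "dvd_in B q p" using q by (auto simp: dvd_in_def)
  have FC: "coeff F i \<in> C" for i using F by (simp add: polys_def)
  have FB: "coeff F i \<in> B" for i using FC CA AB by blast
  have "\<forall>i. \<exists>\<mu>. \<mu> \<in> L \<and> dvd_in B q (coeff F i - \<mu>)" using mod_const[OF q(1) pC(1,2) qp FC] by blast
  then obtain \<mu> where \<mu>: "\<And>i. \<mu> i \<in> L" "\<And>i. dvd_in B q (coeff F i - \<mu> i)" by metis
  \<comment> \<open>F with its coefficients replaced by the constants of L to which they are
    congruent modulo q.\<close>
  define G where "G = (\<Sum>i\<le>degree F. monom (\<mu> i) i)"
  have cG: "coeff G i = (if i \<le> degree F then \<mu> i else 0)" for i by (simp add: G_def coeff_sum)
  have GL: "G \<in> polys L" using \<mu>(1) L.zero_in by (auto simp: polys_def cG)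
  have "poly F t - poly G t = (\<Sum>i\<le>degree F. coeff F i * t ^ i) - (\<Sum>i\<le>degree F. \<mu> i * t ^ i)"
    unfolding G_def by (simp only: poly_sum poly_monom poly_altdef[of F])
  also have "\<dots> = (\<Sum>i\<le>degree F. (coeff F i - \<mu> i) * t ^ i)"
    by (simp only: sum_subtractf left_diff_distrib)
  also have "dvd_in B q \<dots>"
  proof (rule B.dvd_in_sum)
    fix i
    obtain w where "w \<in> B" "coeff F i - \<mu> i = q * w" using \<mu>(2) by (auto simp: dvd_in_def)
    then have "(coeff F i - \<mu> i) * t ^ i = q * (w * t ^ i)" "w * t ^ i \<in> B" using B.mult_power_in tB by (auto simp: mult.assoc)
    then show "dvd_in B q ((coeff F i - \<mu> i) * t ^ i)" by (auto simp: dvd_in_def)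
  qed
  finally have d1: "dvd_in B q (poly F t - poly G t)" .
  have d2: "dvd_in B q (poly F t)" using B.dvd_in_mult[OF qp, of a] a AB by auto
  have dG: "dvd_in B q (poly G t)" using B.dvd_in_diff[OF d2 d1] by simp
  \<comment> \<open>The coefficient at \<open>i0\<close> is comaximal with p in C and therefore not
    divisible by q.\<close>
  have "G \<noteq> 0"
  proof
    assume "G = 0"
    have "i0 \<le> degree F" using ndvd C.dvd_in_0 coeff_eq_0[of F i0] by (cases "i0 \<le> degree F") auto
    then have "\<mu> i0 = 0" using cG[of i0] \<open>G = 0\<close> by simp
    then have "dvd_in B q (coeff F i0)" using \<mu>(2)[of i0] by simp
    moreover obtain u v where uv: "u \<in> C" "v \<in> C" "u * coeff F i0 + v * p = e"
      using prime_comaximal[OF C.dom_in_axioms fieldK KC p FC ndvd dep[OF FC pC(1)]] by blast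
    ultimately have "dvd_in B q (coeff F i0 * u + p * v)"
      using B.dvd_in_add B.dvd_in_mult qp CA AB by (meson subsetD)
    then have "dvd_in B q e" using uv by (simp add: mult.commute)
    then show False using B.prime_not_dvd_unit[OF q(1) B.unit_one] by simp
  qed
  then obtain m where m: "m \<in> L" "dvd_in B q (t - m)" using prime_root[OF q(1) GL _ tB dG] by blast
  then obtain b where b: "b \<in> B" "t - m = q * b" by (auto simp: dvd_in_def)
  \<comment> \<open>The factor q' turns divisibility by q, which has no meaning for coordinates,
    into divisibility by p, which lies in A and commutes with \<open>co j\<close>.\<close>
  have eq: "t * q' - m * q' = p * b" using arg_cong[OF b(2), of "\<lambda>x. x * q'"] q(4) by (simp add: algebra_simps)
  have q'CL: "q' \<in> CL" using CL_closed[of q' q] q pC E.AB by (metis mult.commute subsetD)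
  have mCL: "m * q' \<in> CL" using E.LB m(1) q'CL E.B.mult_in by blast
  have "\<exists>g. g \<in> C \<and> co j q' = p * g" if j: "j \<in> J" for j
  proof -
    have "co j (t * q' - m * q') = t * co j q' - co j (m * q')"
      using co_diff[of "t * q'" "m * q'" j] co_mult[OF tA q(3) j] B.mult_in[OF tB q(3)] mCL CL_B j by auto
    moreover have "co j (p * b) = p * co j b" using co_mult[of p b j] pC CA b(1) j by blast
    ultimately have "co j q' * t - co j (m * q') = p * co j b" using eq by (simp add: mult.commute)
    moreover have "co j q' \<in> C" "co j (m * q') \<in> C" using q'CL mCL j by (auto simp: ext_def)
    ultimately have "dvd_in C p (co j q')" using mint[OF p co_in[OF b(1) j]] dep pC(1) by blast
    then show ?thesis by (auto simp: dvd_in_def)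
  qed
  then obtain g where g: "\<And>j. j \<in> J \<Longrightarrow> g j \<in> C \<and> co j q' = p * g j" by metis
  define \<gamma> where "\<gamma> = (\<Sum>j | j \<in> J \<and> co j q' \<noteq> 0. j * g j)"
  have \<gamma>B: "\<gamma> \<in> B" unfolding \<gamma>_def using g JB CA AB by (intro B.sum_in B.mult_in) auto
  have "q' = (\<Sum>j | j \<in> J \<and> co j q' \<noteq> 0. j * co j q')" by (rule co_sum[OF q(3)])
  also have "\<dots> = p * \<gamma>" unfolding \<gamma>_def sum_distrib_left using g by (intro sum.cong refl) (auto simp: mult_ac)
  finally have "p * e = p * (q * \<gamma>)" using q(4) B.mult_one[OF pB(1)] by (metis mult.left_commute)
  then have "e = q * \<gamma>" using B.cancel[OF B.one_in B.mult_in[OF q(2) \<gamma>B] pB(1) pC(2)] by simp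
  then have "unit_in e B q" using q(2) \<gamma>B unfolding unit_in_def by metis
  then show False using q(1) by (simp add: prime_in_def)
qed

text \<open>The prime factors of the denominator from \<open>clear_denominator\<close> are cancelled
  one at a time: each divides F(t), so it divides F.\<close>

theorem A_eq_adj: "A = adj C t"
proof
  show "adj C t \<subseteq> A" by (rule adj_subset[OF rng_in_axioms CA tA])
  have main: "\<exists>F\<in>polys C. a = poly F t"
    if "prime_fact e C k c" "F \<in> polys C" "a \<in> A" "c * a = poly F t" for k c F a
    using that
  proof (induction k arbitrary: c F)
    case 0
    then obtain v where v: "c \<in> C" "v \<in> C" "c * v = e" by (auto simp: C.prime_fact_0 unit_in_def)
    have "a = (c * v) * a" using v one_mult 0 by simp
    also have "\<dots> = poly (smult v F) t" by (simp add: 0(4)[symmetric] mult_ac)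
    finally show ?case using v C.smult_in_polys 0(2) by blast
  next
    case (Suc k)
    obtain p c' where p: "prime_in e C p" and c': "prime_fact e C k c'" "c = p * c'" "c' \<in> C"
      using Suc.prems(1) by (rule C.prime_fact_SucD)
    have pC: "p \<in> C" "p \<noteq> 0" using p by (auto simp: prime_in_def)
    have c'a: "c' * a \<in> A" using c' CA Suc.prems(3) mult_in by blast
    have "poly F t = p * (c' * a)" using Suc.prems(4) c'(2) by (simp add: mult.assoc)
    then have "\<forall>i. dvd_in C p (coeff F i)" using coeff_divisible[OF p Suc.prems(2) c'a] by blast
    then have "dvd_in (polys C) [:p:] F" using C.const_dvd_iff[OF Suc.prems(2) pC(1)] by blast
    then obtain F' where F': "F' \<in> polys C" "F = [:p:] * F'" by (auto simp: dvd_in_def)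
    have "p * (c' * a) = p * poly F' t" using Suc.prems(4) c'(2) F'(2) by (simp add: mult.assoc)
    moreover have "poly F' t \<in> A" using F'(1) polys_mono[OF CA] tA poly_in by blast
    ultimately have "c' * a = poly F' t" using cancel[OF c'a _ _ pC(2)] pC(1) CA by blast
    then show ?case using Suc.IH[OF c'(1) F'(1) Suc.prems(3)] by blast
  qed
  show "A \<subseteq> adj C t"
  proof
    fix a assume a: "a \<in> A"
    obtain c F where F: "c \<in> C" "F \<in> polys C" "c \<noteq> 0" "c * a = poly F t"
      using clear_denominator[OF tA dt n0 dv a] by blast
    obtain k where "prime_fact e C k c" using factC F by (auto simp: factorial_in_def)
    then show "a \<in> adj C t" using main[OF _ F(2) a F(4)] unfolding adj_def by blast
  qed
qed

end


section \<open>Cylinders\<close>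

text \<open>The Hasse derivative, that is, the i-th derivative divided by i!, which makes sense in
  every characteristic.\<close>

definition hasse :: "nat \<Rightarrow> 'r::comm_ring_1 poly \<Rightarrow> 'r poly"
  where "hasse i F = Abs_poly (\<lambda>n. of_nat ((n + i) choose i) * coeff F (n + i))"

lemma coeff_hasse: "coeff (hasse i F) n = of_nat ((n + i) choose i) * coeff F (n + i)"
proof -
  have "{n. of_nat ((n + i) choose i) * coeff F (n + i) \<noteq> 0} \<subseteq> {..degree F}"
    by (auto intro: ccontr simp: coeff_eq_0)
  then have "finite {n. of_nat ((n + i) choose i) * coeff F (n + i) \<noteq> 0}" by (rule finite_subset) simp
  then show ?thesis unfolding hasse_def by (subst Abs_poly_inverse) (auto simp: eventually_cofinite)
qed

lemma hasse_add: "hasse i (F + G) = hasse i F + hasse i G"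
  by (rule poly_eqI) (simp add: coeff_hasse distrib_left)

lemma hasse_0: "hasse 0 F = F"
  by (rule poly_eqI) (simp add: coeff_hasse)

lemma hasse_const_mult: "hasse i (smult a F) = smult a (hasse i F)"
  by (rule poly_eqI) (simp add: coeff_hasse mult.left_commute)

lemma hasse_const: "i > 0 \<Longrightarrow> hasse i [:a:] = 0"
  by (rule poly_eqI) (simp add: coeff_hasse coeff_pCons split: nat.split)

lemma hasse_pCons_0: "hasse (Suc i) (pCons 0 F) = pCons 0 (hasse (Suc i) F) + hasse i F"
proof (rule poly_eqI)
  fix n
  show "coeff (hasse (Suc i) (pCons 0 F)) n = coeff (pCons 0 (hasse (Suc i) F) + hasse i F) n"
    by (cases n) (simp_all add: coeff_hasse distrib_right add.commute)
qed

text \<open>Induction on F, written as a constant plus a multiple of the variable; for the second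
  summand \<open>hasse_pCons_0\<close> is the Leibniz rule with the variable as a factor.\<close>

lemma hasse_mult: "hasse n (F * G) = (\<Sum>i\<le>n. hasse i F * hasse (n - i) G)"
proof (induction F arbitrary: n)
  case 0
  have "hasse i (0 :: 'a poly) = 0" for i by (rule poly_eqI) (simp add: coeff_hasse)
  then show ?case by simp
next
  case (pCons a F)
  have X: "hasse n (pCons 0 (F * G)) = (\<Sum>i\<le>n. hasse i (pCons 0 F) * hasse (n - i) G)"
  proof (cases n)
    case 0
    then show ?thesis by (simp add: hasse_0)
  next
    case (Suc m)
    have "hasse n (pCons 0 (F * G)) = pCons 0 (hasse n (F * G)) + hasse m (F * G)"
      unfolding Suc by (rule hasse_pCons_0)
    also have "pCons 0 (hasse n (F * G)) = pCons 0 (F * hasse n G) + (\<Sum>i\<le>m. pCons 0 (hasse (Suc i) F) * hasse (m - i) G)"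
    proof -
      have p: "pCons 0 H = [:0, 1:] * H" for H :: "'a poly" by simp
      have "pCons 0 (hasse n (F * G)) = [:0, 1:] * (\<Sum>i\<le>n. hasse i F * hasse (n - i) G)"
        unfolding pCons.IH by (rule p)
      also have "\<dots> = [:0, 1:] * (F * hasse n G + (\<Sum>i\<le>m. hasse (Suc i) F * hasse (m - i) G))"
        unfolding Suc by (subst sum.atMost_Suc_shift) (simp add: hasse_0)
      also have "\<dots> = pCons 0 (F * hasse n G) + (\<Sum>i\<le>m. pCons 0 (hasse (Suc i) F) * hasse (m - i) G)"
        unfolding p[of "hasse (Suc i) F" for i] p[of "F * hasse n G"]
        by (simp only: distrib_left sum_distrib_left mult.assoc)
      finally show ?thesis .
    qed
    also have "hasse m (F * G) = (\<Sum>i\<le>m. hasse i F * hasse (m - i) G)" by (rule pCons.IH)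
    finally have "hasse n (pCons 0 (F * G)) = pCons 0 (F * hasse n G) +
        (\<Sum>i\<le>m. (pCons 0 (hasse (Suc i) F) + hasse i F) * hasse (m - i) G)"
      by (simp add: sum.distrib distrib_right add.assoc)
    also have "\<dots> = hasse 0 (pCons 0 F) * hasse n G + (\<Sum>i\<le>m. hasse (Suc i) (pCons 0 F) * hasse (m - i) G)"
      by (simp add: hasse_0 hasse_pCons_0)
    also have "\<dots> = (\<Sum>i\<le>n. hasse i (pCons 0 F) * hasse (n - i) G)"
      unfolding Suc by (subst sum.atMost_Suc_shift) simp
    finally show ?thesis .
  qed
  have C: "smult a (hasse n G) = (\<Sum>i\<le>n. hasse i [:a:] * hasse (n - i) G)"
  proof -
    have "(\<Sum>i\<le>n. hasse i [:a:] * hasse (n - i) G) = (\<Sum>i\<in>{0}. hasse i [:a:] * hasse (n - i) G)"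
      by (rule sum.mono_neutral_right) (auto simp: hasse_const)
    then show ?thesis by (simp add: hasse_0)
  qed
  have "pCons a F * G = smult a G + pCons 0 (F * G)" by simp
  then have "hasse n (pCons a F * G) = smult a (hasse n G) + hasse n (pCons 0 (F * G))"
    by (simp add: hasse_add hasse_const_mult)
  also have "\<dots> = (\<Sum>i\<le>n. (hasse i [:a:] + hasse i (pCons 0 F)) * hasse (n - i) G)"
    unfolding X C by (simp add: sum.distrib distrib_right)
  also have "\<dots> = (\<Sum>i\<le>n. hasse i (pCons a F) * hasse (n - i) G)"
    by (simp flip: hasse_add)
  finally show ?case .
qed

lemma hasse_iter: "hasse j (hasse i F) = of_nat ((i + j) choose i) * hasse (i + j) F"
proof (rule poly_eqI)
  fix n
  have "((n + j) choose j) * ((n + j + i) choose i) = ((i + j) choose i) * ((n + (i + j)) choose (i + j))"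
    using choose_mult[of i "i + j" "n + (i + j)"] by (simp add: mult.commute add_ac)
  then have "of_nat ((n + j) choose j) * (of_nat ((n + j + i) choose i) * coeff F (n + j + i)) =
      (of_nat ((i + j) choose i) :: 'a) * (of_nat ((n + (i + j)) choose (i + j)) * coeff F (n + (i + j)))"
    unfolding mult.assoc[symmetric] of_nat_mult[symmetric] by (simp add: add_ac)
  then show "coeff (hasse j (hasse i F)) n = coeff (of_nat ((i + j) choose i) * hasse (i + j) F) n"
    by (simp add: coeff_hasse of_nat_poly)
qed

lemma (in dom_in) hasse_exp_family: "exp_family [:e:] (polys S) hasse"
proof (intro exp_family.intro polys_dom_in exp_family_axioms.intro)
  show "hasse i F \<in> polys S" if "F \<in> polys S" for i F
    using that of_nat_mult_in by (simp add: polys_def coeff_hasse)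
  show "\<exists>N. \<forall>i\<ge>N. hasse i F = 0" for F :: "'a poly"
    by (intro exI[of _ "Suc (degree F)"] allI impI poly_eqI) (simp add: coeff_hasse coeff_eq_0)
qed (simp_all add: hasse_0 hasse_add hasse_mult hasse_iter)

text \<open>The leading coefficient of F is the constant term of \<open>hasse (degree F) F\<close>,
  so an invariant has degree 0.\<close>

lemma (in dom_in) hasse_invs: "exp_family.invs (polys S) hasse = (\<lambda>a. [:a:]) ` S"
proof -
  interpret H: exp_family "[:e:]" "polys S" hasse by (rule hasse_exp_family)
  show ?thesis
  proof
    show "(\<lambda>a. [:a:]) ` S \<subseteq> H.invs" by (auto simp: H.invs_def hasse_const)
    show "H.invs \<subseteq> (\<lambda>a. [:a:]) ` S"
    proof
      fix F assume F: "F \<in> H.invs"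
      have "degree F = 0"
      proof (rule ccontr)
        assume d: "degree F \<noteq> 0"
        then have "coeff (hasse (degree F) F) 0 = 0" using F by (simp add: H.invs_def)
        then have "F = 0" by (simp add: coeff_hasse)
        then show False using d by simp
      qed
      then obtain a where "F = [:a:]" by (auto elim: degree_eq_zeroE)
      then show "F \<in> (\<lambda>a. [:a:]) ` S" using F by (auto simp: H.invs_def)
    qed
  qed
qed

text \<open>Transport of structure along \<sigma>. It moves the Hasse derivatives of one description
  of R as a polynomial ring to the other description.\<close>

lemma exp_family_transfer:
  assumes S: "dom_in e S" and D: "exp_family e' S' D" and bij: "bij_betw \<sigma> S S'"
    and add: "\<And>a b. a \<in> S \<Longrightarrow> b \<in> S \<Longrightarrow> \<sigma> (a + b) = \<sigma> a + \<sigma> b"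
    and mult: "\<And>a b. a \<in> S \<Longrightarrow> b \<in> S \<Longrightarrow> \<sigma> (a * b) = \<sigma> a * \<sigma> b"
  shows "exp_family e S (\<lambda>i a. inv_into S \<sigma> (D i (\<sigma> a)))"
    and "exp_family.invs S (\<lambda>i a. inv_into S \<sigma> (D i (\<sigma> a))) = {a \<in> S. \<sigma> a \<in> exp_family.invs S' D}"
proof -
  interpret S: dom_in e S by fact
  interpret D: exp_family e' S' D by fact
  let ?d = "\<lambda>i a. inv_into S \<sigma> (D i (\<sigma> a))"
  have sS: "\<sigma> a \<in> S'" if "a \<in> S" for a using bij that by (auto simp: bij_betw_def)
  have dS: "?d i a \<in> S" if "a \<in> S" for i a
    using bij D.d_in[OF sS[OF that]] by (metis bij_betw_imp_surj_on inv_into_into)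
  have sd: "\<sigma> (?d i a) = D i (\<sigma> a)" if "a \<in> S" for i a
    using bij D.d_in[OF sS[OF that]] by (simp add: bij_betw_def f_inv_into_f)
  have eqI: "a = b" if "a \<in> S" "b \<in> S" "\<sigma> a = \<sigma> b" for a b
    using bij that by (auto simp: bij_betw_def inj_on_def)
  have s0: "\<sigma> 0 = 0" using add[of 0 0] by simp
  have szero: "\<sigma> a = 0 \<longleftrightarrow> a = 0" if "a \<in> S" for a using eqI[OF that S.zero_in] s0 by auto
  have ssum: "\<sigma> (sum f I) = (\<Sum>i\<in>I. \<sigma> (f i))" if "\<And>i. i \<in> I \<Longrightarrow> f i \<in> S" for f :: "nat \<Rightarrow> 'a" and I
    using that by (induction I rule: infinite_finite_induct) (auto simp: s0 add S.sum_in)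
  have snat: "\<sigma> (of_nat m * a) = of_nat m * \<sigma> a" if "a \<in> S" for m a
    by (induction m) (auto simp: s0 distrib_right add S.of_nat_mult_in that)
  show "exp_family e S ?d"
  proof (intro exp_family.intro S exp_family_axioms.intro)
    show "?d i a \<in> S" if "a \<in> S" for i a using dS[OF that] .
    show "?d 0 a = a" if "a \<in> S" for a
      by (rule eqI[OF dS[OF that] that trans[OF sd[OF that] D.d_0[OF sS[OF that]]]])
    show "?d i (a + b) = ?d i a + ?d i b" if "a \<in> S" "b \<in> S" for i a b
    proof (rule eqI)
      show "?d i (a + b) \<in> S" "?d i a + ?d i b \<in> S" using that dS S.add_in by auto
      have "\<sigma> (?d i (a + b)) = D i (\<sigma> a + \<sigma> b)"        using sd[OF S.add_in[OF that], of i] unfolding add[OF that] .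
      also have "\<dots> = \<sigma> (?d i a + ?d i b)"
        unfolding D.d_add[OF sS sS, OF that] add[OF dS dS, OF that] sd[OF that(1)] sd[OF that(2)] ..
      finally show "\<sigma> (?d i (a + b)) = \<sigma> (?d i a + ?d i b)" .
    qed
    show "?d n (a * b) = (\<Sum>i\<le>n. ?d i a * ?d (n - i) b)" if "a \<in> S" "b \<in> S" for n a b
    proof (rule eqI)
      show "?d n (a * b) \<in> S" using that S.mult_in dS by blast
      show m: "(\<Sum>i\<le>n. ?d i a * ?d (n - i) b) \<in> S" using that S.mult_in dS by (intro S.sum_in) blast
      have "\<sigma> (?d n (a * b)) = D n (\<sigma> a * \<sigma> b)"        using sd[OF S.mult_in[OF that], of n] unfolding mult[OF that] .
      also have "\<dots> = (\<Sum>i\<le>n. \<sigma> (?d i a * ?d (n - i) b))"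
        unfolding D.d_mult[OF sS sS, OF that] mult[OF dS dS, OF that] sd[OF that(1)] sd[OF that(2)] ..
      also have "\<dots> = \<sigma> (\<Sum>i\<le>n. ?d i a * ?d (n - i) b)"
        using that S.mult_in dS by (intro ssum[symmetric]) blast
      finally show "\<sigma> (?d n (a * b)) = \<sigma> (\<Sum>i\<le>n. ?d i a * ?d (n - i) b)" .
    qed
    show "\<exists>N. \<forall>i\<ge>N. ?d i a = 0" if a: "a \<in> S" for a
    proof -
      obtain N where "\<forall>i\<ge>N. D i (\<sigma> a) = 0" using D.d_fin[OF sS[OF a]] by blast
      then have "\<sigma> (?d i a) = 0" if "i \<ge> N" for i using that sd[OF a, of i] by simp
      then show ?thesis using szero[OF dS[OF a]] by blast
    qed
    show "?d j (?d i a) = of_nat ((i + j) choose i) * ?d (i + j) a" if "a \<in> S" for a i j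
    proof (rule eqI)
      show "?d j (?d i a) \<in> S" "of_nat ((i + j) choose i) * ?d (i + j) a \<in> S"
        using dS that S.of_nat_mult_in by auto
      show "\<sigma> (?d j (?d i a)) = \<sigma> (of_nat ((i + j) choose i) * ?d (i + j) a)"
        using sd[OF dS[OF that], of j i] sd[OF that] snat[OF dS[OF that]] D.d_iter[OF sS[OF that]] by simp
    qed
  qed
  then interpret d: exp_family e S ?d .
  have "?d i a = 0 \<longleftrightarrow> D i (\<sigma> a) = 0" if "a \<in> S" for i a
    using szero[OF dS[OF that, of i]] sd[OF that, of i] by simp
  then show "d.invs = {a \<in> S. \<sigma> a \<in> D.invs}" using sS by (auto simp: d.invs_def D.invs_def)
qed

text \<open>R is the common polynomial ring, Om is \<open>L \<otimes> R\<close>, and A is one of the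
  subrings with R = \<open>A[x]\<close>; two instances over the same R and Om are compared later.
  \<open>dep4\<close> bounds the transcendence degree of R by three. Factoriality is required of R
  and Om, which do not single out one of the subrings, and is inherited by A and B.\<close>

locale cylinder = R: tens e K L J co R Om
  for e :: "'r::comm_ring_1" and K L J co R Om +
  fixes A :: "'r set" and x :: 'r and Gs :: "'r set"
  assumes rngA: "rng_in e A" and KA: "K \<subseteq> A" and AR: "A \<subseteq> R" and xR: "x \<in> R"
    and R_eq: "R = adj A x" and transc: "\<And>F. F \<in> polys A \<Longrightarrow> poly F x = 0 \<Longrightarrow> F = 0"
    and factR: "factorial_in e R" and factOm: "factorial_in e Om"
    and dep4: "\<And>a b c d. a \<in> R \<Longrightarrow> b \<in> R \<Longrightarrow> c \<in> R \<Longrightarrow> d \<in> R \<Longrightarrow> algdep K [a, b, c, d]"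
    and gen: "fin_gen_in e K A Gs"
begin

abbreviation "B \<equiv> R.ext A"

sublocale T: tens e K L J co A B
  by (rule R.ext_tens[OF rngA KA AR])

lemma B_Om: "B \<subseteq> Om" by (auto simp: R.ext_def)

lemma xOm: "x \<in> Om" using xR R.AB by auto

lemma co_poly:
  assumes F: "F \<in> polys B" and j: "j \<in> J"
  shows "map_poly (co j) F \<in> polys A \<and> co j (poly F x) = poly (map_poly (co j) F) x"
  using F
proof (induction F rule: T.B.polys_induct)
  case zero
  then show ?case using R.co_zero[OF j] by (simp add: polys_def)
next
  case (pCons a F)
  have "poly F x \<in> Om" using pCons(2) polys_mono[OF B_Om] xOm R.B.poly_in by blast
  moreover have "a \<in> Om" using pCons(1) B_Om by blast
  ultimately have "co j (poly (pCons a F) x) = co j a + x * co j (poly F x)"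
    using R.co_add[of a "x * poly F x" j] R.co_mult[OF xR] xOm R.B.mult_in j by auto
  moreover have "map_poly (co j) (pCons a F) = pCons (co j a) (map_poly (co j) F)"
    using R.co_zero[OF j] by (intro poly_eqI) (auto simp: coeff_map_poly coeff_pCons split: nat.split)
  moreover have "co j a \<in> A" using pCons(1) j by (simp add: R.ext_def)
  ultimately show ?case using pCons.IH T.A.pCons_in_polys by simp
qed

lemma transc_B:
  assumes F: "F \<in> polys B" "poly F x = 0"
  shows "F = 0"
proof (rule poly_eqI)
  fix i
  have "co j (coeff F i) = 0" if j: "j \<in> J" for j
  proof -
    have "map_poly (co j) F = 0" using transc co_poly[OF F(1) j] F(2) R.co_zero[OF j] by auto
    then show ?thesis using R.co_zero[OF j] by (metis coeff_0 coeff_map_poly)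
  qed
  moreover have "coeff F i \<in> Om" using F(1) B_Om by (auto simp: polys_def)
  ultimately show "coeff F i = coeff 0 i" using R.co_eq_0 by simp
qed

lemma Om_eq: "Om = adj B x"
proof
  show "adj B x \<subseteq> Om" by (rule adj_subset[OF R.B.rng_in_axioms B_Om xOm])
  show "Om \<subseteq> adj B x"
  proof
    interpret P: rng_in "[:e:]" "polys B" by (rule T.B.polys_rng_in)
    fix b assume b: "b \<in> Om"
    have "\<forall>j. \<exists>F. j \<in> J \<longrightarrow> F \<in> polys A \<and> co j b = poly F x"
      using R.co_in[OF b] R_eq by (auto simp: adj_def)
    then obtain F where F: "\<And>j. j \<in> J \<Longrightarrow> F j \<in> polys A \<and> co j b = poly (F j) x" by metis
    let ?I = "{j \<in> J. co j b \<noteq> 0}"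
    have "b = (\<Sum>j\<in>?I. j * co j b)" by (rule R.co_sum[OF b])
    also have "\<dots> = poly (\<Sum>j\<in>?I. smult j (F j)) x"
      unfolding poly_sum poly_smult using F by (intro sum.cong refl) auto
    finally have "b = poly (\<Sum>j\<in>?I. smult j (F j)) x" .
    moreover have "(\<Sum>j\<in>?I. smult j (F j)) \<in> polys B"
      using F T.JB polys_mono[OF T.AB] by (intro P.sum_in T.B.smult_in_polys) auto
    ultimately show "b \<in> adj B x" unfolding adj_def by blast
  qed
qed

text \<open>The expansion of an element of Om in powers of x with coefficients in
  \<open>B = L \<otimes> A\<close>; \<open>dg\<close> below is its degree in x.\<close>

definition rep :: "'r \<Rightarrow> 'r poly" where "rep w = (THE F. F \<in> polys B \<and> poly F x = w)"

lemma poly_inj: "F \<in> polys B \<Longrightarrow> G \<in> polys B \<Longrightarrow> poly F x = poly G x \<Longrightarrow> F = G"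
  using transc_B[of "F - G"] rng_in.diff_in[OF T.B.polys_rng_in] by fastforce

lemma rep_poly: "F \<in> polys B \<Longrightarrow> rep (poly F x) = F"
  unfolding rep_def using poly_inj by blast

lemma rep_in: "w \<in> Om \<Longrightarrow> rep w \<in> polys B \<and> poly (rep w) x = w"
proof -
  assume "w \<in> Om"
  then have "w \<in> adj B x" using equalityD1[OF Om_eq] by blast
  then obtain F where "F \<in> polys B" "w = poly F x" by (auto simp: adj_def)
  then show ?thesis using rep_poly by simp
qed

definition dg :: "'r \<Rightarrow> nat" where "dg w = degree (rep w)"

lemma rep_0: "rep 0 = 0"
  using rep_poly[of 0] rng_in.zero_in[OF T.B.polys_rng_in] by simp

lemma rep_nz: "w \<in> Om \<Longrightarrow> w \<noteq> 0 \<Longrightarrow> rep w \<noteq> 0"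
  using rep_in by fastforce

lemma rep_mult: "v \<in> Om \<Longrightarrow> w \<in> Om \<Longrightarrow> rep (v * w) = rep v * rep w"
  using rep_in[of v] rep_in[of w] rep_poly[of "rep v * rep w"] rng_in.mult_in[OF T.B.polys_rng_in] by simp

lemma rep_add: "v \<in> Om \<Longrightarrow> w \<in> Om \<Longrightarrow> rep (v + w) = rep v + rep w"
  using rep_in[of v] rep_in[of w] rep_poly[of "rep v + rep w"] rng_in.add_in[OF T.B.polys_rng_in] by simp

lemma dg_mult: "v \<in> Om \<Longrightarrow> w \<in> Om \<Longrightarrow> v \<noteq> 0 \<Longrightarrow> w \<noteq> 0 \<Longrightarrow> dg (v * w) = dg v + dg w"
  unfolding dg_def using rep_mult[of v w] T.B.degree_mult_polys(1) rep_in rep_nz by metis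

lemma rep_const: "b \<in> B \<Longrightarrow> rep b = [:b:]"
  using rep_poly[of "[:b:]"] by simp

lemma dg_0_iff: "w \<in> Om \<Longrightarrow> dg w = 0 \<longleftrightarrow> w \<in> B"
proof
  assume w: "w \<in> Om" "dg w = 0"
  then obtain b where "rep w = [:b:]" unfolding dg_def by (auto elim: degree_eq_zeroE)
  then show "w \<in> B" using rep_in[OF w(1)] by auto
qed (simp add: dg_def rep_const)

lemma B_inter_R: "w \<in> R \<Longrightarrow> w \<in> B \<longleftrightarrow> w \<in> A"
proof
  assume "w \<in> R" "w \<in> B"
  then show "w \<in> A" using R.co_A[of w e] R.eJ by (auto simp: R.ext_def)
qed (use T.AB in blast)

lemma rep_R: "w \<in> R \<Longrightarrow> rep w \<in> polys A"
  using R_eq rep_poly polys_mono[OF T.AB] by (auto simp: adj_def subset_iff)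

lemma dg_poly:
  assumes w: "w \<in> Om" "dg w > 0"
  shows "F \<in> polys B \<Longrightarrow> F \<noteq> 0 \<Longrightarrow> poly F w \<in> Om \<and> poly F w \<noteq> 0 \<and> dg (poly F w) = dg w * degree F"
proof (induction F rule: T.B.polys_induct)
  case (pCons a F)
  have FO: "poly F w \<in> Om" using pCons(2) polys_mono[OF B_Om] w(1) R.B.poly_in by blast
  have aO: "a \<in> Om" "dg a = 0" using pCons(1) B_Om dg_0_iff by blast+
  have w0: "w \<noteq> 0" using w(2) rep_0 by (auto simp: dg_def)
  show ?case
  proof (cases "F = 0")
    case True
    then show ?thesis using pCons.prems aO by simp
  next
    case False
    have wF: "w * poly F w \<in> Om" "dg (w * poly F w) = dg w * Suc (degree F)"
      using R.B.mult_in w(1) FO dg_mult[OF w(1) FO w0] pCons.IH[OF False] by auto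
    have "dg (a + w * poly F w) = dg (w * poly F w)"
      using wF aO w rep_add[OF aO(1) wF(1)] unfolding dg_def by (simp add: degree_add_eq_right)
    then have 1: "dg (poly (pCons a F) w) = dg w * degree (pCons a F)" using False wF by simp
    moreover have "poly (pCons a F) w \<noteq> 0"
    proof
      assume z: "poly (pCons a F) w = 0"
      have "dg (poly (pCons a F) w) = 0" unfolding z dg_def rep_0 by simp
      then show False using 1 w False by simp
    qed
    moreover have "poly (pCons a F) w \<in> Om" using aO wF R.B.add_in by simp
    ultimately show ?thesis by blast
  qed
qed simp

text \<open>An element of positive degree in x is transcendental over A, because the degrees of its
  powers differ.\<close>

lemma alg_closed: "w \<in> R \<Longrightarrow> alg_in A w \<Longrightarrow> w \<in> A"
proof (rule ccontr)
  assume w: "w \<in> R" "alg_in A w" "w \<notin> A"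
  then have "w \<in> Om" "dg w > 0" using R.AB dg_0_iff[of w] B_inter_R by auto
  then show False using dg_poly polys_mono[OF T.AB] w(2) by (auto simp: alg_in_def)
qed

lemma A_closed: "a \<in> R \<Longrightarrow> b \<in> R \<Longrightarrow> a * b \<in> A \<Longrightarrow> a * b \<noteq> 0 \<Longrightarrow> a \<in> A"
  using dg_mult[of a b] dg_0_iff[of "a * b"] dg_0_iff[of a] B_inter_R[of a] R.AB T.AB B_Om
  by (metis add_is_0 mult_zero_left mult_zero_right subsetD)

lemma B_closed: "a \<in> Om \<Longrightarrow> b \<in> Om \<Longrightarrow> a * b \<in> B \<Longrightarrow> a * b \<noteq> 0 \<Longrightarrow> a \<in> B"
  using dg_mult[of a b] dg_0_iff[of "a * b"] dg_0_iff[of a] B_Om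
  by (metis add_is_0 mult_zero_left mult_zero_right subsetD)

lemma factA: "factorial_in e A"
  using factorial_closed_subring(1)[OF factR rngA AR] A_closed by blast

lemma factB: "factorial_in e B"
  using factorial_closed_subring(1)[OF factOm T.B.rng_in_axioms B_Om] B_closed by blast

lemma dep3: "a \<in> A \<Longrightarrow> b \<in> A \<Longrightarrow> c \<in> A \<Longrightarrow> algdep K [a, b, c]"
proof -
  assume abc: "a \<in> A" "b \<in> A" "c \<in> A"
  have "adjl K [a, b, c] \<subseteq> A"
    using adjl_rng_in[OF rngA R.K.rng_in_axioms KA, of "[a, b, c]"] abc by auto
  then have "\<not> alg_in (adjl K [a, b, c]) x"
    using transc polys_mono[of "adjl K [a, b, c]" A] unfolding alg_in_def by blast
  then show ?thesis using dep4[of x a b c] xR abc AR by auto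
qed

text \<open>Coordinates are taken coefficientwise in the expansion in powers of x, and a nonzero
  leading coefficient has a nonzero coordinate.\<close>

lemma dg_co:
  assumes w: "w \<in> Om"
  shows "\<And>j. j \<in> J \<Longrightarrow> dg (co j w) \<le> dg w" "\<exists>j\<in>J. dg (co j w) = dg w"
proof -
  have rc: "rep (co j w) = map_poly (co j) (rep w)" if "j \<in> J" for j
    using co_poly[of "rep w" j] rep_in[OF w] rep_poly polys_mono[OF T.AB] that by (metis subsetD)
  show "dg (co j w) \<le> dg w" if "j \<in> J" for j
    unfolding dg_def rc[OF that]
    by (rule degree_le) (auto simp: coeff_map_poly R.co_zero[OF that] coeff_eq_0)
  show "\<exists>j\<in>J. dg (co j w) = dg w"
  proof (cases "w = 0")
    case True
    then show ?thesis using R.co_zero R.eJ by auto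
  next
    case False
    then have "coeff (rep w) (dg w) \<noteq> 0" using rep_nz[OF w] by (simp add: dg_def)
    moreover have "coeff (rep w) (dg w) \<in> Om" using rep_in[OF w] B_Om by (auto simp: polys_def)
    ultimately obtain j where j: "j \<in> J" "co j (coeff (rep w) (dg w)) \<noteq> 0" using R.co_eq_0 by blast
    then have "coeff (rep (co j w)) (dg w) \<noteq> 0" using rc R.co_zero by (simp add: coeff_map_poly)
    then have "dg w \<le> dg (co j w)" unfolding dg_def[of "co j w"] by (rule le_degree)
    then show ?thesis using \<open>\<And>j. j \<in> J \<Longrightarrow> dg (co j w) \<le> dg w\<close> j by (auto intro: le_antisym)
  qed
qed

end

section \<open>Comparison of two cylinders over the same ring\<close>

lemma adj_lift_iso:
  assumes C1: "rng_in e C1" and C2: "rng_in e C2" and t: "e * t1 = t1" "e * t2 = t2"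
    and tr1: "\<And>F. F \<in> polys C1 \<Longrightarrow> poly F t1 = 0 \<Longrightarrow> F = 0"
    and tr2: "\<And>F. F \<in> polys C2 \<Longrightarrow> poly F t2 = 0 \<Longrightarrow> F = 0"
    and bij: "bij_betw g C1 C2"
    and g_add: "\<And>a b. a \<in> C1 \<Longrightarrow> b \<in> C1 \<Longrightarrow> g (a + b) = g a + g b"
    and g_mult: "\<And>a b. a \<in> C1 \<Longrightarrow> b \<in> C1 \<Longrightarrow> g (a * b) = g a * g b"
  shows "\<exists>h. bij_betw h (adj C1 t1) (adj C2 t2) \<and> (\<forall>c\<in>C1. h c = g c) \<and>
    (\<forall>a\<in>adj C1 t1. \<forall>b\<in>adj C1 t1. h (a + b) = h a + h b \<and> h (a * b) = h a * h b)"
proof -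
  interpret C1: rng_in e C1 by fact
  interpret C2: rng_in e C2 by fact
  interpret P1: rng_in "[:e:]" "polys C1" by (rule C1.polys_rng_in)
  interpret P2: rng_in "[:e:]" "polys C2" by (rule C2.polys_rng_in)
  have g0: "g 0 = 0" using g_add[of 0 0] by simp
  have gC: "g a \<in> C2" if "a \<in> C1" for a using bij that by (auto simp: bij_betw_def)
  have gsum: "g (sum f I) = (\<Sum>i\<in>I. g (f i))" if "\<And>i. i \<in> I \<Longrightarrow> f i \<in> C1" for f :: "nat \<Rightarrow> 'a" and I
    using that by (induction I rule: infinite_finite_induct) (auto simp: g0 g_add C1.sum_in)
  have ginj: "a = b" if "a \<in> C1" "b \<in> C1" "g a = g b" for a b
    using bij that by (auto simp: bij_betw_def inj_on_def)
  let ?m = "map_poly g"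
  have cm: "coeff (?m F) i = g (coeff F i)" for F i by (simp add: coeff_map_poly g0)
  have mP: "?m F \<in> polys C2" if "F \<in> polys C1" for F using that gC by (simp add: polys_def cm)
  have m_add: "?m (F + H) = ?m F + ?m H" if "F \<in> polys C1" "H \<in> polys C1" for F H
    using that by (intro poly_eqI) (simp add: cm g_add polys_def)
  have m_mult: "?m (F * H) = ?m F * ?m H" if "F \<in> polys C1" "H \<in> polys C1" for F H
  proof (rule poly_eqI)
    fix n
    have "g (\<Sum>i\<le>n. coeff F i * coeff H (n - i)) = (\<Sum>i\<le>n. g (coeff F i * coeff H (n - i)))"
      using that C1.mult_in by (intro gsum) (simp add: polys_def)
    then show "coeff (?m (F * H)) n = coeff (?m F * ?m H) n"
      using that by (simp add: cm coeff_mult g_mult polys_def)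
  qed
  define rep where "rep w = (THE F. F \<in> polys C1 \<and> poly F t1 = w)" for w
  have inj1: "F = H" if "F \<in> polys C1" "H \<in> polys C1" "poly F t1 = poly H t1" for F H
    using tr1[of "F - H"] P1.diff_in that by simp
  have inj2: "F = H" if "F \<in> polys C2" "H \<in> polys C2" "poly F t2 = poly H t2" for F H
    using tr2[of "F - H"] P2.diff_in that by simp
  have rep: "rep (poly F t1) = F" if "F \<in> polys C1" for F
    unfolding rep_def using inj1 that by blast
  define h where "h w = poly (?m (rep w)) t2" for w
  have hp: "h (poly F t1) = poly (?m F) t2" if "F \<in> polys C1" for F by (simp add: h_def rep[OF that])
  have minj: "F = H" if "F \<in> polys C1" "H \<in> polys C1" "?m F = ?m H" for F H
  proof (rule poly_eqI)
    fix i show "coeff F i = coeff H i"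
      using ginj[of "coeff F i" "coeff H i"] that cm[of F i] cm[of H i] by (simp add: polys_def)
  qed
  have msurj: "\<exists>F\<in>polys C1. ?m F = H" if H: "H \<in> polys C2" for H
    using H
  proof (induction H rule: C2.polys_induct)
    case zero
    show ?case by (intro bexI[of _ 0]) auto
  next
    case (pCons a H)
    then obtain F where "F \<in> polys C1" "?m F = H" by blast
    moreover obtain b where "b \<in> C1" "g b = a" using bij pCons(1) by (auto simp: bij_betw_def)
    ultimately have "pCons b F \<in> polys C1" "?m (pCons b F) = pCons a H"
      using C1.pCons_in_polys by (auto intro!: poly_eqI simp: cm coeff_pCons g0 split: nat.split)
    then show ?case by blast
  qed
  have "bij_betw h (adj C1 t1) (adj C2 t2)"
  proof (rule bij_betw_imageI)
    show "inj_on h (adj C1 t1)"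
    proof (rule inj_onI)
      fix v w assume "v \<in> adj C1 t1" "w \<in> adj C1 t1" and eq: "h v = h w"
      then obtain F H where FH: "F \<in> polys C1" "H \<in> polys C1" "v = poly F t1" "w = poly H t1" by (auto simp: adj_def)
      then have "?m F = ?m H" using eq hp inj2[of "?m F" "?m H"] mP by simp
      then show "v = w" using minj FH by blast
    qed
    show "h ` adj C1 t1 = adj C2 t2"
    proof
      show "h ` adj C1 t1 \<subseteq> adj C2 t2" using hp mP by (auto simp: adj_def)
      show "adj C2 t2 \<subseteq> h ` adj C1 t1"
      proof
        fix w assume "w \<in> adj C2 t2"
        then obtain H where H: "H \<in> polys C2" "w = poly H t2" by (auto simp: adj_def)
        then obtain F where F: "F \<in> polys C1" "?m F = H" using msurj by blast
        then have "w = h (poly F t1)" using hp H by simp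
        then show "w \<in> h ` adj C1 t1" using F by (auto simp: adj_def)
      qed
    qed
  qed
  moreover have "h c = g c" if "c \<in> C1" for c
    using hp[of "[:c:]"] that by (simp add: map_poly_pCons g0)
  moreover have "h (a + b) = h a + h b \<and> h (a * b) = h a * h b" if ab: "a \<in> adj C1 t1" "b \<in> adj C1 t1" for a b
  proof -
    obtain F H where FH: "F \<in> polys C1" "H \<in> polys C1" "a = poly F t1" "b = poly H t1" using ab by (auto simp: adj_def)
    show ?thesis
      using hp[OF P1.add_in[OF FH(1,2)]] hp[OF P1.mult_in[OF FH(1,2)]] hp[OF FH(1)] hp[OF FH(2)] m_add[OF FH(1,2)] m_mult[OF FH(1,2)] FH(3,4)
      by simp
  qed
  ultimately show ?thesis by blast
qed

lemma adj_id_iso: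
  assumes "rng_in e C1" "rng_in e C2" "e * t1 = t1" "e * t2 = t2" "C1 = C2"
    and "\<And>F. F \<in> polys C1 \<Longrightarrow> poly F t1 = 0 \<Longrightarrow> F = 0"
    and "\<And>F. F \<in> polys C2 \<Longrightarrow> poly F t2 = 0 \<Longrightarrow> F = 0"
  shows "\<exists>h. bij_betw h (adj C1 t1) (adj C2 t2) \<and> (\<forall>c\<in>C1. h c = c) \<and>
    (\<forall>a\<in>adj C1 t1. \<forall>b\<in>adj C1 t1. h (a + b) = h a + h b \<and> h (a * b) = h a * h b)"
proof -
  have "bij_betw (\<lambda>x. x) C1 C2" using assms(5) by (simp add: bij_betw_def)
  from adj_lift_iso[OF assms(1-4,6,7) this] show ?thesis by blast
qed

text \<open>A ring \<open>C\<close> of transcendence degree one that sticks out of \<open>A\<close> in \<open>A[x]\<close> is a polynomial ring: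
  the degree in \<open>x\<close> makes division by a prime of \<open>L \<otimes> C\<close>, which has residue field \<open>L\<close>, terminate.\<close>

lemma (in cylinder) curve_is_line:
  assumes S: "slice e K L J co A1 (R.ext A1) d n t" and A1R: "A1 \<subseteq> R"
    and out: "\<not> exp_family.invs A1 d \<subseteq> A" and ne: "exp_family.invs A1 d \<noteq> K"
  shows "\<exists>s\<in>exp_family.invs A1 d. exp_family.invs A1 d = adj K s \<and>
    (\<forall>F\<in>polys K. poly F s = 0 \<longrightarrow> F = 0)"
proof -
  interpret S: slice e K L J co A1 "R.ext A1" d n t by fact
  let ?C = "S.C" and ?CL = "S.ext S.C"
  have B1Om: "R.ext A1 \<subseteq> Om" by (auto simp: R.ext_def)
  have CR: "?C \<subseteq> R" using S.CA A1R by blast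
  have CLOm: "?CL \<subseteq> Om" using S.CL_B B1Om by blast
  have COm: "?C \<subseteq> Om" using CR R.AB by blast
  interpret E: tens e K L J co ?C ?CL by (rule S.E_tens)
  \<comment> \<open>An element z of C and A outside K would make C algebraic over
    \<open>adj K z\<close>, and hence contained in A, which is algebraically closed in R. This
    contradicts \<open>out\<close>.\<close>
  have CK: "z \<in> K" if z: "z \<in> ?C" "z \<in> A" for z
  proof (rule ccontr)
    assume "z \<notin> K"
    have "?C \<subseteq> A"
    proof
      fix c assume c: "c \<in> ?C"
      have "\<not> alg_in K z" using S.algebraic_const[of z] z S.CA \<open>z \<notin> K\<close> by blast
      then have "alg_in (adj K z) c" using S.dep[OF c z(1)] by simp
      then have "alg_in A c" using alg_in_mono adj_subset[OF rngA KA z(2)] by blast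
      then show "c \<in> A" using alg_closed c CR by blast
    qed
    then show False using out by blast
  qed
  \<comment> \<open>The coordinates of such an element have degree 0 in x and lie in C, so they lie
    in K by \<open>CK\<close>.\<close>
  have dg0L: "f \<in> L" if f: "f \<in> ?CL" "dg f = 0" for f
  proof -
    have fO: "f \<in> Om" using f CLOm by blast
    have "co j f \<in> K" if j: "j \<in> J" for j
    proof (rule CK)
      show "co j f \<in> ?C" using f(1) j by (simp add: S.ext_def)
      then have "co j f \<in> R" "co j f \<in> Om" using CR COm by blast+
      moreover have "dg (co j f) = 0" using dg_co(1)[OF fO j] f(2) by simp
      ultimately show "co j f \<in> A" using dg_0_iff B_inter_R by blast
    qed
    then have "(\<Sum>j | j \<in> J \<and> co j f \<noteq> 0. j * co j f) \<in> L"
      using R.JL R.KL by (intro R.L.sum_in R.L.mult_in) auto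
    then show ?thesis using R.co_sum[OF fO] by simp
  qed
  have Ldg: "dg l = 0" if "l \<in> L" for l
    using that dg_0_iff[of l] T.LB B_Om by blast
  \<comment> \<open>An element of C outside K has positive degree in x and is therefore not a unit;
    this yields the prime q to divide by.\<close>
  obtain c0 where c0: "c0 \<in> ?C" "c0 \<notin> K" using ne S.KC by blast
  have c0B: "c0 \<in> R.ext A1" "c0 \<in> Om" using c0 S.CA S.AB B1Om by blast+
  have c0nz: "c0 \<noteq> 0" using c0(2) by auto
  have "dg c0 \<noteq> 0" using CK c0 dg_0_iff[OF c0B(2)] B_inter_R CR by blast
  have "\<not> unit_in e (R.ext A1) c0"
  proof
    assume "unit_in e (R.ext A1) c0"
    then obtain v where v: "v \<in> Om" "c0 * v = e" using B1Om by (auto simp: unit_in_def)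
    then have "v \<noteq> 0" using R.B.one_nz by auto
    then have "dg e = dg c0 + dg v" using dg_mult[OF c0B(2) v(1) c0nz] v(2) by simp
    then show False using Ldg[OF R.L.one_in] \<open>dg c0 \<noteq> 0\<close> by simp
  qed
  then obtain q q' where q: "prime_in e (R.ext A1) q" "q \<in> R.ext A1" "q' \<in> R.ext A1" "c0 = q * q'"
    using S.prime_factor_B[OF c0B(1) c0nz] by blast
  have qc0: "dvd_in (R.ext A1) q c0" using q by (auto simp: dvd_in_def)
  have "c0 \<in> ?CL" using c0 E.AB by blast
  then have qCL: "q \<in> ?CL" using S.CL_closed[OF q(2,3)] q(4) c0nz by simp
  have qOm: "q \<in> Om" using qCL CLOm by blast
  have q0: "q \<noteq> 0" "\<not> unit_in e (R.ext A1) q" using q(1) by (auto simp: prime_in_def)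
  have dgq: "dg q > 0"
  proof (rule ccontr)
    assume "\<not> ?thesis"
    then have "q \<in> L" using dg0L qCL by simp
    then obtain v where "v \<in> L" "q * v = e" using R.fieldL q0(1) by (auto simp: subfield_in_def)
    then show False using q0(2) q(2) S.LB unfolding unit_in_def by blast
  qed
  \<comment> \<open>Modulo q the coordinates of f are constants of L by \<open>mod_const\<close>;
    their combination with the basis elements is again one.\<close>
  have quot: "\<exists>\<mu>\<in>L. \<exists>w\<in>R.ext A1. f = \<mu> + q * w" if f: "f \<in> ?CL" for f
  proof -
    have fO: "f \<in> Om" using f CLOm by blast
    let ?I = "{j \<in> J. co j f \<noteq> 0}"
    have "\<forall>j. \<exists>\<mu> w. j \<in> J \<longrightarrow> \<mu> \<in> L \<and> w \<in> R.ext A1 \<and> co j f = \<mu> + q * w"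
    proof (intro allI)
      fix j
      show "\<exists>\<mu> w. j \<in> J \<longrightarrow> \<mu> \<in> L \<and> w \<in> R.ext A1 \<and> co j f = \<mu> + q * w"
      proof (cases "j \<in> J")
        case True
        then have "co j f \<in> ?C" using f by (simp add: S.ext_def)
        then obtain \<mu> where "\<mu> \<in> L" "dvd_in (R.ext A1) q (co j f - \<mu>)"
          using S.mod_const[OF q(1) c0(1) c0nz qc0] by blast
        then obtain w where "w \<in> R.ext A1" "co j f - \<mu> = q * w" by (auto simp: dvd_in_def)
        then show ?thesis using \<open>\<mu> \<in> L\<close> by (metis add.commute diff_add_cancel)
      qed simp
    qed
    then obtain \<mu> w where mw: "\<And>j. j \<in> J \<Longrightarrow> \<mu> j \<in> L \<and> w j \<in> R.ext A1 \<and> co j f = \<mu> j + q * w j" by metis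
    have "f = (\<Sum>j\<in>?I. j * co j f)" by (rule R.co_sum[OF fO])
    also have "\<dots> = (\<Sum>j\<in>?I. j * (\<mu> j + q * w j))" using mw by (intro sum.cong) auto
    also have "\<dots> = (\<Sum>j\<in>?I. j * \<mu> j) + q * (\<Sum>j\<in>?I. j * w j)"
      by (simp add: distrib_left sum.distrib sum_distrib_left mult_ac)
    finally have "f = (\<Sum>j\<in>?I. j * \<mu> j) + q * (\<Sum>j\<in>?I. j * w j)" .
    moreover have "(\<Sum>j\<in>?I. j * \<mu> j) \<in> L" using mw R.JL by (intro R.L.sum_in R.L.mult_in) auto
    moreover have "(\<Sum>j\<in>?I. j * w j) \<in> R.ext A1" using mw S.JB by (intro S.B.sum_in S.B.mult_in) auto
    ultimately show ?thesis by blast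
  qed
  \<comment> \<open>Expansion in powers of q by repeated division. The quotient w stays in
    \<open>L \<otimes> C\<close> because this ring is factorially closed, and its degree in x drops
    because q has positive degree.\<close>
  have CLq: "\<exists>F\<in>polys L. f = poly F q" if "f \<in> ?CL" for f
    using that
  proof (induction "dg f" arbitrary: f rule: less_induct)
    case less
    obtain \<mu> w where mw: "\<mu> \<in> L" "w \<in> R.ext A1" "f = \<mu> + q * w" using quot[OF less.prems] by blast
    show ?case
    proof (cases "w = 0")
      case True
      then show ?thesis using mw by (intro bexI[of _ "[:\<mu>:]"]) auto
    next
      case False
      have fO: "f \<in> Om" "w \<in> Om" using less.prems mw CLOm B1Om by blast+
      have mO: "\<mu> \<in> Om" using mw R.LB by blast
      have qw: "q * w = f - \<mu>" "q * w \<noteq> 0" using mw R.B.mult_nz[OF qOm fO(2) q0(1) False] by auto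
      have "f - \<mu> \<in> ?CL" using less.prems mw(1) E.LB E.B.diff_in by blast
      then have wCL: "w \<in> ?CL" using S.CL_closed[OF mw(2) q(2)] qw by (simp add: mult.commute)
      have "dg (q * w) = dg q + dg w" using dg_mult[OF qOm fO(2) q0(1) False] .
      moreover have "dg (q * w) \<le> dg f"
      proof -
        have "rep f = rep \<mu> + rep (q * w)" using rep_add[OF mO, of "q * w"] R.B.mult_in[OF qOm fO(2)] mw(3) by simp
        then have "rep (q * w) = rep f - rep \<mu>" by simp
        moreover have "degree (rep \<mu>) = 0" using Ldg[OF mw(1)] by (simp add: dg_def)
        ultimately show ?thesis unfolding dg_def by (metis degree_diff_le le0 order_refl)
      qed
      ultimately have "dg w < dg f" using dgq by linarith
      then obtain F where F: "F \<in> polys L" "w = poly F q" using less.hyps[OF _ wCL] by blast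
      then have "f = poly (pCons \<mu> F) q" using mw(3) by simp
      moreover have "pCons \<mu> F \<in> polys L" using R.L.pCons_in_polys mw(1) F(1) by blast
      ultimately show ?thesis by blast
    qed
  qed
  \<comment> \<open>Descent from L to K: q lies only in \<open>L \<otimes> C\<close>, but some
    coordinate s of it, which lies in C, has the same degree in x. As a polynomial in q it must be
    linear, so s generates \<open>L \<otimes> C\<close> over L as well.\<close>
  obtain j where j: "j \<in> J" "dg (co j q) = dg q" using dg_co(2)[OF qOm] by blast
  define s where "s = co j q"
  have sC: "s \<in> ?C" using qCL j by (simp add: S.ext_def s_def)
  have sOm: "s \<in> Om" using sC COm by blast
  have dgs: "dg s = dg q" using j by (simp add: s_def)
  obtain F where F: "F \<in> polys L" "s = poly F q" using CLq[of s] sC E.AB by blast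
  have FB: "F \<in> polys B" using F(1) polys_mono[OF T.LB] by blast
  have "F \<noteq> 0" using F(2) dgs dgq by (auto simp: dg_def rep_0)
  then have "dg q * degree F = dg q" using dg_poly[OF qOm dgq FB] F(2) dgs by simp
  then have "degree F = 1" using dgq by simp
  then obtain \<beta> \<alpha> where F2: "F = [:\<beta>, \<alpha>:]" "\<alpha> \<noteq> 0" by (metis degree1_coeffs)
  have ab: "\<beta> \<in> L" "\<alpha> \<in> L" using polys_coeff[OF F(1), of 0] polys_coeff[OF F(1), of 1] F2 by auto
  obtain v where v: "v \<in> L" "\<alpha> * v = e" using R.fieldL ab(2) F2(2) by (auto simp: subfield_in_def)
  have "v * (s - \<beta>) = (\<alpha> * v) * q" using F(2) F2(1) by (simp add: algebra_simps)
  then have qs: "q = v * (s - \<beta>)" using v(2) R.B.one_mult[OF qOm] by simp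
  interpret AdjL: rng_in e "adj L s" by (rule adj_rng_in(1)[OF R.L.rng_in_axioms R.B.one_mult[OF sOm]])
  have AdL: "L \<subseteq> adj L s" "s \<in> adj L s" using adj_rng_in(2,3)[OF R.L.rng_in_axioms R.B.one_mult[OF sOm]] by auto
  have "q \<in> adj L s" unfolding qs using AdL v(1) ab(1) by (intro AdjL.mult_in AdjL.diff_in) auto
  then have CLs: "f \<in> adj L s" if "f \<in> ?CL" for f
    using CLq[OF that] AdjL.poly_in polys_mono[OF AdL(1)] by blast
  have "?C \<subseteq> adj K s"
  proof
    fix c assume c: "c \<in> ?C"
    then obtain H where H: "H \<in> polys L" "c = poly H s" using CLs[of c] E.AB by (auto simp: adj_def)
    \<comment> \<open>The coordinate at e is the identity on C and replaces the coefficients in L by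
      coefficients in K.\<close>
    have HE: "H \<in> polys L \<Longrightarrow> map_poly (co e) H \<in> polys K \<and> co e (poly H s) = poly (map_poly (co e) H) s" for H
    proof (induction H rule: R.L.polys_induct)
      case zero
      then show ?case using R.co_zero[OF R.eJ] by (simp add: polys_def)
    next
      case (pCons a H)
      have "poly H s \<in> Om" using pCons(2) polys_mono[OF R.LB] sOm R.B.poly_in by blast
      moreover have "a \<in> Om" using pCons(1) R.LB by blast
      moreover have "s \<in> R" using sC CR by blast
      ultimately have "co e (poly (pCons a H) s) = co e a + s * co e (poly H s)"
        using R.co_add[of a "s * poly H s" e] R.co_mult[of s] sOm R.B.mult_in R.eJ by auto
      moreover have "map_poly (co e) (pCons a H) = pCons (co e a) (map_poly (co e) H)"
        using R.co_zero[OF R.eJ] by (intro poly_eqI) (auto simp: coeff_map_poly coeff_pCons split: nat.split)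
      moreover have "co e a \<in> K" using R.co_L[OF pCons(1) R.eJ] .
      ultimately show ?case using pCons.IH R.K.pCons_in_polys by simp
    qed
    have "co e c = c" using R.co_A[of c e] c CR R.eJ by auto
    then have "c = poly (map_poly (co e) H) s" using HE[OF H(1)] H(2) by simp
    then show "c \<in> adj K s" using HE[OF H(1)] unfolding adj_def by blast
  qed
  moreover have "adj K s \<subseteq> ?C" using adj_subset[OF S.C.rng_in_axioms S.KC sC] .
  moreover have "F = 0" if "F \<in> polys K" "poly F s = 0" for F
  proof (rule ccontr)
    assume "F \<noteq> 0"
    moreover have "F \<in> polys B" using that(1) polys_mono[OF order.trans[OF KA T.AB]] by blast
    ultimately show False using dg_poly[OF sOm] dgs dgq that(2) by auto
  qed
  ultimately show ?thesis using sC by blast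
qed

text \<open>Degrees are taken in x2. As x2 is a polynomial in x1 over A1, and hence over A2, the
  degree of x1 divides 1. An element of A2 has degree 0, so its expansion in powers of x1 with
  coefficients in A1 is constant.\<close>

lemma cylinder_subset_eq:
  assumes c1: "cylinder e K L J co R Om A1 x1 G1" and c2: "cylinder e K L J co R Om A2 x2 G2" and sub: "A1 \<subseteq> A2"
  shows "A1 = A2"
proof
  interpret c1: cylinder e K L J co R Om A1 x1 G1 by fact
  interpret c2: cylinder e K L J co R Om A2 x2 G2 by fact
  have polysA1: "polys A1 \<subseteq> polys c2.B" using polys_mono[OF order.trans[OF sub c2.T.AB]] .
  have rep1: "\<exists>F\<in>polys A1. w = poly F x1" if "w \<in> R" for w using that c1.R_eq by (auto simp: adj_def)
  have "poly [:0, e:] x2 = x2" using c1.R.B.one_mult[OF c2.xOm] by (simp add: mult.commute)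
  moreover have "[:0, e:] \<in> polys c2.B" using c2.T.B.one_in by (intro c2.T.B.pCons_in_polys) (auto simp: polys_def)
  ultimately have "c2.rep x2 = [:0, e:]" using c2.rep_poly by metis
  then have dx2: "c2.dg x2 = 1" using c2.T.B.one_nz by (simp add: c2.dg_def)
  obtain G where G: "G \<in> polys A1" "x2 = poly G x1" using rep1[OF c2.xR] by blast
  have "x2 \<notin> A2" using dx2 c2.dg_0_iff[OF c2.xOm] c2.T.AB by auto
  then have "x1 \<notin> A2" using G polys_mono[OF sub] c2.T.A.poly_in by blast
  then have dx1: "c2.dg x1 > 0" using c2.dg_0_iff[OF c1.xOm] c2.B_inter_R[OF c1.xR] by auto
  have "x2 \<noteq> 0" using dx2 c2.rep_0 by (metis c2.dg_def degree_0 zero_neq_one)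
  then have "G \<noteq> 0" using G by auto
  then have "c2.dg x1 * degree G = 1" using c2.dg_poly[OF c1.xOm dx1, of G] G polysA1 dx2 by auto
  then have dx1': "c2.dg x1 = 1" by simp
  show "A2 \<subseteq> A1"
  proof
    fix a assume a: "a \<in> A2"
    then obtain H where H: "H \<in> polys A1" "a = poly H x1" using rep1 c2.AR by blast
    show "a \<in> A1"
    proof (cases "H = 0")
      case True
      then show ?thesis using H c1.T.A.zero_in by simp
    next
      case False
      have "c2.dg a = 0" using c2.dg_0_iff a c2.T.AB c2.B_Om by blast
      then have "degree H = 0" using c2.dg_poly[OF c1.xOm dx1, of H] H polysA1 False dx1' by auto
      then obtain b where "H = [:b:]" by (auto elim: degree_eq_zeroE)
      then show ?thesis using H by simp
    qed
  qed
qed (rule sub)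

text \<open>The map \<sigma> rewrites polynomials in x1 over A1 as polynomials in x2 over A2. Pulled
  back along it, the Hasse derivatives with respect to x2 form a higher derivation of
  \<open>A1[x1]\<close>, whose invariants in A1 are the elements of A2; it is nontrivial on A1
  because A1 is not contained in A2.\<close>

lemma slice_exists:
  assumes c1: "cylinder e K L J co R Om A1 x1 G1" and c2: "cylinder e K L J co R Om A2 x2 G2" and nsub: "\<not> A1 \<subseteq> A2"
  shows "\<exists>d n t. slice e K L J co A1 (tens.ext J co Om A1) d n t \<and> A1 \<inter> A2 \<subseteq> exp_family.invs A1 d"
proof -
  interpret c1: cylinder e K L J co R Om A1 x1 G1 by fact
  interpret c2: cylinder e K L J co R Om A2 x2 G2 by fact
  interpret P1: dom_in "[:e:]" "polys A1" by (rule c1.T.A.polys_dom_in)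
  interpret H: exp_family "[:e:]" "polys A2" hasse by (rule c2.T.A.hasse_exp_family)
  define \<sigma> where "\<sigma> F = c2.rep (poly F x1)" for F
  have R1: "poly F x1 \<in> R" if "F \<in> polys A1" for F using that c1.R_eq by (auto simp: adj_def)
  have O1: "poly F x1 \<in> Om" if "F \<in> polys A1" for F using R1[OF that] c1.R.AB by blast
  have P1B: "polys A1 \<subseteq> polys c1.B" by (rule polys_mono[OF c1.T.AB])
  have bij: "bij_betw \<sigma> (polys A1) (polys A2)"
  proof (rule bij_betw_imageI)
    show "inj_on \<sigma> (polys A1)"
    proof (rule inj_onI)
      fix F G assume FG: "F \<in> polys A1" "G \<in> polys A1" "\<sigma> F = \<sigma> G"
      then have "poly F x1 = poly G x1" using c2.rep_in[OF O1] unfolding \<sigma>_def by metis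
      then show "F = G" using c1.poly_inj FG P1B by blast
    qed
    show "\<sigma> ` polys A1 = polys A2"
    proof
      show "\<sigma> ` polys A1 \<subseteq> polys A2" using c2.rep_R R1 by (auto simp: \<sigma>_def)
      show "polys A2 \<subseteq> \<sigma> ` polys A1"
      proof
        fix H assume H: "H \<in> polys A2"
        have "poly H x2 \<in> R" using H c2.R_eq by (auto simp: adj_def)
        then obtain F where F: "F \<in> polys A1" "poly H x2 = poly F x1" using c1.R_eq by (auto simp: adj_def)
        have "\<sigma> F = H" unfolding \<sigma>_def F(2)[symmetric] using c2.rep_poly H polys_mono[OF c2.T.AB] by blast
        then show "H \<in> \<sigma> ` polys A1" using F(1) by blast
      qed
    qed
  qed
  have add: "\<sigma> (F + G) = \<sigma> F + \<sigma> G" if "F \<in> polys A1" "G \<in> polys A1" for F G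
    using c2.rep_add[OF O1 O1, OF that] by (simp add: \<sigma>_def)
  have mult: "\<sigma> (F * G) = \<sigma> F * \<sigma> G" if "F \<in> polys A1" "G \<in> polys A1" for F G
    using c2.rep_mult[OF O1 O1, OF that] by (simp add: \<sigma>_def)
  define D where "D = (\<lambda>i F. inv_into (polys A1) \<sigma> (hasse i (\<sigma> F)))"
  have Dexp: "exp_family [:e:] (polys A1) D"
    unfolding D_def by (rule exp_family_transfer(1)[OF P1.dom_in_axioms H.exp_family_axioms bij add mult])
  interpret D: exp_family "[:e:]" "polys A1" D by (rule Dexp)
  have "D.invs = {F \<in> polys A1. \<sigma> F \<in> H.invs}"
    unfolding D_def by (rule exp_family_transfer(2)[OF P1.dom_in_axioms H.exp_family_axioms bij add mult])
  then have invs: "[:a:] \<in> D.invs \<longleftrightarrow> a \<in> A2" if a: "a \<in> A1" for a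
  proof -
    assume D: "D.invs = {F \<in> polys A1. \<sigma> F \<in> H.invs}"
    have s: "\<sigma> [:a:] = c2.rep a" by (simp add: \<sigma>_def)
    have aO: "a \<in> Om" using a c1.AR c1.R.AB by blast
    have "c2.rep a \<in> (\<lambda>a. [:a:]) ` A2 \<longleftrightarrow> a \<in> A2"
    proof
      assume "c2.rep a \<in> (\<lambda>a. [:a:]) ` A2"
      then obtain b where "b \<in> A2" "c2.rep a = [:b:]" by blast
      then show "a \<in> A2" using c2.rep_in[OF aO] by auto
    next
      assume "a \<in> A2"
      then show "c2.rep a \<in> (\<lambda>a. [:a:]) ` A2" using c2.rep_const c2.T.AB by blast
    qed
    then show ?thesis unfolding D c2.T.A.hasse_invs using s a by simp
  qed
  obtain a0 where a0: "a0 \<in> A1" "a0 \<notin> A2" using nsub by blast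
  then have "[:a0:] \<notin> D.invs" using invs by simp
  then obtain i0 where i0: "i0 > 0" "D i0 [:a0:] \<noteq> 0" using a0 by (auto simp: D.invs_def)
  obtain d where d: "exp_family e A1 d" "\<exists>a\<in>A1. a \<notin> exp_family.invs A1 d"
    "\<forall>a\<in>A1. [:a:] \<in> D.invs \<longrightarrow> a \<in> exp_family.invs A1 d"
    using exp_family_restrict[OF c1.T.A.dom_in_axioms Dexp c1.R.fieldK c1.KA c1.gen a0(1) i0] by blast
  have s2: "exp_surface e K L J co A1 c1.B d"
    using d(1) c1.T.tens_axioms c1.factA c1.factB c1.dep3 d(2)
    by (intro exp_surface.intro exp_surface_axioms.intro)
  interpret s2: exp_surface e K L J co A1 c1.B d by (rule s2)
  obtain n t where nt: "t \<in> A1" "n > 0" "degree (s2.gen t) = n" "\<And>a. a \<in> A1 \<Longrightarrow> n dvd degree (s2.gen a)"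
    "\<And>p b \<alpha> r. prime_in e s2.C p \<Longrightarrow> b \<in> A1 \<Longrightarrow> \<alpha> \<in> s2.C \<Longrightarrow> r \<in> s2.C \<Longrightarrow> algdep K [\<alpha>, p] \<Longrightarrow> \<alpha> * t - r = p * b \<Longrightarrow> dvd_in s2.C p \<alpha>"
    by (rule s2.exists_generator) (rule that)
  have "slice e K L J co A1 c1.B d n t"
    by (intro slice.intro s2 slice_axioms.intro nt)
  moreover have "A1 \<inter> A2 \<subseteq> exp_family.invs A1 d" using d(3) invs by blast
  ultimately show ?thesis by blast
qed

text \<open>If the first ring of invariants is K, then R = \<open>K[t1, x1]\<close> has two
  generators, so x2, t2 and c are dependent. Now x2 is transcendental over A2, which contains t2 and
  c, and t2 over the second ring of invariants, which contains c. So c is algebraic over K and hence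
  in K.\<close>

lemma const_curve:
  assumes c1: "cylinder e K L J co R Om A1 x1 G1" and c2: "cylinder e K L J co R Om A2 x2 G2"
    and s1: "slice e K L J co A1 (tens.ext J co Om A1) d1 n1 t1"
    and s2: "slice e K L J co A2 (tens.ext J co Om A2) d2 n2 t2"
    and K1: "exp_family.invs A1 d1 = K"
  shows "exp_family.invs A2 d2 = K"
proof -
  interpret c1: cylinder e K L J co R Om A1 x1 G1 by fact
  interpret c2: cylinder e K L J co R Om A2 x2 G2 by fact
  interpret s1: slice e K L J co A1 c1.B d1 n1 t1 by fact
  interpret s2: slice e K L J co A2 c2.B d2 n2 t2 by fact
  have "c \<in> K" if c: "c \<in> s2.C" for c
  proof -
    have cA: "c \<in> A2" using c s2.CA by blast
    have "A1 = adj K t1" using s1.A_eq_adj K1 by simp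
    then have R: "R = adjl K [x1, t1]" using c1.R_eq by simp
    have alg: "alg_in (adjl K [x1, t1]) y" if y: "y \<in> R" for y
    proof -
      have "[:- y, e:] \<in> polys R" using y c1.R.A.one_in c1.R.A.uminus_in
        by (intro c1.R.A.pCons_in_polys) (auto simp: polys_def)
      moreover have "poly [:- y, e:] y = 0" using c1.R.A.one_mult[OF y] by (simp add: mult.commute)
      moreover have "[:- y, e:] \<noteq> 0" using c1.R.A.one_nz by simp
      ultimately show ?thesis unfolding R[symmetric] alg_in_def by blast
    qed
    have mem: "t1 \<in> R" "t2 \<in> R" "c \<in> R" using s1.tA s2.tA cA c1.AR c2.AR by auto
    have "algdep K [x2, t2, c]"
    proof (rule algdep_counting[OF c1.R.A.dom_in_axioms c1.R.fieldK c1.R.KA])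
      show "set [x1, t1] \<subseteq> R" "set [x2, t2, c] \<subseteq> R" using mem c1.xR c2.xR by auto
      show "length [x1, t1] < length [x2, t2, c]" by simp
      show "alg_in (adjl K [x1, t1]) y" if "y \<in> set [x2, t2, c]" for y
        using alg that mem c2.xR by auto
    qed
    moreover have "\<not> alg_in (adjl K [t2, c]) x2"
    proof -
      have "adjl K [t2, c] \<subseteq> A2"
        using adjl_rng_in[OF c2.rngA c1.R.K.rng_in_axioms c2.KA, of "[t2, c]"] s2.tA cA by auto
      then show ?thesis using c2.transc polys_mono[of "adjl K [t2, c]" A2] unfolding alg_in_def by blast
    qed
    moreover have "\<not> alg_in (adjl K [c]) t2"
    proof -
      have "adjl K [c] \<subseteq> s2.C"
        using adjl_rng_in[OF s2.C.rng_in_axioms c1.R.K.rng_in_axioms s2.KC, of "[c]"] c by auto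
      then show ?thesis using s2.transc polys_mono[of "adjl K [c]" s2.C] unfolding alg_in_def by blast
    qed
    ultimately have "alg_in K c" by simp
    then show "c \<in> K" using c2.T.algebraic_const[OF cA] by blast
  qed
  then show ?thesis using s2.KC by blast
qed

text \<open>Suppose that C1 lies in A2. Then C1 lies in C2 by \<open>i2\<close>. Conversely C2 is
  algebraic over \<open>adj K z\<close> for an element z of C1 outside K, so it lies in A1, which is
  algebraically closed in R, and by \<open>i1\<close> in C1. This contradicts
  \<open>ne\<close>.\<close>

lemma curve_sticks_out:
  assumes c1: "cylinder e K L J co R Om A1 x1 G1" and c2: "cylinder e K L J co R Om A2 x2 G2"
    and s1: "slice e K L J co A1 (tens.ext J co Om A1) d1 n1 t1"
    and s2: "slice e K L J co A2 (tens.ext J co Om A2) d2 n2 t2"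
    and i1: "A1 \<inter> A2 \<subseteq> exp_family.invs A1 d1" and i2: "A1 \<inter> A2 \<subseteq> exp_family.invs A2 d2"
    and ne: "exp_family.invs A1 d1 \<noteq> exp_family.invs A2 d2" "exp_family.invs A1 d1 \<noteq> K"
  shows "\<not> exp_family.invs A1 d1 \<subseteq> A2"
proof
  interpret c1: cylinder e K L J co R Om A1 x1 G1 by fact
  interpret c2: cylinder e K L J co R Om A2 x2 G2 by fact
  interpret s1: slice e K L J co A1 c1.B d1 n1 t1 by fact
  interpret s2: slice e K L J co A2 c2.B d2 n2 t2 by fact
  assume sub: "s1.C \<subseteq> A2"
  then have 12: "s1.C \<subseteq> s2.C" using i2 s1.CA by blast
  obtain z where z: "z \<in> s1.C" "z \<notin> K" using ne(2) s1.KC by blast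
  have "s2.C \<subseteq> s1.C"
  proof
    fix c assume c: "c \<in> s2.C"
    have "\<not> alg_in K z" using c1.T.algebraic_const[of z] z s1.CA by blast
    moreover have "z \<in> s2.C" using z 12 by blast
    ultimately have "alg_in (adj K z) c" using s2.dep[OF c \<open>z \<in> s2.C\<close>] by simp
    moreover have "adj K z \<subseteq> A1" using adj_subset[OF c1.rngA c1.KA] z s1.CA by blast
    ultimately have "alg_in A1 c" using alg_in_mono by blast
    then have "c \<in> A1" using c1.alg_closed c s2.CA c2.AR by blast
    then show "c \<in> s1.C" using i1 c s2.CA by blast
  qed
  then show False using 12 ne(1) by blast
qed

theorem cylinder_cancellation:
  assumes c1: "cylinder e K L J co R Om A1 x1 G1" and c2: "cylinder e K L J co R Om A2 x2 G2"
  shows "\<exists>h. bij_betw h A1 A2 \<and> (\<forall>k\<in>K. h k = k) \<and>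
    (\<forall>a\<in>A1. \<forall>b\<in>A1. h (a + b) = h a + h b \<and> h (a * b) = h a * h b)"
proof (cases "A1 \<subseteq> A2 \<or> A2 \<subseteq> A1")
  case True
  then have "A1 = A2" using cylinder_subset_eq[OF c1 c2] cylinder_subset_eq[OF c2 c1] by blast
  then show ?thesis by (intro exI[of _ "\<lambda>x. x"]) (simp add: bij_betw_def)
next
  case False
  interpret c1: cylinder e K L J co R Om A1 x1 G1 by fact
  interpret c2: cylinder e K L J co R Om A2 x2 G2 by fact
  obtain d1 n1 t1 where s1: "slice e K L J co A1 c1.B d1 n1 t1" and i1: "A1 \<inter> A2 \<subseteq> exp_family.invs A1 d1"
    using slice_exists[OF c1 c2] False by blast
  obtain d2 n2 t2 where s2: "slice e K L J co A2 c2.B d2 n2 t2" and i2': "A2 \<inter> A1 \<subseteq> exp_family.invs A2 d2"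
    using slice_exists[OF c2 c1] False by blast
  then have i2: "A1 \<inter> A2 \<subseteq> exp_family.invs A2 d2" by blast
  interpret s1: slice e K L J co A1 c1.B d1 n1 t1 by (rule s1)
  interpret s2: slice e K L J co A2 c2.B d2 n2 t2 by (rule s2)
  have et: "e * t1 = t1" "e * t2 = t2"
    using c1.T.A.one_mult[OF s1.tA] c2.T.A.one_mult[OF s2.tA] by auto
  have lift: ?thesis
    if g: "bij_betw g s1.C s2.C" "\<forall>k\<in>K. g k = k"
      "\<forall>a\<in>s1.C. \<forall>b\<in>s1.C. g (a + b) = g a + g b \<and> g (a * b) = g a * g b" for g
  proof -
    obtain h where h: "bij_betw h (adj s1.C t1) (adj s2.C t2)" "\<forall>c\<in>s1.C. h c = g c"
      "\<forall>a\<in>adj s1.C t1. \<forall>b\<in>adj s1.C t1. h (a + b) = h a + h b \<and> h (a * b) = h a * h b"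
      using adj_lift_iso[OF s1.C.rng_in_axioms s2.C.rng_in_axioms et s1.transc s2.transc g(1)] g(3) by blast
    have "\<forall>k\<in>K. h k = k" using h(2) g(2) s1.KC by auto
    then show ?thesis using h(1,3) unfolding s1.A_eq_adj[symmetric] s2.A_eq_adj[symmetric] by blast
  qed
  show ?thesis
  proof (cases "s1.C = s2.C")
    case True
    then show ?thesis using lift[of "\<lambda>x. x"] by (simp add: bij_betw_def)
  next
    case ne: False
    have K: "s1.C \<noteq> K" "s2.C \<noteq> K"
      using ne const_curve[OF c1 c2 s1 s2] const_curve[OF c2 c1 s2 s1] by auto
    have o1: "\<not> s1.C \<subseteq> A2" using curve_sticks_out[OF c1 c2 s1 s2 i1 i2 ne K(1)] .
    have o2: "\<not> s2.C \<subseteq> A1" using curve_sticks_out[OF c2 c1 s2 s1 i2' _ ne[symmetric] K(2)] i1 by blast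
    obtain u1 where u1: "u1 \<in> s1.C" "s1.C = adj K u1" "\<And>F. F \<in> polys K \<Longrightarrow> poly F u1 = 0 \<Longrightarrow> F = 0"
      using c2.curve_is_line[OF s1 c1.AR o1 K(1)] by blast
    obtain u2 where u2: "u2 \<in> s2.C" "s2.C = adj K u2" "\<And>F. F \<in> polys K \<Longrightarrow> poly F u2 = 0 \<Longrightarrow> F = 0"
      using c1.curve_is_line[OF s2 c2.AR o2 K(2)] by blast
    have eu: "e * u1 = u1" "e * u2 = u2"
      using s1.C.one_mult[OF u1(1)] s2.C.one_mult[OF u2(1)] by auto
    obtain g where g: "bij_betw g (adj K u1) (adj K u2)" "\<forall>k\<in>K. g k = k"
      "\<forall>a\<in>adj K u1. \<forall>b\<in>adj K u1. g (a + b) = g a + g b \<and> g (a * b) = g a * g b"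
      using adj_id_iso[OF c1.R.K.rng_in_axioms c1.R.K.rng_in_axioms eu refl u1(3) u2(3)] by blast
    show ?thesis using lift[of g] g unfolding u1(2)[symmetric] u2(2)[symmetric] by blast
  qed
qed


section \<open>Rings given by records inside a type-class ring\<close>

text \<open>
  The type \<open>'a crt\<close> is \<open>int\<close> times the product of all commutative rings with carrier in \<open>'a\<close>.
  Each such ring \<open>R\<close> embeds into it (not unitally) as a factor, so that one can calculate
  in a ring given as a record with the tools for the type class \<^class>\<open>comm_ring_1\<close>.
\<close>

typedef 'a crt = "{f :: int \<times> ('a ring \<Rightarrow> 'a). \<forall>R. if cring R then snd f R \<in> carrier R else snd f R = undefined}"
proof -
  have "(0, \<lambda>R. if cring R then \<zero>\<^bsub>R\<^esub> else undefined) \<in>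
      {f :: int \<times> ('a ring \<Rightarrow> 'a). \<forall>R. if cring R then snd f R \<in> carrier R else snd f R = undefined}"
    by (auto simp: cring.cring_simprules)
  then show ?thesis by blast
qed

setup_lifting type_definition_crt

instantiation crt :: (type) comm_ring_1
begin

lift_definition zero_crt :: "'a crt" is "(0, \<lambda>R. if cring R then \<zero>\<^bsub>R\<^esub> else undefined)"
  by (auto simp: cring.cring_simprules)

lift_definition one_crt :: "'a crt" is "(1, \<lambda>R. if cring R then \<one>\<^bsub>R\<^esub> else undefined)"
  by (auto simp: cring.cring_simprules)

lift_definition plus_crt :: "'a crt \<Rightarrow> 'a crt \<Rightarrow> 'a crt"
  is "\<lambda>f g. (fst f + fst g, \<lambda>R. if cring R then snd f R \<oplus>\<^bsub>R\<^esub> snd g R else undefined)"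
  by (auto simp: cring.cring_simprules split: if_splits)

lift_definition times_crt :: "'a crt \<Rightarrow> 'a crt \<Rightarrow> 'a crt"
  is "\<lambda>f g. (fst f * fst g, \<lambda>R. if cring R then snd f R \<otimes>\<^bsub>R\<^esub> snd g R else undefined)"
  by (auto simp: cring.cring_simprules split: if_splits)

lift_definition uminus_crt :: "'a crt \<Rightarrow> 'a crt"
  is "\<lambda>f. (- fst f, \<lambda>R. if cring R then \<ominus>\<^bsub>R\<^esub> snd f R else undefined)"
  by (auto simp: cring.cring_simprules split: if_splits)

definition minus_crt :: "'a crt \<Rightarrow> 'a crt \<Rightarrow> 'a crt" where "minus_crt f g = f + - g"

instance
proof
  fix a b c :: "'a crt"
  show "a + b + c = a + (b + c)" by transfer (auto simp: fun_eq_iff cring.cring_simprules)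
  show "a + b = b + a" by transfer (auto simp: fun_eq_iff cring.cring_simprules)
  show "0 + a = a" by transfer (auto simp: fun_eq_iff cring.cring_simprules prod_eq_iff)
  show "- a + a = 0" by transfer (auto simp: fun_eq_iff cring.cring_simprules)
  show "a - b = a + - b" by (simp add: minus_crt_def)
  show "a * b * c = a * (b * c)" by transfer (auto simp: fun_eq_iff cring.cring_simprules)
  show "a * b = b * a" by transfer (auto simp: fun_eq_iff cring.cring_simprules)
  show "1 * a = a" by transfer (auto simp: fun_eq_iff cring.cring_simprules prod_eq_iff)
  show "(a + b) * c = a * c + b * c" by transfer (auto simp: fun_eq_iff cring.cring_simprules distrib_right)
  \<comment> \<open>This is what the factor \<open>int\<close> is for: if \<open>'a\<close> has only
    one element, every ring with carrier in \<open>'a\<close> is trivial.\<close>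
  show "(0::'a crt) \<noteq> 1" by transfer simp
qed

end

text \<open>The product is indexed by plain records of type \<open>'a ring\<close>, so the further
  fields of a ring or module record have to be dropped.\<close>

definition ring_part :: "('a, 'm) ring_scheme \<Rightarrow> 'a ring"
  where "ring_part R = \<lparr>carrier = carrier R, monoid.mult = monoid.mult R, monoid.one = monoid.one R,
     ring.zero = ring.zero R, ring.add = ring.add R\<rparr>"

lemma ring_part_simps [simp]:
  "carrier (ring_part R) = carrier R" "monoid.mult (ring_part R) = monoid.mult R" "monoid.one (ring_part R) = monoid.one R"
  "ring.zero (ring_part R) = ring.zero R" "ring.add (ring_part R) = ring.add R"
  by (simp_all add: ring_part_def)

lemma ring_part_cring: "cring R \<Longrightarrow> cring (ring_part R)"
proof -
  assume "cring R"
  then interpret R: cring R .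
  have neg: "\<exists>y\<in>carrier R. y \<oplus>\<^bsub>R\<^esub> x = \<zero>\<^bsub>R\<^esub>" if "x \<in> carrier R" for x
    using R.l_neg[OF that] R.a_inv_closed[OF that] by blast
  show ?thesis
    by (intro cringI abelian_groupI comm_monoidI; unfold ring_part_simps)
      (simp_all add: R.m_ac R.a_ac R.l_distr R.r_distr neg)
qed

lift_definition emb_aux :: "'a ring \<Rightarrow> 'a \<Rightarrow> 'a crt"
  is "\<lambda>S a. (0, \<lambda>R. if cring R then if R = S \<and> a \<in> carrier S then a else \<zero>\<^bsub>R\<^esub> else undefined)"
  by (auto simp: cring.cring_simprules)

definition emb :: "('a, 'm) ring_scheme \<Rightarrow> 'a \<Rightarrow> 'a crt"
  where "emb R = emb_aux (ring_part R)"

definition emb_one :: "('a, 'm) ring_scheme \<Rightarrow> 'a crt"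
  where "emb_one R = emb R \<one>\<^bsub>R\<^esub>"

definition img :: "('a, 'm) ring_scheme \<Rightarrow> 'a crt set"
  where "img R = emb R ` carrier R"

context cring
begin

lemma emb_add:
  assumes "a \<in> carrier R" "b \<in> carrier R"
  shows "emb R (a \<oplus> b) = emb R a + emb R b"
proof -
  have "\<zero>\<^bsub>S\<^esub> \<oplus>\<^bsub>S\<^esub> \<zero>\<^bsub>S\<^esub> = \<zero>\<^bsub>S\<^esub>" if "cring S" for S :: "'a ring"
    using that by (simp add: cring.cring_simprules)
  then show ?thesis
    unfolding emb_def using assms a_closed[OF assms] by (simp add: Rep_crt_inject[symmetric] emb_aux.rep_eq plus_crt.rep_eq fun_eq_iff)
qed

lemma emb_mult:
  assumes "a \<in> carrier R" "b \<in> carrier R"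
  shows "emb R (a \<otimes> b) = emb R a * emb R b"
proof -
  have "\<zero>\<^bsub>S\<^esub> \<otimes>\<^bsub>S\<^esub> \<zero>\<^bsub>S\<^esub> = \<zero>\<^bsub>S\<^esub>" if "cring S" for S :: "'a ring"
  proof -
    interpret S: cring S by fact
    show ?thesis by simp
  qed
  then show ?thesis
    unfolding emb_def using assms m_closed[OF assms] by (simp add: Rep_crt_inject[symmetric] emb_aux.rep_eq times_crt.rep_eq fun_eq_iff)
qed

lemma emb_zero: "emb R \<zero> = 0"
  unfolding emb_def by transfer (auto simp: fun_eq_iff)

lemma emb_inj: "a \<in> carrier R \<Longrightarrow> b \<in> carrier R \<Longrightarrow> emb R a = emb R b \<longleftrightarrow> a = b"
  unfolding emb_def using ring_part_cring[OF is_cring]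
  by transfer (auto simp: fun_eq_iff dest: spec[of _ "ring_part R"])

lemma emb_eq_0: "a \<in> carrier R \<Longrightarrow> emb R a = 0 \<longleftrightarrow> a = \<zero>"
  using emb_inj[of a \<zero>] emb_zero by simp

lemma emb_uminus: "a \<in> carrier R \<Longrightarrow> emb R (\<ominus> a) = - emb R a"
  using emb_add[of a "\<ominus> a"] by (simp add: r_neg emb_zero eq_neg_iff_add_eq_0 add.commute)

lemma emb_minus: "a \<in> carrier R \<Longrightarrow> b \<in> carrier R \<Longrightarrow> emb R (a \<ominus> b) = emb R a - emb R b"
  by (simp add: a_minus_def emb_add emb_uminus)

lemma emb_rng_in:
  assumes "subring S R"
  shows "rng_in (emb_one R) (emb R ` S)"
proof -
  interpret S: subring S R by fact
  have sub: "a \<in> carrier R" if "a \<in> S" for a using that S.subset by blast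
  show ?thesis
  proof
    show "emb_one R \<in> emb R ` S" unfolding emb_one_def using S.one_closed by blast
    fix a b assume "a \<in> emb R ` S" "b \<in> emb R ` S"
    then obtain x y where xy: "x \<in> S" "y \<in> S" "a = emb R x" "b = emb R y" by blast
    show "emb_one R * a = a" using sub[OF xy(1)] emb_mult[of \<one> x] xy(3) by (simp add: emb_one_def)
    have "x \<ominus> y \<in> S" using xy subringE(5,7)[OF assms] by (auto simp: a_minus_def)
    then show "a - b \<in> emb R ` S" using emb_minus[OF sub sub, OF xy(1,2)] xy(3,4) by (metis image_eqI)
    show "a * b \<in> emb R ` S" using emb_mult[OF sub sub, OF xy(1,2)] S.m_closed[OF xy(1,2)] xy(3,4) by (metis image_eqI)
  qed
qed

lemma img_rng_in: "rng_in (emb_one R) (img R)"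
  unfolding img_def by (rule emb_rng_in[OF carrier_is_subring])

end

lemma (in field) emb_subfield_in:
  assumes "subfield K R"
  shows "subfield_in (emb_one R) (emb R ` K)"
proof -
  interpret K: subfield K R by fact
  have sub: "a \<in> carrier R" if "a \<in> K" for a using that K.subset by blast
  have "rng_in (emb_one R) (emb R ` K)" by (rule emb_rng_in[OF K.subring_axioms])
  moreover have "\<exists>v\<in>emb R ` K. k * v = emb_one R" if k: "k \<in> emb R ` K" "k \<noteq> 0" for k
  proof -
    obtain x where x: "x \<in> K" "k = emb R x" using k by blast
    then have "x \<in> K - {\<zero>}" using k(2) emb_zero by auto
    then have "inv x \<in> K" "x \<otimes> inv x = \<one>" using subfield_m_inv[OF assms] by auto
    then show ?thesis using x emb_mult[of x "inv x"] sub by (auto simp: emb_one_def)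
  qed
  ultimately show ?thesis using emb_eq_0[OF one_closed] one_not_zero by (auto simp: subfield_in_def emb_one_def)
qed

section \<open>Embedded record rings: polynomials, generators, factoriality\<close>

locale ring_embed = cring R for R (structure) +
  fixes h :: "'a \<Rightarrow> 'r::comm_ring_1"
  assumes h_add: "a \<in> carrier R \<Longrightarrow> b \<in> carrier R \<Longrightarrow> h (a \<oplus> b) = h a + h b"
    and h_mult: "a \<in> carrier R \<Longrightarrow> b \<in> carrier R \<Longrightarrow> h (a \<otimes> b) = h a * h b"
    and h_inj: "a \<in> carrier R \<Longrightarrow> b \<in> carrier R \<Longrightarrow> h a = h b \<Longrightarrow> a = b"
begin

lemma h_zero [simp]: "h \<zero> = 0"
  using h_add[of \<zero> \<zero>] by simp

lemma h_uminus: "a \<in> carrier R \<Longrightarrow> h (\<ominus> a) = - h a"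
  using h_add[of a "\<ominus> a"] by (simp add: r_neg eq_neg_iff_add_eq_0 add.commute)

lemma h_finsum: "finite I \<Longrightarrow> (\<And>i. i \<in> I \<Longrightarrow> f i \<in> carrier R) \<Longrightarrow> h (finsum R f I) = (\<Sum>i\<in>I. h (f i))"
proof (induction I rule: finite_induct)
  case (insert i I)
  then have "finsum R f I \<in> carrier R" by (intro finsum_closed) auto
  then show ?case using insert by (simp add: finsum_insert Pi_def h_add)
qed simp

definition up_poly :: "(nat \<Rightarrow> 'a) \<Rightarrow> 'r poly"
  where "up_poly p = Abs_poly (\<lambda>n. h (p n))"

lemma coeff_up_poly: "p \<in> up R \<Longrightarrow> poly.coeff (up_poly p) n = h (p n)"
proof -
  assume "p \<in> up R"
  then obtain N where "bound \<zero> N p" by blast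
  then have z: "h (p n) = 0" if "n > N" for n using that by (simp add: bound_def)
  show ?thesis unfolding up_poly_def by (rule fun_cong[OF coeff_Abs_poly[OF z]])
qed

lemma up_poly_in: "p \<in> up R \<Longrightarrow> up_poly p \<in> polys (h ` carrier R)"
  by (auto simp: polys_def coeff_up_poly)

lemma up_poly_inj: "p \<in> up R \<Longrightarrow> q \<in> up R \<Longrightarrow> up_poly p = up_poly q \<Longrightarrow> p = q"
proof (rule ext)
  fix n
  assume "p \<in> up R" "q \<in> up R" "up_poly p = up_poly q"
  then show "p n = q n" using coeff_up_poly[of p n] coeff_up_poly[of q n] h_inj[of "p n" "q n"] by auto
qed

lemma up_poly_surj: "q \<in> polys (h ` carrier R) \<Longrightarrow> \<exists>p\<in>up R. up_poly p = q"
proof -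
  assume q: "q \<in> polys (h ` carrier R)"
  define p where "p n = (if poly.coeff q n = 0 then \<zero> else inv_into (carrier R) h (poly.coeff q n))" for n
  have p: "p n \<in> carrier R \<and> h (p n) = poly.coeff q n" for n
    using polys_coeff[OF q, of n] by (auto simp: p_def inv_into_into f_inv_into_f)
  have "bound \<zero> (degree q) p" by (rule bound.intro) (simp add: p_def coeff_eq_0)
  then have "p \<in> up R" using p by blast
  moreover from this have "up_poly p = q" using p by (intro poly_eqI) (simp add: coeff_up_poly)
  ultimately show ?thesis by blast
qed

lemma up_poly_add:
  assumes "p \<in> up R" "q \<in> up R"
  shows "up_poly (p \<oplus>\<^bsub>UP R\<^esub> q) = up_poly p + up_poly q"
proof (rule poly_eqI)
  fix n
  have "p \<oplus>\<^bsub>UP R\<^esub> q = (\<lambda>i. p i \<oplus> q i)" using assms by (simp add: UP_def)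
  then show "poly.coeff (up_poly (p \<oplus>\<^bsub>UP R\<^esub> q)) n = poly.coeff (up_poly p + up_poly q) n"
    using assms up_add_closed[OF assms] by (simp add: coeff_up_poly h_add mem_upD)
qed

lemma up_poly_mult:
  assumes "p \<in> up R" "q \<in> up R"
  shows "up_poly (p \<otimes>\<^bsub>UP R\<^esub> q) = up_poly p * up_poly q"
proof (rule poly_eqI)
  fix n
  have eq: "p \<otimes>\<^bsub>UP R\<^esub> q = (\<lambda>n. \<Oplus>i\<in>{..n}. p i \<otimes> q (n - i))" using assms by (simp add: UP_def)
  have "h (\<Oplus>i\<in>{..n}. p i \<otimes> q (n - i)) = (\<Sum>i\<le>n. h (p i \<otimes> q (n - i)))"
    using assms by (intro h_finsum) auto
  then show "poly.coeff (up_poly (p \<otimes>\<^bsub>UP R\<^esub> q)) n = poly.coeff (up_poly p * up_poly q) n"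
    using assms up_mult_closed[OF assms] unfolding eq by (simp add: coeff_up_poly coeff_mult h_mult mem_upD)
qed

lemma up_poly_const: "a \<in> carrier R \<Longrightarrow> up_poly (\<lambda>n. if n = 0 then a else \<zero>) = [:h a:]"
proof -
  assume a: "a \<in> carrier R"
  then have "(\<lambda>n. if n = 0 then a else \<zero>) \<in> up R" by (intro mem_upI exI[of _ 0] bound.intro) auto
  then show ?thesis by (intro poly_eqI) (simp add: coeff_up_poly coeff_pCons split: nat.split)
qed

lemma image_rng_in: "rng_in (h \<one>) (h ` carrier R)"
proof
  show "h \<one> \<in> h ` carrier R" by blast
  fix a b assume "a \<in> h ` carrier R" "b \<in> h ` carrier R"
  then obtain x y where xy: "x \<in> carrier R" "y \<in> carrier R" "a = h x" "b = h y" by blast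
  show "h \<one> * a = a" using h_mult[of \<one> x] xy by simp
  have "a - b = h (x \<oplus> (\<ominus> y))" "a * b = h (x \<otimes> y)" using xy by (simp_all add: h_add h_uminus h_mult)
  then show "a - b \<in> h ` carrier R" "a * b \<in> h ` carrier R" using xy by auto
qed

lemma image_fin_gen_in:
  assumes "H \<subseteq> carrier R" "finite G" "generate_ring R (H \<union> G) = carrier R"
  shows "fin_gen_in (h \<one>) (h ` H) (h ` carrier R) (h ` G)"
proof -
  have GR: "G \<subseteq> carrier R" using assms(3) generate_ring.incl[of _ "H \<union> G" R] by blast
  have "S = h ` carrier R" if S: "rng_in (h \<one>) S" "S \<subseteq> h ` carrier R" "h ` H \<subseteq> S" "h ` G \<subseteq> S" for S
  proof -
    interpret S: rng_in "h \<one>" S by fact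
    have car: "y \<in> carrier R" if "y \<in> generate_ring R (H \<union> G)" for y using that assms(3) by simp
    have "h y \<in> S" if "y \<in> generate_ring R (H \<union> G)" for y
      using that
    proof (induction rule: generate_ring.induct)
      case one
      then show ?case by (rule S.one_in)
    next
      case (incl y)
      then show ?case using S(3,4) by blast
    next
      case (a_inv y)
      then show ?case using h_uminus[OF car[OF a_inv(1)]] S.uminus_in by simp
    next
      case (eng_add y z)
      then show ?case using h_add[OF car car, OF eng_add(1,2)] S.add_in by simp
    next
      case (eng_mult y z)
      then show ?case using h_mult[OF car car, OF eng_mult(1,2)] S.mult_in by simp
    qed
    then show ?thesis using S(2) assms(3) by blast
  qed
  then show ?thesis using assms GR unfolding fin_gen_in_def by blast
qed

end

context ring_embed
begin

lemma h_eq_iff: "a \<in> carrier R \<Longrightarrow> b \<in> carrier R \<Longrightarrow> h a = h b \<longleftrightarrow> a = b"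
  using h_inj by blast

lemma h_eq_0: "a \<in> carrier R \<Longrightarrow> h a = 0 \<longleftrightarrow> a = \<zero>"
  using h_eq_iff[of a \<zero>] by simp

lemma image_dom_in: "domain R \<Longrightarrow> dom_in (h \<one>) (h ` carrier R)"
proof (intro dom_in.intro image_rng_in dom_in_axioms.intro)
  assume "domain R"
  then interpret D: domain R .
  show "h \<one> \<noteq> 0" using h_eq_0[OF one_closed] D.one_not_zero by simp
  fix a b assume "a \<in> h ` carrier R" "b \<in> h ` carrier R" and ab: "a * b = 0"
  then obtain x y where xy: "x \<in> carrier R" "y \<in> carrier R" "a = h x" "b = h y" by blast
  then have "x \<otimes> y = \<zero>" using ab h_mult[of x y] h_eq_0[of "x \<otimes> y"] by simp
  then show "a = 0 \<or> b = 0" using xy D.integral_iff by auto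
qed

end

lemma (in factorial_domain) image_factorial_in:
  fixes h :: "'a \<Rightarrow> 'r::comm_ring_1"
  assumes "ring_embed R h"
  shows "factorial_in (h \<one>) (h ` carrier R)"
proof -
  interpret H: ring_embed R h by fact
  interpret I: dom_in "h \<one>" "h ` carrier R" by (rule H.image_dom_in[OF domain_axioms])
  have un: "unit_in (h \<one>) (h ` carrier R) (h u) \<longleftrightarrow> u \<in> Units R" if u: "u \<in> carrier R" for u
  proof
    assume "unit_in (h \<one>) (h ` carrier R) (h u)"
    then obtain v where v: "v \<in> carrier R" "h u * h v = h \<one>" by (auto simp: unit_in_def)
    then have "u \<otimes> v = \<one>" using H.h_eq_iff[of "u \<otimes> v" \<one>] H.h_mult[OF u v(1)] u by simp
    then show "u \<in> Units R" using u v(1) m_comm[OF u v(1)] unfolding Units_def by auto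
  next
    assume "u \<in> Units R"
    then obtain v where "v \<in> carrier R" "u \<otimes> v = \<one>" by (auto simp: Units_def)
    then show "unit_in (h \<one>) (h ` carrier R) (h u)"
      using u H.h_mult[of u v] by (auto simp: unit_in_def)
  qed
  have dv: "dvd_in (h ` carrier R) (h a) (h b) \<longleftrightarrow> a divides b" if ab: "a \<in> carrier R" "b \<in> carrier R" for a b
  proof
    assume "dvd_in (h ` carrier R) (h a) (h b)"
    then obtain c where c: "c \<in> carrier R" "h b = h a * h c" by (auto simp: dvd_in_def)
    then have "b = a \<otimes> c" using H.h_eq_iff[of b "a \<otimes> c"] H.h_mult[of a c] ab by simp
    then show "a divides b" using c(1) by (auto simp: factor_def)
  next
    assume "a divides b"
    then obtain c where "c \<in> carrier R" "b = a \<otimes> c" by (auto simp: factor_def)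
    then show "dvd_in (h ` carrier R) (h a) (h b)" using H.h_mult[of a c] ab by (auto simp: dvd_in_def)
  qed
  have pr: "prime_in (h \<one>) (h ` carrier R) (h p)" if p: "p \<in> carrier R - {\<zero>}" "Divisibility.prime (mult_of R) p" for p
  proof -
    have pR: "p \<in> carrier R" "p \<noteq> \<zero>" using p by auto
    have pnu: "p \<notin> Units R" using p(2) by (auto simp: Divisibility.prime_def)
    \<comment> \<open>Primality in \<open>mult_of R\<close> concerns nonzero elements only; products
      with a zero factor are added by hand.\<close>
    have pdiv: "p divides a \<or> p divides b" if ab: "a \<in> carrier R" "b \<in> carrier R" "p divides (a \<otimes> b)" for a b
    proof (cases "a = \<zero> \<or> b = \<zero>")
      case True
      then show ?thesis using pR by (auto simp: factor_def intro!: bexI[of _ \<zero>])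
    next
      case False
      then have "a \<in> carrier (mult_of R)" "b \<in> carrier (mult_of R)" using ab by auto
      moreover have "p divides\<^bsub>mult_of R\<^esub> (a \<otimes>\<^bsub>mult_of R\<^esub> b)"
        using divides_imp_divides_mult[OF pR(1) _ ab(3)] ab False integral_iff by auto
      ultimately have "p divides\<^bsub>mult_of R\<^esub> a \<or> p divides\<^bsub>mult_of R\<^esub> b"
        using p(2) unfolding Divisibility.prime_def by auto
      then show ?thesis using divides_mult_imp_divides[of R p a] divides_mult_imp_divides[of R p b] by blast
    qed
    show ?thesis unfolding prime_in_def
    proof (intro conjI ballI impI)
      show "h p \<in> h ` carrier R" "h p \<noteq> 0" using pR H.h_eq_0 by auto
      show "\<not> unit_in (h \<one>) (h ` carrier R) (h p)" using un pR pnu by simp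
      fix a b assume "a \<in> h ` carrier R" "b \<in> h ` carrier R" and d: "dvd_in (h ` carrier R) (h p) (a * b)"
      then obtain x y where xy: "x \<in> carrier R" "y \<in> carrier R" "a = h x" "b = h y" by auto
      then have "p divides (x \<otimes> y)" using d dv[of p "x \<otimes> y"] H.h_mult[of x y] pR by simp
      then show "dvd_in (h ` carrier R) (h p) a \<or> dvd_in (h ` carrier R) (h p) b" using pdiv xy dv pR by auto
    qed
  qed
  have list: "h (foldr (\<otimes>) fs \<one>) = h \<one> * prod_list (map h fs) \<and> foldr (\<otimes>) fs \<one> \<in> carrier R"
    if "set fs \<subseteq> carrier R" for fs
    using that
  proof (induction fs)
    case Nil
    then show ?case by simp
  next
    case (Cons f fs)
    then show ?case by (simp add: H.h_mult mult.left_commute)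
  qed
  have "\<exists>n. prime_fact (h \<one>) (h ` carrier R) n a" if a: "a \<in> h ` carrier R" "a \<noteq> 0" for a
  proof -
    obtain x where x: "x \<in> carrier R" "a = h x" using a by auto
    then have x0: "x \<noteq> \<zero>" using a H.h_zero by auto
    show ?thesis
    proof (cases "x \<in> Units R")
      case True
      then show ?thesis using un x I.prime_fact_0 by blast
    next
      case False
      then have "x \<in> carrier (mult_of R)" "x \<notin> Units (mult_of R)" using x x0 by auto
      then obtain fs where fs: "set fs \<subseteq> carrier (mult_of R)" "factors (mult_of R) fs x"
        using factors_exist by blast
      have irr: "\<forall>f\<in>set fs. Divisibility.prime (mult_of R) f"
        using fs irreducible_prime by (auto simp: factors_def)
      have fsR: "set fs \<subseteq> carrier R" using fs(1) by auto
      have "foldr (\<otimes>) fs \<one> = x" using fs(2) by (simp add: factors_def)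
      then have "a = h \<one> * prod_list (map h fs)" using list[OF fsR] x by simp
      moreover have "\<forall>p\<in>set (map h fs). prime_in (h \<one>) (h ` carrier R) p"
        using pr irr fs(1) by auto
      ultimately show ?thesis unfolding prime_fact_def using I.unit_one by blast
    qed
  qed
  then show ?thesis using I.dom_in_axioms by (auto simp: factorial_in_def)
qed

lemma (in cring) emb_ring_embed: "ring_embed R (emb R)"
  by unfold_locales (auto simp: emb_add emb_mult emb_inj)

lemma (in domain) img_dom_in: "dom_in (emb_one R) (img R)"
  using ring_embed.image_dom_in[OF emb_ring_embed domain_axioms] by (simp add: emb_one_def img_def)

lemma (in factorial_domain) img_factorial_in: "factorial_in (emb_one R) (img R)"
  using image_factorial_in[OF emb_ring_embed] by (simp add: emb_one_def img_def)


section \<open>Coordinates over a subfield\<close>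

definition indep_in :: "'r::comm_ring_1 set \<Rightarrow> 'r set \<Rightarrow> bool"
  where "indep_in K J \<longleftrightarrow> (\<forall>F c. finite F \<longrightarrow> F \<subseteq> J \<longrightarrow> (\<forall>j. c j \<in> K) \<longrightarrow> (\<Sum>j\<in>F. c j * j) = 0 \<longrightarrow> (\<forall>j\<in>F. c j = 0))"

lemma indep_inD:
  "indep_in K J \<Longrightarrow> finite F \<Longrightarrow> F \<subseteq> J \<Longrightarrow> (\<And>j. c j \<in> K) \<Longrightarrow> (\<Sum>j\<in>F. c j * j) = 0 \<Longrightarrow> j \<in> F \<Longrightarrow> c j = 0"
  unfolding indep_in_def by simp

text \<open>Zorn's lemma above \<open>{e}\<close>: with e in the basis, the coordinate at e is the
  identity on the smaller ring, which is how elements of \<open>L \<otimes> A\<close> that lie in A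
  or in K are recognized.\<close>

lemma exists_maximal_indep:
  assumes e: "e \<in> V" "indep_in K {e}"
  shows "\<exists>J. J \<subseteq> V \<and> e \<in> J \<and> indep_in K J \<and> (\<forall>J'. J \<subseteq> J' \<and> J' \<subseteq> V \<and> indep_in K J' \<longrightarrow> J' = J)"
proof -
  let ?A = "{J. J \<subseteq> V \<and> e \<in> J \<and> indep_in K J}"
  have "\<exists>M\<in>?A. \<forall>X\<in>?A. M \<subseteq> X \<longrightarrow> X = M"
  proof (rule subset_Zorn_nonempty)
    show "?A \<noteq> {}" using e by auto
    fix C assume C: "C \<noteq> {}" "subset.chain ?A C"
    have sub: "C \<subseteq> ?A" using C(2) by (simp add: subset_chain_def)
    have "indep_in K (\<Union>C)"
      unfolding indep_in_def
    proof (intro allI impI)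
      fix F c assume F: "finite F" "F \<subseteq> \<Union>C" "\<forall>j. c j \<in> K" "(\<Sum>j\<in>F. c j * j) = 0"
      obtain X where "X \<in> C" "F \<subseteq> X" using finite_subset_Union_chain[OF F(1,2) C] by blast
      moreover have "indep_in K X" using sub \<open>X \<in> C\<close> by blast
      ultimately show "\<forall>j\<in>F. c j = 0" using indep_inD[of K X F c] F by blast
    qed
    then show "\<Union>C \<in> ?A" using sub C(1) by auto
  qed
  then obtain M where M: "M \<subseteq> V" "e \<in> M" "indep_in K M"
    and max: "\<forall>X\<in>?A. M \<subseteq> X \<longrightarrow> X = M" by blast
  show ?thesis
  proof (intro exI[of _ M] conjI allI impI)
    fix J' assume "M \<subseteq> J' \<and> J' \<subseteq> V \<and> indep_in K J'"
    then show "J' = M" using max M(2) by blast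
  qed (use M in auto)
qed

text \<open>\<open>J\<close> is a basis, and \<open>co j v\<close> is the coordinate of \<open>v\<close> at \<open>j\<close>.\<close>

lemma exists_coordinates:
  assumes K: "subfield_in e K" and V: "rng_in e V" "K \<subseteq> V"
  shows "\<exists>J co. J \<subseteq> V \<and> e \<in> J \<and> (\<forall>v\<in>V. (\<forall>j. co j v \<in> K) \<and> finite {j. co j v \<noteq> 0} \<and> {j. co j v \<noteq> 0} \<subseteq> J \<and>
      v = (\<Sum>j | co j v \<noteq> 0. co j v * j)) \<and>
    (\<forall>v\<in>V. \<forall>w\<in>V. \<forall>j. co j (v + w) = co j v + co j w) \<and>
    (\<forall>k\<in>K. \<forall>v\<in>V. \<forall>j. co j (k * v) = k * co j v) \<and>
    (\<forall>j\<in>J. \<forall>i. co i j = (if i = j then e else 0))"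
proof -
  interpret V: rng_in e V by fact
  interpret K: rng_in e K using K by (simp add: subfield_in_def)
  have "indep_in K {e}"
    unfolding indep_in_def
  proof (intro allI impI ballI)
    fix F c j assume F: "F \<subseteq> {e}" "\<forall>j. c j \<in> K" "(\<Sum>j\<in>F. c j * j) = 0" "j \<in> F"
    then have "F = {e}" "j = e" by auto
    then show "c j = 0" using F K.mult_one[of "c e"] by simp
  qed
  then obtain J where J: "J \<subseteq> V" "e \<in> J" "indep_in K J"
    and max: "\<And>J'. J \<subseteq> J' \<Longrightarrow> J' \<subseteq> V \<Longrightarrow> indep_in K J' \<Longrightarrow> J' = J"
    using exists_maximal_indep[OF V.one_in] by meson
  let ?R = "\<lambda>v c. (\<forall>j. c j \<in> K) \<and> finite {j. c j \<noteq> 0} \<and> {j. c j \<noteq> 0} \<subseteq> J \<and> v = (\<Sum>j | c j \<noteq> 0. c j * j)"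
  have sup: "(\<Sum>j | c j \<noteq> 0. c j * j) = (\<Sum>j\<in>F. c j * j)" if "finite F" "{j. c j \<noteq> 0} \<subseteq> F" for c and F :: "'a set"
    using that by (intro sum.mono_neutral_left) auto
  have uniq: "c = c'" if c: "?R v c" "?R v c'" for v c c'
  proof -
    let ?F = "{j. c j \<noteq> 0} \<union> {j. c' j \<noteq> 0}"
    have fin: "finite ?F" using c by auto
    have "(\<Sum>j\<in>?F. c j * j) = v" using sup[of ?F c] fin c(1) by auto
    moreover have "(\<Sum>j\<in>?F. c' j * j) = v" using sup[of ?F c'] fin c(2) by auto
    ultimately have "(\<Sum>j\<in>?F. (c j - c' j) * j) = 0" by (simp add: left_diff_distrib sum_subtractf)
    moreover have cK: "c j - c' j \<in> K" for j using c K.diff_in by auto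
    moreover have FJ: "?F \<subseteq> J" using c by auto
    ultimately have *: "c j - c' j = 0" if "j \<in> ?F" for j
      using indep_inD[OF J(3) fin FJ, of "\<lambda>j. c j - c' j"] that by blast
    show ?thesis
    proof
      fix j show "c j = c' j"
      proof (cases "j \<in> ?F")
        case True
        then show ?thesis using *[OF True] by simp
      qed simp
    qed
  qed
  have addR: "?R (v + w) (\<lambda>j. c j + c' j)" if c: "?R v c" "?R w c'" for v w c c'
  proof -
    let ?F = "{j. c j \<noteq> 0} \<union> {j. c' j \<noteq> 0}"
    have fin: "finite ?F" using c by auto
    have sub: "{j. c j + c' j \<noteq> 0} \<subseteq> ?F" by auto
    have "v + w = (\<Sum>j\<in>?F. c j * j) + (\<Sum>j\<in>?F. c' j * j)" using sup[of ?F c] sup[of ?F c'] fin c by auto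
    also have "\<dots> = (\<Sum>j\<in>?F. (c j + c' j) * j)" by (simp add: distrib_right sum.distrib)
    also have "\<dots> = (\<Sum>j | c j + c' j \<noteq> 0. (c j + c' j) * j)" using sup[OF fin sub] by simp
    finally have "v + w = (\<Sum>j | c j + c' j \<noteq> 0. (c j + c' j) * j)" .
    moreover have "{j. c j + c' j \<noteq> 0} \<subseteq> J" using sub c by blast
    moreover have "finite {j. c j + c' j \<noteq> 0}" using finite_subset[OF sub fin] .
    moreover have "\<forall>j. c j + c' j \<in> K" using c K.add_in by auto
    ultimately show ?thesis by blast
  qed
  have multR: "?R (k * v) (\<lambda>j. k * c j)" if c: "?R v c" and k: "k \<in> K" for k v c
  proof -
    let ?F = "{j. c j \<noteq> 0}"
    have fin: "finite ?F" using c by auto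
    have sub: "{j. k * c j \<noteq> 0} \<subseteq> ?F" by auto
    have "v = (\<Sum>j\<in>?F. c j * j)" using c by blast
    then have "k * v = (\<Sum>j\<in>?F. k * c j * j)" by (simp add: sum_distrib_left mult.assoc)
    also have "\<dots> = (\<Sum>j | k * c j \<noteq> 0. k * c j * j)" using sup[OF fin sub] by simp
    finally have "k * v = (\<Sum>j | k * c j \<noteq> 0. k * c j * j)" .
    moreover have "{j. k * c j \<noteq> 0} \<subseteq> J" using sub c by blast
    moreover have "finite {j. k * c j \<noteq> 0}" using finite_subset[OF sub fin] .
    moreover have "\<forall>j. k * c j \<in> K" using c k K.mult_in by auto
    ultimately show ?thesis by blast
  qed
  have singleR: "?R j (\<lambda>i. if i = j then e else 0)" if "j \<in> J" for j
  proof -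
    have "e \<noteq> 0" using K by (simp add: subfield_in_def)
    then have "{i. (if i = j then e else 0) \<noteq> 0} = {j}" by auto
    then show ?thesis using that J(1) V.one_mult K.one_in by auto
  qed
  have span: "\<exists>c. ?R v c" if v: "v \<in> V" for v
  proof (cases "v \<in> J")
    case True
    from exI[of "?R v", OF singleR[OF True]] show ?thesis .
  next
    case False
    \<comment> \<open>By maximality v satisfies a relation with elements of J. The coefficient of v
      is nonzero, because J is independent, and dividing by it gives the coordinates of v.\<close>
    have "\<not> indep_in K (insert v J)" using max[of "insert v J"] J(1) v False by blast
    then obtain F c where F: "finite F" "F \<subseteq> insert v J" "\<forall>j. c j \<in> K" "(\<Sum>j\<in>F. c j * j) = 0" "\<exists>j\<in>F. c j \<noteq> 0"
      unfolding indep_in_def by auto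
    have "v \<in> F"
    proof (rule ccontr)
      assume "v \<notin> F"
      then have "F \<subseteq> J" using F(2) by blast
      then show False using indep_inD[OF J(3) F(1) _ _ F(4)] F(3,5) by blast
    qed
    let ?G = "F - {v}"
    have G: "finite ?G" "?G \<subseteq> J" using F by auto
    have eq: "c v * v + (\<Sum>j\<in>?G. c j * j) = 0" using F(1,4) \<open>v \<in> F\<close> by (simp add: sum.remove)
    have "c v \<noteq> 0"
    proof
      assume "c v = 0"
      then have "(\<Sum>j\<in>?G. c j * j) = 0" using eq by simp
      then have "\<forall>j\<in>?G. c j = 0" using indep_inD[OF J(3) G] F(3) by blast
      then show False using F(5) \<open>c v = 0\<close> by auto
    qed
    then obtain w where w: "w \<in> K" "c v * w = e" using K F(3) by (auto simp: subfield_in_def)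
    define a where "a j = (if j \<in> ?G then - (w * c j) else 0)" for j
    have "v = (c v * w) * v" using w V.one_mult[OF v] by simp
    also have "\<dots> = w * (c v * v)" by (simp add: mult_ac)
    also have "c v * v = - (\<Sum>j\<in>?G. c j * j)" using eq by (simp add: eq_neg_iff_add_eq_0)
    also have "w * - (\<Sum>j\<in>?G. c j * j) = (\<Sum>j\<in>?G. a j * j)"
      by (simp add: a_def sum_distrib_left sum_negf mult.assoc)
    also have "\<dots> = (\<Sum>j | a j \<noteq> 0. a j * j)" using G(1) by (intro sup[symmetric]) (auto simp: a_def)
    finally have "v = (\<Sum>j | a j \<noteq> 0. a j * j)" .
    moreover have "{j. a j \<noteq> 0} \<subseteq> ?G" by (auto simp: a_def)
    moreover have "\<forall>j. a j \<in> K" using w F(3) K.mult_in K.uminus_in by (auto simp: a_def)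
    ultimately have "?R v a" using G finite_subset by blast
    then show ?thesis by blast
  qed
  define rp where "rp v = (SOME c. ?R v c)" for v
  have rp: "?R v (rp v)" if "v \<in> V" for v unfolding rp_def using someI_ex[OF span[OF that]] .
  have rpI: "rp v = c" if "v \<in> V" "?R v c" for v c using uniq[OF rp[OF that(1)] that(2)] .
  show ?thesis
  proof (intro exI[of _ J] exI[of _ "\<lambda>j v. rp v j"] conjI ballI allI)
    show "J \<subseteq> V" "e \<in> J" by fact+
    fix v assume v: "v \<in> V"
    show "rp v j \<in> K" for j using rp[OF v] by blast
    show "finite {j. rp v j \<noteq> 0}" "{j. rp v j \<noteq> 0} \<subseteq> J" "v = (\<Sum>j | rp v j \<noteq> 0. rp v j * j)"
      using rp[OF v] by blast+
    show "rp (v + w) j = rp v j + rp w j" if "w \<in> V" for w j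
      using rpI[OF V.add_in[OF v that] addR[OF rp[OF v] rp[OF that]]] by simp
  next
    fix k v j assume "k \<in> K" "v \<in> V"
    then show "rp (k * v) j = k * rp v j"
      using rpI[OF V.mult_in multR[OF rp]] V(2) by auto
  next
    fix j i assume "j \<in> J"
    then show "rp j i = (if i = j then e else 0)" using rpI[OF _ singleR] J(1) by auto
  qed
qed


section \<open>Tensor products\<close>

text \<open>The class of a formal combination of pairs in the tensor product, moved into the
  type-class ring.\<close>

definition tcl :: "('k, 'n) ring_scheme \<Rightarrow> ('k, 'l, 'm) module_scheme \<Rightarrow> ('k, 'a, 'p) module_scheme \<Rightarrow>
    ('l \<times> 'a \<Rightarrow>\<^sub>0 int) \<Rightarrow> (('l \<times> 'a) \<Rightarrow>\<^sub>0 int) set crt"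
  where "tcl K L A r = emb (tensor_ring K L A) (tensor_ideal K L A +>\<^bsub>pair_ring L A\<^esub> r)"

definition ten :: "('k, 'n) ring_scheme \<Rightarrow> ('k, 'l, 'm) module_scheme \<Rightarrow> ('k, 'a, 'p) module_scheme \<Rightarrow>
    'l \<Rightarrow> 'a \<Rightarrow> (('l \<times> 'a) \<Rightarrow>\<^sub>0 int) set crt"
  where "ten K L A x a = tcl K L A (frag_of (x, a))"

definition frag_sum :: "('b \<Rightarrow> 'm::comm_ring_1) \<Rightarrow> ('b \<Rightarrow>\<^sub>0 int) \<Rightarrow> 'm"
  where "frag_sum \<phi> f = (\<Sum>p\<in>Poly_Mapping.keys f. of_int (poly_mapping.lookup f p) * \<phi> p)"

lemma frag_sum_superset:
  assumes "finite S" "Poly_Mapping.keys f \<subseteq> S"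
  shows "frag_sum \<phi> f = (\<Sum>p\<in>S. of_int (poly_mapping.lookup f p) * \<phi> p)"
  unfolding frag_sum_def using assms by (intro sum.mono_neutral_left) (auto simp: in_keys_iff)

lemma frag_sum_add: "frag_sum \<phi> (f + g) = frag_sum \<phi> f + frag_sum \<phi> g"
proof -
  let ?S = "Poly_Mapping.keys f \<union> Poly_Mapping.keys g"
  have "Poly_Mapping.keys (f + g) \<subseteq> ?S" by (rule keys_add)
  then show ?thesis
    using frag_sum_superset[of ?S f \<phi>] frag_sum_superset[of ?S g \<phi>] frag_sum_superset[of ?S "f + g" \<phi>]
    by (simp add: lookup_add distrib_right sum.distrib)
qed

lemma frag_sum_frag_of: "frag_sum \<phi> (frag_of p) = \<phi> p"
  by (simp add: frag_sum_def)

lemma frag_sum_zero: "frag_sum \<phi> 0 = 0"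
  by (simp add: frag_sum_def)

lemma frag_sum_minus: "frag_sum \<phi> (- f) = - frag_sum \<phi> f"
  using frag_sum_add[of \<phi> f "- f"] frag_sum_zero[of \<phi>] by (simp add: eq_neg_iff_add_eq_0 add.commute)

lemma frag_sum_diff: "frag_sum \<phi> (f - g) = frag_sum \<phi> f - frag_sum \<phi> g"
  using frag_sum_add[of \<phi> f "- g"] by (simp add: frag_sum_minus)

context
  fixes K :: "('k, 'n) ring_scheme" and L :: "('k, 'l, 'm) module_scheme" and A :: "('k, 'a, 'p) module_scheme"
  assumes KL: "algebra K L" and KA: "algebra K A"
begin

interpretation L: algebra K L by (rule KL)
interpretation A: algebra K A by (rule KA)
interpretation PR: cring "pair_ring L A" by (rule pair_ring_cring[OF L.M_cring A.M_cring])
interpretation TI: ideal "tensor_ideal K L A" "pair_ring L A" by (rule tensor_ideal_ideal[OF KL KA])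
interpretation TR: cring "tensor_ring K L A" by (rule tensor_ring_cring[OF KL KA])

abbreviation "PRc \<equiv> carrier (pair_ring L A)"

lemma PR_carrier: "r \<in> PRc \<longleftrightarrow> Poly_Mapping.keys r \<subseteq> carrier L \<times> carrier A"
  by (rule pair_ring_simps(1))

lemma coset_hom: "(+>\<^bsub>pair_ring L A\<^esub>) (tensor_ideal K L A) \<in> ring_hom (pair_ring L A) (tensor_ring K L A)"
  unfolding tensor_ring_def by (rule TI.rcos_ring_hom)

lemma tcl_add: "r \<in> PRc \<Longrightarrow> s \<in> PRc \<Longrightarrow> tcl K L A (r + s) = tcl K L A r + tcl K L A s"
  using ring_hom_add[OF coset_hom, of r s] ring_hom_closed[OF coset_hom] TR.emb_add
  by (simp add: tcl_def pair_ring_simps)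

lemma tcl_mult: "r \<in> PRc \<Longrightarrow> s \<in> PRc \<Longrightarrow>
    tcl K L A (r \<otimes>\<^bsub>pair_ring L A\<^esub> s) = tcl K L A r * tcl K L A s"
  using ring_hom_mult[OF coset_hom, of r s] ring_hom_closed[OF coset_hom] TR.emb_mult
  by (simp add: tcl_def)

lemma tcl_in: "r \<in> PRc \<Longrightarrow> tcl K L A r \<in> img (tensor_ring K L A)"
  using ring_hom_closed[OF coset_hom, of r] by (simp add: tcl_def img_def)

lemma tcl_surj: "b \<in> img (tensor_ring K L A) \<Longrightarrow> \<exists>r\<in>PRc. b = tcl K L A r"
  by (auto simp: img_def tensor_ring_def FactRing_def A_RCOSETS_def' tcl_def)

lemma PR_zero: "0 \<in> PRc" by (simp add: PR_carrier)

lemma tcl_zero: "tcl K L A 0 = 0"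
  using tcl_add[OF PR_zero PR_zero] by simp

lemma PR_uminus: "r \<in> PRc \<Longrightarrow> - r \<in> PRc" by (simp add: PR_carrier)

lemma PR_diff: "r \<in> PRc \<Longrightarrow> s \<in> PRc \<Longrightarrow> r - s \<in> PRc"
  unfolding PR_carrier using keys_diff[of r s] by blast

lemma tcl_uminus: "r \<in> PRc \<Longrightarrow> tcl K L A (- r) = - tcl K L A r"
  using tcl_add[of r "- r"] PR_uminus[of r] tcl_zero by (simp add: eq_neg_iff_add_eq_0 add.commute)

lemma tcl_diff: "r \<in> PRc \<Longrightarrow> s \<in> PRc \<Longrightarrow> tcl K L A (r - s) = tcl K L A r - tcl K L A s"
  using tcl_add[of r "- s"] PR_uminus[of s] tcl_uminus[of s] by simp

lemma tcl_eq_0_iff: "r \<in> PRc \<Longrightarrow> tcl K L A r = 0 \<longleftrightarrow> r \<in> tensor_ideal K L A"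
proof -
  assume r: "r \<in> PRc"
  have "tcl K L A r = 0 \<longleftrightarrow> tensor_ideal K L A +>\<^bsub>pair_ring L A\<^esub> r = \<zero>\<^bsub>tensor_ring K L A\<^esub>"
    using TR.emb_eq_0 ring_hom_closed[OF coset_hom r] by (simp add: tcl_def)
  also have "\<zero>\<^bsub>tensor_ring K L A\<^esub> = tensor_ideal K L A"
    by (simp add: tensor_ring_def FactRing_def)
  also have "tensor_ideal K L A +>\<^bsub>pair_ring L A\<^esub> r = tensor_ideal K L A \<longleftrightarrow> r \<in> tensor_ideal K L A"
  proof
    assume "tensor_ideal K L A +>\<^bsub>pair_ring L A\<^esub> r = tensor_ideal K L A"
    then show "r \<in> tensor_ideal K L A" using TI.a_rcos_self[OF r] by simp
  qed (rule TI.a_rcos_const)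
  finally show ?thesis .
qed

lemma ten_in: "x \<in> carrier L \<Longrightarrow> a \<in> carrier A \<Longrightarrow> ten K L A x a \<in> img (tensor_ring K L A)"
  by (simp add: ten_def tcl_in PR_carrier)

lemma relation_zero: "r \<in> tensor_relations K L A \<Longrightarrow> r \<in> PRc \<Longrightarrow> tcl K L A r = 0"
  unfolding tcl_eq_0_iff tensor_ideal_def by (rule generate.incl)

lemma frag_PR: "x \<in> carrier L \<Longrightarrow> a \<in> carrier A \<Longrightarrow> frag_of (x, a) \<in> PRc"
  by (simp add: PR_carrier)

lemma ten_add_left:
  assumes "x \<in> carrier L" "y \<in> carrier L" "a \<in> carrier A"
  shows "ten K L A (x \<oplus>\<^bsub>L\<^esub> y) a = ten K L A x a + ten K L A y a"
proof -
  have "frag_of (x \<oplus>\<^bsub>L\<^esub> y, a) - frag_of (x, a) - frag_of (y, a) \<in> tensor_relations K L A"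
    using assms unfolding tensor_relations_def by blast
  then have "tcl K L A (frag_of (x \<oplus>\<^bsub>L\<^esub> y, a) - frag_of (x, a) - frag_of (y, a)) = 0"
    using assms by (intro relation_zero PR_diff frag_PR) auto
  then show ?thesis using assms by (simp add: tcl_diff PR_diff frag_PR ten_def diff_eq_eq add.commute)
qed

lemma ten_add_right:
  assumes "x \<in> carrier L" "a \<in> carrier A" "b \<in> carrier A"
  shows "ten K L A x (a \<oplus>\<^bsub>A\<^esub> b) = ten K L A x a + ten K L A x b"
proof -
  have "frag_of (x, a \<oplus>\<^bsub>A\<^esub> b) - frag_of (x, a) - frag_of (x, b) \<in> tensor_relations K L A"
    using assms unfolding tensor_relations_def by blast
  then have "tcl K L A (frag_of (x, a \<oplus>\<^bsub>A\<^esub> b) - frag_of (x, a) - frag_of (x, b)) = 0"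
    using assms by (intro relation_zero PR_diff frag_PR) auto
  then show ?thesis using assms by (simp add: tcl_diff PR_diff frag_PR ten_def diff_eq_eq add.commute)
qed

lemma ten_smult:
  assumes "c \<in> carrier K" "x \<in> carrier L" "a \<in> carrier A"
  shows "ten K L A (c \<odot>\<^bsub>L\<^esub> x) a = ten K L A x (c \<odot>\<^bsub>A\<^esub> a)"
proof -
  have "frag_of (c \<odot>\<^bsub>L\<^esub> x, a) - frag_of (x, c \<odot>\<^bsub>A\<^esub> a) \<in> tensor_relations K L A"
    using assms unfolding tensor_relations_def by blast
  then have "tcl K L A (frag_of (c \<odot>\<^bsub>L\<^esub> x, a) - frag_of (x, c \<odot>\<^bsub>A\<^esub> a)) = 0"
    using assms by (intro relation_zero PR_diff frag_PR) auto
  then show ?thesis using assms by (simp add: tcl_diff frag_PR ten_def)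
qed

lemma ten_mult:
  assumes "x \<in> carrier L" "a \<in> carrier A" "y \<in> carrier L" "b \<in> carrier A"
  shows "ten K L A x a * ten K L A y b = ten K L A (x \<otimes>\<^bsub>L\<^esub> y) (a \<otimes>\<^bsub>A\<^esub> b)"
  using tcl_mult[OF frag_PR[OF assms(1,2)] frag_PR[OF assms(3,4)]] by (simp add: ten_def pair_ring_simps)

lemma ten_one: "ten K L A \<one>\<^bsub>L\<^esub> \<one>\<^bsub>A\<^esub> = emb_one (tensor_ring K L A)"
  using ring_hom_one[OF coset_hom] by (simp add: ten_def tcl_def emb_one_def pair_ring_simps)

text \<open>The pure tensors generate the additive group, so closure under differences
  suffices.\<close>

lemma ten_induct [consumes 1, case_names zero ten diff]:
  assumes b: "b \<in> img (tensor_ring K L A)" and "P 0"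
    and t: "\<And>x a. x \<in> carrier L \<Longrightarrow> a \<in> carrier A \<Longrightarrow> P (ten K L A x a)"
    and d: "\<And>b c. b \<in> img (tensor_ring K L A) \<Longrightarrow> c \<in> img (tensor_ring K L A) \<Longrightarrow> P b \<Longrightarrow> P c \<Longrightarrow> P (b - c)"
  shows "P b"
proof -
  obtain r where r: "r \<in> PRc" "b = tcl K L A r" using tcl_surj[OF b] by blast
  have "Poly_Mapping.keys r \<subseteq> carrier L \<times> carrier A" using r by (simp add: PR_carrier)
  then have "r \<in> PRc \<and> P (tcl K L A r)"
  proof (induction r rule: frag_induction)
    case zero
    then show ?case using assms(2) tcl_zero PR_zero by simp
  next
    case (one p)
    then show ?case using t[of "fst p" "snd p"] frag_PR[of "fst p" "snd p"] by (auto simp: ten_def)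
  next
    case (diff r s)
    then show ?case using d[OF tcl_in tcl_in] PR_diff tcl_diff by metis
  qed
  then show ?thesis using r by simp
qed

text \<open>The universal property: the additive extension of \<phi> to formal combinations kills
  the relations, hence the subgroup generated by them. Only additivity is claimed of \<pi>, because
  coordinate maps are not multiplicative.\<close>

lemma ten_lift:
  fixes \<phi> :: "'l \<Rightarrow> 'a \<Rightarrow> 'r::comm_ring_1"
  assumes left: "\<And>x y a. x \<in> carrier L \<Longrightarrow> y \<in> carrier L \<Longrightarrow> a \<in> carrier A \<Longrightarrow> \<phi> (x \<oplus>\<^bsub>L\<^esub> y) a = \<phi> x a + \<phi> y a"
    and right: "\<And>x a b. x \<in> carrier L \<Longrightarrow> a \<in> carrier A \<Longrightarrow> b \<in> carrier A \<Longrightarrow> \<phi> x (a \<oplus>\<^bsub>A\<^esub> b) = \<phi> x a + \<phi> x b"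
    and smult: "\<And>c x a. c \<in> carrier K \<Longrightarrow> x \<in> carrier L \<Longrightarrow> a \<in> carrier A \<Longrightarrow> \<phi> (c \<odot>\<^bsub>L\<^esub> x) a = \<phi> x (c \<odot>\<^bsub>A\<^esub> a)"
  shows "\<exists>\<pi>. (\<forall>x\<in>carrier L. \<forall>a\<in>carrier A. \<pi> (ten K L A x a) = \<phi> x a) \<and>
    (\<forall>b\<in>img (tensor_ring K L A). \<forall>c\<in>img (tensor_ring K L A). \<pi> (b + c) = \<pi> b + \<pi> c)"
proof -
  let ?f = "frag_sum (\<lambda>p. \<phi> (fst p) (snd p))"
  have rel: "?f r = 0" if "r \<in> tensor_relations K L A" for r
    using that by (cases rule: tensor_relations_cases) (simp_all add: frag_sum_diff frag_sum_frag_of left right smult)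
  have sub: "r \<in> PRc" if "r \<in> tensor_ideal K L A" for r using that TI.a_Hcarr by blast
  have ideal: "?f r = 0" if "r \<in> tensor_ideal K L A" for r
    using that unfolding tensor_ideal_def
  proof (induction rule: generate.induct)
    case one
    then show ?case by (simp add: frag_sum_zero)
  next
    case (incl h)
    then show ?case by (rule rel)
  next
    case (inv h)
    have "h \<in> PRc" by (rule sub) (simp add: tensor_ideal_def generate.incl inv)
    then show ?case using rel[OF inv] by (simp add: PR_carrier frag_sum_minus)
  next
    case (eng h1 h2)
    then show ?case by (simp add: frag_sum_add)
  qed
  have wd: "?f r = ?f s" if "r \<in> PRc" "s \<in> PRc" "tcl K L A r = tcl K L A s" for r s
    using ideal[of "r - s"] tcl_eq_0_iff[OF PR_diff[OF that(1,2)]] tcl_diff[OF that(1,2)] that(3)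
    by (simp add: frag_sum_diff)
  define \<pi> where "\<pi> b = ?f (SOME r. r \<in> PRc \<and> tcl K L A r = b)" for b
  have \<pi>: "\<pi> (tcl K L A r) = ?f r" if "r \<in> PRc" for r
  proof -
    have "(SOME s. s \<in> PRc \<and> tcl K L A s = tcl K L A r) \<in> PRc \<and> tcl K L A (SOME s. s \<in> PRc \<and> tcl K L A s = tcl K L A r) = tcl K L A r"
      using that by (intro someI_ex[of "\<lambda>s. s \<in> PRc \<and> tcl K L A s = tcl K L A r"]) blast
    then show ?thesis unfolding \<pi>_def using wd that by blast
  qed
  have "\<pi> (b + c) = \<pi> b + \<pi> c" if bc: "b \<in> img (tensor_ring K L A)" "c \<in> img (tensor_ring K L A)" for b c
  proof -
    obtain r s where rs: "r \<in> PRc" "s \<in> PRc" "b = tcl K L A r" "c = tcl K L A s" using tcl_surj bc by metis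
    have "r + s \<in> PRc" using PR_diff[OF rs(1) PR_uminus[OF rs(2)]] by simp
    then show ?thesis using \<pi> rs tcl_add[OF rs(1,2)] frag_sum_add by metis
  qed
  moreover have "\<pi> (ten K L A x a) = \<phi> x a" if "x \<in> carrier L" "a \<in> carrier A" for x a
    using \<pi>[OF frag_PR[OF that]] by (simp add: ten_def frag_sum_frag_of)
  ultimately show ?thesis by blast
qed

end

lemma poly_Poly_snoc:
  fixes y :: "'r::comm_ring_1"
  shows "poly (Poly (xs @ [a])) y = poly (Poly xs) y + a * y ^ length xs"
  by (induction xs) (simp_all add: algebra_simps)

text \<open>The polynomial lists of HOL-Algebra start with the leading coefficient.\<close>

lemma (in domain) hom_eval:
  fixes h :: "'a \<Rightarrow> 'r::comm_ring_1"
  assumes add: "\<And>a b. a \<in> carrier R \<Longrightarrow> b \<in> carrier R \<Longrightarrow> h (a \<oplus> b) = h a + h b"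
    and mult: "\<And>a b. a \<in> carrier R \<Longrightarrow> b \<in> carrier R \<Longrightarrow> h (a \<otimes> b) = h a * h b"
    and x: "x \<in> carrier R"
  shows "set q \<subseteq> carrier R \<Longrightarrow> eval q x \<in> carrier R \<and> h (eval q x) = poly (Poly (rev (map h q))) (h x)"
proof (induction q)
  case Nil
  have "h \<zero> = 0" using add[of \<zero> \<zero>] by simp
  then show ?case by simp
next
  case (Cons a q)
  have aR: "a \<in> carrier R" using Cons.prems by simp
  have pw: "h (a \<otimes> x [^] n) = h a * h x ^ n" for n :: nat
  proof (induction n)
    case 0
    then show ?case using aR by simp
  next
    case (Suc n)
    have "a \<otimes> x [^] Suc n = (a \<otimes> x [^] n) \<otimes> x" using aR x by (simp add: m_assoc)
    then show ?case using Suc mult[of "a \<otimes> x [^] n" x] aR x by (simp add: mult_ac)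
  qed
  have "eval (a # q) x = a \<otimes> x [^] length q \<oplus> eval q x" by simp
  then show ?case using Cons add[of "a \<otimes> x [^] length q" "eval q x"] pw aR x
    by (simp add: poly_Poly_snoc add.commute)
qed

text \<open>Preimages of the coefficients of p, with the leading one in front, form a polynomial in
  the sense of HOL-Algebra, which splits over L.\<close>

lemma (in algebraically_closed) hom_root:
  fixes h :: "'a \<Rightarrow> 'r::comm_ring_1"
  assumes add: "\<And>a b. a \<in> carrier L \<Longrightarrow> b \<in> carrier L \<Longrightarrow> h (a \<oplus>\<^bsub>L\<^esub> b) = h a + h b"
    and mult: "\<And>a b. a \<in> carrier L \<Longrightarrow> b \<in> carrier L \<Longrightarrow> h (a \<otimes>\<^bsub>L\<^esub> b) = h a * h b"
    and p: "p \<in> polys (h ` carrier L)" "degree p > 0"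
  shows "\<exists>\<mu>\<in>h ` carrier L. poly p \<mu> = 0"
proof -
  have h0: "h \<zero>\<^bsub>L\<^esub> = 0" using add[of "\<zero>\<^bsub>L\<^esub>" "\<zero>\<^bsub>L\<^esub>"] by simp
  define g where "g = inv_into (carrier L) h"
  have g: "g c \<in> carrier L" "h (g c) = c" if "c \<in> h ` carrier L" for c
    using that unfolding g_def by (auto intro: inv_into_into f_inv_into_f)
  define q where "q = map g (rev (coeffs p))"
  have cp: "set (coeffs p) \<subseteq> h ` carrier L" using p(1) by (auto simp: coeffs_def polys_def)
  have hq: "rev (map h q) = coeffs p"
  proof -
    have "map (h \<circ> g) (coeffs p) = map id (coeffs p)" using cp g(2) by (intro map_cong) auto
    then show ?thesis by (simp add: q_def rev_map)
  qed
  have qL: "set q \<subseteq> carrier L" using cp g(1) by (auto simp: q_def)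
  have p0: "p \<noteq> 0" using p(2) by auto
  have len: "length q = Suc (degree p)" using p0 by (simp add: q_def length_coeffs_degree)
  have "hd q \<noteq> \<zero>\<^bsub>L\<^esub>"
  proof
    assume "hd q = \<zero>\<^bsub>L\<^esub>"
    then have "g (last (coeffs p)) = \<zero>\<^bsub>L\<^esub>" using p0 by (simp add: q_def hd_map hd_rev)
    moreover have "last (coeffs p) \<in> h ` carrier L" using cp p0 by (meson coeffs_eq_Nil last_in_set subsetD)
    ultimately have "last (coeffs p) = 0" using g(2) h0 by metis
    then show False using last_coeffs_eq_coeff_degree[OF p0] p0 by simp
  qed
  then have "q \<in> carrier (poly_ring L)" using qL unfolding univ_poly_carrier[symmetric] polynomial_def by auto
  moreover have "splitted q" using roots_over_carrier[OF calculation] .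
  moreover have "length q - 1 > 0" using len p(2) by simp
  ultimately have "roots q \<noteq> {#}" unfolding splitted_def by auto
  then obtain x where "x \<in># roots q" by blast
  then have x: "x \<in> carrier L" "eval q x = \<zero>\<^bsub>L\<^esub>"
    using roots_mem_iff_is_root[OF \<open>q \<in> carrier (poly_ring L)\<close>] by (auto simp: is_root_def)
  have "h (eval q x) = poly (Poly (coeffs p)) (h x)" using hom_eval[where h = h and q = q, OF add mult x(1) qL] hq by simp
  then have "poly p (h x) = 0" using x h0 by simp
  then show ?thesis using x(1) by blast
qed

section \<open>The tensor product of the theorem as an instance of \<open>tens\<close>\<close>

locale tensor_data =
  fixes K :: "('k, 'n) ring_scheme" and L :: "('k, 'l, 'm) module_scheme" and A :: "('k, 'a, 'p) module_scheme"
  assumes fieldK: "field K" and KL: "algebra K L" and KA: "algebra K A"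
    and closure: "algebraic_closure L (scalars K L)" and domA: "domain A" and domT: "domain (tensor_ring K L A)"
begin

sublocale K: field K by (rule fieldK)
sublocale C: algebraic_closure L "scalars K L" by (rule closure)
sublocale A: domain A by (rule domA)
sublocale L: algebra K L by (rule KL)
sublocale A: algebra K A by (rule KA)
sublocale T: domain "tensor_ring K L A" by (rule domT)

abbreviation "tn \<equiv> ten K L A"
abbreviation "e0 \<equiv> emb_one (tensor_ring K L A)"
abbreviation "B0 \<equiv> img (tensor_ring K L A)"
definition "lL x = tn x \<one>\<^bsub>A\<^esub>"
definition "lA a = tn \<one>\<^bsub>L\<^esub> a"
definition "L0 = lL ` carrier L"
definition "A0 = lA ` carrier A"
definition "K0 = lA ` scalars K A"

lemmas tn_add_left = ten_add_left[OF KL KA]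
  and tn_add_right = ten_add_right[OF KL KA]
  and tn_smult = ten_smult[OF KL KA]
  and tn_mult = ten_mult[OF KL KA]
  and tn_one = ten_one[OF KL KA]
  and tn_in = ten_in[OF KL KA]
  and tn_induct = ten_induct[OF KL KA, consumes 1, case_names zero ten diff]
  and tn_lift = ten_lift[OF KL KA]

sublocale B: dom_in e0 B0 by (rule T.img_dom_in)

lemma lL_add: "x \<in> carrier L \<Longrightarrow> y \<in> carrier L \<Longrightarrow> lL (x \<oplus>\<^bsub>L\<^esub> y) = lL x + lL y"
  by (simp add: lL_def tn_add_left)

lemma lA_add: "a \<in> carrier A \<Longrightarrow> b \<in> carrier A \<Longrightarrow> lA (a \<oplus>\<^bsub>A\<^esub> b) = lA a + lA b"
  by (simp add: lA_def tn_add_right)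

lemma lL_mult: "x \<in> carrier L \<Longrightarrow> y \<in> carrier L \<Longrightarrow> lL (x \<otimes>\<^bsub>L\<^esub> y) = lL x * lL y"
  by (simp add: lL_def tn_mult)

lemma lA_mult: "a \<in> carrier A \<Longrightarrow> b \<in> carrier A \<Longrightarrow> lA (a \<otimes>\<^bsub>A\<^esub> b) = lA a * lA b"
  by (simp add: lA_def tn_mult)

lemma lL_one: "lL \<one>\<^bsub>L\<^esub> = e0" and lA_one: "lA \<one>\<^bsub>A\<^esub> = e0"
  by (simp_all add: lL_def lA_def tn_one)

lemma lL_zero: "lL \<zero>\<^bsub>L\<^esub> = 0" using lL_add[of "\<zero>\<^bsub>L\<^esub>" "\<zero>\<^bsub>L\<^esub>"] by simp

lemma lA_zero: "lA \<zero>\<^bsub>A\<^esub> = 0" using lA_add[of "\<zero>\<^bsub>A\<^esub>" "\<zero>\<^bsub>A\<^esub>"] by simp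

lemma lL_uminus: "x \<in> carrier L \<Longrightarrow> lL (\<ominus>\<^bsub>L\<^esub> x) = - lL x"
  using lL_add[of x "\<ominus>\<^bsub>L\<^esub> x"] lL_zero by (simp add: C.r_neg eq_neg_iff_add_eq_0 add.commute)

lemma lA_uminus: "a \<in> carrier A \<Longrightarrow> lA (\<ominus>\<^bsub>A\<^esub> a) = - lA a"
  using lA_add[of a "\<ominus>\<^bsub>A\<^esub> a"] lA_zero by (simp add: A.r_neg eq_neg_iff_add_eq_0 add.commute)

lemma tn_split: "x \<in> carrier L \<Longrightarrow> a \<in> carrier A \<Longrightarrow> tn x a = lL x * lA a"
  by (simp add: lL_def lA_def tn_mult)

lemma lA_scalar: "c \<in> carrier K \<Longrightarrow> lA (c \<odot>\<^bsub>A\<^esub> \<one>\<^bsub>A\<^esub>) = lL (c \<odot>\<^bsub>L\<^esub> \<one>\<^bsub>L\<^esub>)"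
  by (simp add: lA_def lL_def tn_smult)

lemma L0_B0: "L0 \<subseteq> B0" and A0_B0: "A0 \<subseteq> B0"
  by (auto simp: L0_def A0_def lL_def lA_def tn_in)

lemma L0_rng_in: "rng_in e0 L0"
proof
  show "e0 \<in> L0" unfolding L0_def lL_one[symmetric] by simp
  show "e0 * a = a" if "a \<in> L0" for a using that L0_B0 B.one_mult by blast
  fix a b assume "a \<in> L0" "b \<in> L0"
  then obtain x y where xy: "x \<in> carrier L" "y \<in> carrier L" "a = lL x" "b = lL y" by (auto simp: L0_def)
  have "a - b = lL (x \<oplus>\<^bsub>L\<^esub> (\<ominus>\<^bsub>L\<^esub> y))" using xy by (simp add: lL_add lL_uminus)
  then show "a - b \<in> L0" using xy by (simp add: L0_def)
  have "a * b = lL (x \<otimes>\<^bsub>L\<^esub> y)" using xy by (simp add: lL_mult)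
  then show "a * b \<in> L0" using xy by (simp add: L0_def)
qed

lemma A0_rng_in: "rng_in e0 A0"
proof
  show "e0 \<in> A0" unfolding A0_def lA_one[symmetric] by simp
  show "e0 * a = a" if "a \<in> A0" for a using that A0_B0 B.one_mult by blast
  fix a b assume "a \<in> A0" "b \<in> A0"
  then obtain x y where xy: "x \<in> carrier A" "y \<in> carrier A" "a = lA x" "b = lA y" by (auto simp: A0_def)
  have "a - b = lA (x \<oplus>\<^bsub>A\<^esub> (\<ominus>\<^bsub>A\<^esub> y))" using xy by (simp add: lA_add lA_uminus)
  then show "a - b \<in> A0" using xy by (simp add: A0_def)
  have "a * b = lA (x \<otimes>\<^bsub>A\<^esub> y)" using xy by (simp add: lA_mult)
  then show "a * b \<in> A0" using xy by (simp add: A0_def)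
qed

lemma L0_subfield: "subfield_in e0 L0"
proof -
  have "\<exists>v\<in>L0. k * v = e0" if k: "k \<in> L0" "k \<noteq> 0" for k
  proof -
    obtain x where x: "x \<in> carrier L" "k = lL x" using k by (auto simp: L0_def)
    then have "x \<in> Units L" using k lL_zero C.field_Units by auto
    then obtain y where "y \<in> carrier L" "x \<otimes>\<^bsub>L\<^esub> y = \<one>\<^bsub>L\<^esub>" by (auto simp: Units_def)
    then have "lL y \<in> L0" "k * lL y = e0" using x lL_mult[of x y] lL_one by (auto simp: L0_def)
    then show ?thesis by blast
  qed
  then show ?thesis using L0_rng_in B.one_nz by (simp add: subfield_in_def)
qed

text \<open>A ring homomorphism from a field to a nonzero ring is injective.\<close>

lemma lL_inj: "x \<in> carrier L \<Longrightarrow> y \<in> carrier L \<Longrightarrow> lL x = lL y \<Longrightarrow> x = y"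
proof -
  assume xy: "x \<in> carrier L" "y \<in> carrier L" "lL x = lL y"
  have z: "lL (x \<ominus>\<^bsub>L\<^esub> y) = 0" using xy by (simp add: a_minus_def lL_add lL_uminus)
  have "x \<ominus>\<^bsub>L\<^esub> y = \<zero>\<^bsub>L\<^esub>"
  proof (rule ccontr)
    assume "\<not> ?thesis"
    then have "x \<ominus>\<^bsub>L\<^esub> y \<in> Units L" using xy C.field_Units by auto
    then obtain v where "v \<in> carrier L" "(x \<ominus>\<^bsub>L\<^esub> y) \<otimes>\<^bsub>L\<^esub> v = \<one>\<^bsub>L\<^esub>" by (auto simp: Units_def)
    then have "e0 = lL (x \<ominus>\<^bsub>L\<^esub> y) * lL v" using lL_mult[of "x \<ominus>\<^bsub>L\<^esub> y" v] lL_one xy by simp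
    then show False using z B.one_nz by simp
  qed
  then show ?thesis using xy C.r_right_minus_eq by simp
qed

lemma scal_add: "c \<in> carrier K \<Longrightarrow> d \<in> carrier K \<Longrightarrow>
    (c \<oplus>\<^bsub>K\<^esub> d) \<odot>\<^bsub>L\<^esub> \<one>\<^bsub>L\<^esub> = c \<odot>\<^bsub>L\<^esub> \<one>\<^bsub>L\<^esub> \<oplus>\<^bsub>L\<^esub> d \<odot>\<^bsub>L\<^esub> \<one>\<^bsub>L\<^esub>"
  by (simp add: L.smult_l_distr)

lemma scal_mult: "c \<in> carrier K \<Longrightarrow> x \<in> carrier L \<Longrightarrow> (c \<odot>\<^bsub>L\<^esub> \<one>\<^bsub>L\<^esub>) \<otimes>\<^bsub>L\<^esub> x = c \<odot>\<^bsub>L\<^esub> x"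
  by (simp add: L.smult_assoc2)

lemma scal_inj: "c \<in> carrier K \<Longrightarrow> d \<in> carrier K \<Longrightarrow> c \<odot>\<^bsub>L\<^esub> \<one>\<^bsub>L\<^esub> = d \<odot>\<^bsub>L\<^esub> \<one>\<^bsub>L\<^esub> \<Longrightarrow> c = d"
proof -
  assume cd: "c \<in> carrier K" "d \<in> carrier K" "c \<odot>\<^bsub>L\<^esub> \<one>\<^bsub>L\<^esub> = d \<odot>\<^bsub>L\<^esub> \<one>\<^bsub>L\<^esub>"
  have z: "(c \<ominus>\<^bsub>K\<^esub> d) \<odot>\<^bsub>L\<^esub> \<one>\<^bsub>L\<^esub> = \<zero>\<^bsub>L\<^esub>"
    using cd L.smult_l_distr[of c "\<ominus>\<^bsub>K\<^esub> d" "\<one>\<^bsub>L\<^esub>"] L.smult_l_minus[of d "\<one>\<^bsub>L\<^esub>"]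
    by (simp add: a_minus_def C.r_neg)
  have "c \<ominus>\<^bsub>K\<^esub> d = \<zero>\<^bsub>K\<^esub>"
  proof (rule ccontr)
    assume "\<not> ?thesis"
    then have "c \<ominus>\<^bsub>K\<^esub> d \<in> Units K" using cd K.field_Units by auto
    then obtain v where v: "v \<in> carrier K" "v \<otimes>\<^bsub>K\<^esub> (c \<ominus>\<^bsub>K\<^esub> d) = \<one>\<^bsub>K\<^esub>" by (auto simp: Units_def)
    then have "\<one>\<^bsub>L\<^esub> = v \<odot>\<^bsub>L\<^esub> ((c \<ominus>\<^bsub>K\<^esub> d) \<odot>\<^bsub>L\<^esub> \<one>\<^bsub>L\<^esub>)"
      using L.smult_assoc1[of v "c \<ominus>\<^bsub>K\<^esub> d" "\<one>\<^bsub>L\<^esub>"] cd by simp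
    then show False using z v(1) C.one_not_zero by simp
  qed
  then show ?thesis using cd K.r_right_minus_eq by simp
qed

lemma K0_L0: "K0 \<subseteq> L0" and K0_A0: "K0 \<subseteq> A0"
  using lA_scalar by (auto simp: K0_def L0_def A0_def scalars_def)

lemma K0_eq: "K0 = (\<lambda>c. lL (c \<odot>\<^bsub>L\<^esub> \<one>\<^bsub>L\<^esub>)) ` carrier K"
  using lA_scalar by (auto simp: K0_def scalars_def image_image)

lemma K0_subfield: "subfield_in e0 K0"
proof -
  let ?s = "\<lambda>c. c \<odot>\<^bsub>L\<^esub> \<one>\<^bsub>L\<^esub>"
  have mult: "?s c \<otimes>\<^bsub>L\<^esub> ?s d = ?s (c \<otimes>\<^bsub>K\<^esub> d)" if "c \<in> carrier K" "d \<in> carrier K" for c d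
    using that by (simp add: scal_mult L.smult_assoc1)
  have "rng_in e0 K0"
  proof
    have "lL (?s \<one>\<^bsub>K\<^esub>) = e0" by (simp add: lL_one)
    then show "e0 \<in> K0" unfolding K0_eq by (metis K.one_closed image_eqI)
    show "e0 * a = a" if "a \<in> K0" for a using that K0_L0 L0_B0 B.one_mult by blast
    fix a b assume "a \<in> K0" "b \<in> K0"
    then obtain c d where cd: "c \<in> carrier K" "d \<in> carrier K" "a = lL (?s c)" "b = lL (?s d)" by (auto simp: K0_eq)
    have "a - b = lL (?s (c \<oplus>\<^bsub>K\<^esub> (\<ominus>\<^bsub>K\<^esub> d)))"
      using cd by (simp add: L.smult_l_distr L.smult_l_minus lL_add lL_uminus)
    then show "a - b \<in> K0" unfolding K0_eq using cd by blast
    have "a * b = lL (?s (c \<otimes>\<^bsub>K\<^esub> d))" using cd mult[of c d] lL_mult[of "?s c" "?s d"] by simp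
    then show "a * b \<in> K0" unfolding K0_eq using cd by blast
  qed
  moreover have "\<exists>v\<in>K0. k * v = e0" if k: "k \<in> K0" "k \<noteq> 0" for k
  proof -
    obtain c where c: "c \<in> carrier K" "k = lL (?s c)" using k by (auto simp: K0_eq)
    have "c \<noteq> \<zero>\<^bsub>K\<^esub>" using c k(2) lL_zero by auto
    then have "c \<in> Units K" using c K.field_Units by auto
    then obtain d where d: "d \<in> carrier K" "c \<otimes>\<^bsub>K\<^esub> d = \<one>\<^bsub>K\<^esub>" by (auto simp: Units_def)
    then have "k * lL (?s d) = e0" using c mult[of c d] lL_mult[of "?s c" "?s d"] lL_one by simp
    then show ?thesis unfolding K0_eq using d by blast
  qed
  ultimately show ?thesis using B.one_nz by (simp add: subfield_in_def)
qed

lemma smult_comm: "c \<in> carrier K \<Longrightarrow> d \<in> carrier K \<Longrightarrow> a \<in> carrier A \<Longrightarrow>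
    c \<odot>\<^bsub>A\<^esub> (d \<odot>\<^bsub>A\<^esub> a) = d \<odot>\<^bsub>A\<^esub> (c \<odot>\<^bsub>A\<^esub> a)"
  using A.smult_assoc1[of c d a] A.smult_assoc1[of d c a] K.m_comm[of c d] by simp

text \<open>A basis of L over K becomes a basis of \<open>L \<otimes> A\<close> over A: the
  coordinate map at j is induced by the balanced map that sends x and a to the multiple of a by the
  coordinate of x at j. The coordinate at the unit also shows that A embeds.\<close>

theorem exists_tens: "\<exists>J co. tens e0 K0 L0 J co A0 B0"
  and lA_inj: "a \<in> carrier A \<Longrightarrow> b \<in> carrier A \<Longrightarrow> lA a = lA b \<Longrightarrow> a = b"
proof -
  let ?E = "emb L" and ?s = "\<lambda>c. c \<odot>\<^bsub>L\<^esub> \<one>\<^bsub>L\<^esub>"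
  let ?V = "img L" and ?KV = "emb L ` scalars K L"
  have subf: "subfield (scalars K L) L" by (rule C.subfield_axioms)
  have Ksub: "subfield_in (emb_one L) ?KV" by (rule C.emb_subfield_in[OF subf])
  have Vr: "rng_in (emb_one L) ?V" by (rule C.img_rng_in)
  have KVV: "?KV \<subseteq> ?V" using subfieldE(3)[OF subf] by (auto simp: img_def)
  obtain J co where J: "J \<subseteq> ?V" "emb_one L \<in> J"
    and coords: "\<forall>v\<in>?V. (\<forall>j. co j v \<in> ?KV) \<and> finite {j. co j v \<noteq> 0} \<and> {j. co j v \<noteq> 0} \<subseteq> J \<and>
      v = (\<Sum>j | co j v \<noteq> 0. co j v * j)"
    and co_add': "\<forall>v\<in>?V. \<forall>w\<in>?V. \<forall>j. co j (v + w) = co j v + co j w"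
    and co_mult': "\<forall>k\<in>?KV. \<forall>v\<in>?V. \<forall>j. co j (k * v) = k * co j v"
    and co_J': "\<forall>j\<in>J. \<forall>i. co i j = (if i = j then emb_one L else 0)"
    by (use exists_coordinates[OF Ksub Vr KVV] in \<open>elim exE conjE\<close>) (rule that)
  have co: "co j v \<in> ?KV" "finite {j. co j v \<noteq> 0}" "{j. co j v \<noteq> 0} \<subseteq> J" if "v \<in> ?V" for v j
    using bspec[OF coords that] by simp_all
  have co_sum: "v = (\<Sum>j | co j v \<noteq> 0. co j v * j)" if "v \<in> ?V" for v
    using bspec[OF coords that] by (elim conjE)
  have co_add: "co j (v + w) = co j v + co j w" if "v \<in> ?V" "w \<in> ?V" for v w j
    using bspec[OF bspec[OF co_add' that(1)] that(2)] by (rule spec)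
  have co_mult: "co j (k * v) = k * co j v" if "k \<in> ?KV" "v \<in> ?V" for k v j
    using bspec[OF bspec[OF co_mult' that(1)] that(2)] by (rule spec)
  have co_J: "co i j = (if i = j then emb_one L else 0)" if "j \<in> J" for i j
    using bspec[OF co_J' that] by (rule spec)
  have EV: "?E x \<in> ?V" if "x \<in> carrier L" for x using that by (simp add: img_def)
  have Einj: "x = y" if "x \<in> carrier L" "y \<in> carrier L" "?E x = ?E y" for x y using C.emb_inj that by blast
  have sL: "?s c \<in> carrier L" if "c \<in> carrier K" for c using that by simp
  have "\<forall>j x. \<exists>c. x \<in> carrier L \<longrightarrow> c \<in> carrier K \<and> ?E (?s c) = co j (?E x)"
    using co(1)[OF EV] by (auto simp: scalars_def image_iff) metis
  \<comment> \<open>\<open>g j x\<close> is the coordinate of x as an element of the record K, so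
    that it can act on A by scalar multiplication.\<close>
  then obtain g where g: "\<And>j x. x \<in> carrier L \<Longrightarrow> g j x \<in> carrier K \<and> ?E (?s (g j x)) = co j (?E x)" by metis
  have gI: "g j x = c" if "x \<in> carrier L" "c \<in> carrier K" "?E (?s c) = co j (?E x)" for j x c
    using g[OF that(1), of j] that(2,3) Einj[OF sL sL] scal_inj by metis
  have g_add: "g j (x \<oplus>\<^bsub>L\<^esub> y) = g j x \<oplus>\<^bsub>K\<^esub> g j y" if "x \<in> carrier L" "y \<in> carrier L" for j x y
    using that g[of x j] g[of y j] co_add[OF EV EV, of x y j]
    by (intro gI) (simp_all add: scal_add C.emb_add)
  have g_mult: "g j (c \<odot>\<^bsub>L\<^esub> x) = c \<otimes>\<^bsub>K\<^esub> g j x" if c: "c \<in> carrier K" and x: "x \<in> carrier L" for j c x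
  proof (rule gI)
    have gx: "g j x \<in> carrier K" "?E (?s (g j x)) = co j (?E x)" using g[OF x] by auto
    have "?E (?s (c \<otimes>\<^bsub>K\<^esub> g j x)) = ?E (?s c) * ?E (?s (g j x))"
      using c gx(1) by (simp add: L.smult_assoc1 scal_mult flip: C.emb_mult)
    also have "\<dots> = co j (?E (?s c) * ?E x)" unfolding gx(2)
      using co_mult[of "?E (?s c)" "?E x" j] c EV[OF x] by (simp add: scalars_def)
    also have "?E (?s c) * ?E x = ?E (c \<odot>\<^bsub>L\<^esub> x)" using c x by (simp add: scal_mult flip: C.emb_mult)
    finally show "?E (?s (c \<otimes>\<^bsub>K\<^esub> g j x)) = co j (?E (c \<odot>\<^bsub>L\<^esub> x))" .
  qed (use that g in auto)
  have gK: "g j x \<in> carrier K" if "x \<in> carrier L" for j x using g[OF that] by simp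
  have g0: "g j x = \<zero>\<^bsub>K\<^esub>" if "x \<in> carrier L" "co j (?E x) = 0" for j x
    using that C.emb_zero by (intro gI) simp_all
  have g_one: "g j \<one>\<^bsub>L\<^esub> = (if j = emb_one L then \<one>\<^bsub>K\<^esub> else \<zero>\<^bsub>K\<^esub>)" for j
    using co_J[OF J(2), of j] C.emb_zero by (intro gI) (auto simp: emb_one_def)
  show "a = b" if ab: "a \<in> carrier A" "b \<in> carrier A" "lA a = lA b" for a b
  proof -
    \<comment> \<open>The coordinate at the unit of L gives a left inverse of \<open>lA\<close>,
      here with values in the image of A under \<open>emb\<close>.\<close>
    let ?g = "g (emb_one L)"
    obtain \<pi> where \<pi>: "\<forall>x\<in>carrier L. \<forall>a\<in>carrier A. \<pi> (tn x a) = emb A (?g x \<odot>\<^bsub>A\<^esub> a)"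
      using tn_lift[of "\<lambda>x a. emb A (?g x \<odot>\<^bsub>A\<^esub> a)"] g_add g_mult gK
      by (auto simp: A.smult_l_distr A.smult_r_distr A.emb_add A.smult_assoc1 smult_comm)
    have "\<pi> (lA a) = emb A a" "\<pi> (lA b) = emb A b" using \<pi> ab(1,2) g_one[of "emb_one L"] by (simp_all add: lA_def)
    then have "emb A a = emb A b" using ab(3) by simp
    then show ?thesis using A.emb_inj ab by blast
  qed
  have "\<forall>j. \<exists>\<pi>. (\<forall>x\<in>carrier L. \<forall>a\<in>carrier A. \<pi> (tn x a) = lA (g j x \<odot>\<^bsub>A\<^esub> a)) \<and>
      (\<forall>b\<in>B0. \<forall>c\<in>B0. \<pi> (b + c) = \<pi> b + \<pi> c)"
  proof
    fix j
    show "\<exists>\<pi>. (\<forall>x\<in>carrier L. \<forall>a\<in>carrier A. \<pi> (tn x a) = lA (g j x \<odot>\<^bsub>A\<^esub> a)) \<and>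
      (\<forall>b\<in>B0. \<forall>c\<in>B0. \<pi> (b + c) = \<pi> b + \<pi> c)"
    proof (rule tn_lift)
      show "lA (g j (x \<oplus>\<^bsub>L\<^esub> y) \<odot>\<^bsub>A\<^esub> a) = lA (g j x \<odot>\<^bsub>A\<^esub> a) + lA (g j y \<odot>\<^bsub>A\<^esub> a)"
        if "x \<in> carrier L" "y \<in> carrier L" "a \<in> carrier A" for x y a
        using that gK g_add by (simp add: A.smult_l_distr lA_add)
      show "lA (g j x \<odot>\<^bsub>A\<^esub> (a \<oplus>\<^bsub>A\<^esub> b)) = lA (g j x \<odot>\<^bsub>A\<^esub> a) + lA (g j x \<odot>\<^bsub>A\<^esub> b)"
        if "x \<in> carrier L" "a \<in> carrier A" "b \<in> carrier A" for x a b
        using that gK by (simp add: A.smult_r_distr lA_add)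
      show "lA (g j (c \<odot>\<^bsub>L\<^esub> x) \<odot>\<^bsub>A\<^esub> a) = lA (g j x \<odot>\<^bsub>A\<^esub> (c \<odot>\<^bsub>A\<^esub> a))"
        if "c \<in> carrier K" "x \<in> carrier L" "a \<in> carrier A" for c x a
        using that gK[of x j] g_mult[of c x j] by (simp add: A.smult_assoc1 smult_comm)
    qed
  qed
  then obtain \<pi> where \<pi>: "\<And>j x a. x \<in> carrier L \<Longrightarrow> a \<in> carrier A \<Longrightarrow> \<pi> j (tn x a) = lA (g j x \<odot>\<^bsub>A\<^esub> a)"
    and \<pi>_add: "\<And>j b c. b \<in> B0 \<Longrightarrow> c \<in> B0 \<Longrightarrow> \<pi> j (b + c) = \<pi> j b + \<pi> j c" by metis
  have \<pi>0: "\<pi> j 0 = 0" for j using \<pi>_add[of 0 0 j] B.zero_in by simp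
  have \<pi>_diff: "\<pi> j (b - c) = \<pi> j b - \<pi> j c" if "b \<in> B0" "c \<in> B0" for j b c
    using \<pi>_add[of "b - c" c j] B.diff_in that by simp
  interpret A0: rng_in e0 A0 by (rule A0_rng_in)
  have \<pi>A: "\<pi> j b \<in> A0" if "b \<in> B0" for j b
    using that
  proof (induction b rule: tn_induct)
    case zero
    then show ?case using \<pi>0 by simp
  next
    case (ten x a)
    then show ?case using gK by (simp add: \<pi> A0_def)
  next
    case (diff b c)
    then show ?case using A0.diff_in by (simp add: \<pi>_diff)
  qed
  have \<pi>_mult: "\<pi> j (lA a * b) = lA a * \<pi> j b" if a: "a \<in> carrier A" and b: "b \<in> B0" for j a b
    using b
  proof (induction b rule: tn_induct)
    case zero
    then show ?case using \<pi>0 by simp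
  next
    case (ten x c)
    have "lA a * tn x c = tn x (a \<otimes>\<^bsub>A\<^esub> c)" using a ten tn_mult[of "\<one>\<^bsub>L\<^esub>" a x c] by (simp add: lA_def)
    then show ?case
      using a ten gK by (simp add: \<pi> smult_assoc2_r[OF KA domA] flip: lA_mult)
  next
    case (diff b c)
    have "lA a \<in> B0" using a A0_B0 by (auto simp: A0_def)
    then show ?case using diff \<pi>_diff B.mult_in by (simp add: right_diff_distrib)
  qed
  \<comment> \<open>The basis J lies in the image of L under \<open>emb\<close>, whereas
    \<open>tens\<close> asks for a basis inside the tensor product; X leads from the latter back to
    L.\<close>
  define X where "X j0 = inv_into (carrier L) lL j0" for j0
  have X: "X (lL x) = x" if "x \<in> carrier L" for x
    unfolding X_def using that lL_inj by (intro inv_into_f_f inj_onI) auto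
  define J0 where "J0 = lL ` {x \<in> carrier L. ?E x \<in> J}"
  define co0 where "co0 j0 b = \<pi> (?E (X j0)) b" for j0 b
  have J0E: "\<exists>x. x \<in> carrier L \<and> ?E x \<in> J \<and> j0 = lL x \<and> X j0 = x" if "j0 \<in> J0" for j0
    using that X by (auto simp: J0_def)
  \<comment> \<open>The finite support is stated explicitly as a set F, because for a difference b -
    c the two supports have to be merged.\<close>
  have fs: "\<exists>F. finite F \<and> F \<subseteq> {x \<in> carrier L. ?E x \<in> J} \<and>
      (\<forall>x. x \<in> carrier L \<longrightarrow> ?E x \<in> J \<longrightarrow> x \<notin> F \<longrightarrow> \<pi> (?E x) b = 0) \<and> b = (\<Sum>x\<in>F. lL x * \<pi> (?E x) b)"
    if b: "b \<in> B0" for b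
    using b
  proof (induction b rule: tn_induct)
    case zero
    then show ?case using \<pi>0 by (intro exI[of _ "{}"]) auto
  next
    case (ten x a)
    let ?F = "{y \<in> carrier L. co (?E y) (?E x) \<noteq> 0}"
    have inj: "inj_on ?E ?F" using Einj by (auto intro: inj_onI)
    have im: "?E ` ?F = {j. co j (?E x) \<noteq> 0}"
    proof -
      have "\<exists>y\<in>carrier L. j = ?E y" if "co j (?E x) \<noteq> 0" for j
        using that co(3)[OF EV[OF ten(1)]] J(1) by (auto simp: img_def)
      then show ?thesis by auto
    qed
    have "finite (?E ` ?F)" unfolding im by (rule co(2)[OF EV[OF ten(1)]])
    then have finF: "finite ?F" by (rule finite_imageD[OF _ inj])
    have FJ: "?F \<subseteq> {x \<in> carrier L. ?E x \<in> J}" using co(3)[OF EV[OF ten(1)]] by auto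
    have out: "\<pi> (?E y) (tn x a) = 0" if "y \<in> carrier L" "y \<notin> ?F" for y
      using that ten g0[of x "?E y"] by (simp add: \<pi> lA_zero)
    \<comment> \<open>The expansion of x in the basis is an equation between sums in the image of L;
      \<open>lf\<close> carries it over to tensors with second factor a.\<close>
    define lf where "lf v = tn (inv_into (carrier L) ?E v) a" for v
    have lE: "lf (?E y) = tn y a" if "y \<in> carrier L" for y
      unfolding lf_def using that Einj by (subst inv_into_f_f) (auto intro: inj_onI)
    have l_sum: "finite G \<Longrightarrow> G \<subseteq> carrier L \<Longrightarrow> (\<Sum>y\<in>G. ?E (h y)) \<in> ?V \<and> lf (\<Sum>y\<in>G. ?E (h y)) = (\<Sum>y\<in>G. tn (h y) a)"
      if h: "\<And>y. y \<in> carrier L \<Longrightarrow> h y \<in> carrier L" for G h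
    proof (induction G rule: finite_induct)
      case empty
      have "tn \<zero>\<^bsub>L\<^esub> a = 0" using tn_add_left[of "\<zero>\<^bsub>L\<^esub>" "\<zero>\<^bsub>L\<^esub>" a] ten by simp
      then show ?case using lE[of "\<zero>\<^bsub>L\<^esub>"] C.emb_zero EV[of "\<zero>\<^bsub>L\<^esub>"] by simp
    next
      case (insert y G)
      then obtain z where z: "z \<in> carrier L" "(\<Sum>y\<in>G. ?E (h y)) = ?E z" by (auto simp: img_def)
      have hy: "h y \<in> carrier L" using h insert by auto
      have eq: "(\<Sum>y\<in>insert y G. ?E (h y)) = ?E (h y \<oplus>\<^bsub>L\<^esub> z)" using insert z hy by (simp add: C.emb_add)
      have "lf (?E (h y \<oplus>\<^bsub>L\<^esub> z)) = tn (h y) a + lf (?E z)"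
        using lE[of "h y \<oplus>\<^bsub>L\<^esub> z"] lE[of z] hy z tn_add_left[OF hy z(1) ten(2)] by simp
      moreover have "lf (?E z) = (\<Sum>y\<in>G. tn (h y) a)" using insert z(2) by simp
      ultimately show ?case unfolding eq using insert.hyps hy z(1) EV by simp
    qed
    let ?h = "\<lambda>y. g (?E y) x \<odot>\<^bsub>L\<^esub> y"
    have "?E x = (\<Sum>j\<in>?E ` ?F. co j (?E x) * j)" unfolding im by (rule co_sum[OF EV[OF ten(1)]])
    also have "\<dots> = (\<Sum>y\<in>?F. co (?E y) (?E x) * ?E y)" by (simp add: sum.reindex[OF inj])
    also have "\<dots> = (\<Sum>y\<in>?F. ?E (?h y))"
    proof (rule sum.cong)
      fix y assume "y \<in> ?F"
      then have y: "y \<in> carrier L" by simp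
      have "co (?E y) (?E x) * ?E y = ?E (?s (g (?E y) x)) * ?E y" using g[OF ten(1)] by simp
      also have "\<dots> = ?E (?s (g (?E y) x) \<otimes>\<^bsub>L\<^esub> y)" using gK[OF ten(1)] y by (simp add: C.emb_mult)
      also have "\<dots> = ?E (?h y)" using gK[OF ten(1)] y by (simp add: scal_mult)
      finally show "co (?E y) (?E x) * ?E y = ?E (?h y)" .
    qed simp
    finally have Ex: "?E x = (\<Sum>y\<in>?F. ?E (?h y))" .
    have "tn x a = lf (?E x)" using lE ten by simp
    also have "\<dots> = lf (\<Sum>y\<in>?F. ?E (?h y))" by (rule arg_cong[OF Ex])
    also have "\<dots> = (\<Sum>y\<in>?F. tn (?h y) a)"
    proof (rule conjunct2[OF l_sum[OF _ finF]])
      show "?h y \<in> carrier L" if "y \<in> carrier L" for y using gK[OF ten(1)] that by simp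
      show "?F \<subseteq> carrier L" by blast
    qed
    also have "\<dots> = (\<Sum>y\<in>?F. lL y * \<pi> (?E y) (tn x a))"
    proof (rule sum.cong)
      fix y assume "y \<in> ?F"
      then have y: "y \<in> carrier L" by simp
      show "tn (?h y) a = lL y * \<pi> (?E y) (tn x a)"
        using y ten gK[OF ten(1)] tn_split[of y "g (?E y) x \<odot>\<^bsub>A\<^esub> a"] by (simp add: \<pi> tn_smult)
    qed simp
    finally have "tn x a = (\<Sum>y\<in>?F. lL y * \<pi> (?E y) (tn x a))" .
    then show ?case using finF FJ out by (intro exI[of _ ?F]) blast
  next
    case (diff b c)
    from diff(3) obtain F where F: "finite F" "F \<subseteq> {x \<in> carrier L. ?E x \<in> J}"
        "\<forall>x. x \<in> carrier L \<longrightarrow> ?E x \<in> J \<longrightarrow> x \<notin> F \<longrightarrow> \<pi> (?E x) b = 0" "b = (\<Sum>x\<in>F. lL x * \<pi> (?E x) b)"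
      by (elim exE conjE) (rule that)
    from diff(4) obtain G where G: "finite G" "G \<subseteq> {x \<in> carrier L. ?E x \<in> J}"
        "\<forall>x. x \<in> carrier L \<longrightarrow> ?E x \<in> J \<longrightarrow> x \<notin> G \<longrightarrow> \<pi> (?E x) c = 0" "c = (\<Sum>x\<in>G. lL x * \<pi> (?E x) c)"
      by (elim exE conjE) (rule that)
    have b: "(\<Sum>x\<in>F. lL x * \<pi> (?E x) b) = (\<Sum>x\<in>F \<union> G. lL x * \<pi> (?E x) b)"
      using F G by (intro sum.mono_neutral_left) auto
    have c: "(\<Sum>x\<in>G. lL x * \<pi> (?E x) c) = (\<Sum>x\<in>F \<union> G. lL x * \<pi> (?E x) c)"
      using F G by (intro sum.mono_neutral_left) auto
    have "b - c = (\<Sum>x\<in>F \<union> G. lL x * \<pi> (?E x) b) - (\<Sum>x\<in>F \<union> G. lL x * \<pi> (?E x) c)"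
      using F(4) G(4) b c by metis
    also have "\<dots> = (\<Sum>x\<in>F \<union> G. lL x * \<pi> (?E x) (b - c))"
      using diff(1,2) by (simp add: \<pi>_diff right_diff_distrib sum_subtractf)
    finally have "b - c = (\<Sum>x\<in>F \<union> G. lL x * \<pi> (?E x) (b - c))" .
    moreover have "\<forall>x. x \<in> carrier L \<longrightarrow> ?E x \<in> J \<longrightarrow> x \<notin> F \<union> G \<longrightarrow> \<pi> (?E x) (b - c) = 0"
      using F(3) G(3) diff(1,2) \<pi>_diff by simp
    ultimately show ?case using F G by (intro exI[of _ "F \<union> G"]) blast
  qed
  have cofs: "finite {j \<in> J0. co0 j b \<noteq> 0} \<and> b = (\<Sum>j | j \<in> J0 \<and> co0 j b \<noteq> 0. j * co0 j b)" if b: "b \<in> B0" for b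
  proof -
    obtain F where F: "finite F" "F \<subseteq> {x \<in> carrier L. ?E x \<in> J}"
      "\<forall>x. x \<in> carrier L \<longrightarrow> ?E x \<in> J \<longrightarrow> x \<notin> F \<longrightarrow> \<pi> (?E x) b = 0" "b = (\<Sum>x\<in>F. lL x * \<pi> (?E x) b)"
      using fs[OF b] by blast
    have sub: "{j \<in> J0. co0 j b \<noteq> 0} \<subseteq> lL ` F"
    proof
      fix j assume j: "j \<in> {j \<in> J0. co0 j b \<noteq> 0}"
      then obtain x where x: "x \<in> carrier L" "?E x \<in> J" "j = lL x" "X j = x" using J0E by blast
      then have "\<pi> (?E x) b \<noteq> 0" using j by (simp add: co0_def)
      then show "j \<in> lL ` F" using F(3) x by blast
    qed
    have injF: "inj_on lL F" using F(2) lL_inj by (auto intro!: inj_onI)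
    have "b = (\<Sum>x\<in>F. lL x * co0 (lL x) b)"
      using F(4) F(2) X unfolding co0_def by (auto intro!: sum.cong trans[OF F(4)])
    also have "\<dots> = (\<Sum>j\<in>lL ` F. j * co0 j b)" by (simp add: sum.reindex[OF injF])
    also have "\<dots> = (\<Sum>j | j \<in> J0 \<and> co0 j b \<noteq> 0. j * co0 j b)"
      using sub F(1,2) by (intro sum.mono_neutral_right) (auto simp: J0_def)
    finally show ?thesis using finite_subset[OF sub] F(1) by blast
  qed
  have "tens e0 K0 L0 J0 co0 A0 B0"
  proof (intro tens.intro)
    show "dom_in e0 B0" by (rule B.dom_in_axioms)
    show "rng_in e0 A0" "A0 \<subseteq> B0" "subfield_in e0 L0" "L0 \<subseteq> B0" "subfield_in e0 K0" "K0 \<subseteq> L0" "K0 \<subseteq> A0"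
      by (rule A0_rng_in A0_B0 L0_subfield L0_B0 K0_subfield K0_L0 K0_A0)+
    show "\<exists>\<mu>\<in>L0. poly p \<mu> = 0" if "p \<in> polys L0" "degree p > 0" for p
      using C.hom_root[where h = lL, OF lL_add lL_mult, of p] that unfolding L0_def by blast
    show "J0 \<subseteq> L0" by (auto simp: J0_def L0_def)
    have "?E \<one>\<^bsub>L\<^esub> \<in> J" using J(2) by (simp add: emb_one_def)
    then show "e0 \<in> J0" unfolding J0_def lL_one[symmetric] by blast
    show "co0 j b \<in> A0" if "b \<in> B0" for b j using \<pi>A[OF that] by (simp add: co0_def)
    show "finite {j \<in> J0. co0 j b \<noteq> 0}" if "b \<in> B0" for b using cofs[OF that] by blast
    show "b = (\<Sum>j | j \<in> J0 \<and> co0 j b \<noteq> 0. j * co0 j b)" if "b \<in> B0" for b using cofs[OF that] by blast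
    show "co0 j (b + c) = co0 j b + co0 j c" if "b \<in> B0" "c \<in> B0" for b c j using \<pi>_add[OF that] by (simp add: co0_def)
    show "co0 j (a * b) = a * co0 j b" if "a \<in> A0" "b \<in> B0" for a b j
      using \<pi>_mult[OF _ that(2)] that(1) by (auto simp: co0_def A0_def)
    show "co0 j l \<in> K0" if "l \<in> L0" for l j
      using that gK by (auto simp: co0_def L0_def lL_def[abs_def] \<pi> K0_def scalars_def)
    show "co0 j e0 = (if j = e0 then e0 else 0)" if jJ: "j \<in> J0" for j
    proof -
      obtain x where x: "x \<in> carrier L" "?E x \<in> J" "j = lL x" "X j = x" using J0E[OF jJ] by blast
      have "co0 j e0 = lA (g (?E x) \<one>\<^bsub>L\<^esub> \<odot>\<^bsub>A\<^esub> \<one>\<^bsub>A\<^esub>)" using x(4) \<pi>[of "\<one>\<^bsub>L\<^esub>" "\<one>\<^bsub>A\<^esub>"] by (simp add: co0_def tn_one)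
      moreover have "j = e0 \<longleftrightarrow> ?E x = emb_one L"
        using x lL_inj[of x "\<one>\<^bsub>L\<^esub>"] Einj[of x "\<one>\<^bsub>L\<^esub>"] lL_one by (auto simp: emb_one_def)
      ultimately show ?thesis by (simp add: g_one lA_one lA_zero)
    qed
  qed
  then show "\<exists>J co. tens e0 K0 L0 J co A0 B0" by blast
qed

end


section \<open>Injective homomorphisms\<close>

locale hom_in = rng_in e S for e :: "'r::comm_ring_1" and S +
  fixes \<phi> :: "'r \<Rightarrow> 's::comm_ring_1"
  assumes hom_add: "a \<in> S \<Longrightarrow> b \<in> S \<Longrightarrow> \<phi> (a + b) = \<phi> a + \<phi> b"
    and hom_mult: "a \<in> S \<Longrightarrow> b \<in> S \<Longrightarrow> \<phi> (a * b) = \<phi> a * \<phi> b"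
    and hom_inj: "a \<in> S \<Longrightarrow> \<phi> a = 0 \<Longrightarrow> a = 0"
begin

lemma hom_zero [simp]: "\<phi> 0 = 0"
  using hom_add[of 0 0] by simp

lemma hom_diff: "a \<in> S \<Longrightarrow> b \<in> S \<Longrightarrow> \<phi> (a - b) = \<phi> a - \<phi> b"
  using hom_add[of "a - b" b] diff_in by simp

lemma hom_eq_iff: "a \<in> S \<Longrightarrow> b \<in> S \<Longrightarrow> \<phi> a = \<phi> b \<longleftrightarrow> a = b"
  using hom_inj[of "a - b"] hom_diff[of a b] diff_in[of a b] by auto

lemma hom_sum: "(\<And>i. i \<in> I \<Longrightarrow> f i \<in> S) \<Longrightarrow> \<phi> (sum f I) = (\<Sum>i\<in>I. \<phi> (f i))"
  by (induction I rule: infinite_finite_induct) (auto simp: hom_add sum_in)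

lemma image_rng_in:
  assumes "rng_in e T" "T \<subseteq> S"
  shows "rng_in (\<phi> e) (\<phi> ` T)"
proof -
  interpret T: rng_in e T by fact
  show ?thesis
  proof
    show "\<phi> e \<in> \<phi> ` T" using T.one_in by blast
    fix a b assume "a \<in> \<phi> ` T" "b \<in> \<phi> ` T"
    then obtain x y where xy: "x \<in> T" "y \<in> T" "a = \<phi> x" "b = \<phi> y" by blast
    then have S: "x \<in> S" "y \<in> S" using assms(2) by auto
    show "\<phi> e * a = a" using hom_mult[OF one_in S(1)] one_mult[OF S(1)] xy by simp
    show "a - b \<in> \<phi> ` T" using hom_diff[OF S] T.diff_in[OF xy(1,2)] xy by (metis image_eqI)
    show "a * b \<in> \<phi> ` T" using hom_mult[OF S] T.mult_in[OF xy(1,2)] xy by (metis image_eqI)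
  qed
qed

lemma coeff_hom: "coeff (map_poly \<phi> p) i = \<phi> (coeff p i)"
  by (simp add: coeff_map_poly)

lemma polys_image:
  assumes "0 \<in> T" "T \<subseteq> S"
  shows "polys (\<phi> ` T) = map_poly \<phi> ` polys T"
proof
  show "map_poly \<phi> ` polys T \<subseteq> polys (\<phi> ` T)" by (auto simp: polys_def coeff_hom)
  show "polys (\<phi> ` T) \<subseteq> map_poly \<phi> ` polys T"
  proof
    fix q assume q: "q \<in> polys (\<phi> ` T)"
    let ?g = "inv_into T \<phi>"
    have inj: "inj_on \<phi> T" using hom_eq_iff assms(2) by (intro inj_onI) blast
    have g0: "?g 0 = 0" using inv_into_f_f[OF inj assms(1)] by simp
    have "?g c \<in> T" "\<phi> (?g c) = c" if "c \<in> \<phi> ` T" for c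
      using that by (auto intro: inv_into_into f_inv_into_f)
    then have "map_poly ?g q \<in> polys T" "map_poly \<phi> (map_poly ?g q) = q"
      using q by (auto simp: polys_def coeff_map_poly g0 coeff_hom intro!: poly_eqI)
    then show "q \<in> map_poly \<phi> ` polys T" by (metis image_eqI)
  qed
qed

lemma map_poly_hom_in: "hom_in [:e:] (polys S) (map_poly \<phi>)"
proof (intro hom_in.intro polys_rng_in hom_in_axioms.intro)
  show "map_poly \<phi> (p + q) = map_poly \<phi> p + map_poly \<phi> q" if "p \<in> polys S" "q \<in> polys S" for p q
    using that by (intro poly_eqI) (simp add: coeff_hom hom_add polys_def)
  show "map_poly \<phi> (p * q) = map_poly \<phi> p * map_poly \<phi> q" if "p \<in> polys S" "q \<in> polys S" for p q
  proof (rule poly_eqI)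
    fix n
    have "\<phi> (\<Sum>i\<le>n. coeff p i * coeff q (n - i)) = (\<Sum>i\<le>n. \<phi> (coeff p i * coeff q (n - i)))"
      using that mult_in by (intro hom_sum) (simp add: polys_def)
    then show "coeff (map_poly \<phi> (p * q)) n = coeff (map_poly \<phi> p * map_poly \<phi> q) n"
      using that by (simp add: coeff_hom coeff_mult hom_mult polys_def)
  qed
  show "p = 0" if "p \<in> polys S" "map_poly \<phi> p = 0" for p
  proof (rule poly_eqI)
    fix i
    have "\<phi> (coeff p i) = 0" using that(2) coeff_hom[of p i] by simp
    then show "coeff p i = coeff 0 i" using hom_inj that(1) by (simp add: polys_def)
  qed
qed

lemma hom_poly: "p \<in> polys S \<Longrightarrow> y \<in> S \<Longrightarrow> \<phi> (poly p y) = poly (map_poly \<phi> p) (\<phi> y)"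
proof (induction p rule: polys_induct)
  case (pCons a p)
  have "map_poly \<phi> (pCons a p) = pCons (\<phi> a) (map_poly \<phi> p)" by (simp add: map_poly_pCons)
  then show ?case using pCons poly_in[of p y] mult_in[of y "poly p y"] by (simp add: hom_add hom_mult)
qed simp

lemma adj_image:
  assumes "rng_in e T" "T \<subseteq> S" "y \<in> S"
  shows "adj (\<phi> ` T) (\<phi> y) = \<phi> ` adj T y"
proof -
  have "\<phi> (poly p y) = poly (map_poly \<phi> p) (\<phi> y)" if "p \<in> polys T" for p
    using hom_poly[of p y] polys_mono[OF assms(2)] that assms(3) by blast
  then show ?thesis unfolding adj_def polys_image[OF rng_in.zero_in[OF assms(1)] assms(2)]
    by (auto simp: image_image)
qed

lemma adjl_image:
  assumes K: "rng_in e K" "K \<subseteq> S" and ys: "set ys \<subseteq> S"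
  shows "adjl (\<phi> ` K) (map \<phi> ys) = \<phi> ` adjl K ys"
  using ys
proof (induction ys)
  case (Cons y ys)
  then have "rng_in e (adjl K ys)" "adjl K ys \<subseteq> S" using adjl_rng_in[OF rng_in_axioms K, of ys] by auto
  then show ?case using Cons adj_image by simp
qed simp

lemma alg_in_image:
  assumes "0 \<in> T" "T \<subseteq> S" "y \<in> S" "alg_in (\<phi> ` T) (\<phi> y)"
  shows "alg_in T y"
proof -
  interpret P: hom_in "[:e:]" "polys S" "map_poly \<phi>" by (rule map_poly_hom_in)
  obtain p where p: "p \<in> polys T" "map_poly \<phi> p \<noteq> 0" "poly (map_poly \<phi> p) (\<phi> y) = 0"
    using assms(4) unfolding alg_in_def polys_image[OF assms(1,2)] by blast
  have pS: "p \<in> polys S" using polys_mono[OF assms(2)] p(1) by blast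
  then have "poly p y = 0" using hom_inj[OF poly_in[OF pS assms(3)]] hom_poly[OF pS assms(3)] p(3) by simp
  then show ?thesis using p unfolding alg_in_def by (intro bexI[of _ p]) auto
qed

text \<open>Dependence is reflected by injective homomorphisms, so it may be established over the
  fraction field, where the transcendence basis lives.\<close>

lemma algdep_image:
  assumes K: "rng_in e K" "K \<subseteq> S"
  shows "set ys \<subseteq> S \<Longrightarrow> algdep (\<phi> ` K) (map \<phi> ys) \<Longrightarrow> algdep K ys"
proof (induction ys)
  case (Cons y ys)
  then have "rng_in e (adjl K ys)" "adjl K ys \<subseteq> S" using adjl_rng_in[OF rng_in_axioms K, of ys] by auto
  then show ?case using Cons alg_in_image[of "adjl K ys" y] adjl_image[OF K, of ys] by (auto simp: rng_in.zero_in)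
qed simp

end

lemma (in rng_in) const_hom_in: "hom_in e S (\<lambda>a. [:a:])"
  by unfold_locales (auto simp: mult.commute)

lemma poly_map_const:
  assumes "rng_in e S" "p \<in> polys S"
  shows "poly (map_poly (\<lambda>a. [:a:]) p) [:0, e:] = p"
proof -
  interpret rng_in e S by fact
  show ?thesis
    using assms(2)
  proof (induction p rule: polys_induct)
    case (pCons a p)
    have "[:0, e:] * p = pCons 0 ([:e:] * p)" by simp
    also have "[:e:] * p = p" using rng_in.one_mult[OF polys_rng_in pCons(2)] .
    finally show ?case using pCons(3) by (simp add: map_poly_pCons)
  qed simp
qed

text \<open>The polynomial ring in the form that \<open>cylinder\<close> asks of R, with the
  constants as the smaller ring.\<close>

lemma polys_adj: "rng_in e S \<Longrightarrow> polys S = adj ((\<lambda>a. [:a:]) ` S) [:0, e:]"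
proof -
  assume S: "rng_in e S"
  then interpret rng_in e S .
  interpret c: hom_in e S "\<lambda>a. [:a:]" by (rule const_hom_in)
  show ?thesis unfolding adj_def c.polys_image[OF zero_in subset_refl]
    using poly_map_const[OF S] by (auto simp: image_image)
qed

lemma (in dom_in) clear_denominators:
  assumes S: "rng_in e T" "T \<subseteq> S"
  shows "(\<And>i. \<exists>t\<in>T. t \<noteq> 0 \<and> t * coeff P i \<in> T) \<Longrightarrow> \<exists>t\<in>T. t \<noteq> 0 \<and> smult t P \<in> polys T"
proof (induction P)
  interpret T: rng_in e T by fact
  case 0
  show ?case using T.one_in one_nz by (intro bexI[of _ e]) (auto simp: polys_def)
next
  interpret T: rng_in e T by fact
  case (pCons a P)
  obtain s where s: "s \<in> T" "s \<noteq> 0" "s * a \<in> T" using pCons.prems[of 0] by auto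
  have "\<exists>t\<in>T. t \<noteq> 0 \<and> t * coeff P i \<in> T" for i using pCons.prems[of "Suc i"] by simp
  then obtain t where t: "t \<in> T" "t \<noteq> 0" "smult t P \<in> polys T" using pCons.IH by blast
  have "smult s (smult t P) \<in> polys T" using T.smult_in_polys[OF s(1) t(3)] .
  moreover have "(s * t) * a = t * (s * a)" by (simp add: mult_ac)
  then have "(s * t) * a \<in> T" using T.mult_in[OF t(1) s(3)] by metis
  ultimately have "smult (s * t) (pCons a P) \<in> polys T" by (simp add: T.pCons_in_polys)
  moreover have "s * t \<noteq> 0" using mult_nz[of s t] s t S(2) by blast
  ultimately show ?case using T.mult_in[OF s(1) t(1)] by blast
qed

text \<open>Every element of the field generated by H is a quotient of elements of T after applying
  h (\<open>frac\<close>). Multiplying an equation over that field by a common denominator gives one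
  over T.\<close>

lemma (in field) algebraic_over_generated:
  fixes h :: "'a \<Rightarrow> 'r::comm_ring_1"
  assumes add: "\<And>a b. a \<in> carrier R \<Longrightarrow> b \<in> carrier R \<Longrightarrow> h (a \<oplus> b) = h a + h b"
    and mult: "\<And>a b. a \<in> carrier R \<Longrightarrow> b \<in> carrier R \<Longrightarrow> h (a \<otimes> b) = h a * h b"
    and D: "dom_in (h \<one>) D" "h ` carrier R \<subseteq> D" and T: "rng_in (h \<one>) T" "T \<subseteq> D"
    and H: "H \<subseteq> carrier R" "h ` H \<subseteq> T" and y: "y \<in> carrier R" "(algebraic over generate_field R H) y"
  shows "alg_in T (h y)"
proof -
  interpret D: dom_in "h \<one>" D by fact
  interpret T: rng_in "h \<one>" T by fact
  have h0: "h \<zero> = 0" using add[of \<zero> \<zero>] by simp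
  have hD: "h a \<in> D" if "a \<in> carrier R" for a using D(2) that by blast
  have hinv: "h a * h (inv a) = h \<one>" if "a \<in> carrier R" "a \<noteq> \<zero>" for a
    using mult[of a "inv a"] that field_Units by simp
  have hnz: "h a \<noteq> 0" if "a \<in> carrier R" "a \<noteq> \<zero>" for a using hinv[OF that] D.one_nz by auto
  have frac: "\<exists>t\<in>T. t \<noteq> 0 \<and> t * h z \<in> T" if "z \<in> generate_field R H" for z
    using that
  proof (induction rule: generate_field.induct)
    case one
    then show ?case using T.one_in T.mult_in D.one_nz by blast
  next
    case (incl z)
    then show ?case using T.one_in T.mult_in D.one_nz H(2) by blast
  next
    case (a_inv z)
    then obtain t where t: "t \<in> T" "t \<noteq> 0" "t * h z \<in> T" by blast
    have "z \<in> carrier R" using a_inv(1) generate_field_incl[OF H(1)] by blast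
    then have "h (\<ominus> z) = - h z" using add[of z "\<ominus> z"] h0 by (simp add: r_neg eq_neg_iff_add_eq_0 add.commute)
    then show ?case using t T.uminus_in[OF t(3)] by auto
  next
    case (m_inv z)
    then obtain t where t: "t \<in> T" "t \<noteq> 0" "t * h z \<in> T" by blast
    have z: "z \<in> carrier R" using m_inv(1) generate_field_incl[OF H(1)] by blast
    have "t * h z \<noteq> 0" using D.mult_nz[OF _ hD[OF z] t(2) hnz[OF z m_inv(2)]] t(1) T(2) by blast
    moreover have "(t * h z) * h (inv z) = t * h \<one>" using hinv[OF z m_inv(2)] by (simp add: mult.assoc)
    then have "(t * h z) * h (inv z) \<in> T" using t(1) T.mult_one by simp
    ultimately show ?case using t(3) by blast
  next
    case (eng_add z w)
    then obtain t s where t: "t \<in> T" "t \<noteq> 0" "t * h z \<in> T" and s: "s \<in> T" "s \<noteq> 0" "s * h w \<in> T" by blast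
    have zw: "z \<in> carrier R" "w \<in> carrier R" using eng_add(1,2) generate_field_incl[OF H(1)] by auto
    have "(t * s) * h (z \<oplus> w) = s * (t * h z) + t * (s * h w)" using add[OF zw] by (simp add: algebra_simps)
    then have "(t * s) * h (z \<oplus> w) \<in> T" using T.add_in[OF T.mult_in[OF s(1) t(3)] T.mult_in[OF t(1) s(3)]] by simp
    moreover have "t * s \<noteq> 0" using D.mult_nz t s T(2) by blast
    ultimately show ?case using T.mult_in[OF t(1) s(1)] by blast
  next
    case (eng_mult z w)
    then obtain t s where t: "t \<in> T" "t \<noteq> 0" "t * h z \<in> T" and s: "s \<in> T" "s \<noteq> 0" "s * h w \<in> T" by blast
    have zw: "z \<in> carrier R" "w \<in> carrier R" using eng_mult(1,2) generate_field_incl[OF H(1)] by auto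
    have "(t * s) * h (z \<otimes> w) = (t * h z) * (s * h w)" using mult[OF zw] by (simp add: mult_ac)
    then have "(t * s) * h (z \<otimes> w) \<in> T" using T.mult_in[OF t(3) s(3)] by simp
    moreover have "t * s \<noteq> 0" using D.mult_nz t s T(2) by blast
    ultimately show ?case using T.mult_in[OF t(1) s(1)] by blast
  qed
  have sub: "subring (generate_field R H) R" by (rule subfieldE(1)[OF generate_field_is_subfield[OF H(1)]])
  obtain p where p: "p \<in> carrier (univ_poly R (generate_field R H))" "p \<noteq> []" "eval p y = \<zero>"
    by (rule algebraicE[OF sub y])
  have pol: "set p \<subseteq> generate_field R H" "hd p \<noteq> \<zero>"
    using p(1,2) unfolding univ_poly_carrier[symmetric] polynomial_def by auto
  then have pR: "set p \<subseteq> carrier R" using generate_field_incl[OF H(1)] by blast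
  define P where "P = Poly (rev (map h p))"
  have "poly P (h y) = 0" using hom_eval[where h = h and q = p, OF add mult y(1) pR] p(3) h0 by (simp add: P_def)
  moreover have "\<exists>t\<in>T. t \<noteq> 0 \<and> t * poly.coeff P i \<in> T" for i
  proof (cases "i < length p")
    case True
    then have "poly.coeff P i = h (rev p ! i)" by (simp add: P_def coeff_Poly_eq nth_default_def rev_map)
    moreover have "rev p ! i \<in> set p" using True by (metis length_rev nth_mem set_rev)
    ultimately show ?thesis using frac pol(1) by auto
  next
    case False
    then have "poly.coeff P i = 0" by (simp add: P_def coeff_Poly_eq nth_default_def)
    then show ?thesis using T.one_in D.one_nz by auto
  qed
  then obtain t where t: "t \<in> T" "t \<noteq> 0" "smult t P \<in> polys T" using D.clear_denominators[OF T] by blast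
  moreover have "smult t P \<noteq> 0"
  proof
    assume z: "smult t P = 0"
    have "poly.coeff P (length p - 1) = h (hd p)"
      using p(2) by (simp add: P_def coeff_Poly_eq nth_default_def rev_map rev_nth hd_conv_nth)
    then have "t * h (hd p) = 0" using z by (metis coeff_0 coeff_smult)
    moreover have "hd p \<in> carrier R" using pR p(2) by auto
    ultimately show False using D.mult_nz[OF _ hD t(2) hnz, of "hd p"] t(1) T(2) pol(2) by blast
  qed
  ultimately show ?thesis unfolding alg_in_def by (intro bexI[of _ "smult t P"]) auto
qed


section \<open>Cylinders from isomorphic polynomial algebras\<close>

lemma (in hom_in) image_subfield_in:
  assumes "subfield_in e K" "K \<subseteq> S"
  shows "subfield_in (\<phi> e) (\<phi> ` K)"
proof -
  have "\<exists>v\<in>\<phi> ` K. k * v = \<phi> e" if k: "k \<in> \<phi> ` K" "k \<noteq> 0" for k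
  proof -
    obtain a where a: "a \<in> K" "k = \<phi> a" using k by blast
    then have "a \<noteq> 0" using k(2) by auto
    then obtain v where v: "v \<in> K" "a * v = e" using assms(1) a(1) by (auto simp: subfield_in_def)
    have "\<phi> (a * v) = \<phi> a * \<phi> v" by (rule hom_mult) (use a(1) v(1) assms(2) in auto)
    then show ?thesis using a(2) v by (intro bexI[of _ "\<phi> v"]) simp_all
  qed
  moreover have "\<phi> e \<noteq> 0" using hom_inj[OF one_in] assms(1) by (auto simp: subfield_in_def)
  ultimately show ?thesis using image_rng_in[of K] assms by (auto simp: subfield_in_def)
qed

text \<open>\<open>L \<otimes> A[X]\<close> is \<open>(L \<otimes> A)[X]\<close>, with coordinates
  taken coefficientwise. Basis elements are now constant polynomials, and \<open>coeff j 0\<close>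
  recovers the original index.\<close>

theorem (in tens) tens_polys:
  "tens [:e:] ((\<lambda>a. [:a:]) ` K) ((\<lambda>a. [:a:]) ` L) ((\<lambda>a. [:a:]) ` J) (\<lambda>j. map_poly (co (coeff j 0))) (polys A) (polys B)"
proof -
  let ?c = "\<lambda>a::'r. [:a:]"
  interpret cB: hom_in e B ?c by (rule B.const_hom_in)
  have LB': "L \<subseteq> B" "K \<subseteq> B" using LB KL by auto
  have cf: "coeff (map_poly (co j) b) i = co j (coeff b i)" if "j \<in> J" for j b i
    using co_zero[OF that] by (simp add: coeff_map_poly)
  have pB: "coeff b i \<in> B" if "b \<in> polys B" for b i using that by (simp add: polys_def)
  have mc: "map_poly (co j) [:b:] = [:co j b:]" if "j \<in> J" for j b
    using co_zero[OF that] by (simp add: map_poly_pCons)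
  have nz: "finite {j \<in> J. map_poly (co j) b \<noteq> 0}" if b: "b \<in> polys B" for b
  proof -
    have "{j \<in> J. map_poly (co j) b \<noteq> 0} \<subseteq> (\<Union>i\<le>degree b. {j \<in> J. co j (coeff b i) \<noteq> 0})"
    proof
      fix j assume j: "j \<in> {j \<in> J. map_poly (co j) b \<noteq> 0}"
      then obtain i where i: "co j (coeff b i) \<noteq> 0" using cf[of j b] by (auto simp: poly_eq_iff)
      then have "coeff b i \<noteq> 0" using j co_zero[of j] by auto
      then show "j \<in> (\<Union>i\<le>degree b. {j \<in> J. co j (coeff b i) \<noteq> 0})" using i j le_degree by auto
    qed
    moreover have "finite (\<Union>i\<le>degree b. {j \<in> J. co j (coeff b i) \<noteq> 0})" using co_fin[OF pB[OF b]] by blast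
    ultimately show ?thesis by (rule finite_subset)
  qed
  have set_eq: "{j \<in> ?c ` J. map_poly (co (coeff j 0)) b \<noteq> 0} = ?c ` {j \<in> J. map_poly (co j) b \<noteq> 0}" for b
    by auto
  show ?thesis
  proof (intro tens.intro)
    show "dom_in [:e:] (polys B)" by (rule B.polys_dom_in)
    show "rng_in [:e:] (polys A)" by (rule A.polys_rng_in)
    show "polys A \<subseteq> polys B" by (rule polys_mono[OF AB])
    show "subfield_in [:e:] (?c ` L)" "subfield_in [:e:] (?c ` K)"
      by (rule cB.image_subfield_in[OF fieldL LB'(1)], rule cB.image_subfield_in[OF fieldK LB'(2)])
    show "?c ` L \<subseteq> polys B" "?c ` K \<subseteq> polys A" using LB KA by auto
    show "?c ` K \<subseteq> ?c ` L" "?c ` J \<subseteq> ?c ` L" "[:e:] \<in> ?c ` J" using KL JL eJ by auto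
    show "\<exists>\<mu>\<in>?c ` L. poly p \<mu> = 0" if p: "p \<in> polys (?c ` L)" "degree p > 0" for p
    proof -
      obtain q where q: "q \<in> polys L" "p = map_poly ?c q" using p(1) cB.polys_image[OF L.zero_in LB] by auto
      have "degree q > 0"
      proof (rule ccontr)
        assume "\<not> degree q > 0"
        then obtain a where "q = [:a:]" by (auto elim: degree_eq_zeroE)
        then show False using p(2) q(2) by (simp add: map_poly_pCons)
      qed
      then obtain \<mu> where \<mu>: "\<mu> \<in> L" "poly q \<mu> = 0" using closedL[OF q(1)] by blast
      have "q \<in> polys B" using q(1) polys_mono[OF LB] by blast
      then have "poly p [:\<mu>:] = [:poly q \<mu>:]" using cB.hom_poly[of q \<mu>] q(2) \<mu>(1) LB by auto
      then show ?thesis using \<mu> by auto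
    qed
    fix b j assume b: "b \<in> polys B" and jJ: "j \<in> ?c ` J"
    then obtain i where i: "i \<in> J" "j = [:i:]" by blast
    show "map_poly (co (coeff j 0)) b \<in> polys A" using i b by (simp add: polys_def cf co_in)
    show "map_poly (co (coeff j 0)) (b + c) = map_poly (co (coeff j 0)) b + map_poly (co (coeff j 0)) c"
      if "c \<in> polys B" for c
      using that i b by (intro poly_eqI) (simp add: polys_def cf co_add)
    show "map_poly (co (coeff j 0)) (a * b) = a * map_poly (co (coeff j 0)) b" if a: "a \<in> polys A" for a
    proof (rule poly_eqI)
      fix n
      have aA: "coeff a k \<in> A" for k using a by (simp add: polys_def)
      have "co i (\<Sum>k\<le>n. coeff a k * coeff b (n - k)) = (\<Sum>k\<le>n. co i (coeff a k * coeff b (n - k)))"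
        using aA AB pB[OF b] i(1) by (intro co_sum') (auto intro!: B.mult_in)
      also have "\<dots> = (\<Sum>k\<le>n. coeff a k * co i (coeff b (n - k)))"
        using co_mult[OF aA pB[OF b] i(1)] by simp
      finally show "coeff (map_poly (co (coeff j 0)) (a * b)) n = coeff (a * map_poly (co (coeff j 0)) b) n"
        using i by (simp add: cf coeff_mult)
    qed
  next
    fix b assume b: "b \<in> polys B"
    show "finite {j \<in> ?c ` J. map_poly (co (coeff j 0)) b \<noteq> 0}" unfolding set_eq using nz[OF b] by simp
    let ?N = "{j \<in> J. map_poly (co j) b \<noteq> 0}"
    have inj: "inj_on ?c ?N" by (auto intro: inj_onI)
    have "coeff b n = coeff (\<Sum>j\<in>?N. [:j:] * map_poly (co j) b) n" for n
    proof -
      have "{j. j \<in> J \<and> co j (coeff b n) \<noteq> 0} \<subseteq> ?N" using cf[of _ b n] by fastforce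
      then have "(\<Sum>j | j \<in> J \<and> co j (coeff b n) \<noteq> 0. j * co j (coeff b n)) = (\<Sum>j\<in>?N. j * co j (coeff b n))"
        using nz[OF b] by (intro sum.mono_neutral_left) auto
      moreover have "coeff b n = (\<Sum>j | j \<in> J \<and> co j (coeff b n) \<noteq> 0. j * co j (coeff b n))"
        by (rule co_sum[OF pB[OF b]])
      ultimately show ?thesis by (simp add: coeff_sum cf)
    qed
    then have "b = (\<Sum>j\<in>?N. [:j:] * map_poly (co j) b)" by (rule poly_eqI)
    then show "b = (\<Sum>j | j \<in> ?c ` J \<and> map_poly (co (coeff j 0)) b \<noteq> 0. j * map_poly (co (coeff j 0)) b)"
      unfolding set_eq by (simp add: sum.reindex[OF inj])
  next
    fix l j assume "l \<in> ?c ` L" "j \<in> ?c ` J"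
    then show "map_poly (co (coeff j 0)) l \<in> ?c ` K" using co_L by (auto simp: mc)
  next
    fix j assume "j \<in> ?c ` J"
    then show "map_poly (co (coeff j 0)) [:e:] = (if j = [:e:] then [:e:] else 0)" using co_e by (auto simp: mc)
  qed
qed

text \<open>With \<psi> the identity this describes A inside \<open>A[X]\<close>; with \<psi> coming
  from the given isomorphism it describes A' inside the same ring. Factoriality is needed of A and B
  alone and passes to their polynomial rings.\<close>

theorem (in tens) cylinder_polys:
  assumes S: "rng_in e' S" and \<psi>: "hom_in [:e':] (polys S) \<psi>" and surj: "\<psi> ` polys S = polys A"
    and one: "\<psi> [:e':] = [:e:]" and K: "(\<lambda>a. [:a:]) ` K \<subseteq> \<psi> ` (\<lambda>a. [:a:]) ` S"
    and fact: "factorial_in e A" "factorial_in e B"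
    and dep: "\<And>a b c d. a \<in> polys A \<Longrightarrow> b \<in> polys A \<Longrightarrow> c \<in> polys A \<Longrightarrow> d \<in> polys A \<Longrightarrow>
      algdep ((\<lambda>a. [:a:]) ` K) [a, b, c, d]"
    and gen: "fin_gen_in [:e:] ((\<lambda>a. [:a:]) ` K) (\<psi> ` (\<lambda>a. [:a:]) ` S) G"
  shows "cylinder [:e:] ((\<lambda>a. [:a:]) ` K) ((\<lambda>a. [:a:]) ` L) ((\<lambda>a. [:a:]) ` J) (\<lambda>j. map_poly (co (coeff j 0)))
    (polys A) (polys B) (\<psi> ` (\<lambda>a. [:a:]) ` S) (\<psi> [:0, e':]) G"
proof -
  let ?cS = "(\<lambda>a. [:a:]) ` S"
  interpret S: rng_in e' S by fact
  interpret cS: hom_in e' S "\<lambda>a. [:a:]" by (rule S.const_hom_in)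
  interpret \<psi>: hom_in "[:e':]" "polys S" \<psi> by fact
  have cS: "rng_in [:e':] ?cS" by (rule cS.image_rng_in[OF S subset_refl])
  have sub: "?cS \<subseteq> polys S" by auto
  have x: "[:0, e':] \<in> polys S" using S.one_in by (intro S.pCons_in_polys) auto
  show ?thesis
  proof (intro cylinder.intro[OF tens_polys] cylinder_axioms.intro)
    show "rng_in [:e:] (\<psi> ` ?cS)" using \<psi>.image_rng_in[OF cS sub] one by simp
    show "\<psi> ` ?cS \<subseteq> polys A" "\<psi> [:0, e':] \<in> polys A" using sub x surj by blast+
    show "polys A = adj (\<psi> ` ?cS) (\<psi> [:0, e':])"
      using \<psi>.adj_image[OF cS sub x] polys_adj[OF S] surj by simp
    show "F = 0" if F: "F \<in> polys (\<psi> ` ?cS)" "poly F (\<psi> [:0, e':]) = 0" for F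
    proof -
      obtain G where G: "G \<in> polys ?cS" "F = map_poly \<psi> G"
        using F(1) \<psi>.polys_image[OF rng_in.zero_in[OF cS] sub] by blast
      obtain H where H: "H \<in> polys S" "G = map_poly (\<lambda>a. [:a:]) H"
        using G(1) cS.polys_image[OF S.zero_in subset_refl] by blast
      have "G \<in> polys (polys S)" using G(1) polys_mono[OF sub] by blast
      then have "\<psi> (poly G [:0, e':]) = 0" using \<psi>.hom_poly[OF _ x, of G] F(2) G(2) by simp
      then have "\<psi> H = 0" using poly_map_const[OF S H(1)] H(2) by simp
      then have "H = 0" using \<psi>.hom_inj[OF H(1)] by simp
      then show ?thesis using H(2) G(2) by simp
    qed
    show "factorial_in [:e:] (polys A)" "factorial_in [:e:] (polys B)"
      using fact factorial_polys by blast+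
    show "(\<lambda>a. [:a:]) ` K \<subseteq> \<psi> ` ?cS" by (rule K)
    show "algdep ((\<lambda>a. [:a:]) ` K) [a, b, c, d]"
      if "a \<in> polys A" "b \<in> polys A" "c \<in> polys A" "d \<in> polys A" for a b c d
      using that by (rule dep)
    show "fin_gen_in [:e:] ((\<lambda>a. [:a:]) ` K) (\<psi> ` ?cS) G" by (rule gen)
  qed
qed

lemma alg_in_self: "rng_in e S \<Longrightarrow> e \<noteq> 0 \<Longrightarrow> y \<in> S \<Longrightarrow> alg_in S y"
proof -
  assume S: "rng_in e S" "e \<noteq> 0" "y \<in> S"
  interpret rng_in e S by fact
  have "[:- y, e:] \<in> polys S" using S(3) one_in uminus_in by (auto simp: polys_def coeff_pCons split: nat.split)
  moreover have "poly [:- y, e:] y = 0" using mult_one[OF S(3)] by simp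
  ultimately show ?thesis unfolding alg_in_def using S(2) by (intro bexI[of _ "[:- y, e:]"]) auto
qed

section \<open>The transcendence degree of the polynomial ring over A\<close>

context tensor_data
begin

abbreviation "FF \<equiv> fraction_field A"

lemma one_nz: "\<one>\<^bsub>A\<^esub> \<in> carrier A - {\<zero>\<^bsub>A\<^esub>}"
  by simp

definition "frac_hom a = emb FF (fraction A (inv_into (carrier A) lA a) \<one>\<^bsub>A\<^esub>)"

lemma frac_hom: "a \<in> carrier A \<Longrightarrow> frac_hom (lA a) = emb FF (fraction A a \<one>\<^bsub>A\<^esub>)"
  unfolding frac_hom_def using lA_inj by (subst inv_into_f_f) (auto intro: inj_onI)

lemma frac_hom_in: "hom_in e0 A0 frac_hom"
proof -
  interpret F: field FF by (rule fraction_field_field[OF KA domA])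
  have cl: "fraction A a \<one>\<^bsub>A\<^esub> \<in> carrier FF" if "a \<in> carrier A" for a
    by (rule fraction_closed[OF KA domA that one_nz])
  show ?thesis
  proof (intro hom_in.intro A0_rng_in hom_in_axioms.intro)
    fix a b assume "a \<in> A0" "b \<in> A0"
    then obtain x y where xy: "x \<in> carrier A" "y \<in> carrier A" "a = lA x" "b = lA y" by (auto simp: A0_def)
    show "frac_hom (a + b) = frac_hom a + frac_hom b"
      using xy fraction_add[OF KA domA xy(1) one_nz xy(2) one_nz]
      by (simp add: frac_hom lA_add[symmetric] cl flip: F.emb_add)
    show "frac_hom (a * b) = frac_hom a * frac_hom b"
      using xy fraction_mult[OF KA domA xy(1) one_nz xy(2) one_nz]
      by (simp add: frac_hom lA_mult[symmetric] cl flip: F.emb_mult)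
  next
    fix a assume "a \<in> A0" "frac_hom a = 0"
    then obtain x where x: "x \<in> carrier A" "a = lA x" "emb FF (fraction A x \<one>\<^bsub>A\<^esub>) = 0"
      using frac_hom by (auto simp: A0_def)
    then have "fraction A x \<one>\<^bsub>A\<^esub> = fraction A \<zero>\<^bsub>A\<^esub> \<one>\<^bsub>A\<^esub>"
      using F.emb_eq_0[OF cl] fraction_zero[OF KA domA] by simp
    then have "x = \<zero>\<^bsub>A\<^esub>" using x(1) A.fraction_eq_iff[OF x(1) one_nz _ one_nz, of "\<zero>\<^bsub>A\<^esub>"] by simp
    then show "a = 0" using x(2) lA_zero by simp
  qed
qed

lemma frac_hom_one: "frac_hom e0 = emb_one FF"
  using frac_hom[of "\<one>\<^bsub>A\<^esub>"] lA_one fraction_one[OF KA domA] by (simp add: emb_one_def[of FF])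

lemma frac_hom_scalars: "frac_hom ` K0 = emb FF ` scalars K FF"
proof -
  have "frac_hom (lA (c \<odot>\<^bsub>A\<^esub> \<one>\<^bsub>A\<^esub>)) = emb FF (c \<odot>\<^bsub>FF\<^esub> \<one>\<^bsub>FF\<^esub>)" if "c \<in> carrier K" for c
    using that fraction_smult[OF KA domA that _ one_nz, of "\<one>\<^bsub>A\<^esub>"] fraction_one[OF KA domA] by (simp add: frac_hom)
  then show ?thesis unfolding K0_def scalars_def image_image by (auto intro!: image_cong)
qed

text \<open>Over the fraction field, X and the n elements of a transcendence basis are n + 1
  elements over which everything is algebraic, so any longer list is dependent. Injectivity of the
  passage to fractions carries the dependence back. For n = 2 this is \<open>dep4\<close>.\<close>

theorem polys_algdep:
  assumes td: "has_transcendence_degree K A n" and ws: "set ws \<subseteq> polys A0" "length ws > Suc n"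
  shows "algdep ((\<lambda>a. [:a:]) ` K0) ws"
proof -
  interpret F: field FF by (rule fraction_field_field[OF KA domA])
  interpret FA: algebra K FF by (rule fraction_field_algebra[OF KA domA])
  interpret \<phi>: hom_in e0 A0 frac_hom by (rule frac_hom_in)
  interpret P: hom_in "[:e0:]" "polys A0" "map_poly frac_hom" by (rule \<phi>.map_poly_hom_in)
  let ?e = "emb_one FF" and ?D = "img FF" and ?c = "\<lambda>a::('a \<times> 'a) set crt. [:a:]"
  interpret D: dom_in ?e ?D by (rule F.img_dom_in)
  interpret PD: dom_in "[:?e:]" "polys ?D" by (rule D.polys_dom_in)
  interpret c: hom_in ?e ?D ?c by (rule D.const_hom_in)
  interpret c0: hom_in e0 A0 "\<lambda>a. [:a:]" by (rule \<phi>.const_hom_in)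
  define h where "h z = [:emb FF z:]" for z
  obtain B where B: "transcendence_basis K FF B" "finite B" "card B = n"
    using td by (auto simp: has_transcendence_degree_def)
  obtain bs where bs: "set bs = B" "distinct bs" using finite_distinct_list[OF B(2)] by blast
  have len: "length bs = n" using distinct_card[OF bs(2)] bs(1) B(3) by simp
  have BF: "B \<subseteq> carrier FF" using B(1) by (simp add: transcendence_basis_def algebraically_independent_def)
  define K1 where "K1 = ?c ` frac_hom ` K0"
  have sF: "scalars K FF \<subseteq> carrier FF" by (auto simp: scalars_def)
  have Kh: "K1 = h ` scalars K FF" by (simp add: K1_def frac_hom_scalars h_def image_image)
  have "h z \<in> polys ?D" if "z \<in> carrier FF" for z
  proof -
    have "emb FF z \<in> ?D" using that by (simp add: img_def)
    then show ?thesis by (simp add: h_def)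
  qed
  then have hD: "h ` carrier FF \<subseteq> polys ?D" by blast
  have K1P: "K1 = map_poly frac_hom ` (\<lambda>a. [:a:]) ` K0"
    by (simp add: K1_def image_image map_poly_pCons)
  have K0s: "subfield_in [:e0:] ((\<lambda>a. [:a:]) ` K0)" "(\<lambda>a. [:a:]) ` K0 \<subseteq> polys A0"
    using c0.image_subfield_in[OF K0_subfield K0_A0] K0_A0 by auto
  have e1: "map_poly frac_hom [:e0:] = [:?e:]" by (simp add: map_poly_pCons frac_hom_one)
  have K1: "subfield_in [:?e:] K1" using P.image_subfield_in[OF K0s] by (simp add: K1P e1)
  then have K1r: "rng_in [:?e:] K1" by (simp add: subfield_in_def)
  have K1D: "K1 \<subseteq> polys ?D" unfolding Kh using hD sF by blast
  let ?x = "[:0, ?e:]"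
  have x: "?x \<in> polys ?D" using D.one_in by (intro D.pCons_in_polys) auto
  define T where "T = adjl K1 (map h bs)"
  \<comment> \<open>X together with the transcendence basis, the elements that the list
    \<open>ws'\<close> is compared with.\<close>
  define zs where "zs = ?x # map h bs"
  have hbs: "set (map h bs) \<subseteq> polys ?D" using hD BF bs(1) by auto
  have zs: "set zs \<subseteq> polys ?D" using hbs x by (simp add: zs_def)
  have T: "rng_in [:?e:] T" "T \<subseteq> polys ?D" "K1 \<subseteq> T"
    using adjl_rng_in[OF PD.rng_in_axioms K1r K1D hbs] by (auto simp: T_def)
  have Tz: "T \<subseteq> adjl K1 zs" unfolding zs_def T_def[symmetric] adjl.simps
    using adj_rng_in(2)[OF T(1), of ?x] PD.one_mult[OF x] by (simp add: T_def)
  have zr: "rng_in [:?e:] (adjl K1 zs)" using adjl_rng_in[OF PD.rng_in_axioms K1r K1D zs] by simp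
  have alg_h: "alg_in (adjl K1 zs) (h y)" if y: "y \<in> carrier FF" for y
  proof (rule alg_in_mono[OF Tz], rule F.algebraic_over_generated[where D = "polys ?D" and H = "scalars K FF \<union> B"])
    show "h (a \<oplus>\<^bsub>FF\<^esub> b) = h a + h b" "h (a \<otimes>\<^bsub>FF\<^esub> b) = h a * h b" if "a \<in> carrier FF" "b \<in> carrier FF" for a b
      using that by (simp_all add: h_def F.emb_add F.emb_mult mult.commute)
    have h1: "h \<one>\<^bsub>FF\<^esub> = [:?e:]" by (simp add: h_def emb_one_def)
    show "dom_in (h \<one>\<^bsub>FF\<^esub>) (polys ?D)" "rng_in (h \<one>\<^bsub>FF\<^esub>) T" unfolding h1 by (rule PD.dom_in_axioms, rule T(1))
    show "h ` carrier FF \<subseteq> polys ?D" "T \<subseteq> polys ?D" by (rule hD, rule T(2))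
    show "scalars K FF \<union> B \<subseteq> carrier FF" using sF BF by blast
    show "h ` (scalars K FF \<union> B) \<subseteq> T"
      using T(3) generators_in_adjl[OF PD.rng_in_axioms K1r K1D hbs] bs(1) by (auto simp: T_def Kh)
    show "y \<in> carrier FF" by (rule y)
    show "(F.algebraic over generate_field FF (scalars K FF \<union> B)) y"
      using B(1) y by (simp add: transcendence_basis_def)
  qed
  define ws' where "ws' = map (map_poly frac_hom) ws"
  \<comment> \<open>The coefficients of all members of \<open>ws'\<close>. With X they generate a
    ring containing \<open>ws'\<close>, and \<open>algdep_counting_adjl\<close> asks only such
    generators to be algebraic.\<close>
  define us where "us = map ?c (concat (map coeffs ws'))"
  have wsD: "w \<in> polys ?D" if w: "w \<in> set ws'" for w
  proof -
    obtain v where v: "v \<in> polys A0" "w = map_poly frac_hom v" using w ws(1) by (auto simp: ws'_def)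
    have "frac_hom a \<in> ?D" if a: "a \<in> A0" for a
    proof -
      obtain z where "z \<in> carrier A" "a = lA z" using a by (auto simp: A0_def)
      then show ?thesis using fraction_closed[OF KA domA _ one_nz] by (simp add: frac_hom img_def)
    qed
    then show ?thesis using v by (auto simp: polys_def \<phi>.coeff_hom)
  qed
  have cD: "a \<in> ?D" if "a \<in> set (concat (map coeffs ws'))" for a
    using that wsD by (auto simp: coeffs_def polys_def split: if_splits)
  have usD: "set us \<subseteq> polys ?D"
  proof
    fix u assume "u \<in> set us"
    then obtain a where "a \<in> set (concat (map coeffs ws'))" "u = [:a:]" unfolding us_def set_map by blast
    then show "u \<in> polys ?D" using cD[of a] by simp
  qed
  have uxD: "set (?x # us) \<subseteq> polys ?D" using usD x by simp
  have "algdep K1 ws'"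
  proof (rule algdep_counting_adjl[OF PD.dom_in_axioms K1 K1D zs uxD])
    show "set ws' \<subseteq> adjl K1 (?x # us)"
    proof
      fix w assume w: "w \<in> set ws'"
      have ur: "rng_in [:?e:] (adjl K1 us)" using adjl_rng_in[OF PD.rng_in_axioms K1r K1D usD] by simp
      have "[:coeff w i:] \<in> adjl K1 us" for i
      proof (cases "coeff w i = 0")
        case True
        then show ?thesis using rng_in.zero_in[OF ur] by simp
      next
        case False
        then have "coeff w i \<in> set (coeffs w)" using range_coeff[of w] by auto
        then have "[:coeff w i:] \<in> set us" using w by (auto simp: us_def)
        then show ?thesis using generators_in_adjl[OF PD.rng_in_axioms K1r K1D usD] by blast
      qed
      then have "map_poly ?c w \<in> polys (adjl K1 us)" by (simp add: polys_def c.coeff_hom)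
      moreover have "poly (map_poly ?c w) ?x = w" by (rule poly_map_const[OF D.rng_in_axioms wsD[OF w]])
      ultimately show "w \<in> adjl K1 (?x # us)" unfolding adjl.simps adj_def by (metis image_eqI)
    qed
    show "length zs < length ws'" using ws(2) len by (simp add: zs_def ws'_def)
    fix u assume "u \<in> set (?x # us)"
    then consider "u = ?x" | a where "a \<in> ?D" "u = [:a:]" using cD by (auto simp: us_def)
    then show "alg_in (adjl K1 zs) u"
    proof cases
      case 1
      have "?x \<in> set zs" by (simp add: zs_def)
      then have "?x \<in> adjl K1 zs" using generators_in_adjl[OF PD.rng_in_axioms K1r K1D zs] by blast
      then show ?thesis using alg_in_self[OF zr] PD.one_nz 1 by simp
    next
      case 2
      then obtain y where "y \<in> carrier FF" "u = h y" by (auto simp: h_def img_def)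
      then show ?thesis using alg_h by simp
    qed
  qed
  then show ?thesis
    using P.algdep_image[OF _ K0s(2), of ws] K0s(1) ws(1) by (simp add: subfield_in_def K1P ws'_def)
qed

end

section \<open>From cylinders back to the algebras of the theorem\<close>

lemma (in tensor_data) lA_ring_embed: "ring_embed A lA"
  by (intro ring_embed.intro A.is_cring ring_embed_axioms.intro lA_add lA_mult lA_inj)

lemma smult_eq_mult:
  assumes "algebra K A" "c \<in> carrier K" "x \<in> carrier A"
  shows "c \<odot>\<^bsub>A\<^esub> x = (c \<odot>\<^bsub>A\<^esub> \<one>\<^bsub>A\<^esub>) \<otimes>\<^bsub>A\<^esub> x"
proof -
  interpret algebra K A by fact
  show ?thesis using assms(2,3) by (simp add: smult_assoc2)
qed

theorem (in tensor_data) cancellation: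
  fixes A' :: "('k, 'b) module"
  assumes fgA: "finitely_generated_algebra K A" and KA': "algebra K A'" and domA': "domain A'"
    and fgA': "finitely_generated_algebra K A'"
    and iso: "algebra_isomorphic K (poly_algebra A) (poly_algebra A')"
    and facA: "factorial_domain A" and facT: "factorial_domain (tensor_ring K L A)"
    and td: "has_transcendence_degree K A 2"
  shows "algebra_isomorphic K A A'"
proof -
  interpret A': domain A' by (rule domA')
  interpret KA': algebra K A' by (rule KA')
  interpret eA: ring_embed A lA by (rule lA_ring_embed)
  interpret eA': ring_embed A' "emb A'" by (rule A'.emb_ring_embed)
  obtain J co where tens: "tens e0 K0 L0 J co A0 B0" using exists_tens by blast
  interpret T: tens e0 K0 L0 J co A0 B0 by (rule tens)
  let ?S = "img A'" and ?e = "emb_one A'"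
  have Simg: "?S = emb A' ` carrier A'" by (simp add: img_def)
  interpret S: rng_in ?e ?S by (rule A'.img_rng_in)
  obtain H where H: "H \<in> ring_iso (poly_algebra A) (poly_algebra A')"
    and Hsm: "\<And>c p. c \<in> carrier K \<Longrightarrow> p \<in> carrier (poly_algebra A) \<Longrightarrow> H (c \<odot>\<^bsub>poly_algebra A\<^esub> p) = c \<odot>\<^bsub>poly_algebra A'\<^esub> H p"
    using iso by (auto simp: algebra_isomorphic_def)
  have Hhom: "H \<in> ring_hom (poly_algebra A) (poly_algebra A')" and Hbij: "bij_betw H (up A) (up A')"
    using H by (auto simp: ring_iso_def poly_algebra_def UP_def)
  have Hup: "H p \<in> up A'" if "p \<in> up A" for p using Hbij that by (auto simp: bij_betw_def)
  have up_closed: "p \<oplus>\<^bsub>UP A\<^esub> q \<in> up A" "p \<otimes>\<^bsub>UP A\<^esub> q \<in> up A" if "p \<in> up A" "q \<in> up A" for p q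
    using that A.up_add_closed A.up_mult_closed by (simp_all add: UP_def)
  have Hadd: "H (p \<oplus>\<^bsub>UP A\<^esub> q) = H p \<oplus>\<^bsub>UP A'\<^esub> H q" and Hmult: "H (p \<otimes>\<^bsub>UP A\<^esub> q) = H p \<otimes>\<^bsub>UP A'\<^esub> H q"
    if "p \<in> up A" "q \<in> up A" for p q
    using ring_hom_add[OF Hhom, of p q] ring_hom_mult[OF Hhom, of p q] that by (simp_all add: poly_algebra_def UP_def)
  let ?k = "\<lambda>a n. if n = (0::nat) then a else \<zero>\<^bsub>A\<^esub>" and ?k' = "\<lambda>a n. if n = (0::nat) then a else \<zero>\<^bsub>A'\<^esub>"
  have k_up: "?k a \<in> up A" if "a \<in> carrier A" for a
    using that by (intro mem_upI exI[of _ 0] bound.intro) auto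
  have Hk: "H (?k (c \<odot>\<^bsub>A\<^esub> \<one>\<^bsub>A\<^esub>)) = ?k' (c \<odot>\<^bsub>A'\<^esub> \<one>\<^bsub>A'\<^esub>)" if c: "c \<in> carrier K" for c
  proof -
    have 1: "H (?k \<one>\<^bsub>A\<^esub>) = ?k' \<one>\<^bsub>A'\<^esub>" using ring_hom_one[OF Hhom] by (simp add: poly_algebra_def UP_def)
    have "?k (c \<odot>\<^bsub>A\<^esub> \<one>\<^bsub>A\<^esub>) = (\<lambda>n. c \<odot>\<^bsub>A\<^esub> ?k \<one>\<^bsub>A\<^esub> n)" "?k' (c \<odot>\<^bsub>A'\<^esub> \<one>\<^bsub>A'\<^esub>) = (\<lambda>n. c \<odot>\<^bsub>A'\<^esub> ?k' \<one>\<^bsub>A'\<^esub> n)"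
      using c by (auto simp: fun_eq_iff)
    then show ?thesis using Hsm[OF c, of "?k \<one>\<^bsub>A\<^esub>"] 1 k_up[of "\<one>\<^bsub>A\<^esub>"] by (simp add: poly_algebra_def UP_def)
  qed
  define G where "G p = eA'.up_poly (H p)" for p
  have Ginj: "p = q" if "p \<in> up A" "q \<in> up A" "G p = G q" for p q
  proof -
    have "H p = H q" using eA'.up_poly_inj[OF Hup Hup, OF that(1,2)] that(3) by (simp add: G_def)
    then show ?thesis using Hbij that(1,2) by (auto simp: bij_betw_def dest: inj_onD)
  qed
  have Gsurj: "\<exists>p\<in>up A. G p = q" if q: "q \<in> polys ?S" for q
  proof -
    obtain p' where "p' \<in> up A'" "eA'.up_poly p' = q" using eA'.up_poly_surj[OF q[unfolded Simg]] by blast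
    moreover from this(1) have "p' \<in> H ` up A" using Hbij by (simp add: bij_betw_def)
    ultimately show ?thesis by (auto simp: G_def)
  qed
  have Gin: "G p \<in> polys ?S" if "p \<in> up A" for p using eA'.up_poly_in[OF Hup[OF that]] by (simp add: G_def Simg)
  \<comment> \<open>The inverse of the given isomorphism, between polynomials of the type class. It
    places A' and its variable inside \<open>polys A0\<close>, next to A.\<close>
  define \<psi> where "\<psi> q = eA.up_poly (inv_into (up A) G q)" for q
  have \<psi>: "\<psi> (G p) = eA.up_poly p" if "p \<in> up A" for p
    unfolding \<psi>_def using that Ginj by (subst inv_into_f_f) (auto intro: inj_onI)
  have \<psi>k: "\<psi> [:emb A' (c \<odot>\<^bsub>A'\<^esub> \<one>\<^bsub>A'\<^esub>):] = [:lA (c \<odot>\<^bsub>A\<^esub> \<one>\<^bsub>A\<^esub>):]" if c: "c \<in> carrier K" for c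
  proof -
    have "G (?k (c \<odot>\<^bsub>A\<^esub> \<one>\<^bsub>A\<^esub>)) = [:emb A' (c \<odot>\<^bsub>A'\<^esub> \<one>\<^bsub>A'\<^esub>):]"
      using c by (simp add: G_def Hk eA'.up_poly_const)
    then show ?thesis using \<psi>[OF k_up, of "c \<odot>\<^bsub>A\<^esub> \<one>\<^bsub>A\<^esub>"] eA.up_poly_const[of "c \<odot>\<^bsub>A\<^esub> \<one>\<^bsub>A\<^esub>"] c by simp
  qed
  have \<psi>1: "\<psi> [:?e:] = [:e0:]" using \<psi>k[of "\<one>\<^bsub>K\<^esub>"] lA_one by (simp add: emb_one_def)
  have \<psi>hom: "hom_in [:?e:] (polys ?S) \<psi>"
  proof (intro hom_in.intro S.polys_rng_in hom_in_axioms.intro)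
    fix f g assume "f \<in> polys ?S" "g \<in> polys ?S"
    then obtain p q where p: "p \<in> up A" "G p = f" and q: "q \<in> up A" "G q = g" using Gsurj by metis
    have "G (p \<oplus>\<^bsub>UP A\<^esub> q) = f + g" "G (p \<otimes>\<^bsub>UP A\<^esub> q) = f * g"
      using p q eA'.up_poly_add[OF Hup[OF p(1)] Hup[OF q(1)]] eA'.up_poly_mult[OF Hup[OF p(1)] Hup[OF q(1)]]
      by (simp_all add: G_def Hadd Hmult)
    then show "\<psi> (f + g) = \<psi> f + \<psi> g" "\<psi> (f * g) = \<psi> f * \<psi> g"
      using \<psi>[OF up_closed(1)[OF p(1) q(1)]] \<psi>[OF up_closed(2)[OF p(1) q(1)]] \<psi>[OF p(1)] \<psi>[OF q(1)] p q
        eA.up_poly_add[OF p(1) q(1)] eA.up_poly_mult[OF p(1) q(1)] by simp_all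
  next
    fix f assume f: "f \<in> polys ?S" "\<psi> f = 0"
    obtain p where p: "p \<in> up A" "G p = f" using Gsurj[OF f(1)] by blast
    have "eA.up_poly p = eA.up_poly (?k \<zero>\<^bsub>A\<^esub>)" using f(2) \<psi>[OF p(1)] p(2) eA.up_poly_const[of "\<zero>\<^bsub>A\<^esub>"] by simp
    then have pz: "p = ?k \<zero>\<^bsub>A\<^esub>" by (rule eA.up_poly_inj[OF p(1) k_up[OF A.zero_closed]])
    have "f + f = f"
    proof -
      have "p \<oplus>\<^bsub>UP A\<^esub> p = (\<lambda>i. p i \<oplus>\<^bsub>A\<^esub> p i)" using p(1) by (simp add: UP_def)
      also have "\<dots> = p" by (rule ext) (simp add: pz)
      finally have "p \<oplus>\<^bsub>UP A\<^esub> p = p" .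
      then show ?thesis using p(2) eA'.up_poly_add[OF Hup Hup, OF p(1,1)] Hadd[OF p(1,1)] by (simp add: G_def)
    qed
    then show "f = 0" by simp
  qed
  interpret \<psi>: hom_in "[:?e:]" "polys ?S" \<psi> by (rule \<psi>hom)
  have \<psi>surj: "\<psi> ` polys ?S = polys A0"
  proof
    show "\<psi> ` polys ?S \<subseteq> polys A0" using Gsurj \<psi> eA.up_poly_in by (auto simp: A0_def) metis
    show "polys A0 \<subseteq> \<psi> ` polys ?S"
    proof
      fix q assume "q \<in> polys A0"
      then obtain p where "p \<in> up A" "eA.up_poly p = q" using eA.up_poly_surj[of q] by (auto simp: A0_def)
      then show "q \<in> \<psi> ` polys ?S" using \<psi> Gin by (metis image_eqI)
    qed
  qed
  \<comment> \<open>The embeddings of A and of A' into the one ring \<open>polys A0\<close>. They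
    agree on scalars (\<open>hk\<close>), so the isomorphism found there, being the identity on K,
    is one of K-algebras.\<close>
  define h1 where "h1 a = [:lA a:]" for a
  define h2 where "h2 b = \<psi> [:emb A' b:]" for b
  interpret h1: ring_embed A h1
    by unfold_locales (auto simp: h1_def lA_add lA_mult mult.commute dest: lA_inj)
  have cS: "[:emb A' b:] \<in> polys ?S" if "b \<in> carrier A'" for b unfolding S.const_in_polys using that by (simp add: Simg)
  interpret h2: ring_embed A' h2
  proof unfold_locales
    fix a b assume ab: "a \<in> carrier A'" "b \<in> carrier A'"
    show "h2 (a \<oplus>\<^bsub>A'\<^esub> b) = h2 a + h2 b"
      using \<psi>.hom_add[OF cS cS, OF ab] ab by (simp add: h2_def A'.emb_add)
    have "[:emb A' (a \<otimes>\<^bsub>A'\<^esub> b):] = [:emb A' a:] * [:emb A' b:]" using ab by (simp add: A'.emb_mult mult.commute)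
    then show "h2 (a \<otimes>\<^bsub>A'\<^esub> b) = h2 a * h2 b"
      using \<psi>.hom_mult[OF cS cS, OF ab] by (simp add: h2_def)
    show "a = b" if "h2 a = h2 b"
      using \<psi>.hom_eq_iff[OF cS cS, OF ab] that A'.emb_inj[OF ab] by (simp add: h2_def)
  qed
  have hk: "h1 (c \<odot>\<^bsub>A\<^esub> \<one>\<^bsub>A\<^esub>) = h2 (c \<odot>\<^bsub>A'\<^esub> \<one>\<^bsub>A'\<^esub>)" if "c \<in> carrier K" for c
    using \<psi>k[OF that] by (simp add: h1_def h2_def)
  let ?K = "(\<lambda>a. [:a:]) ` K0"
  have K1: "?K = h1 ` scalars K A" by (simp add: K0_def h1_def image_image)
  have K2: "?K = h2 ` scalars K A'" unfolding K1 using hk by (auto simp: scalars_def image_image)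
  have A1: "(\<lambda>q. q) ` (\<lambda>a. [:a:]) ` A0 = h1 ` carrier A" by (simp add: A0_def h1_def image_image)
  have A2: "\<psi> ` (\<lambda>a. [:a:]) ` ?S = h2 ` carrier A'" by (simp add: Simg h2_def image_image)
  have one1: "h1 \<one>\<^bsub>A\<^esub> = [:e0:]" by (simp add: h1_def lA_one)
  have one2: "h2 \<one>\<^bsub>A'\<^esub> = [:e0:]" using \<psi>1 by (simp add: h2_def emb_one_def)
  have facA0: "factorial_in e0 A0"
    using factorial_domain.image_factorial_in[OF facA lA_ring_embed] by (simp add: A0_def lA_one)
  have facB0: "factorial_in e0 B0" by (rule factorial_domain.img_factorial_in[OF facT])
  have dep: "algdep ?K [a, b, c, d]" if "a \<in> polys A0" "b \<in> polys A0" "c \<in> polys A0" "d \<in> polys A0" for a b c d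
    using that by (intro polys_algdep[OF td]) auto
  have sA: "scalars K A \<subseteq> carrier A" "scalars K A' \<subseteq> carrier A'" by (auto simp: scalars_def)
  obtain G1 where g1: "fin_gen_in [:e0:] ?K (h1 ` carrier A) G1"
    using fgA h1.image_fin_gen_in[OF sA(1)] unfolding finitely_generated_algebra_def one1 K1 by blast
  obtain G2 where g2: "fin_gen_in [:e0:] ?K (h2 ` carrier A') G2"
    using fgA' h2.image_fin_gen_in[OF sA(2)] unfolding finitely_generated_algebra_def one2 K2 by blast
  have id: "hom_in [:e0:] (polys A0) (\<lambda>q. q)"
    by (intro hom_in.intro T.A.polys_rng_in hom_in_axioms.intro) simp_all
  \<comment> \<open>A itself is the instance of \<open>cylinder_polys\<close> for the
    identity.\<close>
  have cyl1: "cylinder [:e0:] ?K ((\<lambda>a. [:a:]) ` L0) ((\<lambda>a. [:a:]) ` J) (\<lambda>j. map_poly (co (poly.coeff j 0)))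
      (polys A0) (polys B0) (h1 ` carrier A) [:0, e0:] G1"
    unfolding A1[symmetric]
    by (rule T.cylinder_polys[OF T.A.rng_in_axioms id _ _ _ facA0 facB0 dep g1[folded A1]]) (use T.KA in auto)
  have K2': "?K \<subseteq> \<psi> ` (\<lambda>a. [:a:]) ` ?S" unfolding K2 A2 using sA(2) by blast
  have cyl2: "cylinder [:e0:] ?K ((\<lambda>a. [:a:]) ` L0) ((\<lambda>a. [:a:]) ` J) (\<lambda>j. map_poly (co (poly.coeff j 0)))
      (polys A0) (polys B0) (h2 ` carrier A') (\<psi> [:0, ?e:]) G2"
    unfolding A2[symmetric]
    by (rule T.cylinder_polys[OF S.rng_in_axioms \<psi>hom \<psi>surj \<psi>1 K2' facA0 facB0 dep g2[folded A2]])
  obtain h where h: "bij_betw h (h1 ` carrier A) (h2 ` carrier A')" "\<forall>k\<in>?K. h k = k"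
    "\<forall>a\<in>h1 ` carrier A. \<forall>b\<in>h1 ` carrier A. h (a + b) = h a + h b \<and> h (a * b) = h a * h b"
    using cylinder_cancellation[OF cyl1 cyl2] by blast
  define g where "g a = inv_into (carrier A') h2 (h (h1 a))" for a
  have inj2: "inj_on h2 (carrier A')" using h2.h_inj by (intro inj_onI)
  have g: "g a \<in> carrier A'" "h2 (g a) = h (h1 a)" if "a \<in> carrier A" for a
  proof -
    have "h (h1 a) \<in> h2 ` carrier A'" using h(1) that by (auto simp: bij_betw_def)
    then show "g a \<in> carrier A'" "h2 (g a) = h (h1 a)" unfolding g_def by (rule inv_into_into, rule f_inv_into_f)
  qed
  have gk: "g (c \<odot>\<^bsub>A\<^esub> \<one>\<^bsub>A\<^esub>) = c \<odot>\<^bsub>A'\<^esub> \<one>\<^bsub>A'\<^esub>" if c: "c \<in> carrier K" for c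
  proof -
    have "h1 (c \<odot>\<^bsub>A\<^esub> \<one>\<^bsub>A\<^esub>) \<in> ?K" unfolding K1 scalars_def using c by blast
    from bspec[OF h(2) this] have "h2 (g (c \<odot>\<^bsub>A\<^esub> \<one>\<^bsub>A\<^esub>)) = h2 (c \<odot>\<^bsub>A'\<^esub> \<one>\<^bsub>A'\<^esub>)"
      using g(2)[of "c \<odot>\<^bsub>A\<^esub> \<one>\<^bsub>A\<^esub>"] hk[OF c] c by simp
    then show ?thesis using h2.h_inj[OF g(1)] c by simp
  qed
  have g_add: "g (a \<oplus>\<^bsub>A\<^esub> b) = g a \<oplus>\<^bsub>A'\<^esub> g b" and g_mult: "g (a \<otimes>\<^bsub>A\<^esub> b) = g a \<otimes>\<^bsub>A'\<^esub> g b"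
    if ab: "a \<in> carrier A" "b \<in> carrier A" for a b
  proof -
    have hh: "h (h1 a + h1 b) = h (h1 a) + h (h1 b)" "h (h1 a * h1 b) = h (h1 a) * h (h1 b)" using h(3) ab by auto
    have "h2 (g (a \<oplus>\<^bsub>A\<^esub> b)) = h2 (g a \<oplus>\<^bsub>A'\<^esub> g b)" using ab g hh(1) by (simp add: h1.h_add h2.h_add)
    then show "g (a \<oplus>\<^bsub>A\<^esub> b) = g a \<oplus>\<^bsub>A'\<^esub> g b" using h2.h_inj[OF g(1)] g(1) ab by simp
    have "h2 (g (a \<otimes>\<^bsub>A\<^esub> b)) = h2 (g a \<otimes>\<^bsub>A'\<^esub> g b)" using ab g hh(2) by (simp add: h1.h_mult h2.h_mult)
    then show "g (a \<otimes>\<^bsub>A\<^esub> b) = g a \<otimes>\<^bsub>A'\<^esub> g b" using h2.h_inj[OF g(1)] g(1) ab by simp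
  qed
  have g_one: "g \<one>\<^bsub>A\<^esub> = \<one>\<^bsub>A'\<^esub>" using gk[of "\<one>\<^bsub>K\<^esub>"] by simp
  have g_inj: "a = b" if ab: "a \<in> carrier A" "b \<in> carrier A" "g a = g b" for a b
  proof -
    have "h (h1 a) = h (h1 b)" using g(2) ab by metis
    then have "h1 a = h1 b" using h(1) ab(1,2) by (auto simp: bij_betw_def dest: inj_onD)
    then show ?thesis using h1.h_inj ab by blast
  qed
  have g_surj: "\<exists>a\<in>carrier A. g a = b" if b: "b \<in> carrier A'" for b
  proof -
    have "h2 b \<in> h ` h1 ` carrier A" using h(1) b by (auto simp: bij_betw_def)
    then obtain a where a: "a \<in> carrier A" "h2 b = h (h1 a)" by blast
    then have "g a = b" using h2.h_inj[OF g(1)[OF a(1)] b] g(2)[OF a(1)] by simp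
    then show ?thesis using a(1) by blast
  qed
  have "g \<in> ring_iso A A'"
  proof (rule ring_iso_memI)
    have "g ` carrier A = carrier A'" using g(1) g_surj by blast
    then show "bij_betw g (carrier A) (carrier A')"
      unfolding bij_betw_def using g_inj by (auto intro: inj_onI)
  qed (use g(1) g_add g_mult g_one in auto)
  moreover have "g (c \<odot>\<^bsub>A\<^esub> x) = c \<odot>\<^bsub>A'\<^esub> g x" if "c \<in> carrier K" "x \<in> carrier A" for c x
    using smult_eq_mult[OF KA that] smult_eq_mult[OF KA' that(1) g(1)[OF that(2)]] g_mult[of "c \<odot>\<^bsub>A\<^esub> \<one>\<^bsub>A\<^esub>" x] gk[OF that(1)] that by simp
  ultimately show ?thesis unfolding algebra_isomorphic_def by blast
qed

theorem theorem1p2: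
  fixes K :: "'k ring" and L :: "('k, 'l) module"
    and A :: "('k, 'a) module" and A' :: "('k, 'b) module"
  assumes "field K"
    and "algebra K L" and "algebraic_closure L (scalars K L)"
    and "k_domain K A" and "finitely_generated_algebra K A"
    and "k_domain K A'" and "finitely_generated_algebra K A'"
    and "algebra_isomorphic K (poly_algebra A) (poly_algebra A')"
    and "factorial_domain A"
    and "factorial_domain (tensor_ring K L A)"
    and "has_transcendence_degree K A 2"
  shows "algebra_isomorphic K A A'"
proof -
  have "tensor_data K L A"
    using assms factorial_domain.axioms(1) by (intro tensor_data.intro) (auto simp: k_domain_def)
  then show ?thesis using tensor_data.cancellation assms by (auto simp: k_domain_def)
qed

end
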